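(* Let $\mathcal{A}$ be a real (linear or affine) hyperplane arrangement with associated oriented system $(\Gamma,\sim)$, and let $\hat\rho:(\hat\Gamma,\sim)\rightarrow(\Gamma,\sim)$ denote the universal cover of $(\Gamma,\sim)$. Then $W_{\hat\rho}=\Delta(\mathrm{Plim}\,\mathscr{D}_{\hat\rho})$ (with the map $\Lambda_{\hat\rho}:W_{\hat\rho}\to W\cong Sal(\mathcal{A})$) is the universal cover of the Salvetti complex $Sal(\mathcal{A})$.
   Context: **Arrangements.** $\mathcal{A}$ is a finite set of linear or affine hyperplanes in $\mathbb{R}^d$. $\mathcal{F}=\mathcal{F}(\mathcal{A})$ is its face poset: the set of all relatively open polyhedral cells of the stratification of $\mathbb{R}^d$ induced by $\mathcal{A}$, ordered by $F_1\ge F_2 \iff \overline{F_1}\subseteq\overline{F_2}$. The chambers $\mathcal{C}(\mathcal{A})$ are the minimal elements. $|F|$ is the affine hull of $F$, and $\mathcal{A}_{|F|}=\{H\in\mathcal{A}: |F|\subseteq H\}$. For a face $F$ and chamber $C$, $C_F$ is the unique chamber of $\mathcal{A}$ whose closure contains $F$ and which lies in the same chamber of $\mathcal{A}_{|F|}$ as $C$. **Salvetti complex.** Choose a point $w(F)$ in every face $F$ and put $w(F,C)=w(F)\oplus[w(F)-w(C_F)]\in\mathbb{R}^d\oplus\mathbb{R}^d=\mathbb{C}^d$ (it depends only on $F$ and $C_F$). $Sal(\mathcal{A})$ is the simplicial complex with vertices $w(F,C)$, $F\in\mathcal{F}$, $C\in\mathcal{C}(\mathcal{A})$, in which the convex hull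 of $w(F_0,C_0),\dots,w(F_k,C_k)$ is a simplex iff (up to ordering) $F_0>\dots>F_k$ is a chain in $\mathcal{F}$ and $(C_0)_{F_i}=(C_i)_{F_i}$ for all $i$. **Oriented systems.** In an oriented graph (edges are ordered pairs of vertices), a path is a sequence of edges with exponents $\pm1$ (traversed forward or backward), consecutive in the obvious sense; it is positive if all exponents are $+1$. An oriented system is an oriented graph together with an equivalence relation $\sim$ on its paths such that: $\alpha\sim\beta$ implies equal beginnings and equal ends; $\alpha\alpha^{-1}\sim begin(\alpha)$ (constant path); $\alpha\sim\beta$ implies $\alpha^{-1}\sim\beta^{-1}$; $\alpha\sim\beta$ implies $\gamma_1\alpha\gamma_2\sim\gamma_1\beta\gamma_2$ whenever composable. All graphs and covering spaces are assumed connected. The oriented system $(\Gamma,\sim)$ of $\mathcal{A}$ has vertex set $\mathcal{C}(\mathcal{A})$, an edge $(A,B)$ for every ordered pair of adjacent chambers (separated by exactly one hyperplane), and $\sim$ is generated by identifying any two positive paths with the same beginning and end that both have minimal length among positive paths joining these vertices. A cover $\rho:(\Theta,\sim)\to(\Gamma,\sim)$ is a morphism of oriented graphs such that (1) for each vertex $v$ of $\Theta$ and each path $\alpha$ in $\Gamma$ with $begin(\alpha)=\rho(v)$ there is a unique path $\hat\alpha_v$ in $\Theta$ beginning at $v$ with $\rho(\hat\alpha_v)=\alpha$; (2) $\alpha\sim\beta$ and $begin(\alpha)=begin(\beta)=\rho(v)$ imply $\hat\alpha_v\sim\hat\beta_v$. The relation on the total space $\Theta$ of a cover is the one induced by $\rho$,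 i.e. the smallest one such that $\alpha\sim\beta$ whenever $begin(\alpha)=begin(\beta)$ and $\rho(\alpha)\sim\rho(\beta)$. The universal cover $\hat\rho$ is the cover such that for every cover $\rho:(\Theta,\sim)\to(\Gamma,\sim)$ there is a morphism $\mu:(\hat\Gamma,\sim)\to(\Theta,\sim)$ with $\rho\circ\mu=\hat\rho$. For a vertex $v$ of $\Theta$ with $\rho(v)=A$, $\hat\gamma_v(A\to B)$ denotes the lift at $v$ of a positive minimal path from $A$ to $B$ (unique up to $\sim$; its end is well defined). **The diagram and its poset limit.** For a cover $\rho$, $\mathscr{D}_\rho$ is the diagram of spaces over $\mathcal{F}$ (functor with arrows $F_1\to F_2$ iff $F_1\ge F_2$) with discrete spaces $\mathscr{D}_\rho(F)=\{v\in V(\Theta):\rho(v)\le F\}$ and maps, for $F_1>F_2$, $v\mapsto end(\hat\gamma_v(\rho(v)\to\rho(v)_{F_2}))$. Its poset limit $\mathrm{Plim}\,\mathscr{D}_\rho$ is the set of pairs $(F,v)$ with $F\in\mathcal{F}$, $v\in\mathscr{D}_\rho(F)$, ordered by $(F_1,v_1)\ge(F_2,v_2)$ iff $F_1\ge F_2$ and $v_2=end(\hat\gamma_{v_1}(\rho(v_1)\to\rho(v_1)_{F_2}))$. $\Delta(\cdot)$ denotes the order complex, $W_\rho=\Delta(\mathrm{Plim}\,\mathscr{D}_\rho)$, and $W=W_{id}$ for the identity cover of $(\Gamma,\sim)$. $W$ is identified with $Sal(\mathcal{A})$ through the simplicial isomorphism $(F,C)\mapsto w(F,C)$, and $\Lambda_\rho:W_\rho\to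 W$ is the simplicial map $(F,v)\mapsto(F,\rho(v))$. *)

theory Defs
  imports "HOL-Analysis.Analysis"
begin

section \<open>Hyperplane arrangements\<close>

definition hyperplane :: "(real^'n) set \<Rightarrow> bool" where
  "hyperplane H \<longleftrightarrow> (\<exists>a b. a \<noteq> 0 \<and> H = {x. a \<bullet> x = b})"

definition arrangement :: "(real^'n) set set \<Rightarrow> bool" where
  "arrangement A \<longleftrightarrow> finite A \<and> (\<forall>H\<in>A. hyperplane H)"

definition same_face :: "(real^'n) set set \<Rightarrow> real^'n \<Rightarrow> real^'n \<Rightarrow> bool" where
  "same_face A x y \<longleftrightarrow>
     (\<forall>a b. a \<noteq> 0 \<and> {z. a \<bullet> z = b} \<in> A \<longrightarrow> sgn (a \<bullet> x - b) = sgn (a \<bullet> y - b))"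

definition faces :: "(real^'n) set set \<Rightarrow> (real^'n) set set" where
  "faces A = range (\<lambda>x. {y. same_face A x y})"

text \<open>The face order is reversed inclusion of closures, so chambers are minimal and
  the faces of smallest dimension are maximal.\<close>

definition face_ge :: "(real^'n) set \<Rightarrow> (real^'n) set \<Rightarrow> bool" where
  "face_ge F G \<longleftrightarrow> closure F \<subseteq> closure G"

definition face_gt :: "(real^'n) set \<Rightarrow> (real^'n) set \<Rightarrow> bool" where
  "face_gt F G \<longleftrightarrow> face_ge F G \<and> F \<noteq> G"

definition chambers :: "(real^'n) set set \<Rightarrow> (real^'n) set set" where
  "chambers A = {C \<in> faces A. \<not> (\<exists>F\<in>faces A. face_gt C F)}"

text \<open>The subarrangement written $\mathcal{A}_{|F|}$, where $|F|$ is the affine hull of $F$.\<close>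

definition localization :: "(real^'n) set set \<Rightarrow> (real^'n) set \<Rightarrow> (real^'n) set set" where
  "localization A F = {H \<in> A. affine hull F \<subseteq> H}"

text \<open>The chamber written $C_F$.\<close>

definition chamber_at :: "(real^'n) set set \<Rightarrow> (real^'n) set \<Rightarrow> (real^'n) set \<Rightarrow> (real^'n) set" where
  "chamber_at A C F =
     (THE D. D \<in> chambers A \<and> F \<subseteq> closure D \<and>
        (\<exists>K\<in>chambers (localization A F). C \<subseteq> K \<and> D \<subseteq> K))"

definition separates :: "(real^'n) set \<Rightarrow> (real^'n) set \<Rightarrow> (real^'n) set \<Rightarrow> bool" where
  "separates H C D \<longleftrightarrow>
     (\<exists>a b. a \<noteq> 0 \<and> H = {x. a \<bullet> x = b} \<and> C \<subseteq> {x. a \<bullet> x < b} \<and> D \<subseteq> {x. a \<bullet> x > b})"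

definition adjacent :: "(real^'n) set set \<Rightarrow> (real^'n) set \<Rightarrow> (real^'n) set \<Rightarrow> bool" where
  "adjacent A C D \<longleftrightarrow> card {H \<in> A. separates H C D} = 1"

section \<open>The Salvetti complex\<close>

text \<open>The choice of a point in every face is the parameter \<open>w\<close>; the space
  $\mathbb{C}^d = \mathbb{R}^d \oplus \mathbb{R}^d$ is the product type, with the real part first.\<close>

definition sal_vertex ::
  "(real^'n) set set \<Rightarrow> ((real^'n) set \<Rightarrow> real^'n) \<Rightarrow> (real^'n) set \<Rightarrow> (real^'n) set
     \<Rightarrow> (real^'n) \<times> (real^'n)" where
  "sal_vertex A w F C = (w F, w F - w (chamber_at A C F))"

definition salvetti_complex ::
  "(real^'n) set set \<Rightarrow> ((real^'n) set \<Rightarrow> real^'n) \<Rightarrow> ((real^'n) \<times> (real^'n)) set set" where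
  "salvetti_complex A w =
     {convex hull ((\<lambda>i. sal_vertex A w (F i) (C i)) ` {..k}) | F C (k::nat).
        (\<forall>i\<le>k. F i \<in> faces A \<and> C i \<in> chambers A) \<and>
        (\<forall>i<k. face_gt (F i) (F (Suc i))) \<and>
        (\<forall>i\<le>k. chamber_at A (C 0) (F i) = chamber_at A (C i) (F i))}"

section \<open>Oriented systems and their covers\<close>

text \<open>A path is its starting vertex together with its list of edges, each with an exponent
  (\<open>True\<close> for $+1$, \<open>False\<close> for $-1$). The starting vertex is recorded
  because of the constant paths.\<close>

type_synonym 'v step = "('v \<times> 'v) \<times> bool"
type_synonym 'v opath = "'v \<times> 'v step list"

fun step_begin :: "'v step \<Rightarrow> 'v" where
  "step_begin ((a, b), s) = (if s then a else b)"

fun step_end :: "'v step \<Rightarrow> 'v" where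
  "step_end ((a, b), s) = (if s then b else a)"

fun consecutive :: "'v \<Rightarrow> 'v step list \<Rightarrow> bool" where
  "consecutive v [] \<longleftrightarrow> True"
| "consecutive v (s # ss) \<longleftrightarrow> step_begin s = v \<and> consecutive (step_end s) ss"

definition opaths :: "'v set \<Rightarrow> ('v \<times> 'v) set \<Rightarrow> 'v opath set" where
  "opaths V E = {(v, ss). v \<in> V \<and> fst ` set ss \<subseteq> E \<and> consecutive v ss}"

definition opath_begin :: "'v opath \<Rightarrow> 'v" where
  "opath_begin \<alpha> = fst \<alpha>"

definition opath_end :: "'v opath \<Rightarrow> 'v" where
  "opath_end \<alpha> = (if snd \<alpha> = [] then fst \<alpha> else step_end (last (snd \<alpha>)))"

definition opath_const :: "'v \<Rightarrow> 'v opath" where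
  "opath_const v = (v, [])"

definition opath_comp :: "'v opath \<Rightarrow> 'v opath \<Rightarrow> 'v opath" where
  "opath_comp \<alpha> \<beta> = (fst \<alpha>, snd \<alpha> @ snd \<beta>)"

definition opath_inv :: "'v opath \<Rightarrow> 'v opath" where
  "opath_inv \<alpha> = (opath_end \<alpha>, rev (map (\<lambda>(e, s). (e, \<not> s)) (snd \<alpha>)))"

definition opath_map :: "('v \<Rightarrow> 'u) \<Rightarrow> 'v opath \<Rightarrow> 'u opath" where
  "opath_map f \<alpha> = (f (fst \<alpha>), map (\<lambda>(e, s). (map_prod f f e, s)) (snd \<alpha>))"

definition opath_length :: "'v opath \<Rightarrow> nat" where
  "opath_length \<alpha> = length (snd \<alpha>)"

definition opath_positive :: "'v opath \<Rightarrow> bool" where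
  "opath_positive \<alpha> \<longleftrightarrow> (\<forall>s\<in>set (snd \<alpha>). snd s)"

definition positive_minimal :: "'v set \<Rightarrow> ('v \<times> 'v) set \<Rightarrow> 'v opath \<Rightarrow> bool" where
  "positive_minimal V E \<alpha> \<longleftrightarrow>
     \<alpha> \<in> opaths V E \<and> opath_positive \<alpha> \<and>
     (\<forall>\<beta>\<in>opaths V E. opath_positive \<beta> \<and> opath_begin \<beta> = opath_begin \<alpha> \<and>
        opath_end \<beta> = opath_end \<alpha> \<longrightarrow> opath_length \<alpha> \<le> opath_length \<beta>)"

definition path_relation :: "'v set \<Rightarrow> ('v \<times> 'v) set \<Rightarrow> 'v opath rel \<Rightarrow> bool" where
  "path_relation V E R \<longleftrightarrow>
     equiv (opaths V E) R \<and>
     (\<forall>(\<alpha>, \<beta>)\<in>R. opath_begin \<alpha> = opath_begin \<beta> \<and> opath_end \<alpha> = opath_end \<beta>) \<and>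
     (\<forall>\<alpha>\<in>opaths V E. (opath_comp \<alpha> (opath_inv \<alpha>), opath_const (opath_begin \<alpha>)) \<in> R) \<and>
     (\<forall>(\<alpha>, \<beta>)\<in>R. (opath_inv \<alpha>, opath_inv \<beta>) \<in> R) \<and>
     (\<forall>(\<alpha>, \<beta>)\<in>R. \<forall>\<gamma>\<^sub>1\<in>opaths V E. \<forall>\<gamma>\<^sub>2\<in>opaths V E.
        opath_end \<gamma>\<^sub>1 = opath_begin \<alpha> \<and> opath_end \<alpha> = opath_begin \<gamma>\<^sub>2 \<longrightarrow>
        (opath_comp \<gamma>\<^sub>1 (opath_comp \<alpha> \<gamma>\<^sub>2), opath_comp \<gamma>\<^sub>1 (opath_comp \<beta> \<gamma>\<^sub>2)) \<in> R)"

definition generated_relation :: "'v set \<Rightarrow> ('v \<times> 'v) set \<Rightarrow> 'v opath rel \<Rightarrow> 'v opath rel" where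
  "generated_relation V E R\<^sub>0 = \<Inter>{R. path_relation V E R \<and> R\<^sub>0 \<subseteq> R}"

record 'v osys =
  verts :: "'v set"
  edges :: "('v \<times> 'v) set"
  prel :: "'v opath rel"

definition oriented_system :: "'v osys \<Rightarrow> bool" where
  "oriented_system G \<longleftrightarrow>
     edges G \<subseteq> verts G \<times> verts G \<and> path_relation (verts G) (edges G) (prel G)"

abbreviation paths_of :: "'v osys \<Rightarrow> 'v opath set" where
  "paths_of G \<equiv> opaths (verts G) (edges G)"

definition os_connected :: "'v osys \<Rightarrow> bool" where
  "os_connected G \<longleftrightarrow>
     verts G \<noteq> {} \<and>
     (\<forall>u\<in>verts G. \<forall>v\<in>verts G. \<exists>\<alpha>\<in>paths_of G. opath_begin \<alpha> = u \<and> opath_end \<alpha> = v)"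

definition graph_morphism :: "'v osys \<Rightarrow> 'u osys \<Rightarrow> ('v \<Rightarrow> 'u) \<Rightarrow> bool" where
  "graph_morphism G H f \<longleftrightarrow>
     f ` verts G \<subseteq> verts H \<and> map_prod f f ` edges G \<subseteq> edges H"

definition os_morphism :: "'v osys \<Rightarrow> 'u osys \<Rightarrow> ('v \<Rightarrow> 'u) \<Rightarrow> bool" where
  "os_morphism G H f \<longleftrightarrow>
     graph_morphism G H f \<and> (\<forall>(\<alpha>, \<beta>)\<in>prel G. (opath_map f \<alpha>, opath_map f \<beta>) \<in> prel H)"

definition is_lift :: "'v osys \<Rightarrow> ('v \<Rightarrow> 'u) \<Rightarrow> 'v \<Rightarrow> 'u opath \<Rightarrow> 'v opath \<Rightarrow> bool" where
  "is_lift \<Theta> \<rho> v \<alpha> \<alpha>' \<longleftrightarrow> \<alpha>' \<in> paths_of \<Theta> \<and> opath_begin \<alpha>' = v \<and> opath_map \<rho> \<alpha>' = \<alpha>"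

definition lift :: "'v osys \<Rightarrow> ('v \<Rightarrow> 'u) \<Rightarrow> 'v \<Rightarrow> 'u opath \<Rightarrow> 'v opath" where
  "lift \<Theta> \<rho> v \<alpha> = (THE \<alpha>'. is_lift \<Theta> \<rho> v \<alpha> \<alpha>')"

definition os_cover :: "'v osys \<Rightarrow> 'u osys \<Rightarrow> ('v \<Rightarrow> 'u) \<Rightarrow> bool" where
  "os_cover \<Theta> G \<rho> \<longleftrightarrow>
     oriented_system \<Theta> \<and> oriented_system G \<and> os_connected \<Theta> \<and> os_connected G \<and>
     graph_morphism \<Theta> G \<rho> \<and>
     (\<forall>v\<in>verts \<Theta>. \<forall>\<alpha>\<in>paths_of G. opath_begin \<alpha> = \<rho> v \<longrightarrow> (\<exists>!\<alpha>'. is_lift \<Theta> \<rho> v \<alpha> \<alpha>')) \<and>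
     (\<forall>v\<in>verts \<Theta>. \<forall>(\<alpha>, \<beta>)\<in>prel G. opath_begin \<alpha> = \<rho> v \<and> opath_begin \<beta> = \<rho> v \<longrightarrow>
        (lift \<Theta> \<rho> v \<alpha>, lift \<Theta> \<rho> v \<beta>) \<in> prel \<Theta>) \<and>
     prel \<Theta> = generated_relation (verts \<Theta>) (edges \<Theta>)
       {(\<alpha>, \<beta>) \<in> paths_of \<Theta> \<times> paths_of \<Theta>.
          opath_begin \<alpha> = opath_begin \<beta> \<and> (opath_map \<rho> \<alpha>, opath_map \<rho> \<beta>) \<in> prel G}"

text \<open>The universal property speaks about all covers of \<open>G\<close>. A formula cannot quantify over
  types, so the competing covers are taken with vertices in \<open>nat\<close>. For a finite graph \<open>G\<close>
  (the only case used) this loses nothing: a cover is connected and, by unique lifting of edges,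
  locally finite, hence has countably many vertices and is isomorphic to one with vertices
  in \<open>nat\<close>. The vertex type of the universal cover itself is arbitrary.\<close>

definition universal_os_cover :: "'v osys \<Rightarrow> 'u osys \<Rightarrow> ('v \<Rightarrow> 'u) \<Rightarrow> bool" where
  "universal_os_cover \<Theta> G \<rho> \<longleftrightarrow>
     os_cover \<Theta> G \<rho> \<and>
     (\<forall>(\<Theta>' :: nat osys) \<rho>'. os_cover \<Theta>' G \<rho>' \<longrightarrow>
        (\<exists>\<mu>. os_morphism \<Theta> \<Theta>' \<mu> \<and> (\<forall>v\<in>verts \<Theta>. \<rho>' (\<mu> v) = \<rho> v)))"

definition chamber_edges :: "(real^'n) set set \<Rightarrow> ((real^'n) set \<times> (real^'n) set) set" where
  "chamber_edges A = {(C, D) \<in> chambers A \<times> chambers A. adjacent A C D}"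

definition arrangement_system :: "(real^'n) set set \<Rightarrow> (real^'n) set osys" where
  "arrangement_system A =
     \<lparr> verts = chambers A, edges = chamber_edges A,
       prel = generated_relation (chambers A) (chamber_edges A)
         {(\<alpha>, \<beta>). positive_minimal (chambers A) (chamber_edges A) \<alpha> \<and>
                  positive_minimal (chambers A) (chamber_edges A) \<beta> \<and>
                  opath_begin \<alpha> = opath_begin \<beta> \<and> opath_end \<alpha> = opath_end \<beta>} \<rparr>"

section \<open>The diagram of a cover and its poset limit\<close>

definition minimal_path ::
  "(real^'n) set set \<Rightarrow> (real^'n) set \<Rightarrow> (real^'n) set \<Rightarrow> (real^'n) set opath" where
  "minimal_path A C D =
     (SOME \<alpha>. positive_minimal (chambers A) (chamber_edges A) \<alpha> \<and>
        opath_begin \<alpha> = C \<and> opath_end \<alpha> = D)"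

definition diagram_space ::
  "(real^'n) set set \<Rightarrow> 'v osys \<Rightarrow> ('v \<Rightarrow> (real^'n) set) \<Rightarrow> (real^'n) set \<Rightarrow> 'v set" where
  "diagram_space A \<Theta> \<rho> F = {v \<in> verts \<Theta>. face_ge F (\<rho> v)}"

text \<open>The map attached to $F_1 > F_2$ depends on $F_1$ only through its domain, so only
  $F_2$ is an argument.\<close>

definition diagram_map ::
  "(real^'n) set set \<Rightarrow> 'v osys \<Rightarrow> ('v \<Rightarrow> (real^'n) set) \<Rightarrow> (real^'n) set \<Rightarrow> 'v \<Rightarrow> 'v" where
  "diagram_map A \<Theta> \<rho> F\<^sub>2 v =
     opath_end (lift \<Theta> \<rho> v (minimal_path A (\<rho> v) (chamber_at A (\<rho> v) F\<^sub>2)))"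

definition plim ::
  "(real^'n) set set \<Rightarrow> 'v osys \<Rightarrow> ('v \<Rightarrow> (real^'n) set) \<Rightarrow> ((real^'n) set \<times> 'v) set" where
  "plim A \<Theta> \<rho> = Sigma (faces A) (diagram_space A \<Theta> \<rho>)"

definition plim_ge ::
  "(real^'n) set set \<Rightarrow> 'v osys \<Rightarrow> ('v \<Rightarrow> (real^'n) set) \<Rightarrow>
     (real^'n) set \<times> 'v \<Rightarrow> (real^'n) set \<times> 'v \<Rightarrow> bool" where
  "plim_ge A \<Theta> \<rho> = (\<lambda>(F\<^sub>1, v\<^sub>1) (F\<^sub>2, v\<^sub>2). face_ge F\<^sub>1 F\<^sub>2 \<and> v\<^sub>2 = diagram_map A \<Theta> \<rho> F\<^sub>2 v\<^sub>1)"

definition order_complex :: "'p set \<Rightarrow> ('p \<Rightarrow> 'p \<Rightarrow> bool) \<Rightarrow> 'p set set" where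
  "order_complex P ge =
     {\<sigma>. \<sigma> \<subseteq> P \<and> finite \<sigma> \<and> \<sigma> \<noteq> {} \<and> (\<forall>x\<in>\<sigma>. \<forall>y\<in>\<sigma>. ge x y \<or> ge y x)}"

definition W_complex ::
  "(real^'n) set set \<Rightarrow> 'v osys \<Rightarrow> ('v \<Rightarrow> (real^'n) set) \<Rightarrow> ((real^'n) set \<times> 'v) set set" where
  "W_complex A \<Theta> \<rho> = order_complex (plim A \<Theta> \<rho>) (plim_ge A \<Theta> \<rho>)"

section \<open>Geometric realization and covering maps\<close>

text \<open>Points are barycentric coordinates. The realization has the weak topology with respect to
  its closed simplices, each of which has its Euclidean topology (the subspace topology from the
  product \<open>'v \<Rightarrow> real\<close>, since its points vanish off a finite set).\<close>

definition closed_simplex :: "'v set \<Rightarrow> ('v \<Rightarrow> real) set" where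
  "closed_simplex \<sigma> = {f. (\<forall>v. 0 \<le> f v) \<and> (\<forall>v. v \<notin> \<sigma> \<longrightarrow> f v = 0) \<and> sum f \<sigma> = 1}"

definition realization :: "'v set set \<Rightarrow> ('v \<Rightarrow> real) topology" where
  "realization K =
     topology (\<lambda>U. U \<subseteq> (\<Union>\<sigma>\<in>K. closed_simplex \<sigma>) \<and>
       (\<forall>\<sigma>\<in>K. openin (top_of_set (closed_simplex \<sigma>)) (U \<inter> closed_simplex \<sigma>)))"

lemma openin_realization:
  "openin (realization K) U \<longleftrightarrow>
     U \<subseteq> (\<Union>\<sigma>\<in>K. closed_simplex \<sigma>) \<and>
     (\<forall>\<sigma>\<in>K. openin (top_of_set (closed_simplex \<sigma>)) (U \<inter> closed_simplex \<sigma>))"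
proof -
  have "istopology (\<lambda>U. U \<subseteq> (\<Union>\<sigma>\<in>K. closed_simplex \<sigma>) \<and>
       (\<forall>\<sigma>\<in>K. openin (top_of_set (closed_simplex \<sigma>)) (U \<inter> closed_simplex \<sigma>)))"
    unfolding istopology_def
  proof (intro conjI allI impI)
    fix S T
    assume S: "S \<subseteq> (\<Union>\<sigma>\<in>K. closed_simplex \<sigma>) \<and>
         (\<forall>\<sigma>\<in>K. openin (top_of_set (closed_simplex \<sigma>)) (S \<inter> closed_simplex \<sigma>))"
      and T: "T \<subseteq> (\<Union>\<sigma>\<in>K. closed_simplex \<sigma>) \<and>
         (\<forall>\<sigma>\<in>K. openin (top_of_set (closed_simplex \<sigma>)) (T \<inter> closed_simplex \<sigma>))"
    show "S \<inter> T \<subseteq> (\<Union>\<sigma>\<in>K. closed_simplex \<sigma>)" using S by blast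
    show "\<forall>\<sigma>\<in>K. openin (top_of_set (closed_simplex \<sigma>)) (S \<inter> T \<inter> closed_simplex \<sigma>)"
    proof
      fix \<sigma> assume "\<sigma> \<in> K"
      with S T have "openin (top_of_set (closed_simplex \<sigma>)) (S \<inter> closed_simplex \<sigma>)"
        and "openin (top_of_set (closed_simplex \<sigma>)) (T \<inter> closed_simplex \<sigma>)"
        by simp_all
      then have "openin (top_of_set (closed_simplex \<sigma>))
          ((S \<inter> closed_simplex \<sigma>) \<inter> (T \<inter> closed_simplex \<sigma>))"
        by (rule openin_Int)
      moreover have "(S \<inter> closed_simplex \<sigma>) \<inter> (T \<inter> closed_simplex \<sigma>) = S \<inter> T \<inter> closed_simplex \<sigma>"
        by blast
      ultimately show "openin (top_of_set (closed_simplex \<sigma>)) (S \<inter> T \<inter> closed_simplex \<sigma>)"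
        by (simp only:)
    qed
  next
    fix \<K>
    assume *: "\<forall>U\<in>\<K>. U \<subseteq> (\<Union>\<sigma>\<in>K. closed_simplex \<sigma>) \<and>
         (\<forall>\<sigma>\<in>K. openin (top_of_set (closed_simplex \<sigma>)) (U \<inter> closed_simplex \<sigma>))"
    show "\<Union>\<K> \<subseteq> (\<Union>\<sigma>\<in>K. closed_simplex \<sigma>)" using * by blast
    show "\<forall>\<sigma>\<in>K. openin (top_of_set (closed_simplex \<sigma>)) (\<Union>\<K> \<inter> closed_simplex \<sigma>)"
    proof
      fix \<sigma> assume "\<sigma> \<in> K"
      with * have "\<forall>V\<in>(\<lambda>U. U \<inter> closed_simplex \<sigma>) ` \<K>. openin (top_of_set (closed_simplex \<sigma>)) V"
        by simp
      then have "openin (top_of_set (closed_simplex \<sigma>)) (\<Union>U\<in>\<K>. U \<inter> closed_simplex \<sigma>)"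
        by (intro openin_Union) blast
      then show "openin (top_of_set (closed_simplex \<sigma>)) (\<Union>\<K> \<inter> closed_simplex \<sigma>)"
        by (simp only: Int_Union2)
    qed
  qed
  then show ?thesis
    by (simp only: realization_def topology_inverse')
qed

definition simplicial_extension :: "('v \<Rightarrow> 'u) \<Rightarrow> ('v \<Rightarrow> real) \<Rightarrow> 'u \<Rightarrow> real" where
  "simplicial_extension \<phi> f = (\<lambda>y. \<Sum>x | f x \<noteq> 0 \<and> \<phi> x = y. f x)"

definition affine_extension :: "('v \<Rightarrow> 'b::real_vector) \<Rightarrow> ('v \<Rightarrow> real) \<Rightarrow> 'b" where
  "affine_extension \<phi> f = (\<Sum>x | f x \<noteq> 0. f x *\<^sub>R \<phi> x)"

definition Lambda_map ::
  "('v \<Rightarrow> (real^'n) set) \<Rightarrow> ((real^'n) set \<times> 'v \<Rightarrow> real) \<Rightarrow> (real^'n) set \<times> (real^'n) set \<Rightarrow> real"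
  where "Lambda_map \<rho> = simplicial_extension (\<lambda>(F, v). (F, \<rho> v))"

definition sal_identification ::
  "(real^'n) set set \<Rightarrow> ((real^'n) set \<Rightarrow> real^'n) \<Rightarrow>
     ((real^'n) set \<times> (real^'n) set \<Rightarrow> real) \<Rightarrow> (real^'n) \<times> (real^'n)" where
  "sal_identification A w = affine_extension (\<lambda>(F, C). sal_vertex A w F C)"

text \<open>\<open>covering_space\<close> and \<open>simply_connected\<close> transferred from subsets of type-class spaces to
  abstract topologies: the realization of an infinite complex is not given as such a subset.\<close>

definition covering_map :: "'a topology \<Rightarrow> 'b topology \<Rightarrow> ('a \<Rightarrow> 'b) \<Rightarrow> bool" where
  "covering_map X Y p \<longleftrightarrow>
     continuous_map X Y p \<and> p ` topspace X = topspace Y \<and>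
     (\<forall>y\<in>topspace Y. \<exists>T. y \<in> T \<and> openin Y T \<and>
        (\<exists>\<V>. \<Union>\<V> = {x \<in> topspace X. p x \<in> T} \<and>
             (\<forall>U\<in>\<V>. openin X U) \<and> pairwise disjnt \<V> \<and>
             (\<forall>U\<in>\<V>. homeomorphic_map (subtopology X U) (subtopology Y T) p)))"

definition simply_connected_space :: "'a topology \<Rightarrow> bool" where
  "simply_connected_space X \<longleftrightarrow>
     topspace X \<noteq> {} \<and> path_connected_space X \<and>
     (\<forall>g. pathin X g \<and> g 1 = g 0 \<longrightarrow>
        homotopic_with (\<lambda>h. h 0 = g 0 \<and> h 1 = g 0) (top_of_set {0..1}) X g (\<lambda>_. g 0))"

definition universal_covering_map :: "'a topology \<Rightarrow> 'b topology \<Rightarrow> ('a \<Rightarrow> 'b) \<Rightarrow> bool" where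
  "universal_covering_map X Y p \<longleftrightarrow> covering_map X Y p \<and> simply_connected_space X"

end

theory Submission
  imports Defs
begin

text \<open>Edge paths in the order complex $W$ and the paths of the oriented system are compared in both
  directions. A gallery gives an edge path that passes each wall through the vertex over it, and an
  edge of $\mathrm{Plim}\,\mathscr{D}_\rho$ gives the lift of a minimal gallery. The point is that minimal
  galleries from $C$ to $D$ have homotopic edge paths: a minimal gallery between chambers around a
  common face $F$ lies below one vertex over $F$ and can be coned off, and the general case follows by
  letting a segment from a point of $C$ to a point of $D$ vary and recording the face through which it
  leaves $C$. Hence the relation of the oriented system maps to edge homotopy in $W$.

  The map $(F,v)\mapsto(F,\rho(v))$ is a covering of posets, therefore a covering of complexes along which
  edge homotopies lift. For the universal cover a closed edge path of $W_{\hat\rho}$ is carried to a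
  closed path of $\hat\Gamma$; comparison with the cover by path classes shows that its projection is null,
  so the edge path is null-homotopic in $W$ and, by lifting, in $W_{\hat\rho}$. Finally $W$ is embedded onto
  $Sal(\mathcal{A})$: the real parts recover the barycentric coordinates and the chain of faces, and then the
  imaginary parts recover the chambers.\<close>

section \<open>Signs of faces\<close>

text \<open>The universal property of \<open>universal_os_cover\<close> only supplies morphisms into
  other covers. That closed paths of the universal cover project to null paths is therefore
  extracted from one concrete cover whose lifts detect the relation; its vertices are numbered so
  that the property applies to it. The main obstacle is the comparison of two minimal galleries.
  Instead of elementary moves around faces of codimension two, a connectedness argument is used: the
  set of starting points in C is convex, and passing to a special point only enlarges the set of
  hyperplanes crossed at once, so the detours taken at nearby points all lie below the vertex over
  the special exit face. The induction runs over the number of separating hyperplanes. Edge homotopy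
  is a rewriting of vertex lists, which makes its lifting and its reversal purely combinatorial. One
  chosen affine form per hyperplane turns closures, the face order and the chambers C_F into finite
  sign conditions. Local finiteness identifies the weak topology with a subspace topology, in which
  paths can be joined and deformed.\<close>

definition hyp_normal :: "(real^'n) set \<Rightarrow> real^'n" where
  "hyp_normal H = (SOME a. a \<noteq> 0 \<and> (\<exists>b. H = {x. a \<bullet> x = b}))"

definition hyp_offset :: "(real^'n) set \<Rightarrow> real" where
  "hyp_offset H = (SOME b. H = {x. hyp_normal H \<bullet> x = b})"

definition hyp_form :: "(real^'n) set \<Rightarrow> real^'n \<Rightarrow> real" where
  "hyp_form H x = hyp_normal H \<bullet> x - hyp_offset H"

text \<open>The covector of F in oriented matroid terms. One point of F suffices because signs are
  constant on a face. The values depend on the chosen normals, but the same form of H serves every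
  face, so comparisons between faces are meaningful.\<close>

definition face_sign :: "(real^'n) set \<Rightarrow> (real^'n) set \<Rightarrow> real" where
  "face_sign F H = sgn (hyp_form H (SOME x. x \<in> F))"

lemma hyp_normal_offset:
  assumes "hyperplane H"
  shows "hyp_normal H \<noteq> 0" "H = {x. hyp_normal H \<bullet> x = hyp_offset H}"
proof -
  have 1: "\<exists>a. a \<noteq> 0 \<and> (\<exists>b. H = {x. a \<bullet> x = b})"
    using assms unfolding hyperplane_def by blast
  have 2: "hyp_normal H \<noteq> 0 \<and> (\<exists>b. H = {x. hyp_normal H \<bullet> x = b})"
    unfolding hyp_normal_def by (rule someI_ex[OF 1])
  then show "hyp_normal H \<noteq> 0" by blast
  show "H = {x. hyp_normal H \<bullet> x = hyp_offset H}"
    unfolding hyp_offset_def by (rule someI_ex) (use 2 in blast)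
qed

lemma mem_hyperplane_iff: "hyperplane H \<Longrightarrow> x \<in> H \<longleftrightarrow> hyp_form H x = 0"
  using hyp_normal_offset(2)[of H] by (auto simp: hyp_form_def)

lemma hyp_form_linear:
  "hyp_form H ((1 - t) *\<^sub>R x + t *\<^sub>R y) = (1 - t) * hyp_form H x + t * hyp_form H y"
  by (simp add: hyp_form_def inner_add_right algebra_simps)

lemma continuous_on_hyp_form [continuous_intros]:
  "continuous_on S f \<Longrightarrow> continuous_on S (\<lambda>x. hyp_form H (f x))"
  unfolding hyp_form_def by (intro continuous_intros)

lemma hyperplane_exists_off:
  fixes a :: "real^'n" assumes "a \<noteq> 0"
  shows "\<exists>x. a \<bullet> x = b"
  by (rule exI[of _ "(b / (a \<bullet> a)) *\<^sub>R a"]) (use assms in simp)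

text \<open>The part \<open>u\<close> of a orthogonal to a' is tangent to the common hyperplane.
  Moving x0 along \<open>u\<close> stays on it, so a is orthogonal to \<open>u\<close> as well, and
  \<open>u\<close> is orthogonal to itself.\<close>

lemma hyperplane_eq_imp_proportional:
  fixes a a' :: "real^'n"
  assumes "a \<noteq> 0" "a' \<noteq> 0" and eq: "{x. a \<bullet> x = b} = {x. a' \<bullet> x = b'}"
  shows "\<exists>c. c \<noteq> 0 \<and> a = c *\<^sub>R a' \<and> b = c * b'"
proof -
  obtain x0 where x0: "a' \<bullet> x0 = b'" using hyperplane_exists_off[OF assms(2)] by blast
  then have x0': "a \<bullet> x0 = b" using eq by blast
  define c where "c = (a \<bullet> a') / (a' \<bullet> a')"
  define u where "u = a - c *\<^sub>R a'"
  have u: "a' \<bullet> u = 0"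
    using assms(2) by (simp add: u_def c_def inner_diff_right inner_commute)
  then have "a' \<bullet> (x0 + u) = b'" using x0 by (simp add: inner_add_right)
  then have "a \<bullet> (x0 + u) = b" using eq by blast
  then have "a \<bullet> u = 0" using x0' by (simp add: inner_add_right)
  then have "u \<bullet> u = 0" using u by (simp add: u_def inner_diff_left)
  then have a: "a = c *\<^sub>R a'" by (simp add: u_def)
  then have "c \<noteq> 0" using assms(1) by auto
  moreover have "b = c * b'" using x0 x0' by (simp add: a)
  ultimately show ?thesis using a by blast
qed

lemma hyp_form_proportional:
  assumes "a \<noteq> 0" "H = {z. a \<bullet> z = b}"
  shows "\<exists>c. c \<noteq> 0 \<and> (\<forall>x. a \<bullet> x - b = c * hyp_form H x)"
proof -
  have h: "hyperplane H" using assms unfolding hyperplane_def by blast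
  have "{x. a \<bullet> x = b} = {x. hyp_normal H \<bullet> x = hyp_offset H}"
    using hyp_normal_offset(2)[OF h] assms(2) by simp
  from hyperplane_eq_imp_proportional[OF assms(1) hyp_normal_offset(1)[OF h] this]
  show ?thesis by (auto simp: hyp_form_def right_diff_distrib)
qed

text \<open>\<open>same_face\<close> ranges over every equation of every hyperplane. All equations
  of one hyperplane are proportional, and a nonzero factor acts on both signs alike, so the chosen
  form suffices.\<close>

lemma same_face_iff:
  assumes "arrangement A"
  shows "same_face A x y \<longleftrightarrow> (\<forall>H\<in>A. sgn (hyp_form H x) = sgn (hyp_form H y))"
proof
  assume l: "same_face A x y"
  show "\<forall>H\<in>A. sgn (hyp_form H x) = sgn (hyp_form H y)"
  proof
    fix H assume "H \<in> A"
    moreover then have "hyperplane H" using assms by (auto simp: arrangement_def)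
    ultimately show "sgn (hyp_form H x) = sgn (hyp_form H y)"
      using l hyp_normal_offset[of H] unfolding same_face_def hyp_form_def by metis
  qed
next
  assume r: "\<forall>H\<in>A. sgn (hyp_form H x) = sgn (hyp_form H y)"
  show "same_face A x y"
    unfolding same_face_def
  proof (intro allI impI)
    fix a b assume ab: "a \<noteq> 0 \<and> {z. a \<bullet> z = b} \<in> A"
    define H where "H = {z. a \<bullet> z = b}"
    have "a \<noteq> 0" and H: "H \<in> A" using ab unfolding H_def by (rule conjunct1, rule conjunct2)
    from hyp_form_proportional[OF \<open>a \<noteq> 0\<close> H_def] obtain c
      where c: "\<forall>x. a \<bullet> x - b = c * hyp_form H x"
      by metis
    show "sgn (a \<bullet> x - b) = sgn (a \<bullet> y - b)"
      unfolding c[rule_format] sgn_mult using bspec[OF r H] by (rule arg_cong)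
  qed
qed

lemma face_nonempty: "F \<in> faces A \<Longrightarrow> (SOME x. x \<in> F) \<in> F"
  unfolding faces_def by (rule someI_ex) (auto simp: same_face_def)

lemma face_eq:
  assumes "arrangement A" "F \<in> faces A"
  shows "F = {y. \<forall>H\<in>A. sgn (hyp_form H y) = face_sign F H}"
proof -
  obtain x where F: "F = {y. same_face A x y}" using assms(2) by (auto simp: faces_def)
  have mem: "y \<in> F \<longleftrightarrow> (\<forall>H\<in>A. sgn (hyp_form H x) = sgn (hyp_form H y))" for y
    unfolding same_face_iff[OF assms(1), symmetric] by (subst F) blast
  have "\<forall>H\<in>A. sgn (hyp_form H x) = face_sign F H"
    using mem[THEN iffD1, OF face_nonempty[OF assms(2)]] unfolding face_sign_def .
  then show ?thesis
    using mem by auto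
qed

lemma mem_face_iff:
  assumes "arrangement A" "F \<in> faces A"
  shows "y \<in> F \<longleftrightarrow> (\<forall>H\<in>A. sgn (hyp_form H y) = face_sign F H)"
  using face_eq[OF assms] by blast

lemma face_sign_eqI:
  assumes "arrangement A" "F \<in> faces A" "G \<in> faces A" "\<And>H. H \<in> A \<Longrightarrow> face_sign F H = face_sign G H"
  shows "F = G"
  using face_eq[OF assms(1,2)] face_eq[OF assms(1,3)] assms(4) by auto

section \<open>Cells of points, closures of faces and the face order\<close>

definition cell_of :: "(real^'n) set set \<Rightarrow> real^'n \<Rightarrow> (real^'n) set" where
  "cell_of A x = {y. same_face A x y}"

lemma cell_of_in_faces [simp]: "cell_of A x \<in> faces A"
  unfolding cell_of_def faces_def by (rule rangeI)

lemma mem_cell_of [simp]: "x \<in> cell_of A x"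
  by (auto simp: cell_of_def same_face_def)

lemma face_sign_mem:
  assumes "arrangement A" "F \<in> faces A" "x \<in> F" "H \<in> A"
  shows "face_sign F H = sgn (hyp_form H x)"
  using mem_face_iff[OF assms(1,2)] assms by simp

lemma face_sign_cell_of:
  assumes "arrangement A" "H \<in> A"
  shows "face_sign (cell_of A x) H = sgn (hyp_form H x)"
  using face_sign_mem[OF assms(1) cell_of_in_faces mem_cell_of assms(2)] .

lemma face_sign_cases: "face_sign F H = 0 \<or> face_sign F H = 1 \<or> face_sign F H = -1"
  by (auto simp: face_sign_def sgn_if)

lemma finite_faces:
  assumes "arrangement A"
  shows "finite (faces A)"
proof -
  have "finite A" using assms by (simp add: arrangement_def)
  let ?f = "\<lambda>F. restrict (face_sign F) A"
  have "inj_on ?f (faces A)"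
  proof (rule inj_onI)
    fix F G assume FG: "F \<in> faces A" "G \<in> faces A" "?f F = ?f G"
    then have "\<And>H. H \<in> A \<Longrightarrow> face_sign F H = face_sign G H" by (metis restrict_apply)
    then show "F = G" using FG face_sign_eqI[OF assms] by blast
  qed
  moreover have "?f ` faces A \<subseteq> (\<Pi>\<^sub>E H\<in>A. {0, 1, -1})" using face_sign_cases by fastforce
  moreover have "finite (\<Pi>\<^sub>E H\<in>A. {0::real, 1, -1})" using \<open>finite A\<close> by (intro finite_PiE) auto
  ultimately show ?thesis by (meson finite_imageD finite_subset)
qed

text \<open>A form vanishing at z takes the sign it has at y as soon as z is left, and a form with
  equal signs at both ends keeps that sign. Excluding t = 0 places the point in the face itself and
  not merely in its closure.\<close>

lemma segment_in_open_face:
  assumes "arrangement A" "F \<in> faces A" "y \<in> F" "0 < t" "t \<le> 1"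
    and "\<And>H. H \<in> A \<Longrightarrow> sgn (hyp_form H z) = 0 \<or> sgn (hyp_form H z) = face_sign F H"
  shows "(1 - t) *\<^sub>R z + t *\<^sub>R y \<in> F"
  unfolding mem_face_iff[OF assms(1,2)]
proof
  fix H assume H: "H \<in> A"
  have y: "sgn (hyp_form H y) = face_sign F H" using H assms mem_face_iff by blast
  have z: "sgn (hyp_form H z) = 0 \<or> sgn (hyp_form H z) = sgn (hyp_form H y)"
    using assms(6)[OF H] y by simp
  have "sgn ((1 - t) * hyp_form H z + t * hyp_form H y) = sgn (hyp_form H y)"
  proof (cases "hyp_form H z = 0")
    case True then show ?thesis using assms by (simp add: sgn_mult)
  next
    case False
    then have s: "sgn (hyp_form H z) = sgn (hyp_form H y)" using z by (auto simp: sgn_zero_iff)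
    show ?thesis
    proof (cases "hyp_form H z > 0")
      case True
      then have "hyp_form H y > 0" using s by (metis sgn_greater)
      then have "(1 - t) * hyp_form H z + t * hyp_form H y > 0"
        using True assms by (intro add_nonneg_pos mult_pos_pos mult_nonneg_nonneg) auto
      then show ?thesis using \<open>hyp_form H y > 0\<close> by simp
    next
      case F: False
      then have z0: "hyp_form H z < 0" using False by simp
      then have "hyp_form H y < 0" using s by (metis sgn_less)
      then have "(1 - t) * hyp_form H z + t * hyp_form H y < 0"
        using z0 assms by (intro add_nonpos_neg mult_pos_neg mult_nonneg_nonpos) auto
      then show ?thesis using \<open>hyp_form H y < 0\<close> by simp
    qed
  qed
  then show "sgn (hyp_form H ((1 - t) *\<^sub>R z + t *\<^sub>R y)) = face_sign F H"
    by (simp add: hyp_form_linear y)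
qed

lemma closed_form_sign:
  fixes s :: real
  assumes "s = 0 \<or> s = 1 \<or> s = -1"
  shows "closed {y. sgn (hyp_form H y) = 0 \<or> sgn (hyp_form H y) = s}"
proof -
  have c: "continuous_on UNIV (hyp_form H)"
    using continuous_on_hyp_form[OF continuous_on_id] by simp
  consider "s = 0" | "s = 1" | "s = -1" using assms by blast
  then show ?thesis
  proof cases
    case 1
    then have "{y. sgn (hyp_form H y) = 0 \<or> sgn (hyp_form H y) = s} = {y. hyp_form H y = 0}"
      by (auto simp: sgn_zero_iff)
    then show ?thesis using c by (simp add: closed_Collect_eq)
  next
    case 2
    then have "{y. sgn (hyp_form H y) = 0 \<or> sgn (hyp_form H y) = s} = {y. 0 \<le> hyp_form H y}"
      by (auto simp: sgn_if split: if_splits)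
    then show ?thesis using c by (simp add: closed_Collect_le)
  next
    case 3
    then have "{y. sgn (hyp_form H y) = 0 \<or> sgn (hyp_form H y) = s} = {y. hyp_form H y \<le> 0}"
      by (auto simp: sgn_if split: if_splits)
    then show ?thesis using c by (simp add: closed_Collect_le)
  qed
qed

text \<open>The right side is an intersection of closed sets containing F. Conversely each of its
  points is a limit of points of F along a segment ending in F. This is what turns the order by
  closures into a sign condition.\<close>

lemma closure_face:
  assumes "arrangement A" "F \<in> faces A"
  shows "closure F = {y. \<forall>H\<in>A. sgn (hyp_form H y) = 0 \<or> sgn (hyp_form H y) = face_sign F H}"
    (is "_ = ?R")
proof
  have "closed (\<Inter>H\<in>A. {y. sgn (hyp_form H y) = 0 \<or> sgn (hyp_form H y) = face_sign F H})"
    by (intro closed_INT ballI closed_form_sign face_sign_cases)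
  moreover have "(\<Inter>H\<in>A. {y. sgn (hyp_form H y) = 0 \<or> sgn (hyp_form H y) = face_sign F H}) = ?R" by blast
  ultimately have "closed ?R" by (simp only:)
  moreover have "F \<subseteq> ?R"
  proof
    fix y assume "y \<in> F"
    then show "y \<in> ?R" using mem_face_iff[OF assms, of y] by blast
  qed
  ultimately show "closure F \<subseteq> ?R" by (intro closure_minimal)
next
  show "?R \<subseteq> closure F"
  proof
    fix z assume z: "z \<in> ?R"
    obtain y where y: "y \<in> F" using face_nonempty[OF assms(2)] by blast
    let ?g = "\<lambda>n. (1 - inverse (real (Suc n))) *\<^sub>R z + inverse (real (Suc n)) *\<^sub>R y"
    have "?g n \<in> F" for n
      by (rule segment_in_open_face[OF assms y]) (use z in \<open>auto simp: divide_simps\<close>)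
    moreover have "?g \<longlonglongrightarrow> (1 - 0) *\<^sub>R z + 0 *\<^sub>R y"
      by (intro tendsto_intros LIMSEQ_inverse_real_of_nat)
    ultimately show "z \<in> closure F" unfolding closure_sequential by (intro exI[of _ ?g]) simp
  qed
qed

lemma subset_closure_iff:
  assumes "arrangement A" "F \<in> faces A" "G \<in> faces A"
  shows "F \<subseteq> closure G \<longleftrightarrow> (\<forall>H\<in>A. face_sign F H = 0 \<or> face_sign F H = face_sign G H)"
proof
  assume "F \<subseteq> closure G"
  moreover obtain x where "x \<in> F" using face_nonempty[OF assms(2)] by blast
  ultimately show "\<forall>H\<in>A. face_sign F H = 0 \<or> face_sign F H = face_sign G H"
    using face_sign_mem[OF assms(1,2)] closure_face[OF assms(1,3)] by auto
next
  assume "\<forall>H\<in>A. face_sign F H = 0 \<or> face_sign F H = face_sign G H"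
  then show "F \<subseteq> closure G"
    using mem_face_iff[OF assms(1,2)] closure_face[OF assms(1,3)] by auto
qed

lemma face_ge_iff_subset: "face_ge F G \<longleftrightarrow> F \<subseteq> closure G"
  unfolding face_ge_def by (meson closed_closure closure_minimal closure_subset order_trans)

lemma face_ge_iff:
  assumes "arrangement A" "F \<in> faces A" "G \<in> faces A"
  shows "face_ge F G \<longleftrightarrow> (\<forall>H\<in>A. face_sign F H = 0 \<or> face_sign F H = face_sign G H)"
  using face_ge_iff_subset subset_closure_iff[OF assms] by blast

lemma face_ge_refl [simp]: "face_ge F F"
  by (simp add: face_ge_def)

lemma face_ge_trans: "face_ge F G \<Longrightarrow> face_ge G K \<Longrightarrow> face_ge F K"
  by (auto simp: face_ge_def)

lemma face_ge_antisym:
  assumes "arrangement A" "F \<in> faces A" "G \<in> faces A" "face_ge F G" "face_ge G F"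
  shows "F = G"
  by (rule face_sign_eqI[OF assms(1-3)]) (use assms face_ge_iff in metis)

text \<open>No equation with (c i, d i) nonzero holds throughout a nonempty open set, so finitely
  many are avoided one at a time by shrinking the open set. The alternative in the hypothesis covers
  the degenerate equation 0 = d i, which no point satisfies.\<close>

lemma generic_point:
  fixes S :: "(real^'n) set" and c :: "'i \<Rightarrow> real^'n" and d :: "'i \<Rightarrow> real"
  assumes "finite I" "open S" "S \<noteq> {}" "\<And>i. i \<in> I \<Longrightarrow> c i \<noteq> 0 \<or> d i \<noteq> 0"
  shows "\<exists>x\<in>S. \<forall>i\<in>I. c i \<bullet> x \<noteq> d i"
proof -
  have "\<exists>T. open T \<and> T \<noteq> {} \<and> T \<subseteq> S \<and> (\<forall>x\<in>T. \<forall>i\<in>I. c i \<bullet> x \<noteq> d i)"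
    using assms(1,4)
  proof (induction I rule: finite_induct)
    case empty
    then show ?case using assms(2,3) by auto
  next
    case (insert i I)
    then obtain T where T: "open T" "T \<noteq> {}" "T \<subseteq> S" "\<forall>x\<in>T. \<forall>i\<in>I. c i \<bullet> x \<noteq> d i" by auto
    let ?T = "T \<inter> {x. c i \<bullet> x \<noteq> d i}"
    have "open {x. c i \<bullet> x \<noteq> d i}"
      by (intro open_Collect_neq continuous_intros)
    then have o: "open ?T" using T(1) by blast
    have "?T \<noteq> {}"
    proof
      assume "?T = {}"
      then have all: "\<forall>x\<in>T. c i \<bullet> x = d i" by blast
      obtain x e where x: "x \<in> T" "e > 0" "ball x e \<subseteq> T"
        using T(1,2) by (meson ex_in_conv open_contains_ball)
      have c0: "c i \<noteq> 0"
      proof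
        assume "c i = 0"
        then show False using all x(1) insert.prems[of i] by auto
      qed
      \<comment> \<open>Half the radius in direction c i: the point stays in the ball, while its
        inner product with c i grows by half of e times the norm of c i.\<close>
      let ?y = "x + (e / (2 * norm (c i))) *\<^sub>R c i"
      have "?y \<in> ball x e" using x(2) c0 by (simp add: dist_norm)
      then have "c i \<bullet> ?y = c i \<bullet> x" using all x by auto
      then show False using x(2) c0 by (simp add: inner_add_right)
    qed
    then show ?case using T o by (intro exI[of _ ?T]) auto
  qed
  then show ?thesis by (metis all_not_in_conv subsetD)
qed

text \<open>Minimality is used through a perturbation: a generic point that keeps all nonzero signs
  of x spans a cell below C. The cell must then be C itself, and its signs are nonzero.\<close>

lemma chambers_iff:
  assumes "arrangement A"
  shows "C \<in> chambers A \<longleftrightarrow> C \<in> faces A \<and> (\<forall>H\<in>A. face_sign C H \<noteq> 0)"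
proof
  assume C: "C \<in> faces A \<and> (\<forall>H\<in>A. face_sign C H \<noteq> 0)"
  moreover have "\<not> (\<exists>F\<in>faces A. face_gt C F)"
  proof
    assume "\<exists>F\<in>faces A. face_gt C F"
    then obtain F where F: "F \<in> faces A" "face_ge C F" "C \<noteq> F" by (auto simp: face_gt_def)
    then have "\<forall>H\<in>A. face_sign C H = face_sign F H" using C face_ge_iff[OF assms] by metis
    then show False using F C face_sign_eqI[OF assms] by blast
  qed
  ultimately show "C \<in> chambers A" by (simp add: chambers_def)
next
  assume C: "C \<in> chambers A"
  then have CF: "C \<in> faces A" by (simp add: chambers_def)
  have fin: "finite A" and hyp: "\<And>H. H \<in> A \<Longrightarrow> hyperplane H"
    using assms by (auto simp: arrangement_def)
  obtain x where x: "x \<in> C" using face_nonempty[OF CF] by blast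
  let ?B = "{H\<in>A. hyp_form H x \<noteq> 0}"
  let ?S = "\<Inter>H\<in>?B. {y. sgn (hyp_form H x) * hyp_form H y > 0}"
  have "open ?S"
    using fin by (intro open_INT ballI open_Collect_less continuous_intros) auto
  moreover have "x \<in> ?S"
    by (auto simp: sgn_if)
  ultimately have "\<exists>y\<in>?S. \<forall>H\<in>A. hyp_normal H \<bullet> y \<noteq> hyp_offset H"
    using generic_point[OF fin, of ?S hyp_normal hyp_offset] hyp hyp_normal_offset(1) by blast
  then obtain y where y: "y \<in> ?S" "\<forall>H\<in>A. hyp_form H y \<noteq> 0" by (auto simp: hyp_form_def)
  have sx: "face_sign C H = sgn (hyp_form H x)" if "H \<in> A" for H
    using face_sign_mem[OF assms CF x that] .
  have sy: "face_sign (cell_of A y) H = sgn (hyp_form H y)" if "H \<in> A" for H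
    using face_sign_cell_of[OF assms that] .
  have "face_ge C (cell_of A y)"
    unfolding face_ge_iff[OF assms CF cell_of_in_faces]
  proof
    fix H assume H: "H \<in> A"
    show "face_sign C H = 0 \<or> face_sign C H = face_sign (cell_of A y) H"
    proof (cases "hyp_form H x = 0")
      case True then show ?thesis using sx[OF H] by simp
    next
      case False
      then have "sgn (hyp_form H x) * hyp_form H y > 0" using y(1) H by blast
      then have "sgn (hyp_form H x) = sgn (hyp_form H y)"
        by (auto simp: sgn_if zero_less_mult_iff split: if_splits)
      then show ?thesis using sx sy H by simp
    qed
  qed
  then have "C = cell_of A y" using C by (auto simp: chambers_def face_gt_def)
  then show "C \<in> faces A \<and> (\<forall>H\<in>A. face_sign C H \<noteq> 0)"
    using CF sy y(2) by (simp add: sgn_zero_iff)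
qed

section \<open>Localizations and the chambers C_F\<close>

lemma chamber_is_face: "C \<in> chambers A \<Longrightarrow> C \<in> faces A"
  by (simp add: chambers_def)

lemma chamber_sign_cases:
  assumes "arrangement A" "C \<in> chambers A" "H \<in> A"
  shows "face_sign C H = 1 \<or> face_sign C H = -1"
  using chambers_iff[OF assms(1)] assms face_sign_cases[of C H] by auto

lemma arrangement_localization: "arrangement A \<Longrightarrow> arrangement (localization A F)"
  by (auto simp: arrangement_def localization_def)

lemma localization_iff:
  assumes "arrangement A" "F \<in> faces A"
  shows "H \<in> localization A F \<longleftrightarrow> H \<in> A \<and> face_sign F H = 0"
proof -
  have "affine hull F \<subseteq> H \<longleftrightarrow> face_sign F H = 0" if H: "H \<in> A"
  proof -
    have hyp: "hyperplane H" using H assms by (auto simp: arrangement_def)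
    have "affine H" using hyp_normal_offset(2)[OF hyp] affine_hyperplane by metis
    then have "affine hull F \<subseteq> H \<longleftrightarrow> F \<subseteq> H"
      by (meson hull_minimal hull_subset order_trans)
    also have "\<dots> \<longleftrightarrow> (\<forall>x\<in>F. sgn (hyp_form H x) = 0)"
      using mem_hyperplane_iff[OF hyp] by (auto simp: sgn_zero_iff)
    also have "\<dots> \<longleftrightarrow> face_sign F H = 0"
      using face_sign_mem[OF assms _ H] face_nonempty[OF assms(2)] by metis
    finally show ?thesis .
  qed
  then show ?thesis by (auto simp: localization_def)
qed

text \<open>The sign rule is the composition of the covectors of F and C (the Tits product). A
  witness is the cell of a point displaced slightly from F towards C: nonzero signs of F persist,
  vanishing ones take the sign of C. Uniqueness holds because the closure condition fixes the signs
  that are nonzero on F and the common chamber of the localization fixes the others.\<close>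

lemma chamber_at_unique_ex:
  assumes A: "arrangement A" and C: "C \<in> chambers A" and F: "F \<in> faces A"
  shows "chamber_at A C F \<in> chambers A \<and>
    (\<forall>H\<in>A. face_sign (chamber_at A C F) H = (if face_sign F H = 0 then face_sign C H else face_sign F H))"
proof -
  let ?B = "localization A F"
  have B: "arrangement ?B" using A by (rule arrangement_localization)
  have CF: "C \<in> faces A" using C by (rule chamber_is_face)
  let ?sg = "\<lambda>H. if face_sign F H = 0 then face_sign C H else face_sign F H"
  let ?P = "\<lambda>D. D \<in> chambers A \<and> F \<subseteq> closure D \<and> (\<exists>K\<in>chambers ?B. C \<subseteq> K \<and> D \<subseteq> K)"
  obtain c where c: "c \<in> C" using face_nonempty[OF CF] by blast
  obtain f where f: "f \<in> F" using face_nonempty[OF F] by blast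
  have sc: "sgn (hyp_form H c) = face_sign C H" and sf: "sgn (hyp_form H f) = face_sign F H"
    if "H \<in> A" for H
    using face_sign_mem[OF A CF c that] face_sign_mem[OF A F f that] by auto
  have fin: "finite A" using A by (simp add: arrangement_def)
  let ?g = "\<lambda>t. (1 - t) *\<^sub>R f + t *\<^sub>R c"
  have ev: "\<forall>\<^sub>F t in at_right 0. \<forall>H\<in>A. sgn (hyp_form H (?g t)) = ?sg H"
  proof (rule eventually_ball_finite[OF fin], rule ballI)
    fix H assume H: "H \<in> A"
    show "\<forall>\<^sub>F t in at_right 0. sgn (hyp_form H (?g t)) = ?sg H"
    proof (cases "face_sign F H = 0")
      case True
      then have "hyp_form H f = 0" using sf[OF H] by (simp add: sgn_zero_iff)
      then have e: "sgn (hyp_form H (?g t)) = ?sg H" if "t > 0" for t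
        using that True sc[OF H] by (simp add: hyp_form_linear sgn_mult)
      show ?thesis
        by (rule eventually_mono[OF eventually_at_right_less[of "0::real"]]) (use e in blast)
    next
      case False
      have lim: "((\<lambda>t. hyp_form H (?g t)) \<longlongrightarrow> (1 - 0) * hyp_form H f + 0 * hyp_form H c) (at_right 0)"
        unfolding hyp_form_linear by (intro tendsto_intros)
      have f0: "hyp_form H f \<noteq> 0" using False sf[OF H] by auto
      consider "hyp_form H f > 0" | "hyp_form H f < 0" using f0 by linarith
      then show ?thesis
      proof cases
        case 1
        then have "\<forall>\<^sub>F t in at_right 0. hyp_form H (?g t) > 0"
          using order_tendstoD(1)[OF lim, of 0] by simp
        then show ?thesis by eventually_elim (use 1 False sf[OF H] in auto)
      next
        case 2
        then have "\<forall>\<^sub>F t in at_right 0. hyp_form H (?g t) < 0"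
          using order_tendstoD(2)[OF lim, of 0] by simp
        then show ?thesis by eventually_elim (use 2 False sf[OF H] in auto)
      qed
    qed
  qed
  then obtain t where t: "\<forall>H\<in>A. sgn (hyp_form H (?g t)) = ?sg H"
    using eventually_happens'[OF trivial_limit_at_right_real] by blast
  define D where "D = cell_of A (?g t)"
  have sD: "face_sign D H = ?sg H" if "H \<in> A" for H
    using t that by (simp add: D_def face_sign_cell_of[OF A])
  have DF: "D \<in> faces A" by (simp add: D_def)
  have DC: "D \<in> chambers A"
    using DF sD C by (auto simp: chambers_iff[OF A])
  have bs: "face_sign (cell_of ?B x) H = sgn (hyp_form H x)" if "H \<in> ?B" for H x
    using face_sign_cell_of[OF B that] .
  have PD: "?P D"
  proof (intro conjI bexI)
    show "F \<subseteq> closure D" using subset_closure_iff[OF A F DF] sD by simp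
    have "C \<in> faces A" by fact
    show "cell_of ?B c \<in> chambers ?B"
      using sc C by (auto simp: chambers_iff[OF B] bs localization_iff[OF A F] chambers_iff[OF A])
    show "C \<subseteq> cell_of ?B c"
      using mem_face_iff[OF A CF] mem_face_iff[OF B cell_of_in_faces] sc bs localization_iff[OF A F]
      by auto
    show "D \<subseteq> cell_of ?B c"
    proof
      fix x assume x: "x \<in> D"
      have "sgn (hyp_form H x) = face_sign (cell_of ?B c) H" if "H \<in> ?B" for H
      proof -
        have H: "H \<in> A" "face_sign F H = 0" using that localization_iff[OF A F] by auto
        show ?thesis using sc[OF H(1)] bs[OF that] sD[OF H(1)] face_sign_mem[OF A DF x H(1)] H by simp
      qed
      then show "x \<in> cell_of ?B c" using mem_face_iff[OF B cell_of_in_faces] by blast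
    qed
  qed (use DC in auto)
  have uniq: "E = D" if E: "?P E" for E
  proof (rule face_sign_eqI[OF A])
    show EF: "E \<in> faces A" using E chamber_is_face by blast
    show "D \<in> faces A" by fact
    fix H assume H: "H \<in> A"
    obtain K where K: "K \<in> chambers ?B" "C \<subseteq> K" "E \<subseteq> K" using E by blast
    obtain e where e: "e \<in> E" using face_nonempty[OF EF] by blast
    show "face_sign E H = face_sign D H"
    proof (cases "face_sign F H = 0")
      case True
      then have HB: "H \<in> ?B" using H localization_iff[OF A F] by blast
      have KF: "K \<in> faces ?B" using K chamber_is_face by blast
      have "sgn (hyp_form H e) = sgn (hyp_form H c)"
        using face_sign_mem[OF B KF _ HB] K e c by (metis subsetD)
      then show ?thesis using True sD[OF H] sc[OF H] face_sign_mem[OF A EF e H] by simp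
    next
      case False
      then show ?thesis using E sD[OF H] H subset_closure_iff[OF A F EF] by auto
    qed
  qed
  have "chamber_at A C F = D"
    unfolding chamber_at_def by (rule the_equality) (use PD uniq in blast)+
  then show ?thesis using DC sD by simp
qed

lemma chamber_at_in [simp]:
  "arrangement A \<Longrightarrow> C \<in> chambers A \<Longrightarrow> F \<in> faces A \<Longrightarrow> chamber_at A C F \<in> chambers A"
  using chamber_at_unique_ex by blast

lemma face_sign_chamber_at:
  "arrangement A \<Longrightarrow> C \<in> chambers A \<Longrightarrow> F \<in> faces A \<Longrightarrow> H \<in> A \<Longrightarrow>
   face_sign (chamber_at A C F) H = (if face_sign F H = 0 then face_sign C H else face_sign F H)"
  using chamber_at_unique_ex by blast

section \<open>Separating hyperplanes and adjacency\<close>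

definition sep_set :: "(real^'n) set set \<Rightarrow> (real^'n) set \<Rightarrow> (real^'n) set \<Rightarrow> (real^'n) set set" where
  "sep_set A C D = {H\<in>A. face_sign C H \<noteq> face_sign D H}"

text \<open>\<open>separates\<close> puts C on the negative side, but a normal may be reversed, so
  opposite signs in either order qualify.\<close>

lemma separates_iff:
  assumes A: "arrangement A" and C: "C \<in> chambers A" and D: "D \<in> chambers A" and H: "H \<in> A"
  shows "separates H C D \<longleftrightarrow> face_sign C H \<noteq> face_sign D H"
proof
  assume "separates H C D"
  then obtain a b where ab: "a \<noteq> 0" "H = {x. a \<bullet> x = b}" "C \<subseteq> {x. a \<bullet> x < b}" "D \<subseteq> {x. a \<bullet> x > b}"
    unfolding separates_def by blast
  obtain c where c: "c \<in> C" using face_nonempty[OF chamber_is_face[OF C]] by blast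
  obtain d where d: "d \<in> D" using face_nonempty[OF chamber_is_face[OF D]] by blast
  obtain k where k: "k \<noteq> 0" "\<And>x. a \<bullet> x - b = k * hyp_form H x"
    using hyp_form_proportional[OF ab(1,2)] by blast
  have "k * hyp_form H c < 0" "k * hyp_form H d > 0"
    using k(2)[of c] k(2)[of d] ab c d by auto
  then have "sgn (hyp_form H c) \<noteq> sgn (hyp_form H d)"
    by (auto simp: sgn_if mult_less_0_iff zero_less_mult_iff split: if_splits)
  then show "face_sign C H \<noteq> face_sign D H"
    using face_sign_mem[OF A chamber_is_face[OF C] c H] face_sign_mem[OF A chamber_is_face[OF D] d H] by simp
next
  assume ne: "face_sign C H \<noteq> face_sign D H"
  have hyp: "hyperplane H" using A H by (auto simp: arrangement_def)
  have nz: "hyp_normal H \<noteq> 0" and eq: "H = {x. hyp_normal H \<bullet> x = hyp_offset H}"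
    using hyp_normal_offset[OF hyp] by auto
  have sC: "sgn (hyp_form H x) = face_sign C H" if "x \<in> C" for x
    using face_sign_mem[OF A chamber_is_face[OF C] that H] by simp
  have sD: "sgn (hyp_form H x) = face_sign D H" if "x \<in> D" for x
    using face_sign_mem[OF A chamber_is_face[OF D] that H] by simp
  consider "face_sign C H = -1" "face_sign D H = 1" | "face_sign C H = 1" "face_sign D H = -1"
    using ne chamber_sign_cases[OF A C H] chamber_sign_cases[OF A D H] by auto
  then show "separates H C D"
  proof cases
    case 1
    have "C \<subseteq> {x. hyp_normal H \<bullet> x < hyp_offset H}" "D \<subseteq> {x. hyp_normal H \<bullet> x > hyp_offset H}"
      using sC sD unfolding 1 sgn_1_pos sgn_1_neg by (auto simp: hyp_form_def)
    then show ?thesis unfolding separates_def using nz eq by blast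
  next
    case 2
    have "C \<subseteq> {x. (- hyp_normal H) \<bullet> x < - hyp_offset H}" "D \<subseteq> {x. (- hyp_normal H) \<bullet> x > - hyp_offset H}"
      using sC sD unfolding 2 sgn_1_pos sgn_1_neg by (auto simp: hyp_form_def)
    moreover have "H = {x. (- hyp_normal H) \<bullet> x = - hyp_offset H}" using eq by simp
    moreover have "- hyp_normal H \<noteq> 0" using nz by simp
    ultimately show ?thesis unfolding separates_def by blast
  qed
qed

lemma adjacent_iff:
  assumes "arrangement A" "C \<in> chambers A" "D \<in> chambers A"
  shows "adjacent A C D \<longleftrightarrow> card (sep_set A C D) = 1"
proof -
  have "{H \<in> A. separates H C D} = sep_set A C D"
    using separates_iff[OF assms] by (auto simp: sep_set_def)
  then show ?thesis by (simp add: adjacent_def)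
qed

lemma finite_sep_set [simp]: "arrangement A \<Longrightarrow> finite (sep_set A C D)"
  by (simp add: sep_set_def arrangement_def)

lemma chamber_eqI:
  assumes "arrangement A" "C \<in> chambers A" "D \<in> chambers A" "sep_set A C D = {}"
  shows "C = D"
  by (rule face_sign_eqI[OF assms(1)]) (use assms chamber_is_face in \<open>auto simp: sep_set_def\<close>)

section \<open>Edge paths and their homotopies\<close>

definition abstract_complex :: "'a set set \<Rightarrow> bool" where
  "abstract_complex K \<longleftrightarrow> (\<forall>\<sigma>\<in>K. finite \<sigma> \<and> \<sigma> \<noteq> {} \<and> (\<forall>\<tau>. \<tau> \<subseteq> \<sigma> \<and> \<tau> \<noteq> {} \<longrightarrow> \<tau> \<in> K))"

lemma abstract_complexD:
  assumes "abstract_complex K" "\<sigma> \<in> K"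
  shows "finite \<sigma>" "\<sigma> \<noteq> {}" "\<And>\<tau>. \<tau> \<subseteq> \<sigma> \<Longrightarrow> \<tau> \<noteq> {} \<Longrightarrow> \<tau> \<in> K"
  using assms unfolding abstract_complex_def by blast+

definition edge_path :: "'a set set \<Rightarrow> 'a list \<Rightarrow> bool" where
  "edge_path K xs \<longleftrightarrow> xs \<noteq> [] \<and> set xs \<subseteq> \<Union>K \<and> successively (\<lambda>x y. {x, y} \<in> K) xs"

text \<open>Edge paths are composed by appending lists, which keeps the common end point twice; the rule
  \<open>dup\<close> makes up for this.\<close>

inductive edge_step :: "'a set set \<Rightarrow> 'a list \<Rightarrow> 'a list \<Rightarrow> bool" for K where
  tri: "{x, y, z} \<in> K \<Longrightarrow> edge_step K (us @ [x, y, z] @ vs) (us @ [x, z] @ vs)"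
| dup: "edge_step K (us @ [x, x] @ vs) (us @ [x] @ vs)"

text \<open>The closure acts on arbitrary vertex lists. In an abstract complex a step in either
  direction preserves edge paths, so homotopic lists stay edge paths once one of them is.\<close>

definition edge_hom :: "'a set set \<Rightarrow> 'a list \<Rightarrow> 'a list \<Rightarrow> bool" where
  "edge_hom K = equivclp (edge_step K)"

lemma edge_hom_refl [simp, intro]: "edge_hom K xs xs"
  by (simp add: edge_hom_def)

lemma edge_hom_sym: "edge_hom K xs ys \<Longrightarrow> edge_hom K ys xs"
  by (simp add: edge_hom_def equivclp_sym)

lemma edge_hom_trans [trans]: "edge_hom K xs ys \<Longrightarrow> edge_hom K ys zs \<Longrightarrow> edge_hom K xs zs"
  unfolding edge_hom_def by (rule equivclp_trans)

lemma edge_step_imp_hom: "edge_step K xs ys \<Longrightarrow> edge_hom K xs ys"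
  by (auto simp: edge_hom_def)

lemma edge_hom_induct [consumes 1, case_names base step unstep]:
  assumes "edge_hom K xs ys" "P xs"
    and "\<And>ys zs. edge_hom K xs ys \<Longrightarrow> P ys \<Longrightarrow> edge_step K ys zs \<Longrightarrow> P zs"
    and "\<And>ys zs. edge_hom K xs ys \<Longrightarrow> P ys \<Longrightarrow> edge_step K zs ys \<Longrightarrow> P zs"
  shows "P ys"
  using assms(1) unfolding edge_hom_def
proof (induction rule: equivclp_induct)
  case (step y z) then show ?case using assms(3,4) unfolding edge_hom_def by blast
qed (rule assms(2))

lemma edge_hom_tri: "{x, y, z} \<in> K \<Longrightarrow> edge_hom K (us @ [x, y, z] @ vs) (us @ [x, z] @ vs)"
  by (intro edge_step_imp_hom edge_step.tri)

lemma edge_hom_dup: "edge_hom K (us @ [x, x] @ vs) (us @ [x] @ vs)"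
  by (intro edge_step_imp_hom edge_step.dup)

lemma edge_step_append: "edge_step K xs ys \<Longrightarrow> edge_step K (us @ xs @ vs) (us @ ys @ vs)"
proof (induction rule: edge_step.induct)
  case (tri x y z us' vs')
  then show ?case using edge_step.tri[of x y z K "us @ us'" "vs' @ vs"] by simp
next
  case (dup us' x vs')
  then show ?case using edge_step.dup[of K "us @ us'" x "vs' @ vs"] by simp
qed

lemma edge_hom_append_middle: "edge_hom K xs ys \<Longrightarrow> edge_hom K (us @ xs @ vs) (us @ ys @ vs)"
proof (induction rule: edge_hom_induct)
  case (step ys zs)
  then show ?case using edge_hom_trans edge_step_imp_hom[OF edge_step_append] by blast
next
  case (unstep ys zs)
  then show ?case using edge_hom_trans edge_hom_sym[OF edge_step_imp_hom[OF edge_step_append]] by blast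
qed auto

lemma edge_hom_append: "edge_hom K xs ys \<Longrightarrow> edge_hom K xs' ys' \<Longrightarrow> edge_hom K (xs @ xs') (ys @ ys')"
  using edge_hom_append_middle[of K xs ys "[]" xs'] edge_hom_append_middle[of K xs' ys' ys "[]"]
  by (auto intro: edge_hom_trans)

lemma edge_step_rev: "edge_step K xs ys \<Longrightarrow> edge_step K (rev xs) (rev ys)"
proof (induction rule: edge_step.induct)
  case (tri x y z us vs)
  then have "{z, y, x} \<in> K" by (simp add: insert_commute)
  then show ?case using edge_step.tri[of z y x K "rev vs" "rev us"] by simp
next
  case (dup us x vs)
  then show ?case using edge_step.dup[of K "rev vs" x "rev us"] by simp
qed

lemma edge_hom_rev: "edge_hom K xs ys \<Longrightarrow> edge_hom K (rev xs) (rev ys)"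
proof (induction rule: edge_hom_induct)
  case (step ys zs)
  then show ?case using edge_hom_trans edge_step_imp_hom[OF edge_step_rev] by blast
next
  case (unstep ys zs)
  then show ?case using edge_hom_trans edge_hom_sym[OF edge_step_imp_hom[OF edge_step_rev]] by blast
qed auto

lemma edge_step_ends:
  "edge_step K xs ys \<Longrightarrow> xs \<noteq> [] \<and> ys \<noteq> [] \<and> hd xs = hd ys \<and> last xs = last ys"
  by (induction rule: edge_step.induct) (auto simp: hd_append)

lemma edge_hom_ends: "edge_hom K xs ys \<Longrightarrow> hd xs = hd ys \<and> last xs = last ys \<and> (xs = [] \<longleftrightarrow> ys = [])"
  by (induction rule: edge_hom_induct) (auto dest: edge_step_ends)

text \<open>Spurs have no rule of their own: \<open>tri\<close> applies to the degenerate triangle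
  {x, y, x}, which is the edge itself, and leaves a repeated vertex for \<open>dup\<close>.\<close>

lemma edge_hom_spur:
  assumes "{x, y} \<in> K"
  shows "edge_hom K (us @ [x, y, x] @ vs) (us @ [x] @ vs)"
proof -
  have "{x, y, x} \<in> K" using assms by (simp add: insert_commute)
  from edge_hom_trans[OF edge_hom_tri[OF this] edge_hom_dup] show ?thesis .
qed

lemma edge_hom_rinv:
  assumes "xs \<noteq> []" "successively (\<lambda>x y. {x, y} \<in> K) xs"
  shows "edge_hom K (xs @ rev xs) [hd xs]"
  using assms
proof (induction xs)
  case (Cons x xs)
  show ?case
  proof (cases xs)
    case Nil
    then show ?thesis using edge_hom_dup[of K "[]" x "[]"] by simp
  next
    case (Cons y ys)
    then have "edge_hom K (xs @ rev xs) [y]" and e: "{x, y} \<in> K"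
      using Cons.IH Cons.prems by auto
    then have "edge_hom K ([x] @ (xs @ rev xs) @ [x]) ([x] @ [y] @ [x])"
      by (intro edge_hom_append_middle)
    also have "edge_hom K ([x] @ [y] @ [x]) [x]"
      using edge_hom_spur[OF e, of "[]" "[]"] by simp
    finally show ?thesis by simp
  qed
qed simp

lemma successively_adj_rev:
  "successively (\<lambda>x y. {x, y} \<in> K) (rev xs) \<longleftrightarrow> successively (\<lambda>x y. {x, y} \<in> K) xs"
  by (simp add: insert_commute)

lemma edge_path_rev: "edge_path K xs \<Longrightarrow> edge_path K (rev xs)"
  by (auto simp: edge_path_def successively_adj_rev simp del: successively_rev)

lemma edge_hom_linv:
  assumes "xs \<noteq> []" "successively (\<lambda>x y. {x, y} \<in> K) xs"
  shows "edge_hom K (rev xs @ xs) [last xs]"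
proof -
  have "edge_hom K (rev xs @ rev (rev xs)) [hd (rev xs)]"
    by (rule edge_hom_rinv) (use assms in \<open>simp_all only: successively_adj_rev rev_is_Nil_conv simp_thms\<close>)
  then show ?thesis using assms(1) by (simp add: hd_rev)
qed

lemma edge_path_append:
  "edge_path K xs \<Longrightarrow> edge_path K ys \<Longrightarrow> {last xs, hd ys} \<in> K \<Longrightarrow> edge_path K (xs @ ys)"
  by (auto simp: edge_path_def successively_append_iff)

lemma edge_path_joinI:
  assumes "abstract_complex K" "edge_path K xs" "edge_path K ys" "last xs = hd ys"
  shows "edge_path K (xs @ ys)"
proof (rule edge_path_append[OF assms(2,3)])
  have "hd ys \<in> \<Union>K" using assms(3) hd_in_set[of ys] unfolding edge_path_def by blast
  then obtain \<sigma> where \<sigma>: "\<sigma> \<in> K" "hd ys \<in> \<sigma>" by blast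
  have "{hd ys} \<in> K" using abstract_complexD(3)[OF assms(1) \<sigma>(1), of "{hd ys}"] \<sigma>(2) by simp
  then show "{last xs, hd ys} \<in> K" using assms(4) by simp
qed

lemma edge_hom_absorb_right:
  assumes "xs \<noteq> []"
  shows "edge_hom K (xs @ [last xs]) xs"
  using edge_hom_dup[of K "butlast xs" "last xs" "[]"] append_butlast_last_id[OF assms]
  by (metis append.assoc append.right_neutral append_Cons append_Nil)

lemma edge_hom_absorb_left:
  assumes "xs \<noteq> []"
  shows "edge_hom K (hd xs # xs) xs"
  using edge_hom_dup[of K "[]" "hd xs" "tl xs"] assms by simp

text \<open>The loop \<open>xs @ rev ys\<close> is null, and appending ys to it cancels
  \<open>rev ys\<close>. Choices of connecting edge paths thereby become harmless up to
  homotopy.\<close>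

lemma edge_hom_if_loops_null:
  assumes K: "abstract_complex K"
    and null: "\<And>xs. edge_path K xs \<Longrightarrow> hd xs = last xs \<Longrightarrow> edge_hom K xs [hd xs]"
    and xs: "edge_path K xs" and ys: "edge_path K ys" and "hd xs = hd ys" "last xs = last ys"
  shows "edge_hom K xs ys"
proof -
  have ne: "xs \<noteq> []" "ys \<noteq> []" and sy: "successively (\<lambda>x y. {x, y} \<in> K) ys"
    using xs ys by (auto simp: edge_path_def)
  have "edge_path K (xs @ rev ys)"
    by (rule edge_path_joinI[OF K xs edge_path_rev[OF ys]]) (use assms(6) ne in \<open>simp add: hd_rev\<close>)
  moreover have "hd (xs @ rev ys) = hd xs" "last (xs @ rev ys) = hd ys"
    using ne by (auto simp: last_rev)
  ultimately have null': "edge_hom K (xs @ rev ys) [hd xs]" using null[of "xs @ rev ys"] assms(5) by simp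
  have "edge_hom K xs (xs @ [last ys])"
    using edge_hom_sym[OF edge_hom_absorb_right[OF ne(1)]] assms(6) by simp
  also have "edge_hom K (xs @ [last ys]) (xs @ (rev ys @ ys))"
    using edge_hom_append[OF edge_hom_refl edge_hom_sym[OF edge_hom_linv[OF ne(2) sy]]] .
  also have "edge_hom K (xs @ (rev ys @ ys)) ([hd xs] @ ys)"
    using edge_hom_append[OF null' edge_hom_refl[of K ys]] by simp
  also have "edge_hom K ([hd xs] @ ys) ys"
    using edge_hom_absorb_left[OF ne(2)] assms(5) by simp
  finally show ?thesis .
qed

text \<open>For \<open>tri\<close> the faces of the triangle supply all three edges involved. For
  \<open>dup\<close> the singleton {x} must be a simplex, since a repeated vertex counts as an
  edge.\<close>

lemma edge_step_edge_path:
  assumes K: "abstract_complex K" and "edge_step K xs ys"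
  shows "edge_path K xs \<longleftrightarrow> edge_path K ys"
  using assms(2)
proof cases
  case (tri x y z us vs)
  have "{x, y} \<in> K" "{y, z} \<in> K" "{x, z} \<in> K" "y \<in> \<Union>K"
    using abstract_complexD(3)[OF K tri(3)] tri(3) by (simp_all, blast)
  then show ?thesis unfolding tri edge_path_def by (auto simp: successively_append_iff)
next
  case (dup us x vs)
  have "x \<in> \<Union>K \<Longrightarrow> {x} \<in> K" using abstract_complexD(3)[OF K, of _ "{x}"] by blast
  then show ?thesis unfolding dup edge_path_def by (auto simp: successively_append_iff)
qed

lemma edge_hom_edge_path:
  assumes K: "abstract_complex K" and "edge_hom K xs ys" "edge_path K xs"
  shows "edge_path K ys"
  using assms(2)
proof (induction rule: edge_hom_induct)
  case base
  then show ?case by (rule assms(3))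
qed (use edge_step_edge_path[OF K] in blast)+

text \<open>The triangles {c, x, y} are collapsed one after another: the apex is joined to the next
  vertex of the list until only the last vertex is left.\<close>

lemma edge_hom_cone:
  assumes K: "abstract_complex K"
    and "successively (\<lambda>x y. {c, x, y} \<in> K) xs" "xs \<noteq> []" "{c, hd xs} \<in> K"
  shows "edge_hom K ([c] @ xs) [c, last xs]"
  using assms(3,2,4)
proof (induction xs rule: list_nonempty_induct)
  case (cons x xs)
  then have "{c, x, hd xs} \<in> K" by (auto simp: successively_Cons)
  then have "edge_hom K ([] @ [c, x, hd xs] @ tl xs) ([] @ [c, hd xs] @ tl xs)" by (rule edge_hom_tri)
  then have "edge_hom K ([c] @ x # xs) ([c] @ xs)" using cons by simp
  moreover have "successively (\<lambda>x y. {c, x, y} \<in> K) xs" using cons by (auto simp: successively_Cons)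
  moreover have "{c, hd xs} \<in> K"
    using abstract_complexD(3)[OF K \<open>{c, x, hd xs} \<in> K\<close>, of "{c, hd xs}"] by auto
  ultimately show ?case using cons edge_hom_trans by fastforce
qed simp

section \<open>Lifting edge homotopies\<close>

text \<open>The combinatorial form of a covering: the simplices through p correspond bijectively to
  those through f p, and no simplex degenerates.\<close>

definition star_bijective :: "'a set set \<Rightarrow> 'b set set \<Rightarrow> ('a \<Rightarrow> 'b) \<Rightarrow> bool" where
  "star_bijective K L f \<longleftrightarrow>
     (\<forall>\<sigma>\<in>K. f ` \<sigma> \<in> L \<and> inj_on f \<sigma>) \<and>
     (\<forall>p\<in>\<Union>K. \<forall>\<tau>\<in>L. f p \<in> \<tau> \<longrightarrow> (\<exists>!\<sigma>. \<sigma> \<in> K \<and> p \<in> \<sigma> \<and> f ` \<sigma> = \<tau>))"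

lemma star_bijective_image: "star_bijective K L f \<Longrightarrow> \<sigma> \<in> K \<Longrightarrow> f ` \<sigma> \<in> L"
  and star_bijective_inj: "star_bijective K L f \<Longrightarrow> \<sigma> \<in> K \<Longrightarrow> inj_on f \<sigma>"
  by (simp_all add: star_bijective_def)

lemma star_bijective_ex1:
  assumes "star_bijective K L f" "p \<in> \<Union>K" "\<tau> \<in> L" "f p \<in> \<tau>"
  shows "\<exists>!\<sigma>. \<sigma> \<in> K \<and> p \<in> \<sigma> \<and> f ` \<sigma> = \<tau>"
  using bspec[OF bspec[OF conjunct2[OF assms(1)[unfolded star_bijective_def]] assms(2)] assms(3)] assms(4)
  by (rule mp)

text \<open>The face of \<sigma> over the image of \<tau> contains p and has the same image as
  \<tau>, so it equals \<tau> by uniqueness of lifts at p. Simplices through p can thus be compared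
  through their images.\<close>

lemma star_bijective_subset:
  assumes K: "abstract_complex K" and L: "abstract_complex L" and f: "star_bijective K L f"
    and "\<sigma> \<in> K" "\<tau> \<in> K" "p \<in> \<sigma>" "p \<in> \<tau>" "f ` \<tau> \<subseteq> f ` \<sigma>"
  shows "\<tau> \<subseteq> \<sigma>"
proof -
  let ?\<upsilon> = "{x\<in>\<sigma>. f x \<in> f ` \<tau>}"
  have p: "p \<in> ?\<upsilon>" using assms(6,7) by blast
  have "?\<upsilon> \<in> K" by (rule abstract_complexD(3)[OF K \<open>\<sigma> \<in> K\<close>]) (use p in blast)+
  moreover have "f ` ?\<upsilon> = f ` \<tau>"
  proof (rule equalityI; rule subsetI)
    fix y assume y: "y \<in> f ` \<tau>"
    then obtain x where "x \<in> \<sigma>" "y = f x" using assms(8) by blast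
    then show "y \<in> f ` ?\<upsilon>" using y by blast
  qed blast
  ultimately have \<upsilon>: "?\<upsilon> \<in> K" "p \<in> ?\<upsilon>" "f ` ?\<upsilon> = f ` \<tau>" using p by simp_all
  have "f ` \<tau> \<in> L" "f p \<in> f ` \<tau>" "p \<in> \<Union>K" using assms star_bijective_image[OF f] by auto
  then have "\<exists>!\<sigma>. \<sigma> \<in> K \<and> p \<in> \<sigma> \<and> f ` \<sigma> = f ` \<tau>" by (rule star_bijective_ex1[OF f, rotated])
  then have "?\<upsilon> = \<tau>" by (rule ex1E) (metis (no_types, lifting) \<upsilon> assms(5,7))
  then show ?thesis by (rule subst) (rule Collect_subset)
qed

lemma star_bijective_lift:
  assumes "star_bijective K L f" "p \<in> \<Union>K" "\<tau> \<in> L" "f p \<in> \<tau>"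
  obtains \<sigma> where "\<sigma> \<in> K" "p \<in> \<sigma>" "f ` \<sigma> = \<tau>"
  using star_bijective_ex1[OF assms] by (elim ex1E conjE) (rule that)

lemma edge_step_lift:
  assumes K: "abstract_complex K" and L: "abstract_complex L" and f: "star_bijective K L f"
    and "edge_step L xs ys" "edge_path K xs'" "map f xs' = xs"
  shows "\<exists>ys'. map f ys' = ys \<and> edge_step K xs' ys'"
  using assms(4)
proof cases
  case (tri x y z us vs)
  obtain us' x' y' z' vs' where xs': "xs' = us' @ [x', y', z'] @ vs'"
    "map f us' = us" "map f vs' = vs" "f x' = x" "f y' = y" "f z' = z"
    using assms(6) unfolding tri by (auto simp: map_eq_append_conv map_eq_Cons_conv)
  have e: "{x', y'} \<in> K" "{y', z'} \<in> K"
    using assms(5) unfolding xs' edge_path_def by (auto simp: successively_append_iff)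
  \<comment> \<open>The triangle is lifted at its middle vertex, the one lying on both given edges,
    so that both edges belong to the lift.\<close>
  have "y' \<in> \<Union>K" using e by blast
  then obtain \<sigma> where \<sigma>: "\<sigma> \<in> K" "y' \<in> \<sigma>" "f ` \<sigma> = {x, y, z}"
    by (rule star_bijective_lift[OF f _ tri(3)]) (use xs' in auto)
  have "{x', y'} \<subseteq> \<sigma>"
    by (rule star_bijective_subset[OF K L f \<sigma>(1) e(1), of y']) (use \<sigma> xs' in auto)
  moreover have "{y', z'} \<subseteq> \<sigma>"
    by (rule star_bijective_subset[OF K L f \<sigma>(1) e(2), of y']) (use \<sigma> xs' in auto)
  ultimately have "{x', y', z'} \<in> K" using abstract_complexD(3)[OF K \<sigma>(1)] by auto
  then have "edge_step K xs' (us' @ [x', z'] @ vs')" unfolding xs'(1) by (rule edge_step.tri)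
  then show ?thesis using xs' tri by (intro exI[of _ "us' @ [x', z'] @ vs'"]) auto
next
  case (dup us x vs)
  obtain us' x' x'' vs' where xs': "xs' = us' @ [x', x''] @ vs'"
    "map f us' = us" "map f vs' = vs" "f x' = x" "f x'' = x"
    using assms(6) unfolding dup by (auto simp: map_eq_append_conv map_eq_Cons_conv)
  have "{x', x''} \<in> K"
    using assms(5) unfolding xs' edge_path_def by (auto simp: successively_append_iff)
  then have "x' = x''" by (rule inj_onD[OF star_bijective_inj[OF f]]) (use xs' in simp_all)
  then have "edge_step K xs' (us' @ [x'] @ vs')" unfolding xs'(1) by (simp only: edge_step.dup)
  then show ?thesis using xs' dup by (intro exI[of _ "us' @ [x'] @ vs'"]) auto
qed

lemma edge_unstep_lift:
  assumes K: "abstract_complex K" and L: "abstract_complex L" and f: "star_bijective K L f"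
    and "edge_step L ys xs" "edge_path K xs'" "map f xs' = xs"
  shows "\<exists>ys'. map f ys' = ys \<and> edge_step K ys' xs'"
  using assms(4)
proof cases
  case (tri x y z us vs)
  obtain us' x' z' vs' where xs': "xs' = us' @ [x', z'] @ vs'"
    "map f us' = us" "map f vs' = vs" "f x' = x" "f z' = z"
    using assms(6) unfolding tri by (auto simp: map_eq_append_conv map_eq_Cons_conv)
  have e: "{x', z'} \<in> K"
    using assms(5) unfolding xs' edge_path_def by (auto simp: successively_append_iff)
  \<comment> \<open>In this direction the middle vertex has yet to be found: the triangle is lifted
    at x', and y' is read off the lift.\<close>
  then have "x' \<in> \<Union>K" by blast
  then obtain \<sigma> where \<sigma>: "\<sigma> \<in> K" "x' \<in> \<sigma>" "f ` \<sigma> = {x, y, z}"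
    by (rule star_bijective_lift[OF f _ tri(3)]) (use xs' in auto)
  have "y \<in> f ` \<sigma>" unfolding \<sigma>(3) by simp
  then obtain y' where y': "y' \<in> \<sigma>" "f y' = y" by blast
  have "{x', z'} \<subseteq> \<sigma>"
    by (rule star_bijective_subset[OF K L f \<sigma>(1) e, of x']) (use \<sigma> xs' in auto)
  then have "{x', y', z'} \<in> K" using abstract_complexD(3)[OF K \<sigma>(1)] y' by auto
  then have "edge_step K (us' @ [x', y', z'] @ vs') xs'" unfolding xs'(1) by (rule edge_step.tri)
  then show ?thesis using xs' tri y' by (intro exI[of _ "us' @ [x', y', z'] @ vs'"]) auto
next
  case (dup us x vs)
  obtain us' x' vs' where xs': "xs' = us' @ [x'] @ vs'"
    "map f us' = us" "map f vs' = vs" "f x' = x"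
    using assms(6) unfolding dup by (auto simp: map_eq_append_conv map_eq_Cons_conv)
  have "edge_step K (us' @ [x', x'] @ vs') xs'" unfolding xs'(1) by (rule edge_step.dup)
  then show ?thesis using xs' dup by (intro exI[of _ "us' @ [x', x'] @ vs'"]) auto
qed

lemma edge_hom_lift:
  assumes K: "abstract_complex K" and L: "abstract_complex L" and f: "star_bijective K L f"
    and "edge_hom L xs ys" "edge_path K xs'" "map f xs' = xs"
  shows "\<exists>ys'. map f ys' = ys \<and> edge_hom K xs' ys'"
  using assms(4)
proof (induction rule: edge_hom_induct)
  case base
  then show ?case using assms(6) by blast
next
  case (step ys zs)
  then obtain ys' where ys': "map f ys' = ys" "edge_hom K xs' ys'" by blast
  from edge_step_lift[OF K L f step.hyps(2) edge_hom_edge_path[OF K ys'(2) assms(5)] ys'(1)]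
  show ?case using ys' edge_hom_trans edge_step_imp_hom by blast
next
  case (unstep ys zs)
  then obtain ys' where ys': "map f ys' = ys" "edge_hom K xs' ys'" by blast
  from edge_unstep_lift[OF K L f unstep.hyps(2) edge_hom_edge_path[OF K ys'(2) assms(5)] ys'(1)]
  show ?case using ys' edge_hom_trans edge_step_imp_hom edge_hom_sym by blast
qed

text \<open>The lifted homotopy ends in a list with one entry because its image has one entry; that
  entry is \<open>hd xs\<close> since homotopies keep the first vertex.\<close>

lemma null_lift:
  assumes "abstract_complex K" "abstract_complex L" "star_bijective K L f"
    and "edge_path K xs" "edge_hom L (map f xs) [f (hd xs)]"
  shows "edge_hom K xs [hd xs]"
proof -
  obtain ys where ys: "map f ys = [f (hd xs)]" "edge_hom K xs ys"
    using edge_hom_lift[OF assms(1-3) assms(5,4) refl] by (elim exE conjE)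
  then obtain y where "ys = [y]" by auto
  then show ?thesis using ys edge_hom_ends[OF ys(2)] by simp
qed

section \<open>Geometric realizations\<close>

definition geom_carrier :: "'v set set \<Rightarrow> ('v \<Rightarrow> real) set" where
  "geom_carrier K = (\<Union>\<sigma>\<in>K. closed_simplex \<sigma>)"

definition support :: "('v \<Rightarrow> real) \<Rightarrow> 'v set" where
  "support x = {v. x v \<noteq> 0}"

lemma closed_simplex_subset_geom_carrier: "\<sigma> \<in> K \<Longrightarrow> closed_simplex \<sigma> \<subseteq> geom_carrier K"
  by (auto simp: geom_carrier_def)

lemma closed_simplexD:
  assumes "x \<in> closed_simplex \<sigma>"
  shows "0 \<le> x v" "v \<notin> \<sigma> \<Longrightarrow> x v = 0" "sum x \<sigma> = 1"
  using assms by (auto simp: closed_simplex_def)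

lemma support_subset_simplex: "x \<in> closed_simplex \<sigma> \<Longrightarrow> support x \<subseteq> \<sigma>"
  by (auto simp: closed_simplex_def support_def)

lemma closed_simplex_iff_support:
  assumes "finite \<sigma>"
  shows "x \<in> closed_simplex \<sigma> \<longleftrightarrow> (\<forall>v. 0 \<le> x v) \<and> support x \<subseteq> \<sigma> \<and> sum x (support x) = 1"
proof -
  have "sum x \<sigma> = sum x (support x)" if "support x \<subseteq> \<sigma>"
    by (rule sum.mono_neutral_right[OF assms that]) (auto simp: support_def)
  moreover have "support x \<subseteq> \<sigma> \<longleftrightarrow> (\<forall>v. v \<notin> \<sigma> \<longrightarrow> x v = 0)" by (auto simp: support_def)
  ultimately show ?thesis unfolding closed_simplex_def mem_Collect_eq by metis
qed

lemma support_in_complex: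
  assumes K: "abstract_complex K" and x: "x \<in> geom_carrier K"
  shows "support x \<in> K" "x \<in> closed_simplex (support x)" "finite (support x)" "support x \<noteq> {}"
proof -
  obtain \<sigma> where \<sigma>: "\<sigma> \<in> K" "x \<in> closed_simplex \<sigma>" using x by (auto simp: geom_carrier_def)
  have fin: "finite \<sigma>" using abstract_complexD(1)[OF K \<sigma>(1)] .
  have s: "support x \<subseteq> \<sigma>" "sum x (support x) = 1" "\<forall>v. 0 \<le> x v"
    using \<sigma>(2) closed_simplex_iff_support[OF fin] by blast+
  show ne: "support x \<noteq> {}" using s(2) by force
  show "finite (support x)" using fin s(1) finite_subset by blast
  then show "x \<in> closed_simplex (support x)" using closed_simplex_iff_support s by blast
  show "support x \<in> K" using abstract_complexD(3)[OF K \<sigma>(1) s(1) ne] .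
qed

lemma geom_carrier_mem_simplex:
  assumes K: "abstract_complex K" and "\<sigma> \<in> K" "x \<in> geom_carrier K" "support x \<subseteq> \<sigma>"
  shows "x \<in> closed_simplex \<sigma>"
  unfolding closed_simplex_iff_support[OF abstract_complexD(1)[OF K assms(2)]]
  using support_in_complex(2)[OF K assms(3)] assms(4)
  unfolding closed_simplex_iff_support[OF support_in_complex(3)[OF K assms(3)]] by simp

lemma openin_realization':
  "openin (realization K) U \<longleftrightarrow>
     U \<subseteq> geom_carrier K \<and> (\<forall>\<sigma>\<in>K. openin (top_of_set (closed_simplex \<sigma>)) (U \<inter> closed_simplex \<sigma>))"
  unfolding openin_realization geom_carrier_def ..

lemma topspace_realization [simp]: "topspace (realization K) = geom_carrier K"
proof
  show "topspace (realization K) \<subseteq> geom_carrier K"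
    using openin_realization'[of K "topspace (realization K)"] by simp
  have "openin (realization K) (geom_carrier K)"
    unfolding openin_realization'
  proof (intro conjI ballI)
    fix \<sigma> assume "\<sigma> \<in> K"
    then have "geom_carrier K \<inter> closed_simplex \<sigma> = closed_simplex \<sigma>"
      using closed_simplex_subset_geom_carrier by blast
    then show "openin (top_of_set (closed_simplex \<sigma>)) (geom_carrier K \<inter> closed_simplex \<sigma>)" by simp
  qed simp
  then show "geom_carrier K \<subseteq> topspace (realization K)" by (rule openin_subset)
qed

lemma continuous_map_realization:
  assumes "f \<in> geom_carrier K \<rightarrow> topspace Y"
    and "\<And>\<sigma>. \<sigma> \<in> K \<Longrightarrow> continuous_map (top_of_set (closed_simplex \<sigma>)) Y f"
  shows "continuous_map (realization K) Y f"
  unfolding continuous_map_def topspace_realization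
proof (intro conjI allI impI assms(1))
  fix U assume U: "openin Y U"
  show "openin (realization K) {x \<in> geom_carrier K. f x \<in> U}"
    unfolding openin_realization'
  proof (intro conjI ballI)
    fix \<sigma> assume \<sigma>: "\<sigma> \<in> K"
    have "openin (top_of_set (closed_simplex \<sigma>)) {x \<in> topspace (top_of_set (closed_simplex \<sigma>)). f x \<in> U}"
      using openin_continuous_map_preimage[OF assms(2)[OF \<sigma>] U] .
    moreover have "{x \<in> topspace (top_of_set (closed_simplex \<sigma>)). f x \<in> U} = {x \<in> geom_carrier K. f x \<in> U} \<inter> closed_simplex \<sigma>"
      using closed_simplex_subset_geom_carrier[OF \<sigma>] by auto
    ultimately show "openin (top_of_set (closed_simplex \<sigma>)) ({x \<in> geom_carrier K. f x \<in> U} \<inter> closed_simplex \<sigma>)"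
      by simp
  qed auto
qed

text \<open>The sets that will be evenly covered: over the star of q lie the disjoint stars of the
  vertices mapped to q.\<close>

definition open_star :: "'v set set \<Rightarrow> 'v \<Rightarrow> ('v \<Rightarrow> real) set" where
  "open_star K p = {x \<in> geom_carrier K. x p \<noteq> 0}"

lemma continuous_on_coordinate: "continuous_on S (\<lambda>x. x i :: real)"
  by (rule continuous_on_product_coordinates[THEN continuous_on_subset]) simp

lemma openin_open_star: "openin (realization K) (open_star K p)"
  unfolding openin_realization'
proof (intro conjI ballI)
  fix \<sigma> assume \<sigma>: "\<sigma> \<in> K"
  have "open {x :: 'a \<Rightarrow> real. x p \<noteq> 0}"
    by (intro open_Collect_neq continuous_on_coordinate continuous_on_const)
  moreover have "open_star K p \<inter> closed_simplex \<sigma> = closed_simplex \<sigma> \<inter> {x. x p \<noteq> 0}"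
    using closed_simplex_subset_geom_carrier[OF \<sigma>] by (auto simp: open_star_def)
  ultimately show "openin (top_of_set (closed_simplex \<sigma>)) (open_star K p \<inter> closed_simplex \<sigma>)"
    by (simp add: openin_open_Int)
qed (auto simp: open_star_def)

lemma continuous_on_if_const:
  "continuous_on S f \<Longrightarrow> continuous_on S g \<Longrightarrow> continuous_on S (\<lambda>x. if b then f x else g x)"
  by (cases b) simp_all

section \<open>Star-bijective simplicial maps are coverings\<close>

text \<open>Injectivity on \<sigma> leaves at most one summand in each fibre, so on a simplex the
  extension merely relabels coordinates.\<close>

lemma simplicial_extension_on_simplex:
  assumes "finite \<sigma>" "inj_on f \<sigma>" "x \<in> closed_simplex \<sigma>"
  shows "simplicial_extension f x = (\<lambda>y. if y \<in> f ` \<sigma> then x (inv_into \<sigma> f y) else 0)"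
proof
  fix y
  have s: "support x \<subseteq> \<sigma>" using assms(3) by (rule support_subset_simplex)
  have eq: "simplicial_extension f x y = sum x {z. x z \<noteq> 0 \<and> f z = y}"
    by (simp add: simplicial_extension_def)
  show "simplicial_extension f x y = (if y \<in> f ` \<sigma> then x (inv_into \<sigma> f y) else 0)"
  proof (cases "y \<in> f ` \<sigma>")
    case True
    then obtain z where z: "z \<in> \<sigma>" "y = f z" by blast
    have inv: "inv_into \<sigma> f y = z" using z assms(2) by simp
    have "{v. x v \<noteq> 0 \<and> f v = y} = (if x z = 0 then {} else {z})"
      using s z assms(2) by (auto simp: support_def inj_on_def)
    then show ?thesis using True by (auto simp: eq inv)
  next
    case False
    then have "{v. x v \<noteq> 0 \<and> f v = y} = {}" using s by (auto simp: support_def)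
    then show ?thesis using False by (simp only: eq sum.empty if_False)
  qed
qed

lemma simplicial_extension_apply:
  assumes "finite \<sigma>" "inj_on f \<sigma>" "x \<in> closed_simplex \<sigma>" "z \<in> \<sigma>"
  shows "simplicial_extension f x (f z) = x z"
  using simplicial_extension_on_simplex[OF assms(1-3)] assms(2,4) by simp

lemma support_simplicial_extension:
  assumes "finite \<sigma>" "inj_on f \<sigma>" "x \<in> closed_simplex \<sigma>"
  shows "support (simplicial_extension f x) = f ` support x"
proof -
  have s: "support x \<subseteq> \<sigma>" using assms(3) by (rule support_subset_simplex)
  show ?thesis
  proof (intro equalityI subsetI)
    fix y assume "y \<in> support (simplicial_extension f x)"
    then have y: "simplicial_extension f x y \<noteq> 0" by (simp add: support_def)
    then have "y \<in> f ` \<sigma>" using simplicial_extension_on_simplex[OF assms] by (metis (full_types))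
    then obtain z where "z \<in> \<sigma>" "y = f z" by blast
    then show "y \<in> f ` support x" using y simplicial_extension_apply[OF assms] by (auto simp: support_def)
  next
    fix y assume "y \<in> f ` support x"
    then obtain z where "z \<in> support x" "y = f z" by blast
    then show "y \<in> support (simplicial_extension f x)"
      using s simplicial_extension_apply[OF assms, of z] by (auto simp: support_def)
  qed
qed

lemma simplicial_extension_in_simplex:
  assumes "finite \<sigma>" "inj_on f \<sigma>" "x \<in> closed_simplex \<sigma>"
  shows "simplicial_extension f x \<in> closed_simplex (f ` \<sigma>)"
proof -
  have "sum (simplicial_extension f x) (f ` \<sigma>) = (\<Sum>z\<in>\<sigma>. simplicial_extension f x (f z))"
    using assms(2) by (simp add: sum.reindex)
  also have "\<dots> = sum x \<sigma>"
    by (rule sum.cong) (simp_all add: simplicial_extension_apply[OF assms])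
  finally show ?thesis
    using assms(3) simplicial_extension_on_simplex[OF assms] by (simp add: closed_simplex_def)
qed

lemma continuous_on_simplicial_extension:
  assumes "finite \<sigma>" "inj_on f \<sigma>"
  shows "continuous_on (closed_simplex \<sigma>) (simplicial_extension f)"
proof -
  have "continuous_on (closed_simplex \<sigma>) (\<lambda>x y. if y \<in> f ` \<sigma> then x (inv_into \<sigma> f y) else 0)"
    by (rule continuous_on_coordinatewise_then_product, rule continuous_on_if_const)
       (intro continuous_on_coordinate continuous_on_const)+
  then show ?thesis
    by (rule continuous_on_eq) (simp add: simplicial_extension_on_simplex[OF assms])
qed

lemma openin_simplicial_image:
  assumes "finite \<sigma>" "inj_on f \<sigma>" "openin (top_of_set (closed_simplex \<sigma>)) U"
  shows "openin (top_of_set (closed_simplex (f ` \<sigma>))) (simplicial_extension f ` U)"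
proof -
  \<comment> \<open>\<open>?G\<close> pulls coordinates back along f. It inverts the extension on
    this simplex, so openness of the image becomes continuity of \<open>?G\<close>.\<close>
  let ?G = "\<lambda>y x. if x \<in> \<sigma> then y (f x) else (0::real)"
  have US: "U \<subseteq> closed_simplex \<sigma>" using openin_imp_subset[OF assms(3)] .
  have cont: "continuous_on (closed_simplex (f ` \<sigma>)) ?G"
    by (rule continuous_on_coordinatewise_then_product, rule continuous_on_if_const)
       (intro continuous_on_coordinate continuous_on_const)+
  have Gin: "?G y \<in> closed_simplex \<sigma>" if "y \<in> closed_simplex (f ` \<sigma>)" for y
  proof -
    have "sum (?G y) \<sigma> = (\<Sum>x\<in>\<sigma>. y (f x))" by (rule sum.cong) auto
    also have "\<dots> = sum y (f ` \<sigma>)" using assms(2) by (simp add: sum.reindex)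
    finally show ?thesis using that by (simp add: closed_simplex_def)
  qed
  have FG: "simplicial_extension f (?G y) = y" if "y \<in> closed_simplex (f ` \<sigma>)" for y
  proof
    fix z
    show "simplicial_extension f (?G y) z = y z"
      using simplicial_extension_on_simplex[OF assms(1,2) Gin[OF that]] closed_simplexD(2)[OF that, of z]
        assms(2) by auto
  qed
  have GF: "?G (simplicial_extension f x) = x" if "x \<in> closed_simplex \<sigma>" for x
  proof
    fix z
    show "?G (simplicial_extension f x) z = x z"
      using simplicial_extension_apply[OF assms(1,2) that, of z] closed_simplexD(2)[OF that, of z] by auto
  qed
  have "simplicial_extension f ` U = closed_simplex (f ` \<sigma>) \<inter> ?G -` U"
  proof (intro equalityI subsetI)
    fix y assume "y \<in> simplicial_extension f ` U"
    then obtain x where x: "x \<in> U" "y = simplicial_extension f x" by blast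
    then have "x \<in> closed_simplex \<sigma>" using US by blast
    then show "y \<in> closed_simplex (f ` \<sigma>) \<inter> ?G -` U"
      using GF x simplicial_extension_in_simplex[OF assms(1,2)] by auto
  next
    fix y assume y: "y \<in> closed_simplex (f ` \<sigma>) \<inter> ?G -` U"
    then have "y = simplicial_extension f (?G y)" "?G y \<in> U" using FG by auto
    then show "y \<in> simplicial_extension f ` U" by (rule image_eqI)
  qed
  moreover have "openin (top_of_set (closed_simplex (f ` \<sigma>))) (closed_simplex (f ` \<sigma>) \<inter> ?G -` U)"
    by (rule continuous_openin_preimage[OF cont _ assms(3)]) (use Gin in auto)
  ultimately show ?thesis by simp
qed

text \<open>Both supports contain p and have the same image, so star bijectivity makes them equal;
  the coordinates then agree vertex by vertex.\<close>

lemma simplicial_extension_star_inj: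
  assumes K: "abstract_complex K" and L: "abstract_complex L" and f: "star_bijective K L f"
    and x: "x \<in> open_star K p" and y: "y \<in> open_star K p"
    and eq: "simplicial_extension f x = simplicial_extension f y"
  shows "x = y"
proof -
  have xK: "x \<in> geom_carrier K" "p \<in> support x" and yK: "y \<in> geom_carrier K" "p \<in> support y"
    using x y by (auto simp: open_star_def support_def)
  note sx = support_in_complex[OF K xK(1)] and sy = support_in_complex[OF K yK(1)]
  note ix = star_bijective_inj[OF f sx(1)] and iy = star_bijective_inj[OF f sy(1)]
  have "f ` support x = f ` support y"
    using support_simplicial_extension[OF sx(3) ix sx(2)] support_simplicial_extension[OF sy(3) iy sy(2)] eq
    by simp
  then have s: "support x = support y"
    using star_bijective_subset[OF K L f sx(1) sy(1) xK(2) yK(2)]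
      star_bijective_subset[OF K L f sy(1) sx(1) yK(2) xK(2)] by blast
  have "x z = y z" for z
  proof (cases "z \<in> support x")
    case True
    then show ?thesis
      using simplicial_extension_apply[OF sx(3) ix sx(2), of z]
        simplicial_extension_apply[OF sy(3) iy sy(2), of z] eq s by simp
  next
    case False
    then show ?thesis using s unfolding support_def by (metis (mono_tags, lifting) mem_Collect_eq)
  qed
  then show ?thesis by blast
qed

lemma simplicial_extension_geom_carrier:
  assumes K: "abstract_complex K" and f: "star_bijective K L f" and x: "x \<in> geom_carrier K"
  shows "simplicial_extension f x \<in> geom_carrier L"
proof -
  note sx = support_in_complex[OF K x]
  have "f ` support x \<in> L" using star_bijective_image[OF f sx(1)] .
  then show ?thesis
    using simplicial_extension_in_simplex[OF sx(3) star_bijective_inj[OF f sx(1)] sx(2)]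
      closed_simplex_subset_geom_carrier by blast
qed

lemma simplicial_extension_star_surj:
  assumes K: "abstract_complex K" and L: "abstract_complex L" and f: "star_bijective K L f"
    and p: "p \<in> \<Union>K" and y: "y \<in> open_star L (f p)" and "support y \<subseteq> \<tau>" "\<tau> \<in> L"
    "\<sigma> \<in> K" "p \<in> \<sigma>" "f ` \<sigma> = \<tau>"
  shows "\<exists>x\<in>open_star K p. x \<in> closed_simplex \<sigma> \<and> simplicial_extension f x = y"
proof -
  have fin: "finite \<sigma>" using abstract_complexD(1)[OF K assms(8)] .
  have inj: "inj_on f \<sigma>" using star_bijective_inj[OF f assms(8)] .
  have yt: "y \<in> closed_simplex \<tau>"
    using geom_carrier_mem_simplex[OF L assms(7) _ assms(6)] y by (simp add: open_star_def)
  let ?x = "\<lambda>x. if x \<in> \<sigma> then y (f x) else 0"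
  have "sum ?x \<sigma> = (\<Sum>x\<in>\<sigma>. y (f x))" by (rule sum.cong) auto
  also have "\<dots> = sum y (f ` \<sigma>)" using inj by (simp add: sum.reindex)
  finally have x: "?x \<in> closed_simplex \<sigma>" using yt assms(10) by (simp add: closed_simplex_def)
  moreover have "simplicial_extension f ?x = y"
  proof
    fix z
    show "simplicial_extension f ?x z = y z"
      using simplicial_extension_on_simplex[OF fin inj x] closed_simplexD(2)[OF yt, of z] inj assms(10) by auto
  qed
  moreover have "?x \<in> open_star K p"
    using closed_simplex_subset_geom_carrier[OF assms(8)] x y assms(9) by (auto simp: open_star_def)
  ultimately show ?thesis by blast
qed

text \<open>A closed simplex \<tau> meets the image only if it contains f p, and then every point of
  U mapped into \<tau> lies in the one lift of \<tau> at p. On that lift the map is a relabelling of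
  coordinates.\<close>

lemma openin_simplicial_star_image:
  assumes K: "abstract_complex K" and L: "abstract_complex L" and f: "star_bijective K L f"
    and p: "p \<in> \<Union>K" and U: "openin (realization K) U" "U \<subseteq> open_star K p"
  shows "openin (realization L) (simplicial_extension f ` U)"
  unfolding openin_realization'
proof (intro conjI ballI)
  have UK: "U \<subseteq> geom_carrier K" using U(2) by (auto simp: open_star_def)
  then show "simplicial_extension f ` U \<subseteq> geom_carrier L"
    using simplicial_extension_geom_carrier[OF K f] by blast
  fix \<tau> assume \<tau>: "\<tau> \<in> L"
  have supp: "support x \<in> K" "p \<in> support x"
    "support (simplicial_extension f x) = f ` support x" if "x \<in> U" for x
  proof -
    have "x \<in> geom_carrier K" using that UK by blast
    note sx = support_in_complex[OF K this]
    show "support x \<in> K" by (rule sx(1))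
    show "p \<in> support x" using that U(2) by (auto simp: open_star_def support_def)
    show "support (simplicial_extension f x) = f ` support x"
      by (rule support_simplicial_extension[OF sx(3) star_bijective_inj[OF f sx(1)] sx(2)])
  qed
  show "openin (top_of_set (closed_simplex \<tau>)) (simplicial_extension f ` U \<inter> closed_simplex \<tau>)"
  proof (cases "f p \<in> \<tau>")
    case False
    have "simplicial_extension f x \<notin> closed_simplex \<tau>" if "x \<in> U" for x
      using supp(2,3)[OF that] False support_subset_simplex by blast
    then have "simplicial_extension f ` U \<inter> closed_simplex \<tau> = {}" by blast
    then show ?thesis by simp
  next
    case True
    obtain \<sigma> where \<sigma>: "\<sigma> \<in> K" "p \<in> \<sigma>" "f ` \<sigma> = \<tau>"
      by (rule star_bijective_lift[OF f p \<tau> True])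
    have fin: "finite \<sigma>" using abstract_complexD(1)[OF K \<sigma>(1)] .
    have inj: "inj_on f \<sigma>" using star_bijective_inj[OF f \<sigma>(1)] .
    have "simplicial_extension f ` U \<inter> closed_simplex \<tau> = simplicial_extension f ` (U \<inter> closed_simplex \<sigma>)"
    proof (intro equalityI subsetI)
      fix y assume y: "y \<in> simplicial_extension f ` U \<inter> closed_simplex \<tau>"
      then obtain x where x: "x \<in> U" "y = simplicial_extension f x" by blast
      have "f ` support x \<subseteq> f ` \<sigma>"
        using y x supp(3)[OF x(1)] support_subset_simplex[of y \<tau>] \<sigma>(3) by auto
      then have "support x \<subseteq> \<sigma>"
        using star_bijective_subset[OF K L f \<sigma>(1) supp(1)[OF x(1)] \<sigma>(2) supp(2)[OF x(1)]] by blast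
      then have "x \<in> closed_simplex \<sigma>"
        using geom_carrier_mem_simplex[OF K \<sigma>(1)] UK x(1) by blast
      then show "y \<in> simplicial_extension f ` (U \<inter> closed_simplex \<sigma>)" using x by blast
    next
      fix y assume "y \<in> simplicial_extension f ` (U \<inter> closed_simplex \<sigma>)"
      then show "y \<in> simplicial_extension f ` U \<inter> closed_simplex \<tau>"
        using simplicial_extension_in_simplex[OF fin inj] \<sigma>(3) by blast
    qed
    moreover have "openin (top_of_set (closed_simplex (f ` \<sigma>))) (simplicial_extension f ` (U \<inter> closed_simplex \<sigma>))"
      by (rule openin_simplicial_image[OF fin inj]) (use U(1) \<sigma>(1) openin_realization' in blast)
    ultimately show ?thesis using \<sigma>(3) by simp
  qed
qed

theorem covering_map_simplicial_extension:
  assumes K: "abstract_complex K" and L: "abstract_complex L" and f: "star_bijective K L f"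
    and surj: "\<Union>L \<subseteq> f ` \<Union>K"
  shows "covering_map (realization K) (realization L) (simplicial_extension f)"
proof -
  let ?F = "simplicial_extension f"
  have into: "?F x \<in> geom_carrier L" if "x \<in> geom_carrier K" for x
    using simplicial_extension_geom_carrier[OF K f that] .
  have cont: "continuous_map (realization K) (realization L) ?F"
  proof (rule continuous_map_realization)
    show "?F \<in> geom_carrier K \<rightarrow> topspace (realization L)" using into by simp
    fix \<sigma> assume \<sigma>: "\<sigma> \<in> K"
    have fin: "finite \<sigma>" and inj: "inj_on f \<sigma>" and fL: "f ` \<sigma> \<in> L"
      using abstract_complexD(1)[OF K \<sigma>] star_bijective_inj[OF f \<sigma>] star_bijective_image[OF f \<sigma>] by auto
    have sub: "?F ` closed_simplex \<sigma> \<subseteq> closed_simplex (f ` \<sigma>)"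
      using simplicial_extension_in_simplex[OF fin inj] by blast
    show "continuous_map (top_of_set (closed_simplex \<sigma>)) (realization L) ?F"
      unfolding continuous_map_def
    proof (intro conjI allI impI)
      show "?F \<in> topspace (top_of_set (closed_simplex \<sigma>)) \<rightarrow> topspace (realization L)"
        using sub closed_simplex_subset_geom_carrier[OF fL] by auto
      fix U assume "openin (realization L) U"
      then have "openin (top_of_set (closed_simplex (f ` \<sigma>))) (U \<inter> closed_simplex (f ` \<sigma>))"
        using fL by (simp add: openin_realization')
      then have "openin (top_of_set (closed_simplex \<sigma>)) (closed_simplex \<sigma> \<inter> ?F -` (U \<inter> closed_simplex (f ` \<sigma>)))"
        by (rule continuous_openin_preimage[OF continuous_on_simplicial_extension[OF fin inj], rotated])
           (use sub in auto)
      moreover have "closed_simplex \<sigma> \<inter> ?F -` (U \<inter> closed_simplex (f ` \<sigma>)) = {x \<in> topspace (top_of_set (closed_simplex \<sigma>)). ?F x \<in> U}"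
        using sub by auto
      ultimately show "openin (top_of_set (closed_simplex \<sigma>)) {x \<in> topspace (top_of_set (closed_simplex \<sigma>)). ?F x \<in> U}"
        by simp
    qed
  qed
  have star_image: "?F ` open_star K p = open_star L (f p)" if p: "p \<in> \<Union>K" for p
  proof (intro equalityI subsetI)
    fix y assume "y \<in> ?F ` open_star K p"
    then obtain x where x: "x \<in> open_star K p" "y = ?F x" by blast
    then have xK: "x \<in> geom_carrier K" "p \<in> support x" by (auto simp: open_star_def support_def)
    note sx = support_in_complex[OF K xK(1)]
    have "support y = f ` support x"
      using support_simplicial_extension[OF sx(3) star_bijective_inj[OF f sx(1)] sx(2)] x(2) by simp
    then have "f p \<in> support y" using xK(2) by blast
    then show "y \<in> open_star L (f p)" using into[OF xK(1)] x(2) by (simp add: open_star_def support_def)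
  next
    fix y assume y: "y \<in> open_star L (f p)"
    then have yL: "y \<in> geom_carrier L" "f p \<in> support y" by (auto simp: open_star_def support_def)
    note sy = support_in_complex[OF L yL(1)]
    obtain \<sigma> where \<sigma>: "\<sigma> \<in> K" "p \<in> \<sigma>" "f ` \<sigma> = support y"
      by (rule star_bijective_lift[OF f p sy(1) yL(2)])
    from simplicial_extension_star_surj[OF K L f p y subset_refl sy(1) \<sigma>]
    show "y \<in> ?F ` open_star K p" by blast
  qed
  have evenly: "\<exists>T. y \<in> T \<and> openin (realization L) T \<and>
        (\<exists>\<V>. \<Union>\<V> = {x \<in> topspace (realization K). ?F x \<in> T} \<and>
             (\<forall>U\<in>\<V>. openin (realization K) U) \<and> pairwise disjnt \<V> \<and>
             (\<forall>U\<in>\<V>. homeomorphic_map (subtopology (realization K) U) (subtopology (realization L) T) ?F))"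
    if y: "y \<in> topspace (realization L)" for y
  proof -
    have yL: "y \<in> geom_carrier L" using y by simp
    \<comment> \<open>Any vertex of the support serves: its open star contains y, and the sheets are
      the open stars of the vertices above it.\<close>
    obtain q where q: "q \<in> support y" using support_in_complex(4)[OF L yL] by blast
    let ?T = "open_star L q" and ?V = "open_star K ` {p\<in>\<Union>K. f p = q}"
    have "\<Union>?V = {x \<in> geom_carrier K. ?F x \<in> ?T}"
    proof (intro equalityI subsetI)
      fix x assume "x \<in> \<Union>?V"
      then show "x \<in> {x \<in> geom_carrier K. ?F x \<in> ?T}" using star_image by (auto simp: open_star_def[of K])
    next
      fix x assume "x \<in> {x \<in> geom_carrier K. ?F x \<in> ?T}"
      then have x: "x \<in> geom_carrier K" "q \<in> support (?F x)" by (auto simp: open_star_def support_def)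
      note sx = support_in_complex[OF K x(1)]
      have "support (?F x) = f ` support x"
        using support_simplicial_extension[OF sx(3) star_bijective_inj[OF f sx(1)] sx(2)] .
      then have "q \<in> f ` support x" using x(2) by simp
      then obtain p where p: "p \<in> support x" "f p = q" by blast
      then have "x \<in> open_star K p" using x(1) by (simp add: open_star_def support_def)
      moreover have "p \<in> \<Union>K" using p(1) sx(1) by blast
      ultimately show "x \<in> \<Union>?V" using p(2) by blast
    qed
    moreover have "pairwise disjnt ?V"
    proof (rule pairwise_imageI)
      fix p p' assume pp: "p \<in> {p\<in>\<Union>K. f p = q}" "p' \<in> {p\<in>\<Union>K. f p = q}" "p \<noteq> p'"
      \<comment> \<open>A point in two sheets would have two vertices of its support over q, against
        injectivity on simplices.\<close>
      have False if "x \<in> open_star K p" "x \<in> open_star K p'" for x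
      proof -
        have x: "x \<in> geom_carrier K" "p \<in> support x" "p' \<in> support x"
          using that by (auto simp: open_star_def support_def)
        show False
          using inj_onD[OF star_bijective_inj[OF f support_in_complex(1)[OF K x(1)]] _ x(2,3)] pp by simp
      qed
      then show "disjnt (open_star K p) (open_star K p')" by (auto simp: disjnt_def)
    qed
    moreover have "homeomorphic_map (subtopology (realization K) (open_star K p)) (subtopology (realization L) ?T) ?F"
      if p: "p \<in> \<Union>K" "f p = q" for p
    proof (rule bijective_open_imp_homeomorphic_map)
      have ts: "geom_carrier K \<inter> open_star K p = open_star K p" "geom_carrier L \<inter> ?T = ?T"
        by (auto simp: open_star_def)
      show "continuous_map (subtopology (realization K) (open_star K p)) (subtopology (realization L) ?T) ?F"
        unfolding continuous_map_in_subtopology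
        using continuous_map_from_subtopology[OF cont] star_image[OF p(1)] p(2) ts by auto
      show "?F ` topspace (subtopology (realization K) (open_star K p)) = topspace (subtopology (realization L) ?T)"
        using star_image[OF p(1)] p(2) ts by simp
      show "inj_on ?F (topspace (subtopology (realization K) (open_star K p)))"
        by (intro inj_onI simplicial_extension_star_inj[OF K L f, of _ p]) (use ts in auto)
      show "open_map (subtopology (realization K) (open_star K p)) (subtopology (realization L) ?T) ?F"
        unfolding open_map_def openin_open_subtopology[OF openin_open_star]
        using openin_simplicial_star_image[OF K L f p(1)] star_image[OF p(1)] p(2) by blast
    qed
    moreover have "y \<in> ?T" using yL q by (simp add: open_star_def support_def)
    ultimately show ?thesis
      by (intro exI[of _ ?T] conjI exI[of _ ?V]) (simp_all add: openin_open_star)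
  qed
  have "?F ` geom_carrier K = geom_carrier L"
  proof (intro equalityI subsetI)
    fix y assume y: "y \<in> geom_carrier L"
    obtain q where q: "q \<in> support y" using support_in_complex(4)[OF L y] by blast
    then have "q \<in> \<Union>L" using support_in_complex(1)[OF L y] by blast
    then have "q \<in> f ` \<Union>K" by (rule subsetD[OF surj])
    then obtain p where p: "p \<in> \<Union>K" "f p = q" by (elim imageE) simp
    have "y \<in> open_star L q" using y q by (simp add: open_star_def support_def)
    then have "y \<in> open_star L (f p)" unfolding p(2) .
    then have "y \<in> ?F ` open_star K p" unfolding star_image[OF p(1)] .
    moreover have "open_star K p \<subseteq> geom_carrier K" unfolding open_star_def by (rule Collect_restrict)
    ultimately show "y \<in> ?F ` geom_carrier K" by (rule subsetD[OF image_mono, rotated])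
  qed (use into in blast)
  then show ?thesis unfolding covering_map_def using cont evenly by simp
qed

lemma covering_map_compose_homeomorphic:
  assumes p: "covering_map X Y p" and h: "homeomorphic_map Y Z h"
  shows "covering_map X Z (h \<circ> p)"
proof -
  have pc: "continuous_map X Y p" and ps: "p ` topspace X = topspace Y"
    using p by (auto simp: covering_map_def)
  have hc: "continuous_map Y Z h" and hs: "h ` topspace Y = topspace Z" and hi: "inj_on h (topspace Y)"
    using homeomorphic_imp_continuous_map[OF h] homeomorphic_imp_surjective_map[OF h]
      homeomorphic_imp_injective_map[OF h] by simp_all
  show ?thesis
    unfolding covering_map_def
  proof (intro conjI ballI)
    show "continuous_map X Z (h \<circ> p)" using continuous_map_compose[OF pc hc] .
    show "(h \<circ> p) ` topspace X = topspace Z" using ps hs by (simp only: image_comp[symmetric])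
    fix z assume "z \<in> topspace Z"
    then obtain y where y: "y \<in> topspace Y" "z = h y" using hs by blast
    then obtain T \<V> where T: "y \<in> T" "openin Y T" and V: "\<Union>\<V> = {x \<in> topspace X. p x \<in> T}"
      "\<forall>U\<in>\<V>. openin X U" "pairwise disjnt \<V>"
      "\<forall>U\<in>\<V>. homeomorphic_map (subtopology X U) (subtopology Y T) p"
      using p unfolding covering_map_def by meson
    have TY: "T \<subseteq> topspace Y" using T(2) by (rule openin_subset)
    have "openin Z (h ` T)" using homeomorphic_imp_open_map[OF h] T(2) by (simp add: open_map_def)
    moreover have "{x \<in> topspace X. (h \<circ> p) x \<in> h ` T} = {x \<in> topspace X. p x \<in> T}"
    proof (intro equalityI subsetI)
      fix x assume x: "x \<in> {x \<in> topspace X. (h \<circ> p) x \<in> h ` T}"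
      then obtain t where t: "t \<in> T" "h (p x) = h t" by auto
      have "p x \<in> topspace Y" using x ps by blast
      then have "p x = t" using inj_onD[OF hi t(2)] t(1) TY by blast
      then show "x \<in> {x \<in> topspace X. p x \<in> T}" using x t(1) by simp
    qed auto
    moreover have hT: "homeomorphic_map (subtopology Y T) (subtopology Z (h ` T)) h"
      using homeomorphic_map_subtopologies[OF h, of T "h ` T"] TY hs by auto
    moreover have "\<forall>U\<in>\<V>. homeomorphic_map (subtopology X U) (subtopology Z (h ` T)) (h \<circ> p)"
      using V(4) homeomorphic_map_compose[OF _ hT] by blast
    ultimately show "\<exists>T. z \<in> T \<and> openin Z T \<and>
        (\<exists>\<V>. \<Union>\<V> = {x \<in> topspace X. (h \<circ> p) x \<in> T} \<and> (\<forall>U\<in>\<V>. openin X U) \<and> pairwise disjnt \<V> \<and>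
             (\<forall>U\<in>\<V>. homeomorphic_map (subtopology X U) (subtopology Z T) (h \<circ> p)))"
      using y T V(1-3) by (intro exI[of _ "h ` T"] conjI exI[of _ \<V>]) auto
  qed
qed

lemma homotopic_paths_homotopic_with:
  "homotopic_paths S p q \<Longrightarrow>
   homotopic_with (\<lambda>h. h 0 = p 0 \<and> h 1 = p 1) (top_of_set {0..1}) (top_of_set S) p q"
  unfolding homotopic_paths_def pathstart_def pathfinish_def .

section \<open>Locally finite complexes\<close>

lemma closed_closed_simplex:
  assumes "finite \<sigma>"
  shows "closed (closed_simplex \<sigma>)"
proof -
  have "closed_simplex \<sigma> = (\<Inter>v. {x. 0 \<le> x v}) \<inter> (\<Inter>v\<in>-\<sigma>. {x. x v = 0}) \<inter> {x. sum x \<sigma> = 1}"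
    by (auto simp: closed_simplex_def)
  moreover have "closed {x. 0 \<le> (x v :: real)}" for v
    by (intro closed_Collect_le continuous_on_const continuous_on_coordinate)
  moreover have "closed {x. (x v :: real) = 0}" for v
    by (intro closed_Collect_eq continuous_on_const continuous_on_coordinate)
  moreover have "closed {x. sum x \<sigma> = (1::real)}"
    by (intro closed_Collect_eq continuous_on_const continuous_on_sum continuous_on_coordinate)
  ultimately show ?thesis by (auto intro!: closed_INT closed_Int)
qed

text \<open>Near a point with p in its support only the simplices through p matter. They are
  finitely many and closed in the product topology, so the parts of them outside U form a closed set
  whose removal leaves an ordinary neighbourhood inside U.\<close>

lemma realization_locally_finite:
  assumes K: "abstract_complex K" and lf: "\<And>p. finite {\<sigma>\<in>K. p \<in> \<sigma>}"
  shows "realization K = top_of_set (geom_carrier K)"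
  unfolding topology_eq
proof (intro allI iffI)
  fix U assume "openin (top_of_set (geom_carrier K)) U"
  then obtain T where T: "open T" "U = geom_carrier K \<inter> T" by (meson openin_open)
  have "U \<inter> closed_simplex \<sigma> = closed_simplex \<sigma> \<inter> T" if "\<sigma> \<in> K" for \<sigma>
    using T(2) closed_simplex_subset_geom_carrier[OF that] by blast
  then show "openin (realization K) U"
    unfolding openin_realization' using T by (simp add: openin_open_Int)
next
  fix U assume U: "openin (realization K) U"
  have UK: "U \<subseteq> geom_carrier K" using U by (simp add: openin_realization')
  show "openin (top_of_set (geom_carrier K)) U"
  proof (subst openin_subopen, intro ballI)
    fix x assume x: "x \<in> U"
    then obtain p where p: "p \<in> support x" using UK support_in_complex(4)[OF K] by blast
    let ?S = "{\<sigma>\<in>K. p \<in> \<sigma>}"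
    let ?C = "\<Union>\<sigma>\<in>?S. closed_simplex \<sigma> - U"
    have "closed (closed_simplex \<sigma> - U)" if \<sigma>: "\<sigma> \<in> K" for \<sigma>
    proof -
      have "openin (top_of_set (closed_simplex \<sigma>)) (U \<inter> closed_simplex \<sigma>)"
        using U \<sigma> by (simp add: openin_realization')
      then have "closedin (top_of_set (closed_simplex \<sigma>)) (closed_simplex \<sigma> - U \<inter> closed_simplex \<sigma>)"
        by (metis closedin_diff closedin_topspace topspace_euclidean_subtopology)
      moreover have "closed_simplex \<sigma> - U \<inter> closed_simplex \<sigma> = closed_simplex \<sigma> - U" by blast
      ultimately show ?thesis
        using closedin_closed_trans closed_closed_simplex[OF abstract_complexD(1)[OF K \<sigma>]] by metis
    qed
    then have "closed ?C" by (intro closed_UN lf) auto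
    moreover have "open {y :: 'a \<Rightarrow> real. y p \<noteq> 0}"
      by (intro open_Collect_neq continuous_on_coordinate continuous_on_const)
    ultimately have o: "open ({y. y p \<noteq> 0} - ?C)" by blast
    have sub: "geom_carrier K \<inter> ({y. y p \<noteq> 0} - ?C) \<subseteq> U"
    proof
      fix y assume y: "y \<in> geom_carrier K \<inter> ({y. y p \<noteq> 0} - ?C)"
      then have yK: "y \<in> geom_carrier K" and yp: "p \<in> support y" by (auto simp: support_def)
      have "support y \<in> ?S" using support_in_complex(1)[OF K yK] yp by blast
      then show "y \<in> U" using y support_in_complex(2)[OF K yK] by blast
    qed
    show "\<exists>T. openin (top_of_set (geom_carrier K)) T \<and> x \<in> T \<and> T \<subseteq> U"
      using openin_open_Int[OF o, of "geom_carrier K"] sub x UK p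
      by (intro exI[of _ "geom_carrier K \<inter> ({y. y p \<noteq> 0} - ?C)"]) (auto simp: support_def)
  qed
qed

section \<open>Homotopies of paths in a complex\<close>

text \<open>The function space carries no norm, so the library's results on linear homotopies do not apply.
  Reparametrization homotopies are instead images of linear homotopies in an interval or a square.\<close>

definition seg :: "('v \<Rightarrow> real) \<Rightarrow> ('v \<Rightarrow> real) \<Rightarrow> real \<Rightarrow> 'v \<Rightarrow> real" where
  "seg x y t = (\<lambda>v. (1 - t) * x v + t * y v)"

lemma pathstart_seg [simp]: "pathstart (seg x y) = x"
  and pathfinish_seg [simp]: "pathfinish (seg x y) = y"
  by (simp_all add: pathstart_def pathfinish_def seg_def)

lemma seg_0 [simp]: "seg x y 0 = x" and seg_1 [simp]: "seg x y 1 = y"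
  by (simp_all add: seg_def)

lemma continuous_on_coord: "continuous_on S f \<Longrightarrow> continuous_on S (\<lambda>t. f t v :: real)"
  by (rule continuous_on_compose2[OF continuous_on_coordinate[of UNIV v]]) auto

lemma continuous_on_seg:
  assumes "continuous_on S f" "continuous_on S g" "continuous_on S h"
  shows "continuous_on S (\<lambda>t. seg (f t) (g t) (h t))"
  unfolding seg_def
  by (rule continuous_on_coordinatewise_then_product)
     (intro continuous_on_add continuous_on_mult continuous_on_diff continuous_on_const
        continuous_on_coord assms)

lemma path_seg [simp]: "path (seg x y)"
  unfolding path_def using continuous_on_seg[of "{0..1}" "\<lambda>_. x" "\<lambda>_. y" "\<lambda>t. t"]
  by (simp add: continuous_on_id continuous_on_const)

definition seg_closed :: "('v \<Rightarrow> real) set \<Rightarrow> bool" where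
  "seg_closed T \<longleftrightarrow> (\<forall>x\<in>T. \<forall>y\<in>T. \<forall>t\<in>{0..1}. seg x y t \<in> T)"

lemma seg_closed_simplex: "seg_closed (closed_simplex \<sigma>)"
  unfolding seg_closed_def
proof (intro ballI)
  fix x y and t :: real assume xy: "x \<in> closed_simplex \<sigma>" "y \<in> closed_simplex \<sigma>" and t: "t \<in> {0..1}"
  have "sum (seg x y t) \<sigma> = (1 - t) * sum x \<sigma> + t * sum y \<sigma>"
    by (simp add: seg_def sum.distrib sum_distrib_left)
  then show "seg x y t \<in> closed_simplex \<sigma>"
    using xy t by (auto simp: closed_simplex_def seg_def)
qed

lemma path_image_seg: "seg_closed T \<Longrightarrow> x \<in> T \<Longrightarrow> y \<in> T \<Longrightarrow> path_image (seg x y) \<subseteq> T"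
  by (auto simp: path_image_def seg_closed_def)

lemma homotopic_paths_seg_closed:
  assumes T: "seg_closed T" and p: "path p" "path_image p \<subseteq> T" and q: "path q" "path_image q \<subseteq> T"
    and ends: "pathstart p = pathstart q" "pathfinish p = pathfinish q"
  shows "homotopic_paths T p q"
  unfolding homotopic_paths
proof (intro exI conjI)
  let ?h = "\<lambda>z. seg (p (snd z)) (q (snd z)) (fst z)"
  show "continuous_on ({0..1} \<times> {0..1}) ?h"
  proof (rule continuous_on_seg)
    show "continuous_on ({0..1} \<times> {0..1}) (\<lambda>z. p (snd z))" "continuous_on ({0..1} \<times> {0..1}) (\<lambda>z. q (snd z))"
      using p(1) q(1) unfolding path_def
      by (auto intro: continuous_on_compose2[OF _ continuous_on_snd[OF continuous_on_id]])
  qed (intro continuous_intros)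
  show "?h \<in> {0..1} \<times> {0..1} \<rightarrow> T"
    using T p(2) q(2) by (auto simp: seg_closed_def path_image_def image_subset_iff)
  show "\<forall>t\<in>{0..1::real}. pathstart (?h \<circ> Pair t) = pathstart p \<and> pathfinish (?h \<circ> Pair t) = pathfinish p"
    using ends by (auto simp: pathstart_def pathfinish_def seg_def algebra_simps fun_eq_iff)
qed simp_all

lemma homotopic_paths_comp_convex:
  fixes C :: "'a::real_normed_vector set"
  assumes C: "convex C" and h: "continuous_on C h" "h ` C \<subseteq> S"
    and p: "path p" "path_image p \<subseteq> C" and q: "path q" "path_image q \<subseteq> C"
    and ends: "pathstart p = pathstart q" "pathfinish p = pathfinish q"
  shows "homotopic_paths S (h \<circ> p) (h \<circ> q)"
proof (rule homotopic_paths_continuous_image[OF _ h(1)])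
  have "closed_segment (p t) (q t) \<subseteq> C" if "t \<in> {0..1}" for t
    using p(2) q(2) that C by (intro closed_segment_subset) (auto simp: path_image_def)
  then show "homotopic_paths C p q"
    using homotopic_paths_linear[OF p(1) q(1) ends[symmetric]] by blast
qed (use h(2) in auto)

lemma homotopic_paths_lid_general:
  fixes S :: "'a::topological_space set"
  assumes "path p" "path_image p \<subseteq> S"
  shows "homotopic_paths S ((\<lambda>_. pathstart p) +++ p) p"
proof -
  have "homotopic_paths S (p \<circ> (linepath 0 0 +++ linepath 0 1)) (p \<circ> linepath 0 1)"
  proof (rule homotopic_paths_comp_convex[of "{0..1}"])
    show "path_image (linepath 0 0 +++ linepath 0 1) \<subseteq> {0..1::real}"
      by (intro subset_path_image_join) (simp_all add: closed_segment_eq_real_ivl)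
  qed (use assms in \<open>simp_all add: path_def[of p] path_image_def[of p] closed_segment_eq_real_ivl\<close>)
  moreover have "p \<circ> (linepath 0 0 +++ linepath 0 1) = (\<lambda>_. pathstart p) +++ p"
    by (auto simp: joinpaths_def linepath_def pathstart_def fun_eq_iff)
  moreover have "p \<circ> linepath 0 1 = p" by (auto simp: linepath_def fun_eq_iff)
  ultimately show ?thesis by simp
qed

lemma homotopic_paths_join_subpaths:
  fixes S :: "'a::topological_space set"
  assumes p: "path p" "path_image p \<subseteq> S" and "0 \<le> a" "a \<le> b" "b \<le> c" "c \<le> 1"
  shows "homotopic_paths S ((p \<circ> linepath a b) +++ (p \<circ> linepath b c)) (p \<circ> linepath a c)"
proof -
  have "homotopic_paths S (p \<circ> (linepath a b +++ linepath b c)) (p \<circ> linepath a c)"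
  proof (rule homotopic_paths_comp_convex[of "{0..1}"])
    show "path_image (linepath a b +++ linepath b c) \<subseteq> {0..1::real}"
      by (intro subset_path_image_join) (use assms in \<open>simp_all add: closed_segment_eq_real_ivl\<close>)
  qed (use assms in \<open>simp_all add: path_def[of p] path_image_def[of p] closed_segment_eq_real_ivl\<close>)
  then show ?thesis by (simp add: path_compose_join)
qed

text \<open>The map \<open>(r, u) \<mapsto> seg z (k u) r\<close> carries the two halves of the boundary of the unit square to
  the two sides.\<close>

lemma homotopic_paths_star:
  assumes K: "abstract_complex K" and k: "path k" "path_image k \<subseteq> geom_carrier K"
    and z: "\<And>t. t \<in> {0..1} \<Longrightarrow> seg_closed (T t) \<and> T t \<subseteq> geom_carrier K \<and> z \<in> T t \<and> k t \<in> T t"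
  shows "homotopic_paths (geom_carrier K) (seg z (pathstart k) +++ k) (seg z (pathfinish k))"
proof -
  let ?S = "geom_carrier K"
  let ?\<Phi> = "\<lambda>(r, u). seg z (k u) r"
  let ?Q = "{0..1::real} \<times> {0..1::real}"
  have cont: "continuous_on ?Q ?\<Phi>"
    unfolding case_prod_unfold
    by (rule continuous_on_seg) (use k(1) in \<open>auto simp: path_def
      intro: continuous_on_compose2[OF _ continuous_on_snd[OF continuous_on_id]] continuous_intros\<close>)
  have im: "?\<Phi> ` ?Q \<subseteq> ?S" using z unfolding seg_closed_def by fast
  have "homotopic_paths ?S (?\<Phi> \<circ> (linepath (0,0) (1,0) +++ linepath (1,0) (1,1)))
          (?\<Phi> \<circ> (linepath (0,0) (0,1) +++ linepath (0,1) (1,1)))"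
  proof (rule homotopic_paths_comp_convex[OF _ cont im])
    have C: "convex ?Q" by (intro convex_Times) simp_all
    then show "convex ?Q" .
    show "path_image (linepath (0, 0) (1, 0) +++ linepath (1, 0) (1, 1)) \<subseteq> ?Q"
      "path_image (linepath (0, 0) (0, 1) +++ linepath (0, 1) (1, 1)) \<subseteq> ?Q"
      by (intro subset_path_image_join; simp only: path_image_linepath; rule closed_segment_subset[OF _ _ C]; simp)+
  qed simp_all
  moreover have "?\<Phi> \<circ> linepath (0,0) (1,0) = seg z (pathstart k)" "?\<Phi> \<circ> linepath (1,0) (1,1) = k"
    "?\<Phi> \<circ> linepath (0,0) (0,1) = (\<lambda>_. z)" "?\<Phi> \<circ> linepath (0,1) (1,1) = seg z (pathfinish k)"
    by (simp_all add: fun_eq_iff linepath_def pathstart_def pathfinish_def seg_def)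
  ultimately have "homotopic_paths ?S (seg z (pathstart k) +++ k) ((\<lambda>_. z) +++ seg z (pathfinish k))"
    by (simp add: path_compose_join)
  also have "homotopic_paths ?S ((\<lambda>_. z) +++ seg z (pathfinish k)) (seg z (pathfinish k))"
  proof -
    have "path_image (seg z (pathfinish k)) \<subseteq> T 1"
      using z[of 1] by (intro path_image_seg) (auto simp: pathfinish_def)
    then show ?thesis
      using homotopic_paths_lid_general[of "seg z (pathfinish k)" ?S] z[of 1] by auto
  qed
  finally show ?thesis .
qed

section \<open>Polygonal paths of vertex lists\<close>

definition vertex_point :: "'v \<Rightarrow> 'v \<Rightarrow> real" where
  "vertex_point p = (\<lambda>v. if v = p then 1 else 0)"

lemma vertex_point_in_simplex: "finite \<sigma> \<Longrightarrow> p \<in> \<sigma> \<Longrightarrow> vertex_point p \<in> closed_simplex \<sigma>"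
  by (auto simp: vertex_point_def closed_simplex_def)

text \<open>The value at the empty list is arbitrary. Joins nest to the right, so prefixing a vertex
  is a single join, while changes at the far end require reassociation.\<close>

fun polyline :: "'v list \<Rightarrow> real \<Rightarrow> 'v \<Rightarrow> real" where
  "polyline [] = (\<lambda>_. vertex_point undefined)"
| "polyline [x] = (\<lambda>_. vertex_point x)"
| "polyline (x # y # zs) = seg (vertex_point x) (vertex_point y) +++ polyline (y # zs)"

lemma polyline_ends:
  "xs \<noteq> [] \<Longrightarrow> pathstart (polyline xs) = vertex_point (hd xs) \<and> pathfinish (polyline xs) = vertex_point (last xs)"
  by (induction xs rule: polyline.induct) (auto simp: pathstart_def[of "\<lambda>_. _"] pathfinish_def[of "\<lambda>_. _"])

lemma path_seg_simplex:
  assumes "abstract_complex K" "\<sigma> \<in> K" "x \<in> closed_simplex \<sigma>" "y \<in> closed_simplex \<sigma>"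
  shows "path_image (seg x y) \<subseteq> geom_carrier K"
  using path_image_seg[OF seg_closed_simplex assms(3,4)] closed_simplex_subset_geom_carrier[OF assms(2)] by blast

lemma path_polyline:
  assumes K: "abstract_complex K"
  shows "edge_path K xs \<Longrightarrow> path (polyline xs) \<and> path_image (polyline xs) \<subseteq> geom_carrier K"
proof (induction xs rule: polyline.induct)
  case (2 x)
  then obtain \<sigma> where \<sigma>: "\<sigma> \<in> K" "x \<in> \<sigma>" by (auto simp: edge_path_def)
  have "vertex_point x \<in> geom_carrier K"
    using vertex_point_in_simplex[OF abstract_complexD(1)[OF K \<sigma>(1)] \<sigma>(2)]
    by (rule subsetD[OF closed_simplex_subset_geom_carrier[OF \<sigma>(1)]])
  then show ?case by (auto simp: path_def path_image_def continuous_on_const)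
next
  case (3 x y zs)
  then have e: "{x, y} \<in> K" and ep: "edge_path K (y # zs)" by (auto simp: edge_path_def)
  have "path_image (seg (vertex_point x) (vertex_point y)) \<subseteq> geom_carrier K"
    by (rule path_seg_simplex[OF K e]; rule vertex_point_in_simplex) auto
  then show ?case using 3(1)[OF ep] polyline_ends[of "y # zs"]
    by (simp add: subset_path_image_join)
qed (simp add: edge_path_def)

lemma homotopic_polyline_edge_step_Nil:
  assumes K: "abstract_complex K" and "{x, y, z} \<in> K" "edge_path K (z # vs)"
  shows "homotopic_paths (geom_carrier K) (polyline (x # y # z # vs)) (polyline (x # z # vs))"
proof -
  let ?S = "geom_carrier K" and ?v = vertex_point
  have vp: "?v x \<in> closed_simplex {x, y, z}" "?v y \<in> closed_simplex {x, y, z}" "?v z \<in> closed_simplex {x, y, z}"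
    by (rule vertex_point_in_simplex; simp)+
  note im = path_image_seg[OF seg_closed_simplex vp(1) vp(2)] path_image_seg[OF seg_closed_simplex vp(2) vp(3)]
    path_image_seg[OF seg_closed_simplex vp(1) vp(3)]
  note sub = closed_simplex_subset_geom_carrier[OF assms(2)]
  have pl: "path (polyline (z # vs))" "path_image (polyline (z # vs)) \<subseteq> ?S" "pathstart (polyline (z # vs)) = ?v z"
    using path_polyline[OF K assms(3)] polyline_ends[of "z # vs"] by auto
  have "homotopic_paths (closed_simplex {x, y, z}) (seg (?v x) (?v y) +++ seg (?v y) (?v z)) (seg (?v x) (?v z))"
    by (rule homotopic_paths_seg_closed[OF seg_closed_simplex]) (use im in \<open>simp_all add: subset_path_image_join\<close>)
  then have tri: "homotopic_paths ?S (seg (?v x) (?v y) +++ seg (?v y) (?v z)) (seg (?v x) (?v z))"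
    by (rule homotopic_paths_subset[OF _ sub])
  have "homotopic_paths ?S (polyline (x # y # z # vs)) ((seg (?v x) (?v y) +++ seg (?v y) (?v z)) +++ polyline (z # vs))"
    unfolding polyline.simps by (rule homotopic_paths_assoc) (use im sub pl in auto)
  also have "homotopic_paths ?S \<dots> (polyline (x # z # vs))"
    unfolding polyline.simps by (rule homotopic_paths_join[OF tri]) (use pl in auto)
  finally show ?thesis .
qed

lemma homotopic_polyline_dup_Nil:
  assumes K: "abstract_complex K" and "edge_path K (x # vs)"
  shows "homotopic_paths (geom_carrier K) (polyline (x # x # vs)) (polyline (x # vs))"
proof -
  have "seg (vertex_point x) (vertex_point x) = (\<lambda>_. pathstart (polyline (x # vs)))"
    using polyline_ends[of "x # vs"] by (auto simp: seg_def fun_eq_iff algebra_simps)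
  then show ?thesis
    using homotopic_paths_lid_general[of "polyline (x # vs)"] path_polyline[OF K assms(2)] by simp
qed

text \<open>The first vertices must agree because the edge that joins us to the rest of the list is
  a segment of the polygonal path.\<close>

lemma homotopic_polyline_append:
  assumes K: "abstract_complex K" and "homotopic_paths (geom_carrier K) (polyline xs) (polyline ys)"
    "xs \<noteq> []" "ys \<noteq> []" "hd xs = hd ys" "edge_path K (us @ xs)"
  shows "homotopic_paths (geom_carrier K) (polyline (us @ xs)) (polyline (us @ ys))"
  using assms(6)
proof (induction us)
  case (Cons u us)
  then have ne: "us @ xs \<noteq> []" "us @ ys \<noteq> []" using assms by auto
  have ep: "edge_path K (us @ xs)" and e: "{u, hd (us @ xs)} \<in> K"
    using Cons.prems ne by (auto simp: edge_path_def successively_Cons)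
  have hd: "hd (us @ ys) = hd (us @ xs)" using assms by (cases us) auto
  have pl: "polyline (u # zs) = seg (vertex_point u) (vertex_point (hd zs)) +++ polyline zs" if "zs \<noteq> []" for zs
    using that by (cases zs) auto
  have "homotopic_paths (geom_carrier K) (seg (vertex_point u) (vertex_point (hd (us @ xs))) +++ polyline (us @ xs))
     (seg (vertex_point u) (vertex_point (hd (us @ xs))) +++ polyline (us @ ys))"
  proof (rule homotopic_paths_join)
    show "homotopic_paths (geom_carrier K) (seg (vertex_point u) (vertex_point (hd (us @ xs))))
       (seg (vertex_point u) (vertex_point (hd (us @ xs))))"
      using path_seg_simplex[OF K e] vertex_point_in_simplex[of "{u, hd (us @ xs)}"] by simp
  qed (use Cons.IH ep polyline_ends[OF ne(1)] in auto)
  then show ?case using pl ne hd by simp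
qed (use assms in simp)

lemma homotopic_polyline_edge_step:
  assumes K: "abstract_complex K" and "edge_step K xs ys" "edge_path K xs"
  shows "homotopic_paths (geom_carrier K) (polyline xs) (polyline ys)"
  using assms(2)
proof cases
  case (tri x y z us vs)
  have "edge_path K (z # vs)"
    using assms(3) unfolding tri edge_path_def by (auto simp: successively_append_iff)
  from homotopic_polyline_edge_step_Nil[OF K tri(3) this]
  show ?thesis unfolding tri
    by (intro homotopic_polyline_append[OF K]) (use assms(3) tri in auto)
next
  case (dup us x vs)
  have "edge_path K (x # vs)"
    using assms(3) unfolding dup edge_path_def by (auto simp: successively_append_iff)
  from homotopic_polyline_dup_Nil[OF K this]
  show ?thesis unfolding dup
    by (intro homotopic_polyline_append[OF K]) (use assms(3) dup in auto)
qed

lemma homotopic_polyline: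
  assumes K: "abstract_complex K" and "edge_hom K xs ys" "edge_path K xs"
  shows "homotopic_paths (geom_carrier K) (polyline xs) (polyline ys)"
  using assms(2)
proof (induction rule: edge_hom_induct)
  case base
  then show ?case using path_polyline[OF K assms(3)] by simp
next
  case (step ys zs)
  then show ?case
    using homotopic_polyline_edge_step[OF K] edge_hom_edge_path[OF K _ assms(3)] homotopic_paths_trans by blast
next
  case (unstep ys zs)
  then have "edge_path K zs" using edge_hom_edge_path[OF K _ assms(3)] edge_step_edge_path[OF K] by blast
  then show ?case
    using homotopic_polyline_edge_step[OF K] unstep homotopic_paths_trans homotopic_paths_sym by blast
qed

text \<open>A segment added at the end has to be carried through the right-nested joins by
  associativity; for a single vertex the constant path changes sides.\<close>

lemma homotopic_polyline_snoc:
  assumes K: "abstract_complex K"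
  shows "edge_path K (xs @ [y]) \<Longrightarrow> xs \<noteq> [] \<Longrightarrow> homotopic_paths (geom_carrier K) (polyline (xs @ [y]))
     (polyline xs +++ seg (vertex_point (last xs)) (vertex_point y))"
proof (induction xs rule: polyline.induct)
  case (2 x)
  let ?s = "seg (vertex_point x) (vertex_point y)" and ?S = "geom_carrier K"
  have e: "{x, y} \<in> K" and ep: "edge_path K [y]" using 2 by (auto simp: edge_path_def)
  have s: "path_image ?s \<subseteq> closed_simplex {x, y}"
    by (rule path_image_seg[OF seg_closed_simplex]; rule vertex_point_in_simplex; simp)
  have sub: "closed_simplex {x, y} \<subseteq> ?S" using closed_simplex_subset_geom_carrier[OF e] .
  have "homotopic_paths (closed_simplex {x, y}) (?s +++ (\<lambda>_. vertex_point y)) ((\<lambda>_. vertex_point x) +++ ?s)"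
  proof (rule homotopic_paths_seg_closed[OF seg_closed_simplex])
    have c: "path_image (\<lambda>_. vertex_point v) \<subseteq> closed_simplex {x, y}" if "v \<in> {x, y}" for v
      using vertex_point_in_simplex[OF _ that] by (auto simp: path_image_def)
    show "path_image (?s +++ (\<lambda>_. vertex_point y)) \<subseteq> closed_simplex {x, y}"
      "path_image ((\<lambda>_. vertex_point x) +++ ?s) \<subseteq> closed_simplex {x, y}"
      using s c by (simp_all add: subset_path_image_join)
  qed (auto simp: path_def[of "\<lambda>_. _"] continuous_on_const pathstart_def[of "\<lambda>_. _"] pathfinish_def[of "\<lambda>_. _"])
  then show ?case using homotopic_paths_subset[OF _ sub] by simp
next
  case (3 x z zs)
  let ?S = "geom_carrier K" and ?v = vertex_point
  have e: "{x, z} \<in> K" and ep: "edge_path K ((z # zs) @ [y])" and ep': "edge_path K (z # zs)"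
    and e': "{last (z # zs), y} \<in> K"
    using 3(2) successively_append_iff[of "\<lambda>x y. {x, y} \<in> K" "z # zs" "[y]"]
    by (auto simp: edge_path_def)
  note IH = 3(1)[OF ep]
  have i1: "path_image (seg (?v x) (?v z)) \<subseteq> ?S"
    by (rule path_seg_simplex[OF K e]; rule vertex_point_in_simplex; simp)
  have i2: "path_image (seg (?v (last (z # zs))) (?v y)) \<subseteq> ?S"
    by (rule path_seg_simplex[OF K e']; rule vertex_point_in_simplex; simp)
  have pl: "path (polyline (z # zs))" "path_image (polyline (z # zs)) \<subseteq> ?S"
    "pathstart (polyline (z # zs)) = ?v z" "pathfinish (polyline (z # zs)) = ?v (last (z # zs))"
    using path_polyline[OF K ep'] polyline_ends[of "z # zs"] by auto
  have "homotopic_paths ?S (seg (?v x) (?v z) +++ polyline ((z # zs) @ [y]))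
     (seg (?v x) (?v z) +++ (polyline (z # zs) +++ seg (?v (last (z # zs))) (?v y)))"
    by (rule homotopic_paths_join) (use i1 IH polyline_ends[of "z # zs @ [y]"] in auto)
  also have "homotopic_paths ?S \<dots> ((seg (?v x) (?v z) +++ polyline (z # zs)) +++ seg (?v (last (z # zs))) (?v y))"
    by (rule homotopic_paths_assoc) (use i1 i2 pl in auto)
  finally show ?case by simp
qed simp

text \<open>Loops are contracted without simplicial approximation. Every point x receives a standard
  path \<open>M p x\<close> from the base point through a vertex p of its support, well defined up
  to homotopy because edge loops are null. Following the loop carries standard paths to standard
  paths on short intervals, where one vertex stays in the support, and hence on the whole unit
  interval.\<close>

theorem simply_connected_realization:
  fixes K :: "'v set set"
  assumes K: "abstract_complex K" and lf: "\<And>p. finite {\<sigma>\<in>K. p \<in> \<sigma>}" and ne: "K \<noteq> {}"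
    and conn: "\<And>p q. p \<in> \<Union>K \<Longrightarrow> q \<in> \<Union>K \<Longrightarrow> \<exists>xs. edge_path K xs \<and> hd xs = p \<and> last xs = q"
    and null: "\<And>xs. edge_path K xs \<Longrightarrow> hd xs = last xs \<Longrightarrow> edge_hom K xs [hd xs]"
  shows "simply_connected_space (realization K)"
proof -
  let ?S = "geom_carrier K" and ?v = "vertex_point :: 'v \<Rightarrow> 'v \<Rightarrow> real"
  have top: "realization K = top_of_set ?S" by (rule realization_locally_finite[OF K lf])
  have v_supp: "?v p \<in> closed_simplex (support x)" if "x \<in> ?S" "p \<in> support x" for x p
    using vertex_point_in_simplex[OF support_in_complex(3)[OF K that(1)] that(2)] .
  have seg_S: "path_image (seg (?v p) x) \<subseteq> ?S" "path_image (seg x (?v p)) \<subseteq> ?S"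
    if "x \<in> ?S" "p \<in> support x" for x p
    using path_seg_simplex[OF K support_in_complex(1)[OF K that(1)]] v_supp[OF that]
      support_in_complex(2)[OF K that(1)] by auto
  have supp_vert: "p \<in> \<Union>K" if "x \<in> ?S" "p \<in> support x" for x p
    using support_in_complex(1)[OF K that(1)] that(2) by blast
  have main: "(\<exists>h. path h \<and> path_image h \<subseteq> ?S \<and> pathstart h = x0 \<and> pathfinish h = y0) \<and>
     (\<forall>g. path g \<longrightarrow> path_image g \<subseteq> ?S \<longrightarrow> g 0 = x0 \<longrightarrow> g 1 = x0 \<longrightarrow> homotopic_paths ?S g (\<lambda>_. x0))"
    if x0: "x0 \<in> ?S" and y0: "y0 \<in> ?S" for x0 y0
  proof -
    obtain p0 where p0: "p0 \<in> support x0" using support_in_complex(4)[OF K x0] by blast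
    have "\<forall>p\<in>\<Union>K. \<exists>xs. edge_path K xs \<and> hd xs = p0 \<and> last xs = p"
      using conn[OF supp_vert[OF x0 p0]] by blast
    then obtain \<gamma> where \<gamma>: "\<And>p. p \<in> \<Union>K \<Longrightarrow> edge_path K (\<gamma> p) \<and> hd (\<gamma> p) = p0 \<and> last (\<gamma> p) = p"
      by metis
    have pl: "path (polyline (\<gamma> p))" "path_image (polyline (\<gamma> p)) \<subseteq> ?S"
      "pathstart (polyline (\<gamma> p)) = ?v p0" "pathfinish (polyline (\<gamma> p)) = ?v p" if "p \<in> \<Union>K" for p
      using path_polyline[OF K] polyline_ends[of "\<gamma> p"] \<gamma>[OF that] by (auto simp: edge_path_def)
    define M where "M p x = seg x0 (?v p0) +++ (polyline (\<gamma> p) +++ seg (?v p) x)" for p x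
    have M: "path (M p x)" "path_image (M p x) \<subseteq> ?S" "pathstart (M p x) = x0" "pathfinish (M p x) = x"
      if x: "x \<in> ?S" and p: "p \<in> support x" for p x
      using pl[OF supp_vert[OF x p]] seg_S[OF x p] seg_S[OF x0 p0]
      by (simp_all add: M_def subset_path_image_join)
    have refl0: "homotopic_paths ?S (seg x0 (?v p0)) (seg x0 (?v p0))"
      using seg_S[OF x0 p0] by simp
    have M_indep: "homotopic_paths ?S (M p x) (M q x)"
      if x: "x \<in> ?S" and p: "p \<in> support x" and q: "q \<in> support x" for p q x
    proof -
      note pK = supp_vert[OF x p] and qK = supp_vert[OF x q]
      have pq: "{p, q} \<in> K"
        using abstract_complexD(3)[OF K support_in_complex(1)[OF K x], of "{p, q}"] p q by blast
      have ep: "edge_path K (\<gamma> p @ [q])"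
        using edge_path_append[of K "\<gamma> p" "[q]"] \<gamma>[OF pK] pq qK by (auto simp: edge_path_def)
      have "edge_hom K (\<gamma> p @ [q]) (\<gamma> q)"
        by (rule edge_hom_if_loops_null[OF K null ep]) (use \<gamma>[OF qK] \<gamma>[OF pK] in \<open>auto simp: edge_path_def\<close>)
      then have 1: "homotopic_paths ?S (polyline (\<gamma> p @ [q])) (polyline (\<gamma> q))"
        by (rule homotopic_polyline[OF K _ ep])
      have 2: "homotopic_paths ?S (polyline (\<gamma> p @ [q])) (polyline (\<gamma> p) +++ seg (?v p) (?v q))"
        using homotopic_polyline_snoc[OF K ep] \<gamma>[OF pK] by (auto simp: edge_path_def)
      have spq: "path_image (seg (?v p) (?v q)) \<subseteq> closed_simplex (support x)"
        by (rule path_image_seg[OF seg_closed_simplex v_supp[OF x p] v_supp[OF x q]])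
      note sub = closed_simplex_subset_geom_carrier[OF support_in_complex(1)[OF K x]]
      have sx: "path_image (seg (?v p) x) \<subseteq> closed_simplex (support x)"
        "path_image (seg (?v q) x) \<subseteq> closed_simplex (support x)"
        using path_image_seg[OF seg_closed_simplex _ support_in_complex(2)[OF K x]] v_supp[OF x] p q by auto
      have "homotopic_paths (closed_simplex (support x)) (seg (?v p) x) (seg (?v p) (?v q) +++ seg (?v q) x)"
        by (rule homotopic_paths_seg_closed[OF seg_closed_simplex])
           (use sx spq in \<open>simp_all add: subset_path_image_join\<close>)
      then have 3: "homotopic_paths ?S (seg (?v p) x) (seg (?v p) (?v q) +++ seg (?v q) x)"
        by (rule homotopic_paths_subset[OF _ sub])
      have "homotopic_paths ?S (polyline (\<gamma> p) +++ seg (?v p) x)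
          (polyline (\<gamma> p) +++ (seg (?v p) (?v q) +++ seg (?v q) x))"
        by (rule homotopic_paths_join) (use 3 pl[OF pK] in simp_all)
      also have "homotopic_paths ?S \<dots> ((polyline (\<gamma> p) +++ seg (?v p) (?v q)) +++ seg (?v q) x)"
        by (rule homotopic_paths_assoc) (use pl[OF pK] sx spq sub in auto)
      also have "homotopic_paths ?S \<dots> (polyline (\<gamma> q) +++ seg (?v q) x)"
        by (rule homotopic_paths_join)
           (use homotopic_paths_trans[OF homotopic_paths_sym[OF 2] 1] sx sub in auto)
      finally show ?thesis unfolding M_def
        by (rule homotopic_paths_join[OF refl0]) (use pl[OF pK] in simp_all)
    qed
    have null_loop: "homotopic_paths ?S g (\<lambda>_. x0)"
      if g: "path g" "path_image g \<subseteq> ?S" and ends: "g 0 = x0" "g 1 = x0" for g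
    proof -
      have gS: "g t \<in> ?S" if "t \<in> {0..1}" for t using g(2) that by (auto simp: path_image_def)
      have sub_path: "path (g \<circ> linepath a b)" "path_image (g \<circ> linepath a b) \<subseteq> g ` {a..b}"
        if "0 \<le> a" "a \<le> b" "b \<le> 1" for a b
      proof -
        have im: "path_image (linepath a b) = {a..b}"
          using that by (simp add: closed_segment_eq_real_ivl)
        show "path (g \<circ> linepath a b)"
          by (rule path_continuous_image[OF path_linepath])
             (use g(1) im that in \<open>auto simp: path_def intro: continuous_on_subset\<close>)
        show "path_image (g \<circ> linepath a b) \<subseteq> g ` {a..b}"
          using im by (simp add: path_image_compose)
      qed
      have sub_image: "path_image (g \<circ> linepath a b) \<subseteq> ?S" if "0 \<le> a" "a \<le> b" "b \<le> 1" for a b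
        using sub_path(2)[OF that] gS that by fastforce
      have ends_sub: "pathstart (g \<circ> linepath a b) = g a" "pathfinish (g \<circ> linepath a b) = g b" for a b
        by (simp_all add: pathstart_def pathfinish_def linepath_def)
      define P where "P a b \<longleftrightarrow> (0 \<le> a \<longrightarrow> a \<le> b \<longrightarrow> b \<le> 1 \<longrightarrow> (\<forall>p\<in>support (g a). \<forall>q\<in>support (g b).
        homotopic_paths ?S (M p (g a) +++ (g \<circ> linepath a b)) (M q (g b))))" for a b
      have "0 \<le> (1::real)" by simp
      then have "P 0 1"
      proof (induction rule: Bolzano)
        case (trans a b c)
        show ?case unfolding P_def
        proof (intro impI ballI)
          fix p q assume ac: "0 \<le> a" "a \<le> c" "c \<le> 1" and p: "p \<in> support (g a)" and q: "q \<in> support (g c)"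
          have gb: "g b \<in> ?S" and ga: "g a \<in> ?S" using gS ac trans by auto
          obtain r where r: "r \<in> support (g b)" using support_in_complex(4)[OF K gb] by blast
          have 1: "homotopic_paths ?S (M p (g a) +++ (g \<circ> linepath a b)) (M r (g b))"
            and 2: "homotopic_paths ?S (M r (g b) +++ (g \<circ> linepath b c)) (M q (g c))"
            using trans ac p q r unfolding P_def by auto
          have "homotopic_paths ?S (M p (g a) +++ (g \<circ> linepath a c))
              (M p (g a) +++ ((g \<circ> linepath a b) +++ (g \<circ> linepath b c)))"
            by (rule homotopic_paths_join[OF _ homotopic_paths_sym[OF homotopic_paths_join_subpaths[OF g]]])
               (use M[OF ga p] ac trans in \<open>simp_all add: ends_sub\<close>)
          also have "homotopic_paths ?S \<dots> ((M p (g a) +++ (g \<circ> linepath a b)) +++ (g \<circ> linepath b c))"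
            by (rule homotopic_paths_assoc)
               (use M[OF ga p] ac trans sub_path(1) sub_image in \<open>simp_all add: ends_sub\<close>)
          also have "homotopic_paths ?S \<dots> (M r (g b) +++ (g \<circ> linepath b c))"
            by (rule homotopic_paths_join[OF 1])
               (use ac trans sub_path(1) sub_image in \<open>simp_all add: ends_sub\<close>)
          also note 2
          finally show "homotopic_paths ?S (M p (g a) +++ (g \<circ> linepath a c)) (M q (g c))" .
        qed
      next
        case (local x)
        then have xS: "g x \<in> ?S" using gS by auto
        obtain r where r: "r \<in> support (g x)" using support_in_complex(4)[OF K xS] by blast
        have cg: "continuous_on {0..1} (\<lambda>t. g t r)"
          using g(1) unfolding path_def by (rule continuous_on_coord)
        \<comment> \<open>A coordinate that is nonzero at parameter x stays nonzero nearby, so r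
          remains in the support throughout a short interval.\<close>
        have "\<exists>d>0. \<forall>t\<in>{0..1}. dist t x < d \<longrightarrow> dist (g t r) (g x r) < \<bar>g x r\<bar>"
          using cg[unfolded continuous_on_iff, rule_format, of x "\<bar>g x r\<bar>"] local r by (auto simp: support_def)
        then obtain d where d: "d > 0" "\<And>t. t \<in> {0..1} \<Longrightarrow> dist t x < d \<Longrightarrow> dist (g t r) (g x r) < \<bar>g x r\<bar>"
          by blast
        have rt: "r \<in> support (g t)" if "t \<in> {0..1}" "dist t x < d" for t
          using d(2)[OF that] by (auto simp: support_def dist_real_def)
        show ?case
        proof (intro exI conjI allI impI)
          show "d > 0" by fact
          fix a b assume ab: "a \<le> x \<and> x \<le> b \<and> b - a < d"
          show "P a b" unfolding P_def
          proof (intro impI ballI)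
            fix p q assume ac: "0 \<le> a" "a \<le> b" "b \<le> 1" and p: "p \<in> support (g a)" and q: "q \<in> support (g b)"
            have rr: "r \<in> support (g t)" if "t \<in> {a..b}" for t
              by (rule rt) (use that ab ac in \<open>auto simp: dist_real_def\<close>)
            have ga: "g a \<in> ?S" and gb: "g b \<in> ?S" using gS ac by auto
            have ra: "r \<in> support (g a)" and rb: "r \<in> support (g b)" using rr ac by auto
            note rK = supp_vert[OF ga ra]
            let ?k = "g \<circ> linepath a b"
            have kt: "?k t \<in> ?S \<and> r \<in> support (?k t)" if "t \<in> {0..1}" for t
            proof -
              have "linepath a b t \<in> {a..b}"
                using that ac by (auto simp: path_image_def[symmetric] closed_segment_eq_real_ivl
                  simp flip: path_image_linepath intro: imageI)
                  (metis ac(2) atLeastAtMost_iff closed_segment_eq_real_ivl linepath_in_path path_image_linepath)+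
              then show ?thesis using rr gS ac by auto
            qed
            \<comment> \<open>Each point of this piece lies in a closed simplex having r as a
              vertex, so walking along the piece may be replaced by the segment from r to its
              end.\<close>
            have star: "homotopic_paths ?S (seg (?v r) (pathstart ?k) +++ ?k) (seg (?v r) (pathfinish ?k))"
            proof (rule homotopic_paths_star[OF K sub_path(1)[OF ac] sub_image[OF ac]])
              fix t :: real assume t: "t \<in> {0..1}"
              have kS: "?k t \<in> ?S" and rk: "r \<in> support (?k t)" using kt[OF t] by auto
              show "seg_closed (closed_simplex (support (?k t))) \<and> closed_simplex (support (?k t)) \<subseteq> ?S \<and>
                 ?v r \<in> closed_simplex (support (?k t)) \<and> ?k t \<in> closed_simplex (support (?k t))"
                using seg_closed_simplex closed_simplex_subset_geom_carrier[OF support_in_complex(1)[OF K kS]]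
                  v_supp[OF kS rk] support_in_complex(2)[OF K kS] by blast
            qed
            have "homotopic_paths ?S (M p (g a) +++ ?k) (M r (g a) +++ ?k)"
              by (rule homotopic_paths_join[OF M_indep[OF ga p ra]])
                 (use sub_path(1)[OF ac] sub_image[OF ac] M[OF ga p] in \<open>simp_all add: ends_sub\<close>)
            also have "homotopic_paths ?S \<dots> (seg x0 (?v p0) +++ ((polyline (\<gamma> r) +++ seg (?v r) (g a)) +++ ?k))"
              unfolding M_def
              by (rule homotopic_paths_sym, rule homotopic_paths_assoc)
                 (use pl[OF rK] sub_path(1)[OF ac] sub_image[OF ac] seg_S[OF x0 p0] seg_S[OF ga ra]
                   in \<open>simp_all add: ends_sub subset_path_image_join\<close>)
            also have "homotopic_paths ?S \<dots> (seg x0 (?v p0) +++ (polyline (\<gamma> r) +++ (seg (?v r) (g a) +++ ?k)))"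
              by (rule homotopic_paths_join[OF refl0], rule homotopic_paths_sym, rule homotopic_paths_assoc)
                 (use pl[OF rK] sub_path(1)[OF ac] sub_image[OF ac] seg_S[OF ga ra] in \<open>simp_all add: ends_sub\<close>)
            also have "homotopic_paths ?S \<dots> (M r (g b))"
              unfolding M_def
              by (rule homotopic_paths_join[OF refl0], rule homotopic_paths_join)
                 (use pl[OF rK] star in \<open>simp_all add: ends_sub\<close>)
            also have "homotopic_paths ?S \<dots> (M q (g b))" by (rule M_indep[OF gb rb q])
            finally show "homotopic_paths ?S (M p (g a) +++ ?k) (M q (g b))" .
          qed
        qed
      qed
      moreover have "g \<circ> linepath 0 1 = g" by (auto simp: linepath_def fun_eq_iff)
      ultimately have Mg: "homotopic_paths ?S (M p0 x0 +++ g) (M p0 x0)"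
        using p0 ends by (auto simp: P_def)
      have p0K: "p0 \<in> \<Union>K" using supp_vert[OF x0 p0] .
      have "homotopic_paths ?S (polyline (\<gamma> p0)) (polyline [p0])"
        using homotopic_polyline[OF K null] \<gamma>[OF p0K] by metis
      then have pc: "homotopic_paths ?S (polyline (\<gamma> p0)) (\<lambda>_. pathstart (seg (?v p0) x0))" by simp
      have "homotopic_paths ?S (polyline (\<gamma> p0) +++ seg (?v p0) x0) ((\<lambda>_. pathstart (seg (?v p0) x0)) +++ seg (?v p0) x0)"
        by (rule homotopic_paths_join[OF pc]) (use seg_S[OF x0 p0] pl[OF p0K] in simp_all)
      also have "homotopic_paths ?S \<dots> (seg (?v p0) x0)"
        by (rule homotopic_paths_lid_general) (use seg_S[OF x0 p0] in simp_all)
      finally have "homotopic_paths ?S (M p0 x0) (seg x0 (?v p0) +++ seg (?v p0) x0)"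
        unfolding M_def by (rule homotopic_paths_join[OF refl0]) (use pl[OF p0K] in simp_all)
      also have "homotopic_paths ?S \<dots> (\<lambda>_. x0)"
      proof (rule homotopic_paths_subset[OF homotopic_paths_seg_closed[OF seg_closed_simplex]])
        show "closed_simplex (support x0) \<subseteq> ?S"
          using closed_simplex_subset_geom_carrier[OF support_in_complex(1)[OF K x0]] .
        note i = path_image_seg[OF seg_closed_simplex v_supp[OF x0 p0] support_in_complex(2)[OF K x0]]
          path_image_seg[OF seg_closed_simplex support_in_complex(2)[OF K x0] v_supp[OF x0 p0]]
        show "path_image (seg x0 (?v p0) +++ seg (?v p0) x0) \<subseteq> closed_simplex (support x0)"
          using i by (simp add: subset_path_image_join)
        show "path_image (\<lambda>_. x0) \<subseteq> closed_simplex (support x0)"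
          using support_in_complex(2)[OF K x0] by (auto simp: path_image_def)
        show "path (\<lambda>_. x0)" by (simp add: path_def continuous_on_const)
      qed (simp_all add: pathstart_def[of "\<lambda>_. _"] pathfinish_def[of "\<lambda>_. _"])
      finally have M0: "homotopic_paths ?S (M p0 x0) (\<lambda>_. x0)" .
      have g0: "pathstart g = x0" using ends by (simp add: pathstart_def)
      have "homotopic_paths ?S g ((\<lambda>_. pathstart g) +++ g)"
        using homotopic_paths_sym[OF homotopic_paths_lid_general[OF g]] .
      also have "homotopic_paths ?S \<dots> (M p0 x0 +++ g)"
        by (rule homotopic_paths_join) (use homotopic_paths_sym[OF M0] g g0 in \<open>simp_all add: pathfinish_def\<close>)
      also note Mg
      also note M0
      finally show ?thesis .
    qed
    obtain q where "q \<in> support y0" using support_in_complex(4)[OF K y0] by blast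
    from M[OF y0 this] null_loop show ?thesis by blast
  qed
  have path_iff: "pathin (top_of_set ?S) g \<longleftrightarrow> path g \<and> path_image g \<subseteq> ?S" for g
    unfolding pathin_def path_def path_image_def by (auto simp: continuous_map_in_subtopology)
  obtain \<sigma> p where "\<sigma> \<in> K" "p \<in> \<sigma>" using ne abstract_complexD(2)[OF K] by blast
  then have "?v p \<in> ?S"
    using vertex_point_in_simplex[OF abstract_complexD(1)[OF K]] closed_simplex_subset_geom_carrier by blast
  then have "?S \<noteq> {}" by blast
  moreover have "\<exists>g. path g \<and> path_image g \<subseteq> ?S \<and> g 0 = x \<and> g 1 = y" if "x \<in> ?S" "y \<in> ?S" for x y
    using main[OF that] unfolding pathstart_def pathfinish_def by blast
  moreover have "homotopic_with (\<lambda>h. h 0 = g 0 \<and> h 1 = g 0) (top_of_set {0..1}) (top_of_set ?S) g (\<lambda>_. g 0)"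
    if g: "path g" "path_image g \<subseteq> ?S" "g 1 = g 0" for g
  proof -
    have "g 0 \<in> ?S" using g(2) by (auto simp: path_image_def)
    then have "homotopic_paths ?S g (\<lambda>_. g 0)" using main g by blast
    from homotopic_paths_homotopic_with[OF this] show ?thesis using g(3) by simp
  qed
  ultimately show ?thesis
    unfolding simply_connected_space_def top path_connected_space_def path_iff topspace_euclidean_subtopology
    by (intro conjI ballI allI impI) (simp_all add: conj_assoc)
qed

section \<open>Paths in oriented graphs\<close>

fun step_inv :: "'v step \<Rightarrow> 'v step" where
  "step_inv (e, s) = (e, \<not> s)"

fun step_map :: "('v \<Rightarrow> 'u) \<Rightarrow> 'v step \<Rightarrow> 'u step" where
  "step_map f (e, s) = (map_prod f f e, s)"

lemma opath_inv_eq: "opath_inv (v, ss) = (opath_end (v, ss), rev (map step_inv ss))"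
proof -
  have "(\<lambda>(e, s). (e, \<not> s)) = (step_inv :: 'a step \<Rightarrow> _)" by (auto simp: fun_eq_iff)
  then show ?thesis by (simp add: opath_inv_def)
qed

lemma opath_map_eq: "opath_map f (v, ss) = (f v, map (step_map f) ss)"
proof -
  have "(\<lambda>(e, s). (map_prod f f e, s)) = step_map f" by (auto simp: fun_eq_iff)
  then show ?thesis by (simp add: opath_map_def)
qed

lemma step_inv_simps [simp]:
  "step_begin (step_inv s) = step_end s" "step_end (step_inv s) = step_begin s"
  "fst (step_inv s) = fst s" "step_inv (step_inv s) = s"
  by (cases s; cases "fst s"; auto)+

lemma step_map_simps [simp]:
  "step_begin (step_map f s) = f (step_begin s)" "step_end (step_map f s) = f (step_end s)"
  "fst (step_map f s) = map_prod f f (fst s)" "step_map f (step_inv s) = step_inv (step_map f s)"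
  "snd (step_map f s) = snd s"
  by (cases s; cases "fst s"; auto)+

lemma opath_begin_simp [simp]: "opath_begin (v, ss) = v"
  by (simp add: opath_begin_def)

lemma opath_end_Nil [simp]: "opath_end (v, []) = v"
  by (simp add: opath_end_def)

lemma opath_end_Cons [simp]: "opath_end (v, s # ss) = opath_end (step_end s, ss)"
  by (simp add: opath_end_def)

lemma opath_end_append [simp]: "opath_end (v, ss @ ts) = opath_end (opath_end (v, ss), ts)"
  by (induction ss arbitrary: v) auto

lemma opath_comp_simp [simp]: "opath_comp (v, ss) (u, ts) = (v, ss @ ts)"
  by (simp add: opath_comp_def)

lemma consecutive_append [simp]:
  "consecutive v (ss @ ts) \<longleftrightarrow> consecutive v ss \<and> consecutive (opath_end (v, ss)) ts"
  by (induction ss arbitrary: v) auto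

lemma mem_opaths [simp]:
  "(v, ss) \<in> opaths V E \<longleftrightarrow> v \<in> V \<and> fst ` set ss \<subseteq> E \<and> consecutive v ss"
  by (simp add: opaths_def)

lemma step_verts:
  assumes "E \<subseteq> V \<times> V" "fst s \<in> E"
  shows "step_begin s \<in> V" "step_end s \<in> V"
  using assms by (cases s; cases "fst s"; auto)+

lemma opath_end_in:
  assumes "E \<subseteq> V \<times> V"
  shows "(v, ss) \<in> opaths V E \<Longrightarrow> opath_end (v, ss) \<in> V"
  using step_verts[OF assms] by (induction ss arbitrary: v) auto

lemma opath_begin_in: "\<alpha> \<in> opaths V E \<Longrightarrow> opath_begin \<alpha> \<in> V"
  by (cases \<alpha>) auto

lemma opath_end_in': "E \<subseteq> V \<times> V \<Longrightarrow> \<alpha> \<in> opaths V E \<Longrightarrow> opath_end \<alpha> \<in> V"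
  using opath_end_in[of E V "fst \<alpha>" "snd \<alpha>"] by simp

lemma opath_rev_aux:
  "consecutive v ss \<Longrightarrow> consecutive (opath_end (v, ss)) (rev (map step_inv ss)) \<and>
     opath_end (opath_end (v, ss), rev (map step_inv ss)) = v"
  by (induction ss arbitrary: v) auto

lemma opath_inv_in:
  assumes "E \<subseteq> V \<times> V" "\<alpha> \<in> opaths V E"
  shows "opath_inv \<alpha> \<in> opaths V E"
proof -
  obtain v ss where \<alpha>: "\<alpha> = (v, ss)" by (cases \<alpha>)
  have "fst ` set (rev (map step_inv ss)) = fst ` set ss" by (force simp: image_iff)
  then show ?thesis
    using assms(2) opath_end_in[OF assms(1)] opath_rev_aux[of v ss] by (simp add: \<alpha> opath_inv_eq)
qed

lemma opath_begin_inv [simp]: "opath_begin (opath_inv \<alpha>) = opath_end \<alpha>"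
  by (cases \<alpha>) (simp add: opath_inv_eq)

lemma opath_end_inv [simp]: "\<alpha> \<in> opaths V E \<Longrightarrow> opath_end (opath_inv \<alpha>) = opath_begin \<alpha>"
  by (cases \<alpha>) (simp add: opath_inv_eq opath_rev_aux)

lemma opath_inv_inv:
  assumes "\<alpha> \<in> opaths V E" shows "opath_inv (opath_inv \<alpha>) = \<alpha>"
proof -
  obtain v ss where \<alpha>: "\<alpha> = (v, ss)" by (cases \<alpha>)
  have "map (step_inv \<circ> step_inv) ss = ss" by (rule map_idI) simp
  then show ?thesis using assms opath_rev_aux[of v ss] by (simp add: \<alpha> opath_inv_eq rev_map)
qed

lemma opath_comp_in:
  "\<alpha> \<in> opaths V E \<Longrightarrow> \<beta> \<in> opaths V E \<Longrightarrow> opath_end \<alpha> = opath_begin \<beta> \<Longrightarrow> opath_comp \<alpha> \<beta> \<in> opaths V E"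
  by (cases \<alpha>; cases \<beta>) auto

lemma opath_begin_comp [simp]: "opath_begin (opath_comp \<alpha> \<beta>) = opath_begin \<alpha>"
  by (cases \<alpha>; cases \<beta>) auto

lemma opath_end_comp: "opath_end \<alpha> = opath_begin \<beta> \<Longrightarrow> opath_end (opath_comp \<alpha> \<beta>) = opath_end \<beta>"
  by (cases \<alpha>; cases \<beta>) auto

lemma opath_comp_assoc: "opath_comp (opath_comp \<alpha> \<beta>) \<gamma> = opath_comp \<alpha> (opath_comp \<beta> \<gamma>)"
  by (simp add: opath_comp_def)

lemma opath_const_simps [simp]:
  "opath_begin (opath_const v) = v" "opath_end (opath_const v) = v"
  "opath_comp \<alpha> (opath_const v) = \<alpha>"
  by (simp_all add: opath_const_def opath_comp_def)

lemma opath_const_comp [simp]: "opath_comp (opath_const (opath_begin \<alpha>)) \<alpha> = \<alpha>"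
  by (simp add: opath_const_def opath_comp_def opath_begin_def)

lemma opath_const_in [simp]: "opath_const v \<in> opaths V E \<longleftrightarrow> v \<in> V"
  by (simp add: opath_const_def)

lemma opath_map_ends [simp]:
  "opath_begin (opath_map f \<alpha>) = f (opath_begin \<alpha>)" "opath_end (opath_map f \<alpha>) = f (opath_end \<alpha>)"
proof -
  have "opath_end (opath_map f (v, ss)) = f (opath_end (v, ss))" for v ss
    by (induction ss arbitrary: v) (auto simp: opath_map_eq)
  then show "opath_end (opath_map f \<alpha>) = f (opath_end \<alpha>)" by (cases \<alpha>) simp
  show "opath_begin (opath_map f \<alpha>) = f (opath_begin \<alpha>)" by (cases \<alpha>) (simp add: opath_map_eq)
qed

lemma opath_map_comp: "opath_map f (opath_comp \<alpha> \<beta>) = opath_comp (opath_map f \<alpha>) (opath_map f \<beta>)"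
  by (cases \<alpha>; cases \<beta>) (simp add: opath_map_eq)

lemma opath_map_inv: "opath_map f (opath_inv \<alpha>) = opath_inv (opath_map f \<alpha>)"
proof (cases \<alpha>)
  case (Pair v ss)
  have "opath_end (f v, map (step_map f) ss) = f (opath_end (v, ss))"
    using opath_map_ends(2)[of f "(v, ss)"] by (simp add: opath_map_eq)
  then show ?thesis by (simp add: Pair opath_inv_eq opath_map_eq rev_map o_def)
qed

lemma opath_map_in:
  assumes "graph_morphism G H f" "\<alpha> \<in> paths_of G"
  shows "opath_map f \<alpha> \<in> paths_of H"
proof -
  obtain v ss where \<alpha>: "\<alpha> = (v, ss)" by (cases \<alpha>)
  have "consecutive v ss \<Longrightarrow> consecutive (f v) (map (step_map f) ss)" for v
    by (induction ss arbitrary: v) auto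
  moreover have "fst ` set (map (step_map f) ss) \<subseteq> edges H"
  proof -
    have "fst ` set (map (step_map f) ss) = map_prod f f ` fst ` set ss" by (force simp: image_iff)
    also have "\<dots> \<subseteq> map_prod f f ` edges G" using assms(2) by (intro image_mono) (simp add: \<alpha>)
    also have "\<dots> \<subseteq> edges H" using assms(1) by (simp add: graph_morphism_def)
    finally show ?thesis .
  qed
  ultimately show ?thesis
    using assms unfolding \<alpha> opath_map_eq graph_morphism_def mem_opaths by blast
qed

section \<open>Path relations\<close>

lemma path_relationD:
  assumes "path_relation V E R"
  shows "(\<alpha>, \<beta>) \<in> R \<Longrightarrow> \<alpha> \<in> opaths V E \<and> \<beta> \<in> opaths V E"
    and "\<alpha> \<in> opaths V E \<Longrightarrow> (\<alpha>, \<alpha>) \<in> R"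
    and "(\<alpha>, \<beta>) \<in> R \<Longrightarrow> (\<beta>, \<alpha>) \<in> R"
    and "(\<alpha>, \<beta>) \<in> R \<Longrightarrow> (\<beta>, \<gamma>) \<in> R \<Longrightarrow> (\<alpha>, \<gamma>) \<in> R"
    and "(\<alpha>, \<beta>) \<in> R \<Longrightarrow> opath_begin \<alpha> = opath_begin \<beta> \<and> opath_end \<alpha> = opath_end \<beta>"
    and "\<alpha> \<in> opaths V E \<Longrightarrow> (opath_comp \<alpha> (opath_inv \<alpha>), opath_const (opath_begin \<alpha>)) \<in> R"
    and "(\<alpha>, \<beta>) \<in> R \<Longrightarrow> (opath_inv \<alpha>, opath_inv \<beta>) \<in> R"
    and "(\<alpha>, \<beta>) \<in> R \<Longrightarrow> \<gamma>\<^sub>1 \<in> opaths V E \<Longrightarrow> \<gamma>\<^sub>2 \<in> opaths V E \<Longrightarrow> opath_end \<gamma>\<^sub>1 = opath_begin \<alpha> \<Longrightarrow>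
      opath_end \<alpha> = opath_begin \<gamma>\<^sub>2 \<Longrightarrow>
      (opath_comp \<gamma>\<^sub>1 (opath_comp \<alpha> \<gamma>\<^sub>2), opath_comp \<gamma>\<^sub>1 (opath_comp \<beta> \<gamma>\<^sub>2)) \<in> R"
proof -
  have e: "equiv (opaths V E) R" using assms by (simp add: path_relation_def)
  show "(\<alpha>, \<beta>) \<in> R \<Longrightarrow> \<alpha> \<in> opaths V E \<and> \<beta> \<in> opaths V E" using equiv_type[OF e] by blast
  show "\<alpha> \<in> opaths V E \<Longrightarrow> (\<alpha>, \<alpha>) \<in> R" using e by (simp add: equiv_def refl_on_def)
  show "(\<alpha>, \<beta>) \<in> R \<Longrightarrow> (\<beta>, \<alpha>) \<in> R" using e unfolding equiv_def sym_def by blast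
  show "(\<alpha>, \<beta>) \<in> R \<Longrightarrow> (\<beta>, \<gamma>) \<in> R \<Longrightarrow> (\<alpha>, \<gamma>) \<in> R" using e unfolding equiv_def trans_def by blast
qed (use assms in \<open>auto simp: path_relation_def\<close>)

lemma path_relation_comp:
  assumes R: "path_relation V E R" and E: "E \<subseteq> V \<times> V" and "(\<alpha>, \<beta>) \<in> R" "\<gamma> \<in> opaths V E"
  shows "opath_end \<alpha> = opath_begin \<gamma> \<Longrightarrow> (opath_comp \<alpha> \<gamma>, opath_comp \<beta> \<gamma>) \<in> R"
    and "opath_end \<gamma> = opath_begin \<alpha> \<Longrightarrow> (opath_comp \<gamma> \<alpha>, opath_comp \<gamma> \<beta>) \<in> R"
proof -
  note D = path_relationD[OF R]
  have in': "\<alpha> \<in> opaths V E" "\<beta> \<in> opaths V E" using D(1)[OF assms(3)] by auto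
  have eq: "opath_begin \<beta> = opath_begin \<alpha>" "opath_end \<beta> = opath_end \<alpha>" using D(5)[OF assms(3)] by auto
  have c: "opath_const (opath_begin \<alpha>) \<in> opaths V E" "opath_const (opath_end \<alpha>) \<in> opaths V E"
    using opath_begin_in[OF in'(1)] opath_end_in'[OF E in'(1)] by auto
  show "opath_end \<alpha> = opath_begin \<gamma> \<Longrightarrow> (opath_comp \<alpha> \<gamma>, opath_comp \<beta> \<gamma>) \<in> R"
  proof -
    assume "opath_end \<alpha> = opath_begin \<gamma>"
    from D(8)[OF assms(3) c(1) assms(4) _ this]
    show ?thesis
      using opath_const_comp[of "opath_comp \<alpha> \<gamma>"] opath_const_comp[of "opath_comp \<beta> \<gamma>"] eq by simp
  qed
  show "opath_end \<gamma> = opath_begin \<alpha> \<Longrightarrow> (opath_comp \<gamma> \<alpha>, opath_comp \<gamma> \<beta>) \<in> R"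
    using D(8)[OF assms(3) assms(4) c(2)] by simp
qed

lemma path_relation_linv:
  assumes R: "path_relation V E R" and E: "E \<subseteq> V \<times> V" and "\<alpha> \<in> opaths V E"
  shows "(opath_comp (opath_inv \<alpha>) \<alpha>, opath_const (opath_end \<alpha>)) \<in> R"
  using path_relationD(6)[OF R opath_inv_in[OF E assms(3)]] opath_inv_inv[OF assms(3)] by simp

lemma path_relationI:
  assumes "R \<subseteq> opaths V E \<times> opaths V E"
    and "\<And>\<alpha>. \<alpha> \<in> opaths V E \<Longrightarrow> (\<alpha>, \<alpha>) \<in> R"
    and "\<And>\<alpha> \<beta>. (\<alpha>, \<beta>) \<in> R \<Longrightarrow> (\<beta>, \<alpha>) \<in> R"
    and "\<And>\<alpha> \<beta> \<gamma>. (\<alpha>, \<beta>) \<in> R \<Longrightarrow> (\<beta>, \<gamma>) \<in> R \<Longrightarrow> (\<alpha>, \<gamma>) \<in> R"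
    and "\<And>\<alpha> \<beta>. (\<alpha>, \<beta>) \<in> R \<Longrightarrow> opath_begin \<alpha> = opath_begin \<beta> \<and> opath_end \<alpha> = opath_end \<beta>"
    and "\<And>\<alpha>. \<alpha> \<in> opaths V E \<Longrightarrow> (opath_comp \<alpha> (opath_inv \<alpha>), opath_const (opath_begin \<alpha>)) \<in> R"
    and "\<And>\<alpha> \<beta>. (\<alpha>, \<beta>) \<in> R \<Longrightarrow> (opath_inv \<alpha>, opath_inv \<beta>) \<in> R"
    and "\<And>\<alpha> \<beta> \<gamma>\<^sub>1 \<gamma>\<^sub>2. (\<alpha>, \<beta>) \<in> R \<Longrightarrow> \<gamma>\<^sub>1 \<in> opaths V E \<Longrightarrow> \<gamma>\<^sub>2 \<in> opaths V E \<Longrightarrow>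
      opath_end \<gamma>\<^sub>1 = opath_begin \<alpha> \<Longrightarrow> opath_end \<alpha> = opath_begin \<gamma>\<^sub>2 \<Longrightarrow>
      (opath_comp \<gamma>\<^sub>1 (opath_comp \<alpha> \<gamma>\<^sub>2), opath_comp \<gamma>\<^sub>1 (opath_comp \<beta> \<gamma>\<^sub>2)) \<in> R"
  shows "path_relation V E R"
  unfolding path_relation_def
proof (intro conjI)
  show "equiv (opaths V E) R"
    by (intro equivI refl_onI symI transI) (use assms(1-4) in blast)+
  show "\<forall>(\<alpha>, \<beta>)\<in>R. opath_begin \<alpha> = opath_begin \<beta> \<and> opath_end \<alpha> = opath_end \<beta>"
    using assms(5) by blast
  show "\<forall>\<alpha>\<in>opaths V E. (opath_comp \<alpha> (opath_inv \<alpha>), opath_const (opath_begin \<alpha>)) \<in> R"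
    using assms(6) by blast
  show "\<forall>(\<alpha>, \<beta>)\<in>R. (opath_inv \<alpha>, opath_inv \<beta>) \<in> R" using assms(7) by blast
qed (use assms(8) in \<open>auto simp only: case_prod_beta prod.collapse intro!: ballI\<close>)

lemma path_relation_same_ends:
  assumes E: "E \<subseteq> V \<times> V"
  shows "path_relation V E {(\<alpha>, \<beta>). \<alpha> \<in> opaths V E \<and> \<beta> \<in> opaths V E \<and>
    opath_begin \<alpha> = opath_begin \<beta> \<and> opath_end \<alpha> = opath_end \<beta>}"
  by (rule path_relationI)
     (auto simp: opath_inv_in[OF E] opath_comp_in opath_end_comp opath_begin_in)

lemma path_relation_Inter:
  assumes "\<R> \<noteq> {}" "\<And>R. R \<in> \<R> \<Longrightarrow> path_relation V E R"
  shows "path_relation V E (\<Inter>\<R>)"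
proof -
  obtain R0 where R0: "R0 \<in> \<R>" using assms(1) by blast
  note D = path_relationD[OF assms(2)]
  show ?thesis
  proof (rule path_relationI)
    show "\<Inter>\<R> \<subseteq> opaths V E \<times> opaths V E"
    proof (rule subset_trans[OF Inter_lower[OF R0] subrelI])
      fix \<alpha> \<beta> assume "(\<alpha>, \<beta>) \<in> R0"
      then show "(\<alpha>, \<beta>) \<in> opaths V E \<times> opaths V E" using D(1)[OF R0] by simp
    qed
    fix \<alpha> \<beta> assume ab: "(\<alpha>, \<beta>) \<in> \<Inter>\<R>"
    then show "opath_begin \<alpha> = opath_begin \<beta> \<and> opath_end \<alpha> = opath_end \<beta>" using D(5)[OF R0] R0 by blast
    show "(\<beta>, \<alpha>) \<in> \<Inter>\<R>" using ab D(3) by blast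
    show "(opath_inv \<alpha>, opath_inv \<beta>) \<in> \<Inter>\<R>" using ab D(7) by blast
    show "(\<alpha>, \<gamma>) \<in> \<Inter>\<R>" if "(\<beta>, \<gamma>) \<in> \<Inter>\<R>" for \<gamma> using ab that D(4) by blast
    show "(opath_comp \<gamma>\<^sub>1 (opath_comp \<alpha> \<gamma>\<^sub>2), opath_comp \<gamma>\<^sub>1 (opath_comp \<beta> \<gamma>\<^sub>2)) \<in> \<Inter>\<R>"
      if "\<gamma>\<^sub>1 \<in> opaths V E" "\<gamma>\<^sub>2 \<in> opaths V E" "opath_end \<gamma>\<^sub>1 = opath_begin \<alpha>" "opath_end \<alpha> = opath_begin \<gamma>\<^sub>2" for \<gamma>\<^sub>1 \<gamma>\<^sub>2
      using ab that D(8) by blast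
  qed (use D(2,6) in blast)+
qed

text \<open>Because the generators preserve ends, the relation of having equal ends is one of the
  relations intersected. An empty family would have everything as its intersection.\<close>

lemma path_relation_generated:
  assumes "E \<subseteq> V \<times> V"
    and "\<And>\<alpha> \<beta>. (\<alpha>, \<beta>) \<in> R0 \<Longrightarrow> \<alpha> \<in> opaths V E \<and> \<beta> \<in> opaths V E \<and> opath_begin \<alpha> = opath_begin \<beta> \<and> opath_end \<alpha> = opath_end \<beta>"
  shows "path_relation V E (generated_relation V E R0)"
proof -
  have "{(\<alpha>, \<beta>). \<alpha> \<in> opaths V E \<and> \<beta> \<in> opaths V E \<and> opath_begin \<alpha> = opath_begin \<beta> \<and> opath_end \<alpha> = opath_end \<beta>}
     \<in> {R. path_relation V E R \<and> R0 \<subseteq> R}"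
    using path_relation_same_ends[OF assms(1)] assms(2) by auto
  then show ?thesis unfolding generated_relation_def by (intro path_relation_Inter) blast+
qed

lemma generated_relation_subset: "path_relation V E R \<Longrightarrow> R0 \<subseteq> R \<Longrightarrow> generated_relation V E R0 \<subseteq> R"
  by (auto simp: generated_relation_def)

lemma generated_relation_superset: "R0 \<subseteq> generated_relation V E R0"
  by (auto simp: generated_relation_def)

section \<open>Lifts along covers\<close>

lemma is_lift_lift:
  assumes "os_cover \<Theta> G \<rho>" "v \<in> verts \<Theta>" "\<alpha> \<in> paths_of G" "opath_begin \<alpha> = \<rho> v"
  shows "is_lift \<Theta> \<rho> v \<alpha> (lift \<Theta> \<rho> v \<alpha>)"
proof -
  have "\<exists>!\<alpha>'. is_lift \<Theta> \<rho> v \<alpha> \<alpha>'" using assms unfolding os_cover_def by blast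
  then show ?thesis unfolding lift_def by (rule theI')
qed

lemma lift_unique:
  assumes "os_cover \<Theta> G \<rho>" "v \<in> verts \<Theta>" "\<alpha> \<in> paths_of G" "opath_begin \<alpha> = \<rho> v" "is_lift \<Theta> \<rho> v \<alpha> \<beta>"
  shows "lift \<Theta> \<rho> v \<alpha> = \<beta>"
proof -
  have "\<exists>!\<alpha>'. is_lift \<Theta> \<rho> v \<alpha> \<alpha>'" using assms unfolding os_cover_def by blast
  then show ?thesis using is_lift_lift[OF assms(1-4)] assms(5) by blast
qed

lemma lift_props:
  assumes "os_cover \<Theta> G \<rho>" "v \<in> verts \<Theta>" "\<alpha> \<in> paths_of G" "opath_begin \<alpha> = \<rho> v"
  shows "lift \<Theta> \<rho> v \<alpha> \<in> paths_of \<Theta>" "opath_begin (lift \<Theta> \<rho> v \<alpha>) = v" "opath_map \<rho> (lift \<Theta> \<rho> v \<alpha>) = \<alpha>"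
    "opath_end (lift \<Theta> \<rho> v \<alpha>) \<in> verts \<Theta>" "\<rho> (opath_end (lift \<Theta> \<rho> v \<alpha>)) = opath_end \<alpha>"
proof -
  note l = is_lift_lift[OF assms]
  show 1: "lift \<Theta> \<rho> v \<alpha> \<in> paths_of \<Theta>" "opath_begin (lift \<Theta> \<rho> v \<alpha>) = v" "opath_map \<rho> (lift \<Theta> \<rho> v \<alpha>) = \<alpha>"
    using l by (auto simp: is_lift_def)
  have E: "edges \<Theta> \<subseteq> verts \<Theta> \<times> verts \<Theta>" using assms(1) by (simp add: os_cover_def oriented_system_def)
  show "opath_end (lift \<Theta> \<rho> v \<alpha>) \<in> verts \<Theta>" by (rule opath_end_in'[OF E 1(1)])
  show "\<rho> (opath_end (lift \<Theta> \<rho> v \<alpha>)) = opath_end \<alpha>" using opath_map_ends(2)[of \<rho> "lift \<Theta> \<rho> v \<alpha>"] 1(3) by simp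
qed

lemma lift_of_map:
  assumes c: "os_cover \<Theta> G \<rho>" and "\<beta> \<in> paths_of \<Theta>"
  shows "lift \<Theta> \<rho> (opath_begin \<beta>) (opath_map \<rho> \<beta>) = \<beta>"
proof (rule lift_unique[OF c])
  show "opath_map \<rho> \<beta> \<in> paths_of G" using opath_map_in[OF _ assms(2)] c by (auto simp: os_cover_def)
qed (use assms(2) opath_begin_in[OF assms(2)] in \<open>simp_all add: is_lift_def\<close>)

lemma lift_comp:
  assumes c: "os_cover \<Theta> G \<rho>" "v \<in> verts \<Theta>" "\<alpha> \<in> paths_of G" "\<beta> \<in> paths_of G" "opath_begin \<alpha> = \<rho> v"
    "opath_end \<alpha> = opath_begin \<beta>"
  shows "lift \<Theta> \<rho> v (opath_comp \<alpha> \<beta>) = opath_comp (lift \<Theta> \<rho> v \<alpha>) (lift \<Theta> \<rho> (opath_end (lift \<Theta> \<rho> v \<alpha>)) \<beta>)"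
proof (rule lift_unique[OF c(1,2)])
  note a = lift_props[OF c(1,2,3,5)]
  have "opath_begin \<beta> = \<rho> (opath_end (lift \<Theta> \<rho> v \<alpha>))" using a(5) c(6) by simp
  note b = lift_props[OF c(1) a(4) c(4) this]
  show "is_lift \<Theta> \<rho> v (opath_comp \<alpha> \<beta>) (opath_comp (lift \<Theta> \<rho> v \<alpha>) (lift \<Theta> \<rho> (opath_end (lift \<Theta> \<rho> v \<alpha>)) \<beta>))"
    using a b by (simp add: is_lift_def opath_map_comp opath_comp_in)
qed (use c in \<open>simp_all add: opath_comp_in\<close>)

lemma lift_inv:
  assumes c: "os_cover \<Theta> G \<rho>" "v \<in> verts \<Theta>" "\<alpha> \<in> paths_of G" "opath_begin \<alpha> = \<rho> v"
  shows "lift \<Theta> \<rho> (opath_end (lift \<Theta> \<rho> v \<alpha>)) (opath_inv \<alpha>) = opath_inv (lift \<Theta> \<rho> v \<alpha>)"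
proof -
  note a = lift_props[OF c]
  have E: "edges \<Theta> \<subseteq> verts \<Theta> \<times> verts \<Theta>" using c(1) by (simp add: os_cover_def oriented_system_def)
  show ?thesis
    using lift_of_map[OF c(1) opath_inv_in[OF E a(1)]] a by (simp add: opath_map_inv)
qed

text \<open>The end of a lift depends only on the class of the path below. This makes the end of a
  lifted minimal gallery independent of the gallery.\<close>

lemma lift_related_end:
  assumes c: "os_cover \<Theta> G \<rho>" "v \<in> verts \<Theta>" "(\<alpha>, \<beta>) \<in> prel G" "opath_begin \<alpha> = \<rho> v"
  shows "opath_end (lift \<Theta> \<rho> v \<alpha>) = opath_end (lift \<Theta> \<rho> v \<beta>)"
proof -
  have G: "path_relation (verts G) (edges G) (prel G)" and T: "path_relation (verts \<Theta>) (edges \<Theta>) (prel \<Theta>)"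
    using c(1) by (auto simp: os_cover_def oriented_system_def)
  have "opath_begin \<beta> = \<rho> v" using path_relationD(5)[OF G c(3)] c(4) by simp
  then have "(lift \<Theta> \<rho> v \<alpha>, lift \<Theta> \<rho> v \<beta>) \<in> prel \<Theta>" using c unfolding os_cover_def by blast
  then show ?thesis using path_relationD(5)[OF T] by blast
qed

section \<open>The cover by path classes\<close>

text \<open>Unique lifting of single steps propagates along a path, since the end of each lifted
  step is the beginning of the next.\<close>

lemma lift_unique_if_steps_unique:
  assumes step: "\<And>v s s'. fst s \<in> E' \<Longrightarrow> fst s' \<in> E' \<Longrightarrow> step_begin s = step_begin s' \<Longrightarrow>
      step_map \<rho> s = step_map \<rho> s' \<Longrightarrow> s = s'"
    and "\<alpha> \<in> opaths V' E'" "\<beta> \<in> opaths V' E'" "opath_begin \<alpha> = opath_begin \<beta>" "opath_map \<rho> \<alpha> = opath_map \<rho> \<beta>"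
  shows "\<alpha> = \<beta>"
proof -
  have "consecutive v ss \<Longrightarrow> consecutive v ts \<Longrightarrow> fst ` set ss \<subseteq> E' \<Longrightarrow> fst ` set ts \<subseteq> E' \<Longrightarrow>
     map (step_map \<rho>) ss = map (step_map \<rho>) ts \<Longrightarrow> ss = ts" for v ss ts
  proof (induction ss arbitrary: v ts)
    case (Cons s ss)
    then obtain t ts' where ts: "ts = t # ts'" by (cases ts) auto
    have "s = t" by (rule step) (use Cons.prems ts in auto)
    then show ?case using Cons ts by auto
  qed simp
  then show ?thesis using assms(2-) by (cases \<alpha>; cases \<beta>) (simp add: opath_map_eq)
qed

text \<open>The analogue of the topological universal cover built from classes of paths starting at
  c. Countability of the paths allows the classes to be numbered, which gives a cover of type
  \<open>nat osys\<close>, the kind of cover that the universal property speaks about.\<close>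

locale path_class_cover =
  fixes G :: "'u osys" and c :: 'u
  assumes osys: "oriented_system G" and conn: "os_connected G" and c: "c \<in> verts G"
    and cnt: "countable (paths_of G)"
begin

abbreviation "E \<equiv> edges G"
abbreviation "V \<equiv> verts G"

lemma EV: "E \<subseteq> V \<times> V" and R: "path_relation V E (prel G)"
  using osys by (simp_all add: oriented_system_def)

definition based :: "'u opath set" where
  "based = {\<alpha> \<in> paths_of G. opath_begin \<alpha> = c}"

definition class_of :: "'u opath \<Rightarrow> nat" where
  "class_of \<alpha> = to_nat_on (based // prel G) (prel G `` {\<alpha>})"

lemma class_of_eq_iff:
  assumes "\<alpha> \<in> based" "\<beta> \<in> based"
  shows "class_of \<alpha> = class_of \<beta> \<longleftrightarrow> (\<alpha>, \<beta>) \<in> prel G"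
proof -
  have "countable based" using cnt by (rule countable_subset[rotated]) (auto simp: based_def)
  then have "countable (based // prel G)"
    unfolding quotient_def by simp
  moreover have "prel G `` {\<alpha>} \<in> based // prel G" "prel G `` {\<beta>} \<in> based // prel G"
    using assms by (auto simp: quotient_def)
  ultimately have "class_of \<alpha> = class_of \<beta> \<longleftrightarrow> prel G `` {\<alpha>} = prel G `` {\<beta>}"
    unfolding class_of_def by (rule to_nat_on_inj)
  also have "\<dots> \<longleftrightarrow> (\<alpha>, \<beta>) \<in> prel G"
    by (rule eq_equiv_class_iff[of "paths_of G"]) (use R assms in \<open>auto simp: path_relation_def based_def\<close>)
  finally show ?thesis .
qed

definition proj :: "nat \<Rightarrow> 'u" where
  "proj n = opath_end (SOME \<alpha>. \<alpha> \<in> based \<and> class_of \<alpha> = n)"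

lemma proj_class_of [simp]:
  assumes "\<alpha> \<in> based"
  shows "proj (class_of \<alpha>) = opath_end \<alpha>"
proof -
  have "\<exists>\<beta>. \<beta> \<in> based \<and> class_of \<beta> = class_of \<alpha>" using assms by blast
  from someI_ex[OF this] have "((SOME \<beta>. \<beta> \<in> based \<and> class_of \<beta> = class_of \<alpha>), \<alpha>) \<in> prel G"
    using class_of_eq_iff assms by blast
  from path_relationD(5)[OF R this] show ?thesis unfolding proj_def by simp
qed

definition ext :: "'u opath \<Rightarrow> 'u step \<Rightarrow> 'u opath" where
  "ext \<alpha> s = (fst \<alpha>, snd \<alpha> @ [s])"

lemma ext_based:
  assumes "\<alpha> \<in> based" "fst s \<in> E" "step_begin s = opath_end \<alpha>"
  shows "ext \<alpha> s \<in> based" "opath_end (ext \<alpha> s) = step_end s"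
  using assms by (cases \<alpha>; auto simp: based_def ext_def)+

lemma ext_cong:
  assumes "\<alpha> \<in> based" "\<beta> \<in> based" "class_of \<alpha> = class_of \<beta>" "fst s \<in> E" "step_begin s = opath_end \<alpha>"
  shows "class_of (ext \<alpha> s) = class_of (ext \<beta> s)"
proof -
  have ab: "(\<alpha>, \<beta>) \<in> prel G" using assms class_of_eq_iff by blast
  have e: "opath_end \<beta> = opath_end \<alpha>" using path_relationD(5)[OF R ab] by simp
  have s: "(step_begin s, [s]) \<in> paths_of G" using assms(4) step_verts[OF EV assms(4)] by simp
  have "(opath_comp \<alpha> (step_begin s, [s]), opath_comp \<beta> (step_begin s, [s])) \<in> prel G"
    by (rule path_relation_comp(1)[OF R EV ab s]) (use assms(5) in simp)
  then have "(ext \<alpha> s, ext \<beta> s) \<in> prel G" by (simp add: ext_def opath_comp_def)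
  then show ?thesis using class_of_eq_iff ext_based assms e by metis
qed

lemma ext_ext_inv:
  assumes "\<alpha> \<in> based" "fst s \<in> E" "step_begin s = opath_end \<alpha>"
  shows "class_of (ext (ext \<alpha> s) (step_inv s)) = class_of \<alpha>"
proof -
  have s: "(step_begin s, [s]) \<in> paths_of G" using assms(2) step_verts[OF EV assms(2)] by simp
  have \<alpha>: "\<alpha> \<in> paths_of G" using assms(1) by (simp add: based_def)
  have "(opath_comp (step_begin s, [s]) (opath_inv (step_begin s, [s])), opath_const (step_begin s)) \<in> prel G"
    using path_relationD(6)[OF R s] by simp
  from path_relation_comp(2)[OF R EV this \<alpha>]
  have "(ext (ext \<alpha> s) (step_inv s), \<alpha>) \<in> prel G"
    using assms(3) by (simp add: ext_def opath_inv_eq opath_comp_def opath_const_def)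
  then show ?thesis using class_of_eq_iff ext_based assms by simp
qed

definition cover_verts :: "nat set" where
  "cover_verts = class_of ` based"

definition cover_edges :: "(nat \<times> nat) set" where
  "cover_edges = {(class_of \<alpha>, class_of (ext \<alpha> (e, True))) | \<alpha> e. \<alpha> \<in> based \<and> e \<in> E \<and> fst e = opath_end \<alpha>}"

definition cover_gens :: "nat opath rel" where
  "cover_gens = {(\<alpha>, \<beta>) \<in> opaths cover_verts cover_edges \<times> opaths cover_verts cover_edges.
     opath_begin \<alpha> = opath_begin \<beta> \<and> (opath_map proj \<alpha>, opath_map proj \<beta>) \<in> prel G}"

definition cover :: "nat osys" where
  "cover = \<lparr> verts = cover_verts, edges = cover_edges,
     prel = generated_relation cover_verts cover_edges cover_gens \<rparr>"

lemma step_begin_True: "step_begin (e, True) = fst e" "step_end (e, True) = snd e"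
  "step_begin (e, False) = snd e" "step_end (e, False) = fst e"
  by (cases e; simp)+

lemma cover_edges_verts: "cover_edges \<subseteq> cover_verts \<times> cover_verts"
  using ext_based(1) by (auto simp: cover_edges_def cover_verts_def step_begin_True)

lemma cover_morphism: "graph_morphism cover G proj"
  unfolding graph_morphism_def
proof
  show "proj ` verts cover \<subseteq> V"
    using opath_end_in'[OF EV] by (auto simp: cover_def cover_verts_def based_def)
  show "map_prod proj proj ` edges cover \<subseteq> E"
    using ext_based by (auto simp: cover_def cover_edges_def step_begin_True)
qed

text \<open>A backward step is an extension too: it starts at the class of \<alpha> extended by e
  and continues with e reversed, which leads back to the class of \<alpha>. Both exponents can then
  be treated alike.\<close>

lemma cover_step:
  assumes "s \<in> {s'. fst s' \<in> cover_edges}"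
  obtains \<alpha> t where "\<alpha> \<in> based" "fst t \<in> E" "step_begin t = opath_end \<alpha>"
    "step_begin s = class_of \<alpha>" "step_end s = class_of (ext \<alpha> t)" "step_map proj s = t"
proof -
  obtain \<alpha> e where \<alpha>: "\<alpha> \<in> based" "e \<in> E" "fst e = opath_end \<alpha>"
    "fst s = (class_of \<alpha>, class_of (ext \<alpha> (e, True)))"
    using assms unfolding cover_edges_def by blast
  have x: "ext \<alpha> (e, True) \<in> based" "opath_end (ext \<alpha> (e, True)) = snd e"
    using ext_based[OF \<alpha>(1), of "(e, True)"] \<alpha> by (auto simp: step_begin_True)
  show ?thesis
  proof (cases "snd s")
    case True
    then have s: "s = ((class_of \<alpha>, class_of (ext \<alpha> (e, True))), True)" using \<alpha>(4) by (metis prod.collapse)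
    show ?thesis
      by (rule that[of \<alpha> "(e, True)"]) (use \<alpha>(1-3) x in \<open>simp_all add: s step_begin_True prod_eq_iff\<close>)
  next
    case False
    then have s: "s = ((class_of \<alpha>, class_of (ext \<alpha> (e, True))), False)" using \<alpha>(4) by (metis prod.collapse)
    have "class_of (ext (ext \<alpha> (e, True)) (e, False)) = class_of \<alpha>"
      using ext_ext_inv[OF \<alpha>(1), of "(e, True)"] \<alpha> by (simp add: step_begin_True)
    then show ?thesis
      by (intro that[of "ext \<alpha> (e, True)" "(e, False)"])
         (use \<alpha>(1-3) x in \<open>simp_all add: s step_begin_True prod_eq_iff\<close>)
  qed
qed

lemma cover_step_ex:
  assumes "\<alpha> \<in> based" "fst t \<in> E" "step_begin t = opath_end \<alpha>"
  shows "\<exists>s. fst s \<in> cover_edges \<and> step_begin s = class_of \<alpha> \<and> step_end s = class_of (ext \<alpha> t) \<and> step_map proj s = t"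
proof -
  note x = ext_based[OF assms]
  obtain e b where t: "t = (e, b)" by (cases t)
  show ?thesis
  proof (cases b)
    case True
    have "(class_of \<alpha>, class_of (ext \<alpha> t)) \<in> cover_edges"
      unfolding cover_edges_def
      by (rule CollectI, rule exI[of _ \<alpha>], rule exI[of _ e]) (use assms t True in \<open>simp add: step_begin_True\<close>)
    then show ?thesis
      by (intro exI[of _ "((class_of \<alpha>, class_of (ext \<alpha> t)), True)"])
         (use assms x in \<open>simp_all add: t True step_begin_True prod_eq_iff\<close>)
  next
    case False
    have "class_of (ext (ext \<alpha> t) (e, True)) = class_of \<alpha>"
      using ext_ext_inv[OF assms] t False by simp
    moreover have "(class_of (ext \<alpha> t), class_of (ext (ext \<alpha> t) (e, True))) \<in> cover_edges"
      unfolding cover_edges_def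
      by (rule CollectI, rule exI[of _ "ext \<alpha> t"], rule exI[of _ e])
         (use assms t False x in \<open>simp add: step_begin_True\<close>)
    ultimately show ?thesis
      by (intro exI[of _ "((class_of (ext \<alpha> t), class_of \<alpha>), False)"])
         (use assms x in \<open>simp_all add: t False step_begin_True prod_eq_iff\<close>)
  qed
qed

lemma cover_step_unique:
  assumes "fst s \<in> cover_edges" "fst s' \<in> cover_edges" "step_begin s = step_begin s'"
    "step_map proj s = step_map proj s'"
  shows "s = s'"
proof -
  obtain \<alpha> t where a: "\<alpha> \<in> based" "fst t \<in> E" "step_begin t = opath_end \<alpha>"
    "step_begin s = class_of \<alpha>" "step_end s = class_of (ext \<alpha> t)" "step_map proj s = t"
    using cover_step[of s] assms(1) by blast
  obtain \<alpha>' t' where a': "\<alpha>' \<in> based" "fst t' \<in> E" "step_begin t' = opath_end \<alpha>'"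
    "step_begin s' = class_of \<alpha>'" "step_end s' = class_of (ext \<alpha>' t')" "step_map proj s' = t'"
    using cover_step[of s'] assms(2) by blast
  have t: "t' = t" using a a' assms by simp
  then have "step_end s = step_end s'"
    using ext_cong[OF a(1) a'(1) _ a(2,3)] a a' assms(3) by simp
  moreover have "snd s = snd s'" using a(6) a'(6) t step_map_simps(5) by metis
  ultimately show ?thesis using assms(3) by (cases s; cases s'; cases "fst s"; cases "fst s'") (auto split: if_splits)
qed

text \<open>The lift starting at the class of \<alpha> runs through the classes of the successive
  prolongations of \<alpha>, so its end records the class of the whole concatenation.\<close>

lemma cover_lift_ex:
  assumes "\<alpha> \<in> based" "(opath_end \<alpha>, ss) \<in> paths_of G"
  shows "\<exists>ts. (class_of \<alpha>, ts) \<in> opaths cover_verts cover_edges \<and> map (step_map proj) ts = ss \<and>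
     opath_end (class_of \<alpha>, ts) = class_of (fst \<alpha>, snd \<alpha> @ ss)"
  using assms
proof (induction ss arbitrary: \<alpha>)
  case Nil
  then show ?case by (auto simp: cover_verts_def)
next
  case (Cons s ss)
  then have s: "fst s \<in> E" "step_begin s = opath_end \<alpha>" by auto
  note x = ext_based[OF Cons.prems(1) s]
  obtain t where t: "fst t \<in> cover_edges" "step_begin t = class_of \<alpha>" "step_end t = class_of (ext \<alpha> s)" "step_map proj t = s"
    using cover_step_ex[OF Cons.prems(1) s] by blast
  have "(opath_end (ext \<alpha> s), ss) \<in> paths_of G"
    using Cons.prems(2) x step_verts(2)[OF EV s(1)] by auto
  from Cons.IH[OF x(1) this] obtain ts where ts: "(class_of (ext \<alpha> s), ts) \<in> opaths cover_verts cover_edges"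
    "map (step_map proj) ts = ss" "opath_end (class_of (ext \<alpha> s), ts) = class_of (fst (ext \<alpha> s), snd (ext \<alpha> s) @ ss)"
    by blast
  show ?case
    by (rule exI[of _ "t # ts"]) (use t ts Cons.prems(1) in \<open>auto simp: cover_verts_def ext_def\<close>)
qed

lemma cover_is_lift_ex:
  assumes "\<alpha> \<in> based" "\<beta> \<in> paths_of G" "opath_begin \<beta> = opath_end \<alpha>"
  shows "\<exists>\<beta>'. is_lift cover proj (class_of \<alpha>) \<beta> \<beta>' \<and> opath_end \<beta>' = class_of (opath_comp \<alpha> \<beta>)"
proof -
  obtain ss where b: "\<beta> = (opath_end \<alpha>, ss)" using assms(3) by (cases \<beta>) auto
  obtain ts where "(class_of \<alpha>, ts) \<in> opaths cover_verts cover_edges" "map (step_map proj) ts = ss"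
     "opath_end (class_of \<alpha>, ts) = class_of (fst \<alpha>, snd \<alpha> @ ss)"
    using cover_lift_ex[OF assms(1)] assms(2) b by blast
  then show ?thesis
    by (intro exI[of _ "(class_of \<alpha>, ts)"]) (use b assms(1) in \<open>auto simp: is_lift_def cover_def opath_map_eq opath_comp_def\<close>)
qed

lemma cover_is_lift_unique:
  "is_lift cover proj v \<beta> \<beta>' \<Longrightarrow> is_lift cover proj v \<beta> \<beta>'' \<Longrightarrow> \<beta>' = \<beta>''"
  by (rule lift_unique_if_steps_unique[where \<rho> = proj and E' = cover_edges and V' = cover_verts])
     (erule (3) cover_step_unique, simp_all add: is_lift_def cover_def)

text \<open>A path starting at the class of \<gamma> ends at the class of \<gamma> followed by its
  projection. Related projections give related concatenations, hence the same end, as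
  \<open>path_relation_generated\<close> requires of generators.\<close>

lemma cover_gens_ends:
  assumes "(\<alpha>, \<beta>) \<in> cover_gens"
  shows "\<alpha> \<in> opaths cover_verts cover_edges \<and> \<beta> \<in> opaths cover_verts cover_edges \<and>
     opath_begin \<alpha> = opath_begin \<beta> \<and> opath_end \<alpha> = opath_end \<beta>"
proof -
  have ab: "\<alpha> \<in> opaths cover_verts cover_edges" "\<beta> \<in> opaths cover_verts cover_edges"
    "opath_begin \<alpha> = opath_begin \<beta>" "(opath_map proj \<alpha>, opath_map proj \<beta>) \<in> prel G"
    using assms by (auto simp: cover_gens_def)
  obtain \<gamma> where g: "\<gamma> \<in> based" "opath_begin \<alpha> = class_of \<gamma>"
    using opath_begin_in[OF ab(1)] by (auto simp: cover_verts_def)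
  have e: "opath_end \<delta> = class_of (opath_comp \<gamma> (opath_map proj \<delta>)) \<and> opath_comp \<gamma> (opath_map proj \<delta>) \<in> based
      \<and> opath_map proj \<delta> \<in> paths_of G \<and> opath_end \<gamma> = opath_begin (opath_map proj \<delta>)"
    if d: "\<delta> \<in> opaths cover_verts cover_edges" "opath_begin \<delta> = class_of \<gamma>" for \<delta>
  proof -
    have dG: "opath_map proj \<delta> \<in> paths_of G" using opath_map_in[OF cover_morphism] d by (simp add: cover_def)
    have b: "opath_begin (opath_map proj \<delta>) = opath_end \<gamma>" using d(2) g(1) by simp
    obtain \<delta>' where "is_lift cover proj (class_of \<gamma>) (opath_map proj \<delta>) \<delta>'" "opath_end \<delta>' = class_of (opath_comp \<gamma> (opath_map proj \<delta>))"
      using cover_is_lift_ex[OF g(1) dG b] by blast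
    moreover have "is_lift cover proj (class_of \<gamma>) (opath_map proj \<delta>) \<delta>" using d by (simp add: is_lift_def cover_def)
    ultimately have "opath_end \<delta> = class_of (opath_comp \<gamma> (opath_map proj \<delta>))" using cover_is_lift_unique by blast
    moreover have "opath_comp \<gamma> (opath_map proj \<delta>) \<in> based"
      using g(1) opath_comp_in[OF _ dG b[symmetric]] by (auto simp: based_def)
    ultimately show ?thesis using dG b by simp
  qed
  have "(opath_comp \<gamma> (opath_map proj \<alpha>), opath_comp \<gamma> (opath_map proj \<beta>)) \<in> prel G"
    by (rule path_relation_comp(2)[OF R EV ab(4)]) (use g(1) e[OF ab(1) g(2)] in \<open>auto simp: based_def\<close>)
  then have "opath_end \<alpha> = opath_end \<beta>"
    using e[OF ab(1) g(2)] e[OF ab(2)] ab(3) g(2) class_of_eq_iff by metis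
  then show ?thesis using ab by blast
qed

lemma const_based: "opath_const c \<in> based"
  using c by (simp add: based_def)

lemma cover_connected: "os_connected cover"
proof -
  have E: "edges cover \<subseteq> verts cover \<times> verts cover" using cover_edges_verts by (simp add: cover_def)
  have from_base: "\<exists>\<beta>\<in>paths_of cover. opath_begin \<beta> = class_of (opath_const c) \<and> opath_end \<beta> = u"
    if u: "u \<in> verts cover" for u
  proof -
    obtain \<alpha> where a: "\<alpha> \<in> based" "u = class_of \<alpha>" using u by (auto simp: cover_def cover_verts_def)
    then have a': "\<alpha> \<in> paths_of G" "opath_begin \<alpha> = opath_end (opath_const c)" by (auto simp: based_def)
    have "opath_comp (opath_const c) \<alpha> = \<alpha>" using opath_const_comp[of \<alpha>] a'(2) by simp
    moreover obtain \<beta> where "is_lift cover proj (class_of (opath_const c)) \<alpha> \<beta>"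
      "opath_end \<beta> = class_of (opath_comp (opath_const c) \<alpha>)"
      using cover_is_lift_ex[OF const_based a'] by blast
    ultimately show ?thesis using a(2) unfolding is_lift_def by metis
  qed
  have "\<exists>\<alpha>\<in>paths_of cover. opath_begin \<alpha> = u \<and> opath_end \<alpha> = v" if uv: "u \<in> verts cover" "v \<in> verts cover" for u v
  proof -
    obtain \<beta> where b: "\<beta> \<in> paths_of cover" "opath_begin \<beta> = class_of (opath_const c)" "opath_end \<beta> = u"
      using from_base[OF uv(1)] by blast
    obtain \<gamma> where g: "\<gamma> \<in> paths_of cover" "opath_begin \<gamma> = class_of (opath_const c)" "opath_end \<gamma> = v"
      using from_base[OF uv(2)] by blast
    show ?thesis
      by (rule bexI[of _ "opath_comp (opath_inv \<beta>) \<gamma>"])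
         (use b g opath_end_comp[of "opath_inv \<beta>" \<gamma>] opath_comp_in[OF opath_inv_in[OF E b(1)] g(1)] in auto)
  qed
  moreover have "verts cover \<noteq> {}" using const_based by (auto simp: cover_def cover_verts_def)
  ultimately show ?thesis unfolding os_connected_def by blast
qed

lemma cover_os_cover: "os_cover cover G proj"
  unfolding os_cover_def
proof (intro conjI ballI impI)
  show "oriented_system cover"
    using path_relation_generated[OF cover_edges_verts cover_gens_ends] cover_edges_verts
    by (simp add: oriented_system_def cover_def)
  have ex1: "\<exists>!\<alpha>'. is_lift cover proj v \<alpha> \<alpha>'"
    if va: "v \<in> verts cover" "\<alpha> \<in> paths_of G" "opath_begin \<alpha> = proj v" for v \<alpha>
  proof -
    have "v \<in> class_of ` based" using va(1) by (simp add: cover_def cover_verts_def)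
    then obtain \<gamma> where "\<gamma> \<in> based" "v = class_of \<gamma>" by blast
    then obtain \<alpha>' where l: "is_lift cover proj v \<alpha> \<alpha>'" using cover_is_lift_ex[of \<gamma> \<alpha>] va by auto
    then show ?thesis by (rule ex1I) (rule cover_is_lift_unique[OF _ l])
  qed
  then show "\<exists>!\<alpha>'. is_lift cover proj v \<alpha> \<alpha>'"
    if "v \<in> verts cover" "\<alpha> \<in> paths_of G" "opath_begin \<alpha> = proj v" for v \<alpha> using that by blast
  fix v x assume v: "v \<in> verts cover" and x: "x \<in> prel G"
  obtain \<alpha> \<beta> where xab: "x = (\<alpha>, \<beta>)" by (cases x)
  have "(lift cover proj v \<alpha>, lift cover proj v \<beta>) \<in> cover_gens"
    if b: "opath_begin \<alpha> = proj v" "opath_begin \<beta> = proj v"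
  proof -
    have ab: "\<alpha> \<in> paths_of G" "\<beta> \<in> paths_of G" using path_relationD(1)[OF R] x xab by blast+
    have "is_lift cover proj v \<alpha> (lift cover proj v \<alpha>)" "is_lift cover proj v \<beta> (lift cover proj v \<beta>)"
      unfolding lift_def by (rule theI'[OF ex1[OF v ab(1) b(1)]], rule theI'[OF ex1[OF v ab(2) b(2)]])
    then show ?thesis using x xab by (auto simp: is_lift_def cover_gens_def cover_def)
  qed
  then show "case x of (\<alpha>, \<beta>) \<Rightarrow> opath_begin \<alpha> = proj v \<and> opath_begin \<beta> = proj v \<longrightarrow>
     (lift cover proj v \<alpha>, lift cover proj v \<beta>) \<in> prel cover"
    using generated_relation_superset[of cover_gens] by (auto simp: xab cover_def)
next
  show "prel cover = generated_relation (verts cover) (edges cover)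
       {(\<alpha>, \<beta>) \<in> paths_of cover \<times> paths_of cover.
          opath_begin \<alpha> = opath_begin \<beta> \<and> (opath_map proj \<alpha>, opath_map proj \<beta>) \<in> prel G}"
    by (simp add: cover_def cover_gens_def)
qed (use osys conn cover_connected cover_morphism in simp_all)

end

text \<open>The universal cover maps to the cover by path classes, where a lift closes up only if the path is null.\<close>

lemma universal_cover_loop_null:
  assumes u: "universal_os_cover \<Theta> G \<rho>" and cnt: "countable (paths_of G)"
    and \<alpha>: "\<alpha> \<in> paths_of \<Theta>" "opath_begin \<alpha> = opath_end \<alpha>"
  shows "(opath_map \<rho> \<alpha>, opath_const (\<rho> (opath_begin \<alpha>))) \<in> prel G"
proof -
  have c: "os_cover \<Theta> G \<rho>" using u by (simp add: universal_os_cover_def)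
  have G: "oriented_system G" "os_connected G" and mor: "graph_morphism \<Theta> G \<rho>"
    using c by (auto simp: os_cover_def)
  have b: "opath_begin \<alpha> \<in> verts \<Theta>" using opath_begin_in[OF \<alpha>(1)] .
  then have bG: "\<rho> (opath_begin \<alpha>) \<in> verts G" using mor by (auto simp: graph_morphism_def)
  interpret P: path_class_cover G "\<rho> (opath_begin \<alpha>)"
    by unfold_locales (use G cnt bG in simp_all)
  obtain \<mu> where mu: "os_morphism \<Theta> P.cover \<mu>" "\<forall>v\<in>verts \<Theta>. P.proj (\<mu> v) = \<rho> v"
    using u P.cover_os_cover unfolding universal_os_cover_def by blast
  have mug: "graph_morphism \<Theta> P.cover \<mu>" using mu(1) by (simp add: os_morphism_def)
  have E: "edges \<Theta> \<subseteq> verts \<Theta> \<times> verts \<Theta>" using c by (simp add: os_cover_def oriented_system_def)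
  \<comment> \<open>The morphism need not send the base vertex to the class of the constant path;
    its image is the class of some path \<gamma> with the right end, which has to be cancelled
    later.\<close>
  have "\<mu> (opath_begin \<alpha>) \<in> P.cover_verts" using mug b by (auto simp: graph_morphism_def P.cover_def)
  then obtain \<gamma> where g: "\<gamma> \<in> P.based" "\<mu> (opath_begin \<alpha>) = P.class_of \<gamma>" by (auto simp: P.cover_verts_def)
  have ge: "opath_end \<gamma> = \<rho> (opath_begin \<alpha>)" using mu(2) b g by (metis P.proj_class_of)
  have proj: "opath_map P.proj (opath_map \<mu> \<alpha>) = opath_map \<rho> \<alpha>"
  proof -
    obtain v ss where a: "\<alpha> = (v, ss)" by (cases \<alpha>)
    have "step_map P.proj (step_map \<mu> s) = step_map \<rho> s" if "s \<in> set ss" for s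
    proof -
      have "fst s \<in> edges \<Theta>" using that \<alpha>(1) a by auto
      then have "fst (fst s) \<in> verts \<Theta>" "snd (fst s) \<in> verts \<Theta>" using E by (auto simp: mem_Times_iff)
      then show ?thesis using mu(2) by (cases s; cases "fst s") auto
    qed
    then show ?thesis using mu(2) b a by (simp add: opath_map_eq)
  qed
  have aG: "opath_map \<rho> \<alpha> \<in> paths_of G" using opath_map_in[OF mor \<alpha>(1)] .
  have "is_lift P.cover P.proj (P.class_of \<gamma>) (opath_map \<rho> \<alpha>) (opath_map \<mu> \<alpha>)"
    using opath_map_in[OF mug \<alpha>(1)] proj g(2) by (simp add: is_lift_def)
  moreover obtain \<beta> where "is_lift P.cover P.proj (P.class_of \<gamma>) (opath_map \<rho> \<alpha>) \<beta>"
    "opath_end \<beta> = P.class_of (opath_comp \<gamma> (opath_map \<rho> \<alpha>))"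
    using P.cover_is_lift_ex[OF g(1) aG] ge by auto
  ultimately have "opath_end (opath_map \<mu> \<alpha>) = P.class_of (opath_comp \<gamma> (opath_map \<rho> \<alpha>))"
    using P.cover_is_lift_unique by blast
  \<comment> \<open>Closedness of \<alpha> enters here: the lift returns to the class of \<gamma>,
    so appending the projection of \<alpha> to \<gamma> does not change its class.\<close>
  then have cl: "P.class_of (opath_comp \<gamma> (opath_map \<rho> \<alpha>)) = P.class_of \<gamma>"
    using \<alpha>(2) g(2) by simp
  have gG: "\<gamma> \<in> paths_of G" using g(1) by (simp add: P.based_def)
  have gb: "opath_comp \<gamma> (opath_map \<rho> \<alpha>) \<in> P.based"
    using g(1) opath_comp_in[OF gG aG] ge by (simp add: P.based_def)
  have rel: "(opath_comp \<gamma> (opath_map \<rho> \<alpha>), \<gamma>) \<in> prel G"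
    using P.class_of_eq_iff[OF gb g(1)] cl by simp
  note R = P.R and EV = P.EV
  have inv: "opath_inv \<gamma> \<in> paths_of G" using opath_inv_in[OF EV gG] .
  note ends = opath_end_inv[OF gG]
  have "(opath_comp (opath_inv \<gamma>) (opath_comp \<gamma> (opath_map \<rho> \<alpha>)), opath_comp (opath_inv \<gamma>) \<gamma>) \<in> prel G"
    by (rule path_relation_comp(2)[OF R EV rel inv]) (use ends in simp)
  moreover have linv: "(opath_comp (opath_inv \<gamma>) \<gamma>, opath_const (opath_end \<gamma>)) \<in> prel G"
    using path_relation_linv[OF R EV gG] .
  moreover have "(opath_comp (opath_comp (opath_inv \<gamma>) \<gamma>) (opath_map \<rho> \<alpha>),
      opath_comp (opath_const (opath_end \<gamma>)) (opath_map \<rho> \<alpha>)) \<in> prel G"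
    by (rule path_relation_comp(1)[OF R EV linv aG]) (use ends ge in \<open>simp add: opath_end_comp\<close>)
  moreover have "opath_comp (opath_const (opath_end \<gamma>)) (opath_map \<rho> \<alpha>) = opath_map \<rho> \<alpha>"
    using opath_const_comp[of "opath_map \<rho> \<alpha>"] ge by simp
  ultimately show ?thesis
    using path_relationD(3,4)[OF R] ge by (metis opath_comp_assoc)
qed

lemma countable_opaths:
  assumes "finite V" "E \<subseteq> V \<times> V"
  shows "countable (opaths V E)"
proof -
  have "opaths V E \<subseteq> V \<times> lists (E \<times> UNIV)" by (force simp: opaths_def)
  moreover have "finite E" using assms finite_subset by blast
  then have "countable (V \<times> lists (E \<times> (UNIV :: bool set)))"
    using assms(1) by (intro countable_SIGMA countable_lists countable_finite) auto
  ultimately show ?thesis by (rule countable_subset)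
qed

section \<open>Exit faces and galleries\<close>

lemma abstract_complex_order_complex: "abstract_complex (order_complex P ge)"
  unfolding abstract_complex_def order_complex_def by (auto intro: finite_subset)

lemma sgn_convex_same:
  fixes a b t :: real
  assumes "sgn a = sgn b" "0 \<le> t" "t \<le> 1"
  shows "sgn ((1 - t) * a + t * b) = sgn a"
proof -
  consider "a > 0" "b > 0" | "a = 0" "b = 0" | "a < 0" "b < 0"
    using assms(1) by (auto simp: sgn_if split: if_splits)
  then show ?thesis
  proof cases
    case 1
    have "(1 - t) * a + t * b > 0"
    proof (cases "t = 0")
      case False
      then have "t * b > 0" using 1 assms by simp
      moreover have "(1 - t) * a \<ge> 0" using 1 assms by simp
      ultimately show ?thesis by linarith
    qed (use 1 in simp)
    then show ?thesis using 1 by simp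
  next
    case 3
    have "(1 - t) * a + t * b < 0"
    proof (cases "t = 0")
      case False
      then have "t * b < 0" using 3 assms by (simp add: mult_pos_neg)
      moreover have "(1 - t) * a \<le> 0" using 3 assms by (simp add: mult_nonneg_nonpos)
      ultimately show ?thesis by linarith
    qed (use 3 in simp)
    then show ?thesis using 3 by simp
  qed simp
qed

text \<open>The parameter at which the segment from \<open>p\<close> to \<open>y\<close> crosses the hyperplane \<open>H\<close>.\<close>

definition cross_par :: "real^'n \<Rightarrow> (real^'n) set \<Rightarrow> real^'n \<Rightarrow> real" where
  "cross_par y H p = hyp_form H p / (hyp_form H p - hyp_form H y)"

text \<open>For p in C, y in D and S the hyperplanes separating C from D, these are the hyperplanes
  met at the moment when the segment from p to y leaves C.\<close>

definition first_crossed :: "(real^'n) set set \<Rightarrow> real^'n \<Rightarrow> real^'n \<Rightarrow> (real^'n) set set" where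
  "first_crossed S y p = {H\<in>S. \<forall>H'\<in>S. cross_par y H p \<le> cross_par y H' p}"

lemma first_crossed_nonempty:
  assumes "finite S" "S \<noteq> {}"
  shows "first_crossed S y p \<noteq> {}"
proof -
  have "Min ((\<lambda>H. cross_par y H p) ` S) \<in> (\<lambda>H. cross_par y H p) ` S"
    by (rule Min_in) (use assms in simp_all)
  then obtain H where "H \<in> S" "cross_par y H p = Min ((\<lambda>H. cross_par y H p) ` S)"
    by (elim imageE) simp
  then have "H \<in> first_crossed S y p" using assms by (auto simp: first_crossed_def)
  then show ?thesis by blast
qed

section \<open>Chambers as sign vectors and the faces through which segments leave them\<close>

locale hyperplane_arrangement =
  fixes A :: "(real^'n) set set"
  assumes arr: "arrangement A"
begin

lemma finite_A: "finite A"
  using arr by (simp add: arrangement_def)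

lemma sign_mem: "F \<in> faces A \<Longrightarrow> x \<in> F \<Longrightarrow> H \<in> A \<Longrightarrow> sgn (hyp_form H x) = face_sign F H"
  using face_sign_mem[OF arr] by simp

lemma chamber_face: "C \<in> chambers A \<Longrightarrow> C \<in> faces A"
  by (rule chamber_is_face)

lemma chamber_nz: "C \<in> chambers A \<Longrightarrow> H \<in> A \<Longrightarrow> face_sign C H \<noteq> 0"
  using chambers_iff[OF arr] by blast

lemma chamber_nonempty: "C \<in> chambers A \<Longrightarrow> \<exists>x. x \<in> C"
  using face_nonempty[OF chamber_face] by blast

lemma chamber_sign: "C \<in> chambers A \<Longrightarrow> H \<in> A \<Longrightarrow> face_sign C H = 1 \<or> face_sign C H = -1"
  by (rule chamber_sign_cases[OF arr])

lemma sep_setD: "H \<in> sep_set A C D \<Longrightarrow> H \<in> A \<and> face_sign C H \<noteq> face_sign D H"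
  by (simp add: sep_set_def)

lemma sep_set_sym: "sep_set A C D = sep_set A D C"
  by (auto simp: sep_set_def)

lemma sep_set_self [simp]: "sep_set A C C = {}"
  by (simp add: sep_set_def)

text \<open>A symmetric difference, because a chamber sign has only the values 1 and -1: changing it
  twice restores it.\<close>

lemma sep_set_diff:
  assumes "C \<in> chambers A" "K \<in> chambers A" "D \<in> chambers A"
  shows "sep_set A C D = (sep_set A C K - sep_set A K D) \<union> (sep_set A K D - sep_set A C K)"
  using chamber_sign[OF assms(1)] chamber_sign[OF assms(2)] chamber_sign[OF assms(3)]
  by (auto simp: sep_set_def) metis+

lemma finite_sep [simp]: "finite (sep_set A C D)"
  using finite_sep_set[OF arr] .

lemma open_chamber:
  assumes C: "C \<in> chambers A"
  shows "open C"
proof -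
  have "C = (\<Inter>H\<in>A. {x. 0 < face_sign C H * hyp_form H x})"
  proof (intro equalityI subsetI)
    fix x assume x: "x \<in> C"
    have "0 < face_sign C H * hyp_form H x" if "H \<in> A" for H
      using sign_mem[OF chamber_face[OF C] x that] chamber_nz[OF C that]
      by (auto simp: sgn_if zero_less_mult_iff split: if_splits)
    then show "x \<in> (\<Inter>H\<in>A. {x. 0 < face_sign C H * hyp_form H x})" by blast
  next
    fix x assume x: "x \<in> (\<Inter>H\<in>A. {x. 0 < face_sign C H * hyp_form H x})"
    have "sgn (hyp_form H x) = face_sign C H" if "H \<in> A" for H
      using x that chamber_sign[OF C that] by (auto simp: zero_less_mult_iff)
    then show "x \<in> C" using mem_face_iff[OF arr chamber_face[OF C]] by blast
  qed
  moreover have "open (\<Inter>H\<in>A. {x. 0 < face_sign C H * hyp_form H x})"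
    by (intro open_INT finite_A ballI open_Collect_less continuous_intros)
  ultimately show ?thesis by simp
qed

lemma convex_chamber:
  assumes C: "C \<in> chambers A"
  shows "convex C"
proof (rule convexI)
  fix x y and u v :: real assume xy: "x \<in> C" "y \<in> C" "0 \<le> u" "0 \<le> v" "u + v = 1"
  have u: "u = 1 - v" using xy(5) by simp
  have "sgn (hyp_form H ((1 - v) *\<^sub>R x + v *\<^sub>R y)) = face_sign C H" if "H \<in> A" for H
    unfolding hyp_form_linear
    using sgn_convex_same[of "hyp_form H x" "hyp_form H y" v] sign_mem[OF chamber_face[OF C] _ that] xy by simp
  then show "u *\<^sub>R x + v *\<^sub>R y \<in> C" unfolding u using mem_face_iff[OF arr chamber_face[OF C]] by simp
qed

text \<open>For a chamber C this is the face of C lying on exactly the hyperplanes of M. It is given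
  by its covector, so no point of it has to be carried along.\<close>

definition is_exit_face :: "(real^'n) set \<Rightarrow> (real^'n) set set \<Rightarrow> (real^'n) set \<Rightarrow> bool" where
  "is_exit_face C M F \<longleftrightarrow> F \<in> faces A \<and> (\<forall>H\<in>A. face_sign F H = (if H \<in> M then 0 else face_sign C H))"

lemma is_exit_face_unique: "is_exit_face C M F \<Longrightarrow> is_exit_face C M G \<Longrightarrow> F = G"
  unfolding is_exit_face_def by (intro face_sign_eqI[OF arr]) auto

lemma cross_par_pos:
  assumes "C \<in> chambers A" "D \<in> chambers A" "p \<in> C" "y \<in> D" "H \<in> sep_set A C D"
  shows "0 < cross_par y H p" "cross_par y H p < 1" "hyp_form H p \<noteq> 0" "hyp_form H p - hyp_form H y \<noteq> 0"
proof -
  have H: "H \<in> A" "face_sign C H \<noteq> face_sign D H" using sep_setD[OF assms(5)] by auto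
  have s: "sgn (hyp_form H p) = face_sign C H" "sgn (hyp_form H y) = face_sign D H"
    using sign_mem chamber_face assms H by auto
  have "hyp_form H p > 0 \<and> hyp_form H y < 0 \<or> hyp_form H p < 0 \<and> hyp_form H y > 0"
    using H s chamber_sign[OF assms(1) H(1)] chamber_sign[OF assms(2) H(1)]
    by (auto simp: sgn_if split: if_splits)
  then show "0 < cross_par y H p" "cross_par y H p < 1" "hyp_form H p \<noteq> 0" "hyp_form H p - hyp_form H y \<noteq> 0"
    unfolding cross_par_def by (auto simp: zero_less_divide_iff divide_less_eq)
qed

text \<open>The witness is the cell of the point at the least crossing parameter t. There the form
  of a separating hyperplane has its value at p times 1 - t / c, where c is its own crossing
  parameter, so it vanishes exactly for the hyperplanes crossed first.\<close>

lemma exit_face_exists: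
  assumes C: "C \<in> chambers A" and D: "D \<in> chambers A" and p: "p \<in> C" and y: "y \<in> D"
    and ne: "sep_set A C D \<noteq> {}"
  shows "\<exists>F. is_exit_face C (first_crossed (sep_set A C D) y p) F"
proof -
  let ?S = "sep_set A C D" and ?M = "first_crossed (sep_set A C D) y p"
  obtain H0 where H0: "H0 \<in> ?M" using first_crossed_nonempty[OF finite_sep ne] by blast
  then have H0S: "H0 \<in> ?S" and least: "\<And>H. H \<in> ?S \<Longrightarrow> cross_par y H0 p \<le> cross_par y H p"
    by (auto simp: first_crossed_def)
  define t where "t = cross_par y H0 p"
  have t: "0 < t" "t < 1" using cross_par_pos[OF C D p y H0S] by (auto simp: t_def)
  let ?F = "cell_of A ((1 - t) *\<^sub>R p + t *\<^sub>R y)"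
  have "face_sign ?F H = (if H \<in> ?M then 0 else face_sign C H)" if H: "H \<in> A" for H
  proof -
    have s: "sgn (hyp_form H p) = face_sign C H" "sgn (hyp_form H y) = face_sign D H"
      using sign_mem chamber_face C D p y H by auto
    have F: "face_sign ?F H = sgn ((1 - t) * hyp_form H p + t * hyp_form H y)"
      using face_sign_cell_of[OF arr H] by (simp add: hyp_form_linear)
    show ?thesis
    proof (cases "H \<in> ?S")
      case False
      then have "sgn (hyp_form H p) = sgn (hyp_form H y)" using s H by (simp add: sep_set_def)
      moreover have "H \<notin> ?M" using False by (simp add: first_crossed_def)
      ultimately show ?thesis using F s t sgn_convex_same by simp
    next
      case True
      note c = cross_par_pos[OF C D p y True]
      let ?c = "cross_par y H p"
      have "(1 - t) * hyp_form H p + t * hyp_form H y = hyp_form H p * (1 - t / ?c)"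
        using c(3,4) by (simp add: cross_par_def field_simps)
      then have F': "face_sign ?F H = sgn (hyp_form H p) * sgn (1 - t / ?c)" using F by (simp add: sgn_mult)
      have tc: "t \<le> ?c" using least[OF True] by (simp add: t_def)
      show ?thesis
      proof (cases "t = ?c")
        case eq: True
        then have "H \<in> ?M" using True least by (auto simp: first_crossed_def t_def)
        then show ?thesis using F' eq t by simp
      next
        case neq: False
        then have "\<not> ?c \<le> cross_par y H0 p" using tc by (simp add: t_def)
        then have "H \<notin> ?M" using H0S by (auto simp: first_crossed_def)
        moreover have "1 - t / ?c > 0" using neq tc c(1) by (simp add: divide_less_eq)
        ultimately show ?thesis using F' s by simp
      qed
    qed
  qed
  then show ?thesis unfolding is_exit_face_def by (intro exI[of _ ?F]) simp
qed

text \<open>The chamber behind the exit face differs from C exactly in the signs at M. The remaining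
  way to D has to cross only the separating hyperplanes outside M, so no hyperplane is crossed
  twice.\<close>

lemma exit_face_chamber:
  assumes C: "C \<in> chambers A" and D: "D \<in> chambers A" and F: "is_exit_face C M F" and M: "M \<subseteq> sep_set A C D"
  shows "chamber_at A D F \<in> chambers A" "sep_set A C (chamber_at A D F) = M"
    "sep_set A (chamber_at A D F) D = sep_set A C D - M"
    "face_ge F C" "face_ge F (chamber_at A D F)"
proof -
  have FF: "F \<in> faces A" and s: "\<And>H. H \<in> A \<Longrightarrow> face_sign F H = (if H \<in> M then 0 else face_sign C H)"
    using F by (auto simp: is_exit_face_def)
  show K: "chamber_at A D F \<in> chambers A" using arr D FF by simp
  have k: "face_sign (chamber_at A D F) H = (if H \<in> M then face_sign D H else face_sign C H)" if "H \<in> A" for H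
    using face_sign_chamber_at[OF arr D FF that] s[OF that] chamber_nz[OF C that] by auto
  have MA: "M \<subseteq> A" using M by (auto simp: sep_set_def)
  show "sep_set A C (chamber_at A D F) = M" using k M by (auto simp: sep_set_def split: if_splits)
  show "sep_set A (chamber_at A D F) D = sep_set A C D - M" using k MA by (auto simp: sep_set_def split: if_splits)
  show "face_ge F C" using face_ge_iff[OF arr FF chamber_face[OF C]] s by auto
  show "face_ge F (chamber_at A D F)" using face_ge_iff[OF arr FF chamber_face[OF K]] s k by auto
qed

text \<open>For generic p in C a single hyperplane is crossed first. Coincidence of two crossing
  parameters is an affine equation in p, nontrivial because distinct hyperplanes have
  nonproportional forms, and finitely many such equations can be avoided in the open set C.\<close>

lemma gallery_step:
  assumes C: "C \<in> chambers A" and D: "D \<in> chambers A" and ne: "sep_set A C D \<noteq> {}"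
  shows "\<exists>K H. K \<in> chambers A \<and> H \<in> sep_set A C D \<and> sep_set A C K = {H} \<and> sep_set A K D = sep_set A C D - {H}"
proof -
  let ?S = "sep_set A C D"
  obtain y where y: "y \<in> D" using chamber_nonempty[OF D] by blast
  define I where "I = {(H, H'). H \<in> ?S \<and> H' \<in> ?S \<and> H \<noteq> H'}"
  \<comment> \<open>The equation of \<open>?c\<close> and \<open>?d\<close> at p is equality of the
    crossing parameters of H and H', with denominators cleared and the product of the two values at
    p cancelled.\<close>
  let ?c = "\<lambda>(H, H'). hyp_form H' y *\<^sub>R hyp_normal H - hyp_form H y *\<^sub>R hyp_normal H'"
  let ?d = "\<lambda>(H, H'). hyp_form H' y * hyp_offset H - hyp_form H y * hyp_offset H'"
  have "I \<subseteq> ?S \<times> ?S" by (auto simp: I_def)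
  then have "finite I" by (rule finite_subset) simp
  have nz: "hyp_form H y \<noteq> 0" if "H \<in> ?S" for H
    using sign_mem[OF chamber_face[OF D] y, of H] chamber_nz[OF D, of H] sep_setD[OF that] by auto
  have "\<exists>p\<in>C. \<forall>i\<in>I. ?c i \<bullet> p \<noteq> ?d i"
  proof (rule generic_point[OF \<open>finite I\<close> open_chamber[OF C]])
    show "C \<noteq> {}" using chamber_nonempty[OF C] by blast
    fix i assume "i \<in> I"
    then obtain H H' where i: "i = (H, H')" "H \<in> ?S" "H' \<in> ?S" "H \<noteq> H'" by (auto simp: I_def)
    show "?c i \<noteq> 0 \<or> ?d i \<noteq> 0"
    proof (rule ccontr)
      assume "\<not> (?c i \<noteq> 0 \<or> ?d i \<noteq> 0)"
      then have e: "hyp_form H' y *\<^sub>R hyp_normal H = hyp_form H y *\<^sub>R hyp_normal H'"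
        "hyp_form H' y * hyp_offset H = hyp_form H y * hyp_offset H'" by (auto simp: i)
      have "hyp_form H' y * hyp_form H x = hyp_form H y * hyp_form H' x" for x
      proof -
        have "hyp_form H' y * hyp_form H x = (hyp_form H' y *\<^sub>R hyp_normal H) \<bullet> x - hyp_form H' y * hyp_offset H"
          by (simp add: hyp_form_def[of H x] right_diff_distrib)
        also have "\<dots> = hyp_form H y * hyp_form H' x"
          unfolding e by (simp add: hyp_form_def[of H' x] right_diff_distrib)
        finally show ?thesis .
      qed
      then have "hyp_form H x = 0 \<longleftrightarrow> hyp_form H' x = 0" for x
        using nz[OF i(2)] nz[OF i(3)] by (metis mult_eq_0_iff)
      moreover have "hyperplane H" "hyperplane H'" using i sep_setD arr by (auto simp: arrangement_def)
      ultimately show False using i(4) mem_hyperplane_iff by blast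
    qed
  qed
  then obtain p where p: "p \<in> C" and gen: "\<And>i. i \<in> I \<Longrightarrow> ?c i \<bullet> p \<noteq> ?d i" by blast
  let ?M = "first_crossed ?S y p"
  obtain H where H: "H \<in> ?M" using first_crossed_nonempty[OF finite_sep ne] by blast
  have "H' = H" if H': "H' \<in> ?M" for H'
  proof (rule ccontr)
    assume neq: "H' \<noteq> H"
    have S: "H \<in> ?S" "H' \<in> ?S" and eq: "cross_par y H p = cross_par y H' p"
      using H H' by (auto simp: first_crossed_def intro: antisym)
    note c = cross_par_pos[OF C D p y S(1)] cross_par_pos[OF C D p y S(2)]
    have "hyp_form H p * (hyp_form H' p - hyp_form H' y) = hyp_form H' p * (hyp_form H p - hyp_form H y)"
      using eq c(4,8) by (simp add: cross_par_def frac_eq_eq)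
    then have "hyp_form H' y * hyp_form H p = hyp_form H y * hyp_form H' p" by (simp add: algebra_simps)
    then have "?c (H, H') \<bullet> p = ?d (H, H')"
      by (simp add: hyp_form_def[of H p] hyp_form_def[of H' p] inner_diff_left algebra_simps)
    moreover have "(H, H') \<in> I" using S neq by (auto simp: I_def)
    ultimately show False using gen by blast
  qed
  then have M: "?M = {H}" using H by blast
  obtain F where F: "is_exit_face C ?M F" using exit_face_exists[OF C D p y ne] by blast
  have MS: "?M \<subseteq> ?S" by (auto simp: first_crossed_def)
  then have HS: "H \<in> ?S" using H by (rule subsetD)
  note e = exit_face_chamber[OF C D F MS, unfolded M]
  show ?thesis by (rule exI[of _ "chamber_at A D F"], rule exI[of _ H]) (intro conjI e(1-3) HS)
qed

section \<open>Galleries and their lengths\<close>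

abbreviation "chE \<equiv> chamber_edges A"

lemma chE_sub: "chE \<subseteq> chambers A \<times> chambers A"
  by (auto simp: chamber_edges_def)

lemma chE_iff: "(C, D) \<in> chE \<longleftrightarrow> C \<in> chambers A \<and> D \<in> chambers A \<and> (\<exists>H. sep_set A C D = {H})"
  using adjacent_iff[OF arr] by (auto simp: chamber_edges_def card_1_singleton_iff)

lemma card_sep_triangle:
  assumes "C \<in> chambers A" "K \<in> chambers A" "D \<in> chambers A"
  shows "card (sep_set A C D) \<le> card (sep_set A C K) + card (sep_set A K D)"
proof -
  have "card (sep_set A C D) \<le> card (sep_set A C K \<union> sep_set A K D)"
    by (rule card_mono, simp) (auto simp: sep_set_def)
  also have "\<dots> \<le> card (sep_set A C K) + card (sep_set A K D)" by (rule card_Un_le)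
  finally show ?thesis .
qed

text \<open>Each edge crosses one hyperplane, and the triangle inequality for separating sets adds
  the crossings up.\<close>

lemma positive_path_length:
  assumes "(C, ss) \<in> opaths (chambers A) chE" "opath_positive (C, ss)"
  shows "card (sep_set A C (opath_end (C, ss))) \<le> length ss"
  using assms
proof (induction ss arbitrary: C)
  case (Cons s ss)
  then obtain K where s: "s = ((C, K), True)" by (cases s; cases "fst s") (auto simp: opath_positive_def)
  have e: "(C, K) \<in> chE" using Cons.prems s by simp
  then have K: "K \<in> chambers A" "C \<in> chambers A" "card (sep_set A C K) = 1" by (auto simp: chE_iff)
  have p: "(K, ss) \<in> opaths (chambers A) chE" "opath_positive (K, ss)"
    using Cons.prems s K by (auto simp: opath_positive_def)
  have D: "opath_end (K, ss) \<in> chambers A" using opath_end_in[OF chE_sub p(1)] .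
  show ?case
    using card_sep_triangle[OF K(2,1) D] Cons.IH[OF p] K(3) s by simp
qed simp

lemma positive_path_exists:
  assumes "C \<in> chambers A" "D \<in> chambers A"
  shows "\<exists>ss. (C, ss) \<in> opaths (chambers A) chE \<and> opath_positive (C, ss) \<and> opath_end (C, ss) = D
    \<and> length ss = card (sep_set A C D)"
  using assms
proof (induction "card (sep_set A C D)" arbitrary: C)
  case 0
  then have "sep_set A C D = {}" by simp
  then have "C = D" using chamber_eqI[OF arr 0(2,3)] by blast
  then show ?case using 0 by (intro exI[of _ "[]"]) (auto simp: opath_positive_def)
next
  case (Suc n)
  then have "sep_set A C D \<noteq> {}" by auto
  then obtain K H where K: "K \<in> chambers A" "H \<in> sep_set A C D" "sep_set A C K = {H}" "sep_set A K D = sep_set A C D - {H}"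
    using gallery_step[OF Suc.prems] by blast
  have n: "card (sep_set A K D) = n" using K Suc.hyps(2) by simp
  obtain ss where ss: "(K, ss) \<in> opaths (chambers A) chE" "opath_positive (K, ss)" "opath_end (K, ss) = D" "length ss = n"
    using Suc.hyps(1)[OF n[symmetric] K(1) Suc.prems(2)] n by auto
  have "(C, K) \<in> chE" using K Suc.prems by (simp add: chE_iff)
  then show ?case
    using ss Suc.prems Suc.hyps(2) by (intro exI[of _ "((C, K), True) # ss"]) (auto simp: opath_positive_def)
qed

abbreviation "pmin \<equiv> positive_minimal (chambers A) chE"

text \<open>Comparison with all other positive paths is replaced by a count: no positive path is
  shorter than the number of separating hyperplanes, and \<open>positive_path_exists\<close> attains
  it.\<close>

lemma pmin_iff:
  "pmin (C, ss) \<longleftrightarrow> (C, ss) \<in> opaths (chambers A) chE \<and> opath_positive (C, ss) \<and>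
    length ss = card (sep_set A C (opath_end (C, ss)))"
proof
  assume m: "pmin (C, ss)"
  then have p: "(C, ss) \<in> opaths (chambers A) chE" "opath_positive (C, ss)" by (auto simp: positive_minimal_def)
  have C: "C \<in> chambers A" "opath_end (C, ss) \<in> chambers A" using p(1) opath_end_in[OF chE_sub p(1)] by auto
  obtain ts where ts: "(C, ts) \<in> opaths (chambers A) chE" "opath_positive (C, ts)" "opath_end (C, ts) = opath_end (C, ss)"
    "length ts = card (sep_set A C (opath_end (C, ss)))" using positive_path_exists[OF C] by blast
  have "\<forall>\<beta>\<in>opaths (chambers A) chE. opath_positive \<beta> \<and> opath_begin \<beta> = opath_begin (C, ss) \<and>
      opath_end \<beta> = opath_end (C, ss) \<longrightarrow> opath_length (C, ss) \<le> opath_length \<beta>"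
    using m unfolding positive_minimal_def by (elim conjE)
  from bspec[OF this ts(1)] have "length ss \<le> length ts"
    using ts(2,3) by (simp add: opath_length_def)
  then show "(C, ss) \<in> opaths (chambers A) chE \<and> opath_positive (C, ss) \<and>
    length ss = card (sep_set A C (opath_end (C, ss)))"
    using p ts positive_path_length[OF p] by simp
next
  assume r: "(C, ss) \<in> opaths (chambers A) chE \<and> opath_positive (C, ss) \<and>
    length ss = card (sep_set A C (opath_end (C, ss)))"
  show "pmin (C, ss)"
    unfolding positive_minimal_def
  proof (intro conjI ballI impI)
    fix \<beta> assume b: "\<beta> \<in> opaths (chambers A) chE"
      "opath_positive \<beta> \<and> opath_begin \<beta> = opath_begin (C, ss) \<and> opath_end \<beta> = opath_end (C, ss)"
    obtain ts where \<beta>: "\<beta> = (C, ts)" using b by (cases \<beta>) auto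
    show "opath_length (C, ss) \<le> opath_length \<beta>"
      using positive_path_length[of C ts] b r by (simp add: \<beta> opath_length_def)
  qed (use r in auto)
qed

lemma pmin_exists:
  assumes "C \<in> chambers A" "D \<in> chambers A"
  shows "\<exists>ss. pmin (C, ss) \<and> opath_end (C, ss) = D"
  using positive_path_exists[OF assms] pmin_iff by metis

lemma minimal_path_props:
  assumes "C \<in> chambers A" "D \<in> chambers A"
  shows "pmin (minimal_path A C D)" "opath_begin (minimal_path A C D) = C" "opath_end (minimal_path A C D) = D"
proof -
  have "\<exists>\<alpha>. pmin \<alpha> \<and> opath_begin \<alpha> = C \<and> opath_end \<alpha> = D"
    using pmin_exists[OF assms] by (metis opath_begin_simp)
  from someI_ex[OF this] show "pmin (minimal_path A C D)" "opath_begin (minimal_path A C D) = C" "opath_end (minimal_path A C D) = D"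
    unfolding minimal_path_def by blast+
qed

lemma pmin_path: "pmin \<alpha> \<Longrightarrow> \<alpha> \<in> opaths (chambers A) chE"
  by (simp add: positive_minimal_def)

text \<open>A minimal gallery does not cross H a second time: if H still separated K from D, then C
  and D would be separated by no more hyperplanes than K and D, against the length of the
  gallery.\<close>

lemma pmin_Cons:
  assumes "pmin (C, s # ss)" and D: "D = opath_end (C, s # ss)"
  obtains K H where "s = ((C, K), True)" "(C, K) \<in> chE" "pmin (K, ss)" "opath_end (K, ss) = D"
    "sep_set A C K = {H}" "H \<in> sep_set A C D" "sep_set A K D = sep_set A C D - {H}"
proof -
  have p: "(C, s # ss) \<in> opaths (chambers A) chE" "opath_positive (C, s # ss)"
    "length (s # ss) = card (sep_set A C D)" using assms pmin_iff by auto
  then obtain K where s: "s = ((C, K), True)" by (cases s; cases "fst s") (auto simp: opath_positive_def)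
  have e: "(C, K) \<in> chE" using p s by simp
  then obtain H where K: "K \<in> chambers A" "C \<in> chambers A" "sep_set A C K = {H}" by (auto simp: chE_iff)
  have q: "(K, ss) \<in> opaths (chambers A) chE" "opath_positive (K, ss)" and DK: "D = opath_end (K, ss)"
    using p s K D by (auto simp: opath_positive_def)
  have Dc: "D \<in> chambers A" using opath_end_in[OF chE_sub q(1)] DK by simp
  have len: "card (sep_set A K D) \<le> length ss" using positive_path_length[OF q] DK by simp
  have sd: "sep_set A C D = ({H} - sep_set A K D) \<union> (sep_set A K D - {H})"
    using sep_set_diff[OF K(2,1) Dc] K(3) by simp
  have "H \<notin> sep_set A K D"
  proof
    assume "H \<in> sep_set A K D"
    then have "card (sep_set A C D) \<le> card (sep_set A K D)"
      using sd by (intro card_mono) auto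
    then show False using p(3) len by simp
  qed
  then have H: "H \<in> sep_set A C D" "sep_set A K D = sep_set A C D - {H}" using sd by auto
  then have "card (sep_set A K D) = length ss" using p(3) by simp
  then have "pmin (K, ss)" using q DK pmin_iff by simp
  then show ?thesis using that s e DK K(3) H by blast
qed

lemma pmin_comp:
  assumes a: "pmin \<alpha>" and b: "pmin \<beta>" and e: "opath_end \<alpha> = opath_begin \<beta>"
    and disj: "sep_set A (opath_begin \<alpha>) (opath_end \<alpha>) \<inter> sep_set A (opath_begin \<beta>) (opath_end \<beta>) = {}"
  shows "pmin (opath_comp \<alpha> \<beta>)"
proof -
  obtain C ss K ts where ab: "\<alpha> = (C, ss)" "\<beta> = (K, ts)" by (cases \<alpha>; cases \<beta>)
  have K: "opath_end (C, ss) = K" using e ab by simp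
  have a': "(C, ss) \<in> opaths (chambers A) chE" "opath_positive (C, ss)" "length ss = card (sep_set A C K)"
    using a ab pmin_iff K by auto
  have b': "(K, ts) \<in> opaths (chambers A) chE" "opath_positive (K, ts)" "length ts = card (sep_set A K (opath_end (K, ts)))"
    using b ab pmin_iff by auto
  have ch: "C \<in> chambers A" "K \<in> chambers A" "opath_end (K, ts) \<in> chambers A"
    using a' b' opath_end_in[OF chE_sub b'(1)] by auto
  have d: "sep_set A C K \<inter> sep_set A K (opath_end (K, ts)) = {}" using disj ab K by simp
  then have "sep_set A C (opath_end (K, ts)) = sep_set A C K \<union> sep_set A K (opath_end (K, ts))"
    using sep_set_diff[OF ch] by blast
  then have "card (sep_set A C (opath_end (K, ts))) = length ss + length ts"
    using card_Un_disjoint[OF finite_sep finite_sep d] a'(3) b'(3) by simp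
  then show ?thesis
    using a' b' K by (simp add: ab pmin_iff opath_positive_def ball_Un image_Un)
qed

end

context hyperplane_arrangement
begin

section \<open>The poset of the Salvetti complex\<close>

text \<open>A Salvetti vertex w(F, C) depends on C only through C_F. Requiring F to lie in the
  closure of C keeps one representative, namely C = C_F.\<close>

definition sal_poset :: "((real^'n) set \<times> (real^'n) set) set" where
  "sal_poset = {(F, C). F \<in> faces A \<and> C \<in> chambers A \<and> face_ge F C}"

definition sal_ge :: "(real^'n) set \<times> (real^'n) set \<Rightarrow> (real^'n) set \<times> (real^'n) set \<Rightarrow> bool" where
  "sal_ge = (\<lambda>(F\<^sub>1, C\<^sub>1) (F\<^sub>2, C\<^sub>2). face_ge F\<^sub>1 F\<^sub>2 \<and> C\<^sub>2 = chamber_at A C\<^sub>1 F\<^sub>2)"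

definition sal_cx :: "((real^'n) set \<times> (real^'n) set) set set" where
  "sal_cx = order_complex sal_poset sal_ge"

lemma abstract_sal_cx: "abstract_complex sal_cx"
  unfolding sal_cx_def by (rule abstract_complex_order_complex)

lemma finite_sal_cx: "finite sal_cx"
proof (rule finite_subset)
  show "sal_cx \<subseteq> Pow (faces A \<times> faces A)"
    using chamber_face by (auto simp: sal_cx_def order_complex_def sal_poset_def)
qed (use finite_faces[OF arr] in simp)

lemma chamber_at_eqI:
  assumes "C \<in> chambers A" "F \<in> faces A" "D \<in> chambers A"
    and "\<And>H. H \<in> A \<Longrightarrow> face_sign D H = (if face_sign F H = 0 then face_sign C H else face_sign F H)"
  shows "chamber_at A C F = D"
  by (rule face_sign_eqI[OF arr]) (use assms face_sign_chamber_at[OF arr] arr chamber_face in auto)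

lemma face_geD: "face_ge F G \<Longrightarrow> F \<in> faces A \<Longrightarrow> G \<in> faces A \<Longrightarrow> H \<in> A \<Longrightarrow> face_sign F H = 0 \<or> face_sign F H = face_sign G H"
  using face_ge_iff[OF arr] by blast

lemma chamber_at_self:
  "F \<in> faces A \<Longrightarrow> C \<in> chambers A \<Longrightarrow> face_ge F C \<Longrightarrow> chamber_at A C F = C"
  using face_geD[OF _ _ chamber_face] by (intro chamber_at_eqI) force+

lemma face_ge_chamber_at: "F \<in> faces A \<Longrightarrow> C \<in> chambers A \<Longrightarrow> face_ge F (chamber_at A C F)"
  using face_ge_iff[OF arr _ chamber_face[OF chamber_at_in[OF arr]]] face_sign_chamber_at[OF arr] by simp

lemma chamber_at_chamber_at:
  assumes "F \<in> faces A" "G \<in> faces A" "C \<in> chambers A" "face_ge F G"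
  shows "chamber_at A (chamber_at A C F) G = chamber_at A C G"
proof (rule chamber_at_eqI)
  fix H assume H: "H \<in> A"
  show "face_sign (chamber_at A C G) H = (if face_sign G H = 0 then face_sign (chamber_at A C F) H else face_sign G H)"
    using face_sign_chamber_at[OF arr assms(3,1) H] face_sign_chamber_at[OF arr assms(3,2) H]
      face_geD[OF assms(4,1,2) H] by auto
qed (use assms arr in auto)

lemma chamber_at_chamber: "C \<in> chambers A \<Longrightarrow> D \<in> chambers A \<Longrightarrow> chamber_at A C D = D"
  by (rule chamber_at_eqI) (auto simp: chamber_face chamber_nz)

lemma sal_ge_refl: "x \<in> sal_poset \<Longrightarrow> sal_ge x x"
  by (auto simp: sal_poset_def sal_ge_def chamber_at_self)

lemma sal_ge_antisym:
  assumes "x \<in> sal_poset" "y \<in> sal_poset" "sal_ge x y" "sal_ge y x"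
  shows "x = y"
proof -
  obtain F C G D where xy: "x = (F, C)" "y = (G, D)" by (cases x; cases y)
  then have FG: "F = G" using assms face_ge_antisym[OF arr] by (auto simp: sal_poset_def sal_ge_def)
  then have "D = C" using assms xy chamber_at_self by (auto simp: sal_poset_def sal_ge_def)
  then show ?thesis using FG xy by simp
qed

lemma sal_cx_pair: "x \<in> sal_poset \<Longrightarrow> y \<in> sal_poset \<Longrightarrow> sal_ge x y \<or> sal_ge y x \<Longrightarrow> {x, y} \<in> sal_cx"
  unfolding sal_cx_def order_complex_def using sal_ge_refl by auto

lemma sal_cx_triple:
  "c \<in> sal_poset \<Longrightarrow> x \<in> sal_poset \<Longrightarrow> y \<in> sal_poset \<Longrightarrow> sal_ge c x \<Longrightarrow> sal_ge c y \<Longrightarrow> sal_ge x y \<or> sal_ge y x \<Longrightarrow>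
   {c, x, y} \<in> sal_cx"
  unfolding sal_cx_def order_complex_def using sal_ge_refl by auto

text \<open>The minimal elements of the poset, which stand for the vertices of the oriented
  graph.\<close>

definition bottom :: "(real^'n) set \<Rightarrow> (real^'n) set \<times> (real^'n) set" where
  "bottom C = (C, C)"

lemma bottom_in: "C \<in> chambers A \<Longrightarrow> bottom C \<in> sal_poset"
  by (simp add: bottom_def sal_poset_def chamber_face)

lemma sal_ge_bottom: "C \<in> chambers A \<Longrightarrow> D \<in> chambers A \<Longrightarrow> sal_ge (F, C) (bottom D) \<longleftrightarrow> face_ge F D"
  by (simp add: bottom_def sal_ge_def chamber_at_chamber)

section \<open>Edge paths of galleries\<close>

text \<open>For adjacent chambers the separating set is a single hyperplane, and this is their
  common facet.\<close>

definition wall :: "(real^'n) set \<Rightarrow> (real^'n) set \<Rightarrow> (real^'n) set" where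
  "wall C D = (SOME G. is_exit_face C (sep_set A C D) G)"

lemma wall:
  assumes "(C, D) \<in> chE"
  shows "is_exit_face C (sep_set A C D) (wall C D)"
proof -
  obtain H where CD: "C \<in> chambers A" "D \<in> chambers A" "sep_set A C D = {H}" using assms chE_iff by blast
  obtain p where p: "p \<in> C" using chamber_nonempty[OF CD(1)] ..
  obtain y where y: "y \<in> D" using chamber_nonempty[OF CD(2)] ..
  have ne: "sep_set A C D \<noteq> {}" using CD by simp
  have "first_crossed (sep_set A C D) y p = sep_set A C D"
    using first_crossed_nonempty[OF finite_sep ne, of y p] CD(3) by (auto simp: first_crossed_def)
  then have "\<exists>G. is_exit_face C (sep_set A C D) G" using exit_face_exists[OF CD(1,2) p y ne] by simp
  then show ?thesis unfolding wall_def by (rule someI_ex)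
qed

lemma wall_props:
  assumes "(C, D) \<in> chE"
  shows "C \<in> chambers A" "D \<in> chambers A" "wall C D \<in> faces A" "face_ge (wall C D) C" "face_ge (wall C D) D"
    "(wall C D, C) \<in> sal_poset" "sal_ge (wall C D, C) (bottom C)" "sal_ge (wall C D, C) (bottom D)"
    "chamber_at A D (wall C D) = D"
proof -
  note w = wall[OF assms]
  show C: "C \<in> chambers A" and D: "D \<in> chambers A" using assms chE_iff by auto
  show F: "wall C D \<in> faces A" using w by (simp add: is_exit_face_def)
  show FC: "face_ge (wall C D) C" using exit_face_chamber(4)[OF C D w] by simp
  have "face_sign (wall C D) H = 0 \<or> face_sign (wall C D) H = face_sign D H" if "H \<in> A" for H
    using w that by (auto simp: is_exit_face_def sep_set_def)
  then show FD: "face_ge (wall C D) D" using face_ge_iff[OF arr F chamber_face[OF D]] by blast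
  show "(wall C D, C) \<in> sal_poset" using C F FC by (simp add: sal_poset_def)
  show "sal_ge (wall C D, C) (bottom C)" "sal_ge (wall C D, C) (bottom D)"
    using sal_ge_bottom C D FC FD by auto
  show "chamber_at A D (wall C D) = D" using chamber_at_self[OF F D FD] .
qed

text \<open>The middle vertex carries the chamber from which the wall is crossed. The edges (C, D)
  and (D, C) therefore run through different vertices over the same facet; only the exponent -1
  retraces an edge.\<close>

fun step_list :: "(real^'n) set step \<Rightarrow> ((real^'n) set \<times> (real^'n) set) list" where
  "step_list ((C, D), s) = (if s then [bottom C, (wall C D, C), bottom D] else [bottom D, (wall C D, C), bottom C])"

definition path_list :: "(real^'n) set opath \<Rightarrow> ((real^'n) set \<times> (real^'n) set) list" where
  "path_list \<alpha> = concat (map step_list (snd \<alpha>)) @ [bottom (opath_end \<alpha>)]"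

lemma path_list_Nil [simp]: "path_list (C, []) = [bottom C]"
  by (simp add: path_list_def)

lemma path_list_Cons [simp]: "path_list (C, s # ss) = step_list s @ path_list (step_end s, ss)"
  by (simp add: path_list_def)

lemma path_list_const [simp]: "path_list (opath_const C) = [bottom C]"
  by (simp add: opath_const_def)

lemma step_list_ends [simp]:
  "step_list s \<noteq> []" "hd (step_list s) = bottom (step_begin s)" "last (step_list s) = bottom (step_end s)"
  by (cases s; cases "fst s"; auto)+

lemma step_list_inv [simp]: "step_list (step_inv s) = rev (step_list s)"
  by (cases s; cases "fst s") auto

lemma edge_path_step_list:
  assumes "fst s \<in> chE"
  shows "edge_path sal_cx (step_list s)"
proof -
  obtain C D b where s: "s = ((C, D), b)" by (metis prod.collapse)
  have e: "(C, D) \<in> chE" using assms s by simp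
  note w = wall_props[OF e]
  have "{bottom C, (wall C D, C)} \<in> sal_cx" "{(wall C D, C), bottom D} \<in> sal_cx"
    using w by (auto intro!: sal_cx_pair bottom_in)
  then show ?thesis unfolding s edge_path_def by (auto simp: insert_commute)
qed

lemma path_list_ends:
  "path_list \<alpha> \<noteq> []" "last (path_list \<alpha>) = bottom (opath_end \<alpha>)"
  "consecutive (fst \<alpha>) (snd \<alpha>) \<Longrightarrow> hd (path_list \<alpha>) = bottom (opath_begin \<alpha>)"
proof -
  show "consecutive (fst \<alpha>) (snd \<alpha>) \<Longrightarrow> hd (path_list \<alpha>) = bottom (opath_begin \<alpha>)"
    by (cases \<alpha>; cases "snd \<alpha>") (auto simp: hd_append)
qed (simp_all add: path_list_def)

lemma hd_path_list: "\<alpha> \<in> opaths (chambers A) chE \<Longrightarrow> hd (path_list \<alpha>) = bottom (opath_begin \<alpha>)"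
  by (cases \<alpha>) (auto intro: path_list_ends(3)[of "(_, _)", simplified])

lemma edge_path_path_list:
  "\<alpha> \<in> opaths (chambers A) chE \<Longrightarrow> edge_path sal_cx (path_list \<alpha>)"
proof -
  have "(C, ss) \<in> opaths (chambers A) chE \<Longrightarrow> edge_path sal_cx (path_list (C, ss))" for C ss
  proof (induction ss arbitrary: C)
    case Nil
    then have "bottom C \<in> sal_poset" using bottom_in by simp
    then have "{bottom C, bottom C} \<in> sal_cx" using sal_cx_pair sal_ge_refl by blast
    then show ?case by (auto simp: edge_path_def)
  next
    case (Cons s ss)
    then have p: "(step_end s, ss) \<in> opaths (chambers A) chE" and s: "fst s \<in> chE"
      using step_verts[OF chE_sub] by auto
    show ?case unfolding path_list_Cons
      by (rule edge_path_joinI[OF abstract_sal_cx edge_path_step_list[OF s] Cons.IH[OF p]])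
         (use hd_path_list[OF p] in simp)
  qed
  then show "\<alpha> \<in> opaths (chambers A) chE \<Longrightarrow> edge_path sal_cx (path_list \<alpha>)" by (cases \<alpha>) blast
qed

abbreviation eh (infix "\<approx>" 50) where "xs \<approx> ys \<equiv> edge_hom sal_cx xs ys"

lemma path_list_comp:
  assumes "\<beta> \<in> opaths (chambers A) chE" "opath_end \<alpha> = opath_begin \<beta>"
  shows "path_list \<alpha> @ path_list \<beta> \<approx> path_list (opath_comp \<alpha> \<beta>)"
proof -
  let ?b = "concat (map step_list (snd \<alpha>))"
  have a: "path_list \<alpha> = ?b @ [bottom (opath_begin \<beta>)]" using assms(2) by (simp add: path_list_def)
  have c: "path_list (opath_comp \<alpha> \<beta>) = ?b @ path_list \<beta>"
    using opath_end_comp[OF assms(2)] by (simp add: path_list_def) (simp add: opath_comp_def)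
  have "?b @ (hd (path_list \<beta>) # path_list \<beta>) \<approx> ?b @ path_list \<beta>"
    by (intro edge_hom_append edge_hom_refl edge_hom_absorb_left path_list_ends(1))
  then show ?thesis using hd_path_list[OF assms(1)] a c by simp
qed

text \<open>A nonempty path lists its last vertex twice and its first vertex once, so reversal
  agrees with \<open>path_list\<close> of the inverse only up to repeated end vertices.\<close>

lemma path_list_inv:
  assumes "\<alpha> \<in> opaths (chambers A) chE"
  shows "path_list (opath_inv \<alpha>) \<approx> rev (path_list \<alpha>)"
proof -
  obtain C ss where \<alpha>: "\<alpha> = (C, ss)" by (cases \<alpha>)
  let ?b = "concat (map step_list ss)"
  have e: "opath_end (opath_inv \<alpha>) = C" using opath_end_inv[OF assms] \<alpha> by simp
  have "concat (map step_list (snd (opath_inv \<alpha>))) = rev ?b"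
    by (simp add: \<alpha> opath_inv_eq rev_concat rev_map o_def)
  then have i: "path_list (opath_inv \<alpha>) = rev ?b @ [bottom C]" using e by (simp add: path_list_def)
  have r: "rev (path_list \<alpha>) = bottom (opath_end \<alpha>) # rev ?b" by (simp add: path_list_def \<alpha>)
  show ?thesis
  proof (cases "ss = []")
    case True
    then show ?thesis using i r \<alpha> by simp
  next
    case False
    then have ne: "rev ?b \<noteq> []" by (cases ss) auto
    have "hd ?b = bottom C" using False assms \<alpha> by (cases ss) (auto simp: hd_append)
    then have l: "last (rev ?b) = bottom C" using ne by (simp add: last_rev)
    have "last ?b = bottom (opath_end \<alpha>)"
      using False by (cases ss rule: rev_cases) (auto simp: \<alpha>)
    then have h: "hd (rev ?b) = bottom (opath_end \<alpha>)" using ne by (simp add: hd_rev)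
    have "path_list (opath_inv \<alpha>) \<approx> rev ?b"
      using edge_hom_absorb_right[OF ne, of sal_cx] l i by simp
    also have "rev ?b \<approx> rev (path_list \<alpha>)"
      using edge_hom_sym[OF edge_hom_absorb_left[OF ne, of sal_cx]] h r by simp
    finally show ?thesis .
  qed
qed

text \<open>A minimal gallery between chambers around \<open>F\<close> crosses only hyperplanes containing \<open>F\<close>, so its
  edge path stays below a single vertex over \<open>F\<close>.\<close>

lemma path_list_below:
  assumes "pmin (K, ss)" "D = opath_end (K, ss)" "C \<in> chambers A" "K \<in> chambers A" "F \<in> faces A"
    "face_ge F C" "face_ge F K" "face_ge F D" "sep_set A C K \<inter> sep_set A K D = {}"
  shows "successively (\<lambda>x y. {(F, C), x, y} \<in> sal_cx) (path_list (K, ss))"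
  using assms
proof (induction ss arbitrary: K)
  case (Cons s ss)
  obtain K1 H where k: "s = ((K, K1), True)" "(K, K1) \<in> chE" "pmin (K1, ss)" "opath_end (K1, ss) = D"
    "sep_set A K K1 = {H}" "H \<in> sep_set A K D" "sep_set A K1 D = sep_set A K D - {H}"
    using pmin_Cons[OF Cons.prems(1,2)] by metis
  note w = wall_props[OF k(2)]
  have ws: "face_sign (wall K K1) H' = (if H' = H then 0 else face_sign K H')" if "H' \<in> A" for H'
    using wall[OF k(2)] that by (simp add: is_exit_face_def k(5))
  have D: "D \<in> chambers A" using opath_end_in[OF chE_sub pmin_path[OF k(3)]] k(4) by simp
  have HA: "H \<in> A" using k(6) sep_setD by blast
  have K1s: "face_sign K1 H' = face_sign K H'" if "H' \<in> A" "H' \<noteq> H" for H'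
  proof (rule ccontr)
    assume "face_sign K1 H' \<noteq> face_sign K H'"
    then have "H' \<in> sep_set A K K1" using that(1) by (simp add: sep_set_def)
    then show False using k(5) that(2) by simp
  qed
  \<comment> \<open>H separates K from D while F lies in the closures of both, so F lies in
    H.\<close>
  have FH: "face_sign F H = 0"
    using face_geD[OF Cons.prems(7,5) chamber_face[OF Cons.prems(4)] HA]
      face_geD[OF Cons.prems(8,5) chamber_face[OF D] HA] sep_setD[OF k(6)] by auto
  have FK1: "face_ge F K1"
    unfolding face_ge_iff[OF arr Cons.prems(5) chamber_face[OF w(2)]]
    using face_geD[OF Cons.prems(7,5) chamber_face[OF Cons.prems(4)]] FH K1s by metis
  have FW: "face_ge F (wall K K1)"
    unfolding face_ge_iff[OF arr Cons.prems(5) w(3)]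
    using face_geD[OF Cons.prems(7,5) chamber_face[OF Cons.prems(4)]] FH ws by metis
  \<comment> \<open>By disjointness of the separating sets H has not been crossed between C and K.
    Hence C and K lie on the same side of H, which places the vertex over the wall below (F,
    C).\<close>
  have HC: "face_sign C H = face_sign K H" using k(6) Cons.prems(9) HA by (auto simp: sep_set_def)
  have CW: "chamber_at A C (wall K K1) = K"
    by (rule chamber_at_eqI[OF Cons.prems(3) w(3,1)]) (use ws HC chamber_nz[OF w(1)] in auto)
  have c: "(F, C) \<in> sal_poset" using Cons.prems by (simp add: sal_poset_def)
  have le: "sal_ge (F, C) (bottom K)" "sal_ge (F, C) (wall K K1, K)" "sal_ge (F, C) (bottom K1)"
    using sal_ge_bottom Cons.prems w FK1 FW CW by (auto simp: sal_ge_def[of] split: prod.splits)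
  have t: "{(F, C), bottom K, (wall K K1, K)} \<in> sal_cx" "{(F, C), (wall K K1, K), bottom K1} \<in> sal_cx"
    "{(F, C), bottom K1} \<in> sal_cx"
    using c le w sal_cx_pair[OF c bottom_in[OF w(2)]] by (auto intro!: sal_cx_triple simp: bottom_in)
  have "sep_set A C K1 \<subseteq> sep_set A C K \<union> {H}" unfolding k(5)[symmetric] by (auto simp: sep_set_def)
  then have "sep_set A C K1 \<inter> sep_set A K1 D = {}" using k(7) Cons.prems(9) by blast
  then have IH: "successively (\<lambda>x y. {(F, C), x, y} \<in> sal_cx) (path_list (K1, ss))"
    using Cons.IH[OF k(3) k(4)[symmetric]] Cons.prems w FK1 by blast
  have "hd (path_list (K1, ss)) = bottom K1" using hd_path_list[OF pmin_path[OF k(3)]] by simp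
  then show ?case using IH t path_list_ends(1)[of "(K1, ss)"]
    by (simp add: k(1) successively_Cons)
qed simp

lemma path_list_cone:
  assumes "pmin (K, ss)" "D = opath_end (K, ss)" "C \<in> chambers A" "K \<in> chambers A" "F \<in> faces A"
    "face_ge F C" "face_ge F K" "face_ge F D" "sep_set A C K \<inter> sep_set A K D = {}"
  shows "(F, C) # path_list (K, ss) \<approx> [(F, C), bottom D]"
proof -
  have c: "(F, C) \<in> sal_poset" using assms by (simp add: sal_poset_def)
  have "hd (path_list (K, ss)) = bottom K" using hd_path_list[OF pmin_path[OF assms(1)]] by simp
  then have "{(F, C), hd (path_list (K, ss))} \<in> sal_cx"
    using sal_cx_pair[OF c bottom_in[OF assms(4)]] sal_ge_bottom assms by simp
  from edge_hom_cone[OF abstract_sal_cx path_list_below[OF assms] path_list_ends(1) this]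
  show ?thesis using path_list_ends(2) assms(2) by simp
qed

text \<open>A spur to the vertex over F is inserted at the start, and the whole gallery is then
  coned off from that vertex.\<close>

lemma path_list_star:
  assumes "pmin (C, ss)" "D = opath_end (C, ss)" "C \<in> chambers A" "F \<in> faces A" "face_ge F C" "face_ge F D"
  shows "path_list (C, ss) \<approx> [bottom C, (F, C), bottom D]"
proof -
  have c: "(F, C) \<in> sal_poset" using assms by (simp add: sal_poset_def)
  have h: "hd (path_list (C, ss)) = bottom C" using hd_path_list[OF pmin_path[OF assms(1)]] by simp
  then obtain xs where xs: "path_list (C, ss) = bottom C # xs" using path_list_ends(1) by (metis list.collapse)
  have e: "{bottom C, (F, C)} \<in> sal_cx"
    using sal_cx_pair[OF bottom_in[OF assms(3)] c] sal_ge_bottom assms by simp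
  have "[] @ [bottom C] @ xs \<approx> [] @ [bottom C, (F, C), bottom C] @ xs"
    by (rule edge_hom_sym[OF edge_hom_spur[OF e]])
  then have "path_list (C, ss) \<approx> [bottom C] @ ((F, C) # path_list (C, ss))" using xs by simp
  also have "[bottom C] @ ((F, C) # path_list (C, ss)) \<approx> [bottom C] @ [(F, C), bottom D]"
    by (intro edge_hom_append edge_hom_refl path_list_cone) (use assms in auto)
  finally show ?thesis by simp
qed

section \<open>Minimal galleries with the same ends are homotopic\<close>

text \<open>C is left through F into the chamber of D around F. The choice of the remaining minimal
  gallery becomes harmless in the induction, where shorter galleries with common ends are already
  known to be homotopic.\<close>

definition exit_list :: "(real^'n) set \<Rightarrow> (real^'n) set \<Rightarrow> (real^'n) set \<Rightarrow> ((real^'n) set \<times> (real^'n) set) list" where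
  "exit_list C D F = [bottom C, (F, C), bottom (chamber_at A D F)] @ path_list (minimal_path A (chamber_at A D F) D)"

text \<open>M' inside M puts F' below F, so both detours lie under the one vertex (F, C). The
  gallery between the chambers K' and K behind F' and F crosses M - M' and is coned off from there;
  followed by the gallery to D it is still minimal. Since M' is nonempty, K' is nearer to D than C
  is, and the induction hypothesis, passed as a premise, compares it with the chosen
  gallery.\<close>

lemma exit_list_subset:
  assumes C: "C \<in> chambers A" and D: "D \<in> chambers A"
    and F: "is_exit_face C M F" and F': "is_exit_face C M' F'" and M: "M \<subseteq> sep_set A C D" "M' \<subseteq> M" "M' \<noteq> {}"
    and IH: "\<And>K \<alpha> \<beta>. K \<in> chambers A \<Longrightarrow> card (sep_set A K D) < card (sep_set A C D) \<Longrightarrow> pmin \<alpha> \<Longrightarrow> pmin \<beta> \<Longrightarrow>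
      opath_begin \<alpha> = K \<Longrightarrow> opath_begin \<beta> = K \<Longrightarrow> opath_end \<alpha> = D \<Longrightarrow> opath_end \<beta> = D \<Longrightarrow> path_list \<alpha> \<approx> path_list \<beta>"
  shows "exit_list C D F \<approx> exit_list C D F'"
proof -
  let ?K = "chamber_at A D F" and ?K' = "chamber_at A D F'"
  have M': "M' \<subseteq> sep_set A C D" using M by blast
  note e = exit_face_chamber[OF C D F M(1)] and e' = exit_face_chamber[OF C D F' M']
  have FF: "F \<in> faces A" "F' \<in> faces A" using F F' by (auto simp: is_exit_face_def)
  have FF': "face_ge F F'"
    unfolding face_ge_iff[OF arr FF] using F F' M(2) by (auto simp: is_exit_face_def)
  have FK': "face_ge F ?K'" using face_ge_trans[OF FF' e'(5)] .
  have c: "(F, C) \<in> sal_poset" "(F', C) \<in> sal_poset" using FF C e(4) e'(4) by (auto simp: sal_poset_def)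
  have cc: "sal_ge (F, C) (F', C)" using FF' chamber_at_self[OF FF(2) C e'(4)] by (simp add: sal_ge_def)
  have t1: "{bottom C, (F, C), (F', C)} \<in> sal_cx" "{(F, C), (F', C), bottom ?K'} \<in> sal_cx"
  proof -
    have "{(F, C), (F', C), bottom C} \<in> sal_cx"
      by (rule sal_cx_triple) (use c cc sal_ge_bottom C e e' bottom_in in auto)
    then show "{bottom C, (F, C), (F', C)} \<in> sal_cx" by (simp add: insert_commute)
    show "{(F, C), (F', C), bottom ?K'} \<in> sal_cx"
      by (rule sal_cx_triple) (use c cc sal_ge_bottom C e e' bottom_in FK' in auto)
  qed
  let ?\<mu> = "minimal_path A ?K' ?K" and ?\<nu> = "minimal_path A ?K D" and ?\<nu>' = "minimal_path A ?K' D"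
  note mu = minimal_path_props[OF e'(1) e(1)] and nu = minimal_path_props[OF e(1) D]
    and nu' = minimal_path_props[OF e'(1) D]
  have KK: "sep_set A ?K' ?K = M - M'"
    using sep_set_diff[OF e'(1) C e(1)] e(2) e'(2) sep_set_sym[of C ?K'] M(2) by auto
  have pc: "pmin (opath_comp ?\<mu> ?\<nu>)"
    by (rule pmin_comp) (use mu nu KK e in auto)
  have cardlt: "card (sep_set A ?K' D) < card (sep_set A C D)"
    unfolding e'(3) by (rule psubset_card_mono) (use M' M(3) in auto)
  have 1: "path_list (opath_comp ?\<mu> ?\<nu>) \<approx> path_list ?\<nu>'"
    by (rule IH[OF e'(1) cardlt pc nu'(1)])
       (simp_all add: mu nu nu' opath_end_comp[of ?\<mu> ?\<nu>])
  have 2: "path_list ?\<mu> @ path_list ?\<nu> \<approx> path_list (opath_comp ?\<mu> ?\<nu>)"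
    by (rule path_list_comp) (use pmin_path nu mu in auto)
  obtain ms where ms: "?\<mu> = (?K', ms)" using mu(2) by (cases ?\<mu>) auto
  have 3: "(F, C) # path_list ?\<mu> \<approx> [(F, C), bottom ?K]"
    unfolding ms
    by (rule path_list_cone) (use mu ms C e e' FF FK' KK M in auto)
  have h: "path_list ?\<mu> = bottom ?K' # tl (path_list ?\<mu>)"
    using hd_path_list[OF pmin_path[OF mu(1)]] mu(2) path_list_ends(1) by (metis list.collapse)
  have "exit_list C D F \<approx> [bottom C] @ ((F, C) # path_list ?\<mu>) @ path_list ?\<nu>"
    unfolding exit_list_def using edge_hom_append_middle[OF edge_hom_sym[OF 3], of "[bottom C]" "path_list ?\<nu>"] by simp
  also have "[bottom C] @ ((F, C) # path_list ?\<mu>) @ path_list ?\<nu> \<approx> [bottom C, (F', C)] @ path_list ?\<mu> @ path_list ?\<nu>"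
  proof -
    have "[bottom C, (F, C), bottom ?K'] \<approx> [bottom C, (F, C), (F', C), bottom ?K']"
      using edge_hom_sym[OF edge_hom_tri[OF t1(2), of "[bottom C]" "[]"]] by simp
    also have "[bottom C, (F, C), (F', C), bottom ?K'] \<approx> [bottom C, (F', C), bottom ?K']"
      using edge_hom_tri[OF t1(1), of "[]" "[bottom ?K']"] by simp
    finally have "[] @ [bottom C, (F, C), bottom ?K'] @ (tl (path_list ?\<mu>) @ path_list ?\<nu>) \<approx>
       [] @ [bottom C, (F', C), bottom ?K'] @ (tl (path_list ?\<mu>) @ path_list ?\<nu>)"
      by (rule edge_hom_append_middle)
    then show ?thesis by (subst h, subst (2) h) simp
  qed
  also have "[bottom C, (F', C)] @ path_list ?\<mu> @ path_list ?\<nu> \<approx> [bottom C, (F', C)] @ path_list ?\<nu>'"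
    by (intro edge_hom_append edge_hom_refl edge_hom_trans[OF 2 1])
  also have "[bottom C, (F', C)] @ path_list ?\<nu>' \<approx> exit_list C D F'"
  proof -
    have "bottom ?K' # path_list ?\<nu>' \<approx> path_list ?\<nu>'"
      using edge_hom_absorb_left[OF path_list_ends(1), of sal_cx ?\<nu>'] hd_path_list[OF pmin_path[OF nu'(1)]] nu'(2) by simp
    from edge_hom_append[OF edge_hom_refl edge_hom_sym[OF this], of "[bottom C, (F', C)]"]
    show ?thesis by (simp add: exit_list_def)
  qed
  finally show ?thesis .
qed

definition exit_face :: "(real^'n) set \<Rightarrow> (real^'n) set \<Rightarrow> real^'n \<Rightarrow> real^'n \<Rightarrow> (real^'n) set" where
  "exit_face C D y p = (SOME F. is_exit_face C (first_crossed (sep_set A C D) y p) F)"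

lemma exit_face:
  assumes "C \<in> chambers A" "D \<in> chambers A" "p \<in> C" "y \<in> D" "sep_set A C D \<noteq> {}"
  shows "is_exit_face C (first_crossed (sep_set A C D) y p) (exit_face C D y p)"
  unfolding exit_face_def by (rule someI_ex[OF exit_face_exists[OF assms]])

text \<open>Hyperplanes crossed strictly later than \<open>H0\<close> from p are so from all nearby
  points, by continuity of the crossing parameters. First crossings can be lost near p but not
  gained, which is the inclusion wanted by \<open>exit_list_subset\<close>.\<close>

lemma first_crossed_locally:
  assumes C: "C \<in> chambers A" and D: "D \<in> chambers A" and p: "p \<in> C" and y: "y \<in> D"
    and ne: "sep_set A C D \<noteq> {}"
  shows "\<exists>T. openin (top_of_set C) T \<and> p \<in> T \<and>
    (\<forall>x\<in>T. first_crossed (sep_set A C D) y x \<subseteq> first_crossed (sep_set A C D) y p)"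
proof -
  let ?S = "sep_set A C D" and ?M = "first_crossed (sep_set A C D) y"
  obtain H0 where H0: "H0 \<in> ?M p" using first_crossed_nonempty[OF finite_sep ne] by blast
  then have H0S: "H0 \<in> ?S" and least: "\<And>H. H \<in> ?S \<Longrightarrow> cross_par y H0 p \<le> cross_par y H p"
    by (auto simp: first_crossed_def)
  define B where "B = ?S - ?M p"
  define T where "T = C \<inter> (\<Inter>H\<in>B. {x \<in> C. cross_par y H0 x < cross_par y H x})"
  have cont: "continuous_on C (\<lambda>x. cross_par y H x)" if "H \<in> ?S" for H
    unfolding cross_par_def
    by (intro continuous_intros) (use cross_par_pos(4)[OF C D _ y that] in blast)
  have "openin (top_of_set C) {x \<in> C. cross_par y H0 x < cross_par y H x}" if "H \<in> B" for H
  proof -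
    have "H \<in> ?S" using that by (simp add: B_def)
    then have "open (C \<inter> (\<lambda>x. cross_par y H x - cross_par y H0 x) -` {0<..})"
      by (intro continuous_open_preimage open_chamber[OF C] continuous_on_diff cont H0S) simp_all
    moreover have "C \<inter> (\<lambda>x. cross_par y H x - cross_par y H0 x) -` {0<..} = {x \<in> C. cross_par y H0 x < cross_par y H x}"
      by auto
    ultimately show ?thesis using open_openin_trans[OF open_chamber[OF C]] by auto
  qed
  moreover have "finite B" by (simp add: B_def)
  ultimately have "openin (top_of_set C) T"
    unfolding T_def by (cases "B = {}") (auto intro!: openin_Int openin_INT)
  moreover have "p \<in> T"
  proof -
    have "cross_par y H0 p < cross_par y H p" if "H \<in> B" for H
    proof (rule ccontr)
      assume n: "\<not> cross_par y H0 p < cross_par y H p"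
      have "H \<in> ?M p" unfolding first_crossed_def
      proof (intro CollectI conjI ballI)
        show "H \<in> ?S" using that by (simp add: B_def)
        fix H' assume "H' \<in> ?S"
        from least[OF this] n show "cross_par y H p \<le> cross_par y H' p" by linarith
      qed
      then show False using that by (simp add: B_def)
    qed
    then show ?thesis using p by (auto simp: T_def)
  qed
  moreover have "?M x \<subseteq> ?M p" if x: "x \<in> T" for x
  proof
    fix H assume H: "H \<in> ?M x"
    then have HS: "H \<in> ?S" and "cross_par y H x \<le> cross_par y H0 x" using H0S by (auto simp: first_crossed_def)
    then have "H \<notin> B" using x by (auto simp: T_def)
    then show "H \<in> ?M p" using HS by (simp add: B_def)
  qed
  ultimately show ?thesis by blast
qed

text \<open>The point is found by prolonging the segment from \<open>y\<close> to a point of the wall slightly into \<open>C\<close>.\<close>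

lemma exit_through_wall:
  assumes CK: "(C, K) \<in> chE" and D: "D \<in> chambers A" and y: "y \<in> D"
    and H: "sep_set A C K = {H}" "H \<in> sep_set A C D"
  shows "\<exists>p\<in>C. first_crossed (sep_set A C D) y p = {H}"
proof -
  note w = wall_props[OF CK]
  have C: "C \<in> chambers A" by (rule w(1))
  obtain g where g: "g \<in> wall C K" using face_nonempty[OF w(3)] by blast
  have HA: "H \<in> A" and Hs: "face_sign C H \<noteq> face_sign D H" using sep_setD[OF H(2)] by auto
  have sg: "sgn (hyp_form H' g) = (if H' = H then 0 else face_sign C H')" if "H' \<in> A" for H'
    using sign_mem[OF w(3) g that] wall[OF CK] that H(1) by (auto simp: is_exit_face_def)
  have sy: "sgn (hyp_form H' y) = face_sign D H'" if "H' \<in> A" for H'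
    using sign_mem[OF chamber_face[OF D] y that] .
  have g0: "hyp_form H g = 0" using sg[OF HA] by (simp add: sgn_zero_iff)
  \<comment> \<open>The negative weight prolongs the segment from y to g beyond g by e times its
    length.\<close>
  let ?p = "\<lambda>e. (1 - (- e)) *\<^sub>R g + (- e) *\<^sub>R y"
  have f: "hyp_form H' (?p e) = (1 + e) * hyp_form H' g - e * hyp_form H' y" for H' e
    unfolding hyp_form_linear by simp
  have "\<forall>\<^sub>F e in at_right (0::real). \<forall>H'\<in>A. sgn (hyp_form H' (?p e)) = face_sign C H'"
  proof (rule eventually_ball_finite[OF finite_A], rule ballI)
    fix H' assume H': "H' \<in> A"
    show "\<forall>\<^sub>F e in at_right (0::real). sgn (hyp_form H' (?p e)) = face_sign C H'"
    proof (cases "H' = H")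
      case True
      have "sgn (hyp_form H' (?p e)) = face_sign C H'" if "e > 0" for e
        using that g0 sy[OF H'] Hs chamber_sign[OF C HA] chamber_sign[OF D HA] True
        unfolding f by (auto simp: sgn_mult)
      then show ?thesis by (rule eventually_mono[OF eventually_at_right_less[of "0::real"]])
    next
      case False
      have lim: "((\<lambda>e. hyp_form H' (?p e)) \<longlongrightarrow> (1 + 0) * hyp_form H' g - 0 * hyp_form H' y) (at_right 0)"
        unfolding f by (intro tendsto_intros)
      have s: "sgn (hyp_form H' g) = face_sign C H'" using sg[OF H'] False by simp
      then consider "hyp_form H' g > 0" | "hyp_form H' g < 0"
        using chamber_nz[OF C H'] by (metis linorder_neqE_linordered_idom sgn_0)
      then show ?thesis
      proof cases
        case 1
        then have "\<forall>\<^sub>F e in at_right 0. hyp_form H' (?p e) > 0" using order_tendstoD(1)[OF lim, of 0] by simp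
        then show ?thesis by eventually_elim (use 1 s in auto)
      next
        case 2
        then have "\<forall>\<^sub>F e in at_right 0. hyp_form H' (?p e) < 0" using order_tendstoD(2)[OF lim, of 0] by simp
        then show ?thesis by eventually_elim (use 2 s in auto)
      qed
    qed
  qed
  then have "\<forall>\<^sub>F e in at_right (0::real). 0 < e \<and> (\<forall>H'\<in>A. sgn (hyp_form H' (?p e)) = face_sign C H')"
    using eventually_at_right_less[of "0::real"] eventually_conj by blast
  then obtain e where e: "0 < e" "\<forall>H'\<in>A. sgn (hyp_form H' (?p e)) = face_sign C H'"
    using eventually_happens'[OF trivial_limit_at_right_real] by blast
  have pC: "?p e \<in> C" using e(2) mem_face_iff[OF arr chamber_face[OF C]] by blast
  have y0: "hyp_form H y \<noteq> 0" using sy[OF HA] chamber_nz[OF D HA] by auto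
  \<comment> \<open>The point g divides the segment from \<open>?p e\<close> to y at parameter e /
    (1 + e), and the form of H vanishes at g.\<close>
  have cH: "cross_par y H (?p e) = e / (1 + e)"
  proof -
    have "cross_par y H (?p e) = (e * - hyp_form H y) / ((1 + e) * - hyp_form H y)"
      unfolding cross_par_def f g0 by (simp only: mult_zero_right distrib_right) simp
    then show ?thesis using y0 e(1) by simp
  qed
  have lt: "e / (1 + e) < cross_par y H' (?p e)" if H': "H' \<in> sep_set A C D" "H' \<noteq> H" for H'
  proof -
    have HA': "H' \<in> A" and Hs': "face_sign C H' \<noteq> face_sign D H'" using sep_setD[OF H'(1)] by auto
    have s: "sgn (hyp_form H' g) = face_sign C H'" using sg[OF HA'] H'(2) by simp
    then have sgy: "hyp_form H' g > 0 \<and> hyp_form H' y < 0 \<or> hyp_form H' g < 0 \<and> hyp_form H' y > 0"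
      using sy[OF HA'] Hs' chamber_sign[OF C HA'] chamber_sign[OF D HA'] by (auto simp: sgn_if split: if_splits)
    then have d: "hyp_form H' g - hyp_form H' y \<noteq> 0" by auto
    \<comment> \<open>Beyond the parameter of g there remains the crossing parameter counted from g,
      scaled by the remaining fraction 1 / (1 + e) of the segment. It is positive because H'
      separates g from y.\<close>
    have "cross_par y H' (?p e) = ((1 + e) * hyp_form H' g - e * hyp_form H' y) / ((1 + e) * (hyp_form H' g - hyp_form H' y))"
      unfolding cross_par_def f by (simp add: algebra_simps)
    also have "\<dots> = e / (1 + e) + (hyp_form H' g / (hyp_form H' g - hyp_form H' y)) / (1 + e)"
      using d e(1) by (simp add: divide_simps) (simp add: algebra_simps)
    finally have eq: "cross_par y H' (?p e) = e / (1 + e) + (hyp_form H' g / (hyp_form H' g - hyp_form H' y)) / (1 + e)" .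
    have "hyp_form H' g / (hyp_form H' g - hyp_form H' y) > 0"
      using sgy by (auto simp: zero_less_divide_iff)
    then have "(hyp_form H' g / (hyp_form H' g - hyp_form H' y)) / (1 + e) > 0"
      by (rule divide_pos_pos) (use e(1) in simp)
    then show ?thesis unfolding eq by linarith
  qed
  have "first_crossed (sep_set A C D) y (?p e) = {H}"
  proof (intro equalityI subsetI)
    fix H' assume H': "H' \<in> first_crossed (sep_set A C D) y (?p e)"
    then have "H' \<in> sep_set A C D" "cross_par y H' (?p e) \<le> cross_par y H (?p e)"
      using H(2) by (auto simp: first_crossed_def)
    then show "H' \<in> {H}" using lt[of H'] cH by (metis linorder_not_less singletonI)
  next
    fix H' assume "H' \<in> {H}"
    moreover have "cross_par y H (?p e) \<le> cross_par y H'' (?p e)" if "H'' \<in> sep_set A C D" for H''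
      using lt[OF that] cH by (cases "H'' = H") auto
    ultimately show "H' \<in> first_crossed (sep_set A C D) y (?p e)"
      using H(2) unfolding first_crossed_def by blast
  qed
  then show ?thesis using pC by blast
qed

text \<open>Every \<open>p \<in> C\<close> gives the list that passes around the face where the segment from \<open>p\<close> to \<open>y\<close> leaves \<open>C\<close>.
  By induction its class is locally constant in \<open>p\<close>, hence constant on the connected set \<open>C\<close>, and every
  minimal gallery is of this form for some \<open>p\<close>.\<close>

theorem minimal_galleries_homotopic:
  assumes "pmin \<alpha>" "pmin \<beta>" "opath_begin \<alpha> = C" "opath_begin \<beta> = C" "opath_end \<alpha> = D" "opath_end \<beta> = D"
  shows "path_list \<alpha> \<approx> path_list \<beta>"
  using assms
proof (induction "card (sep_set A C D)" arbitrary: C \<alpha> \<beta> rule: less_induct)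
  case less
  have C: "C \<in> chambers A" and D: "D \<in> chambers A"
    using opath_begin_in[OF pmin_path[OF less.prems(1)]] opath_end_in'[OF chE_sub pmin_path[OF less.prems(1)]] less.prems
    by simp_all
  show ?case
  proof (cases "sep_set A C D = {}")
    case True
    have nil: "\<gamma> = (C, [])" if g0: "pmin \<gamma>" "opath_begin \<gamma> = C" "opath_end \<gamma> = D" for \<gamma>
    proof -
      obtain ss where g: "\<gamma> = (C, ss)" using g0(2) by (cases \<gamma>) auto
      have "length ss = card (sep_set A C D)" using g0(1,3) pmin_iff[of C ss] by (simp add: g)
      then show ?thesis using True by (simp add: g)
    qed
    have "\<alpha> = \<beta>" using nil[OF less.prems(1,3,5)] nil[OF less.prems(2,4,6)] by simp
    then show ?thesis by simp
  next
    case ne: False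
    let ?S = "sep_set A C D"
    obtain y where y: "y \<in> D" using chamber_nonempty[OF D] ..
    let ?X = "\<lambda>p. exit_list C D (exit_face C D y p)"
    note ef = exit_face[OF C D _ y ne]
    have sub: "first_crossed ?S y p \<subseteq> ?S" for p by (auto simp: first_crossed_def)
    have const: "?X p \<approx> ?X p'" if pp: "p \<in> C" "p' \<in> C" for p p'
    proof (rule connected_equivalence_relation[OF convex_connected[OF convex_chamber[OF C]] pp])
      fix p assume p: "p \<in> C"
      obtain T where T: "openin (top_of_set C) T" "p \<in> T"
        "\<And>x. x \<in> T \<Longrightarrow> first_crossed ?S y x \<subseteq> first_crossed ?S y p"
        using first_crossed_locally[OF C D p y ne] by blast
      have "?X p \<approx> ?X x" if x: "x \<in> T" for x
      proof (rule exit_list_subset[OF C D ef[OF p] ef _ T(3)[OF x]])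
        show "x \<in> C" using x openin_imp_subset[OF T(1)] by blast
        show "first_crossed ?S y p \<subseteq> ?S" by (rule sub)
        show "first_crossed ?S y x \<noteq> {}" by (rule first_crossed_nonempty[OF finite_sep ne])
      qed (rule less.hyps)
      then show "\<exists>T. openin (top_of_set C) T \<and> p \<in> T \<and> (\<forall>x\<in>T. ?X p \<approx> ?X x)" using T by blast
    qed (auto intro: edge_hom_sym edge_hom_trans)
    have reach: "\<exists>p\<in>C. path_list \<gamma> \<approx> ?X p" if g: "pmin \<gamma>" "opath_begin \<gamma> = C" "opath_end \<gamma> = D" for \<gamma>
    proof -
      obtain ss where gs: "\<gamma> = (C, ss)" using g(2) by (cases \<gamma>) auto
      have "ss \<noteq> []" using g(1,3) ne pmin_iff[of C ss] gs by auto
      then obtain s ss' where ss: "ss = s # ss'" by (cases ss) auto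
      obtain K H where k: "s = ((C, K), True)" "(C, K) \<in> chE" "pmin (K, ss')" "opath_end (K, ss') = D"
        "sep_set A C K = {H}" "H \<in> ?S" "sep_set A K D = ?S - {H}"
        by (rule pmin_Cons[of C s ss' D]) (use g gs ss in auto)
      obtain p where p: "p \<in> C" "first_crossed ?S y p = {H}"
        using exit_through_wall[OF k(2) D y k(5,6)] by blast
      have F: "exit_face C D y p = wall C K"
        using is_exit_face_unique[OF ef[OF p(1)]] wall[OF k(2)] p(2) k(5) by simp
      have K: "chamber_at A D (wall C K) = K"
      proof (rule chamber_at_eqI[OF D])
        show "wall C K \<in> faces A" "K \<in> chambers A" using wall_props[OF k(2)] by auto
        fix H' assume H': "H' \<in> A"
        have "face_sign (wall C K) H' = (if H' = H then 0 else face_sign C H')"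
          using wall[OF k(2)] H' k(5) by (simp add: is_exit_face_def)
        moreover have "face_sign K H' = face_sign C H'" if "H' \<noteq> H"
        proof (rule ccontr)
          assume "face_sign K H' \<noteq> face_sign C H'"
          then have "H' \<in> sep_set A C K" using H' by (simp add: sep_set_def)
          then show False using that k(5) by simp
        qed
        moreover have "face_sign K H = face_sign D H"
        proof (rule ccontr)
          assume "face_sign K H \<noteq> face_sign D H"
          then have "H \<in> sep_set A K D" using sep_setD[OF k(6)] by (simp add: sep_set_def)
          then show False using k(7) by simp
        qed
        ultimately show "face_sign K H' = (if face_sign (wall C K) H' = 0 then face_sign D H' else face_sign (wall C K) H')"
          using chamber_nz[OF C H'] by auto
      qed
      have Kc: "K \<in> chambers A" using wall_props[OF k(2)] by simp
      note mu = minimal_path_props[OF Kc D]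
      have lt: "card (sep_set A K D) < card ?S" unfolding k(7) by (rule psubset_card_mono) (use k(6) in auto)
      have IH: "path_list (K, ss') \<approx> path_list (minimal_path A K D)"
        by (rule less.hyps[OF lt k(3) mu(1)]) (use mu k in simp_all)
      have "path_list \<gamma> = [bottom C, (wall C K, C), bottom K] @ path_list (K, ss')" by (simp add: gs ss k(1))
      also have "\<dots> \<approx> [bottom C, (wall C K, C), bottom K] @ path_list (minimal_path A K D)"
        by (intro edge_hom_append edge_hom_refl IH)
      also have "\<dots> = ?X p" by (simp add: exit_list_def F K)
      finally show ?thesis using p(1) by blast
    qed
    obtain p where p: "p \<in> C" "path_list \<alpha> \<approx> ?X p"
      using reach[OF less.prems(1,3,5)] by (elim bexE)
    obtain q where q: "q \<in> C" "path_list \<beta> \<approx> ?X q"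
      using reach[OF less.prems(2,4,6)] by (elim bexE)
    show ?thesis
      using edge_hom_trans[OF edge_hom_trans[OF p(2) const[OF p(1) q(1)]] edge_hom_sym[OF q(2)]] .
  qed
qed

section \<open>The relation of the oriented system is realized in the complex\<close>

abbreviation "chV \<equiv> chambers A"

definition list_rel :: "(real^'n) set opath rel" where
  "list_rel = {(\<alpha>, \<beta>). \<alpha> \<in> opaths chV chE \<and> \<beta> \<in> opaths chV chE \<and> opath_begin \<alpha> = opath_begin \<beta> \<and>
     opath_end \<alpha> = opath_end \<beta> \<and> path_list \<alpha> \<approx> path_list \<beta>}"

lemma path_list_rinv:
  assumes "\<alpha> \<in> opaths chV chE"
  shows "path_list (opath_comp \<alpha> (opath_inv \<alpha>)) \<approx> [bottom (opath_begin \<alpha>)]"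
proof -
  have "path_list (opath_comp \<alpha> (opath_inv \<alpha>)) \<approx> path_list \<alpha> @ path_list (opath_inv \<alpha>)"
    by (rule edge_hom_sym[OF path_list_comp]) (use opath_inv_in[OF chE_sub assms] in auto)
  also have "\<dots> \<approx> path_list \<alpha> @ rev (path_list \<alpha>)"
    by (intro edge_hom_append edge_hom_refl path_list_inv assms)
  also have "\<dots> \<approx> [hd (path_list \<alpha>)]"
    using edge_hom_rinv edge_path_path_list[OF assms] by (auto simp: edge_path_def)
  finally show ?thesis using hd_path_list[OF assms] by simp
qed

lemma path_relation_list_rel: "path_relation chV chE list_rel"
proof (rule path_relationI)
  note inv = opath_inv_in[OF chE_sub]
  show "(opath_comp \<alpha> (opath_inv \<alpha>), opath_const (opath_begin \<alpha>)) \<in> list_rel" if a: "\<alpha> \<in> opaths chV chE" for \<alpha>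
    using path_list_rinv[OF a] a inv[OF a] opath_begin_in[OF a]
    by (auto simp: list_rel_def opath_comp_in opath_end_comp)
  show "(opath_inv \<alpha>, opath_inv \<beta>) \<in> list_rel" if ab: "(\<alpha>, \<beta>) \<in> list_rel" for \<alpha> \<beta>
  proof -
    have a: "\<alpha> \<in> opaths chV chE" and b: "\<beta> \<in> opaths chV chE" and r: "path_list \<alpha> \<approx> path_list \<beta>"
      using ab by (auto simp: list_rel_def)
    have "path_list (opath_inv \<alpha>) \<approx> path_list (opath_inv \<beta>)"
      using edge_hom_trans[OF edge_hom_trans[OF path_list_inv[OF a] edge_hom_rev[OF r]] edge_hom_sym[OF path_list_inv[OF b]]] .
    then show ?thesis using ab a b inv by (auto simp: list_rel_def)
  qed
  show "(opath_comp \<gamma>\<^sub>1 (opath_comp \<alpha> \<gamma>\<^sub>2), opath_comp \<gamma>\<^sub>1 (opath_comp \<beta> \<gamma>\<^sub>2)) \<in> list_rel"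
    if ab: "(\<alpha>, \<beta>) \<in> list_rel" and g: "\<gamma>\<^sub>1 \<in> opaths chV chE" "\<gamma>\<^sub>2 \<in> opaths chV chE"
      "opath_end \<gamma>\<^sub>1 = opath_begin \<alpha>" "opath_end \<alpha> = opath_begin \<gamma>\<^sub>2" for \<alpha> \<beta> \<gamma>\<^sub>1 \<gamma>\<^sub>2
  proof -
    have r: "path_list \<alpha> \<approx> path_list \<beta>" using ab by (auto simp: list_rel_def)
    have c: "path_list \<gamma>\<^sub>1 @ path_list \<delta> @ path_list \<gamma>\<^sub>2 \<approx> path_list (opath_comp \<gamma>\<^sub>1 (opath_comp \<delta> \<gamma>\<^sub>2)) \<and>
       opath_comp \<gamma>\<^sub>1 (opath_comp \<delta> \<gamma>\<^sub>2) \<in> opaths chV chE \<and>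
       opath_end (opath_comp \<gamma>\<^sub>1 (opath_comp \<delta> \<gamma>\<^sub>2)) = opath_end \<gamma>\<^sub>2"
      if d: "\<delta> \<in> opaths chV chE" "opath_begin \<delta> = opath_begin \<alpha>" "opath_end \<delta> = opath_end \<alpha>" for \<delta>
    proof -
      have dg: "opath_comp \<delta> \<gamma>\<^sub>2 \<in> opaths chV chE" using opath_comp_in d g by metis
      have "path_list \<gamma>\<^sub>1 @ path_list \<delta> @ path_list \<gamma>\<^sub>2 \<approx> path_list \<gamma>\<^sub>1 @ path_list (opath_comp \<delta> \<gamma>\<^sub>2)"
        by (intro edge_hom_append edge_hom_refl path_list_comp) (use d g in auto)
      also have "\<dots> \<approx> path_list (opath_comp \<gamma>\<^sub>1 (opath_comp \<delta> \<gamma>\<^sub>2))"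
        by (rule path_list_comp[OF dg]) (use d g in auto)
      finally show ?thesis
        using opath_comp_in[OF g(1) dg] d g by (auto simp: opath_end_comp)
    qed
    have a: "\<alpha> \<in> opaths chV chE" and b: "\<beta> \<in> opaths chV chE" "opath_begin \<beta> = opath_begin \<alpha>" "opath_end \<beta> = opath_end \<alpha>"
      using ab by (auto simp: list_rel_def)
    note ca = c[OF a refl refl] and cb = c[OF b]
    have "path_list \<gamma>\<^sub>1 @ path_list \<alpha> @ path_list \<gamma>\<^sub>2 \<approx> path_list \<gamma>\<^sub>1 @ path_list \<beta> @ path_list \<gamma>\<^sub>2"
      by (rule edge_hom_append_middle[OF r])
    then have "path_list (opath_comp \<gamma>\<^sub>1 (opath_comp \<alpha> \<gamma>\<^sub>2)) \<approx> path_list (opath_comp \<gamma>\<^sub>1 (opath_comp \<beta> \<gamma>\<^sub>2))"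
      using edge_hom_trans[OF edge_hom_trans[OF edge_hom_sym[OF conjunct1[OF ca]]] conjunct1[OF cb]] by blast
    then show ?thesis using ca cb by (simp add: list_rel_def)
  qed
qed (auto simp: list_rel_def intro: edge_hom_sym edge_hom_trans)

text \<open>The relation of the oriented system is the least path relation containing all pairs of
  minimal galleries with common ends. It is enough that \<open>list_rel\<close> is a path relation
  and contains these pairs.\<close>

lemma prel_subset_list_rel: "prel (arrangement_system A) \<subseteq> list_rel"
  unfolding arrangement_system_def osys.simps
proof (rule generated_relation_subset[OF path_relation_list_rel], rule subrelI)
  fix \<alpha> \<beta> assume "(\<alpha>, \<beta>) \<in> {(\<alpha>, \<beta>). pmin \<alpha> \<and> pmin \<beta> \<and> opath_begin \<alpha> = opath_begin \<beta> \<and> opath_end \<alpha> = opath_end \<beta>}"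
  then have ab: "pmin \<alpha>" "pmin \<beta>" "opath_begin \<alpha> = opath_begin \<beta>" "opath_end \<alpha> = opath_end \<beta>" by auto
  then show "(\<alpha>, \<beta>) \<in> list_rel"
    using minimal_galleries_homotopic[OF ab(1,2) refl _ refl] pmin_path by (auto simp: list_rel_def)
qed

end

section \<open>Coverings of posets\<close>

text \<open>An element comparable with f p has exactly one lift comparable with p: the down
  conditions give it below p, the up conditions above p, and an element on both sides of f p equals
  f p. The lifts of a chain form a chain: on the same side of p their relation is lifted, on
  opposite sides they are compared through p.\<close>

lemma star_bijective_order_complex:
  assumes f: "\<And>x. x \<in> P \<Longrightarrow> f x \<in> Q"
    and mono: "\<And>x y. x \<in> P \<Longrightarrow> y \<in> P \<Longrightarrow> ge x y \<Longrightarrow> ge' (f x) (f y)"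
    and refl: "\<And>x. x \<in> P \<Longrightarrow> ge x x"
    and trans: "\<And>x y z. x \<in> P \<Longrightarrow> y \<in> P \<Longrightarrow> z \<in> P \<Longrightarrow> ge x y \<Longrightarrow> ge y z \<Longrightarrow> ge x z"
    and antisym': "\<And>x y. x \<in> Q \<Longrightarrow> y \<in> Q \<Longrightarrow> ge' x y \<Longrightarrow> ge' y x \<Longrightarrow> x = y"
    and down_ex: "\<And>x q. x \<in> P \<Longrightarrow> q \<in> Q \<Longrightarrow> ge' (f x) q \<Longrightarrow> \<exists>y\<in>P. ge x y \<and> f y = q"
    and down_uniq: "\<And>x y z. x \<in> P \<Longrightarrow> y \<in> P \<Longrightarrow> z \<in> P \<Longrightarrow> ge x y \<Longrightarrow> ge x z \<Longrightarrow> f y = f z \<Longrightarrow> y = z"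
    and up_ex: "\<And>x q. x \<in> P \<Longrightarrow> q \<in> Q \<Longrightarrow> ge' q (f x) \<Longrightarrow> \<exists>y\<in>P. ge y x \<and> f y = q"
    and up_uniq: "\<And>x y z. x \<in> P \<Longrightarrow> y \<in> P \<Longrightarrow> z \<in> P \<Longrightarrow> ge y x \<Longrightarrow> ge z x \<Longrightarrow> f y = f z \<Longrightarrow> y = z"
  shows "star_bijective (order_complex P ge) (order_complex Q ge') f"
proof -
  have inj: "x = y" if "x \<in> P" "y \<in> P" "ge x y \<or> ge y x" "f x = f y" for x y
    using that down_uniq[of x x y] down_uniq[of y x y] refl by blast
  have comp_uniq: "x = y" if "p \<in> P" "x \<in> P" "y \<in> P" "ge p x \<or> ge x p" "ge p y \<or> ge y p" "f x = f y" for p x y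
  proof (cases "ge p x \<and> ge p y \<or> ge x p \<and> ge y p")
    case True then show ?thesis using down_uniq up_uniq that by blast
  next
    case False
    then have "ge' (f p) (f x)" "ge' (f x) (f p)" using that mono by metis+
    then have "f x = f p" using antisym' f that by blast
    then have "x = p" "y = p" using inj that by metis+
    then show ?thesis by simp
  qed
  show ?thesis
    unfolding star_bijective_def
  proof (intro conjI ballI impI)
    fix \<sigma> assume s: "\<sigma> \<in> order_complex P ge"
    show "f ` \<sigma> \<in> order_complex Q ge'"
      using s f mono unfolding order_complex_def by (auto simp: subset_iff) metis
    show "inj_on f \<sigma>" using s inj unfolding order_complex_def inj_on_def by blast
  next
    fix p \<tau> assume p: "p \<in> \<Union>(order_complex P ge)" and t: "\<tau> \<in> order_complex Q ge'" and pt: "f p \<in> \<tau>"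
    have pP: "p \<in> P" using p by (auto simp: order_complex_def)
    have tQ: "\<tau> \<subseteq> Q" "finite \<tau>" and tc: "\<And>x y. x \<in> \<tau> \<Longrightarrow> y \<in> \<tau> \<Longrightarrow> ge' x y \<or> ge' y x"
      using t by (auto simp: order_complex_def)
    have "\<exists>x. x \<in> P \<and> (ge p x \<or> ge x p) \<and> f x = q" if "q \<in> \<tau>" for q
      using tc[OF pt that] down_ex[OF pP] up_ex[OF pP] tQ that by (metis subsetD)
    then obtain g where g: "\<And>q. q \<in> \<tau> \<Longrightarrow> g q \<in> P \<and> (ge p (g q) \<or> ge (g q) p) \<and> f (g q) = q" by metis
    have gu: "g q = x" if "q \<in> \<tau>" "x \<in> P" "ge p x \<or> ge x p" "f x = q" for q x
      using comp_uniq[OF pP] g[OF that(1)] that by blast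
    have gp: "g (f p) = p" using gu[OF pt pP] refl[OF pP] by blast
    have chain: "ge (g q) (g r)" if qr: "q \<in> \<tau>" "r \<in> \<tau>" "ge' q r" for q r
    proof -
      note gq = g[OF qr(1)] and gr = g[OF qr(2)]
      obtain y where y: "y \<in> P" "ge (g q) y" "f y = r" using down_ex[of "g q" r] gq qr tQ by auto
      obtain z where z: "z \<in> P" "ge z (g r)" "f z = q" using up_ex[of "g r" q] gr qr tQ by auto
      consider "ge p (g q)" | "ge (g r) p" | "ge (g q) p" "ge p (g r)" using gq gr by blast
      then show ?thesis
      proof cases
        case 1
        then have "ge p y" using trans[OF pP _ y(1)] gq y by blast
        then have "g r = y" using gu[OF qr(2) y(1)] y by blast
        then show ?thesis using y by simp
      next
        case 2
        then have "ge z p" using trans[OF z(1) _ pP] gr z by blast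
        then have "g q = z" using gu[OF qr(1) z(1)] z by blast
        then show ?thesis using z by simp
      next
        case 3
        then show ?thesis using trans[of "g q" p "g r"] gq gr pP by blast
      qed
    qed
    show "\<exists>!\<sigma>. \<sigma> \<in> order_complex P ge \<and> p \<in> \<sigma> \<and> f ` \<sigma> = \<tau>"
    proof (rule ex1I[of _ "g ` \<tau>"])
      have "f ` g ` \<tau> = \<tau>" using g by (force simp: image_image)
      moreover have "p \<in> g ` \<tau>" using gp pt by (metis image_eqI)
      moreover have "g ` \<tau> \<in> order_complex P ge"
        unfolding order_complex_def using g tQ pt chain tc by (auto simp: subset_iff) metis
      ultimately show "g ` \<tau> \<in> order_complex P ge \<and> p \<in> g ` \<tau> \<and> f ` g ` \<tau> = \<tau>" by blast
      fix \<sigma> assume s: "\<sigma> \<in> order_complex P ge \<and> p \<in> \<sigma> \<and> f ` \<sigma> = \<tau>"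
      have gx: "g (f x) = x" if "x \<in> \<sigma>" for x
        by (rule gu) (use s that in \<open>auto simp: order_complex_def\<close>)
      show "\<sigma> = g ` \<tau>"
        using s gx by (metis (no_types, lifting) image_cong image_ident image_image)
    qed
  qed
qed

section \<open>The poset limit of a cover\<close>

locale arrangement_cover = hyperplane_arrangement A for A :: "(real^'n) set set" +
  fixes \<Theta> :: "'v osys" and \<rho> :: "'v \<Rightarrow> (real^'n) set"
  assumes cover: "os_cover \<Theta> (arrangement_system A) \<rho>"
begin

abbreviation "G \<equiv> arrangement_system A"

lemma G_simps: "verts G = chambers A" "edges G = chE"
  by (simp_all add: arrangement_system_def)

lemma rho_chamber: "v \<in> verts \<Theta> \<Longrightarrow> \<rho> v \<in> chambers A"
  using cover by (auto simp: os_cover_def graph_morphism_def G_simps)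

lemma edges_verts: "edges \<Theta> \<subseteq> verts \<Theta> \<times> verts \<Theta>"
  using cover by (simp add: os_cover_def oriented_system_def)

text \<open>The diagram map with the target chamber in place of a face. By
  \<open>lift_related_end\<close> any minimal gallery may be used for it.\<close>

definition transport :: "'v \<Rightarrow> (real^'n) set \<Rightarrow> 'v" where
  "transport v D = opath_end (lift \<Theta> \<rho> v (minimal_path A (\<rho> v) D))"

lemma pmin_prel:
  assumes "pmin \<alpha>" "pmin \<beta>" "opath_begin \<alpha> = opath_begin \<beta>" "opath_end \<alpha> = opath_end \<beta>"
  shows "(\<alpha>, \<beta>) \<in> prel G"
  unfolding arrangement_system_def osys.simps
  by (rule subsetD[OF generated_relation_superset]) (use assms in simp)

lemma pmin_paths_of: "pmin \<alpha> \<Longrightarrow> \<alpha> \<in> paths_of G"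
  using pmin_path by (simp add: G_simps)

lemma transport_eq:
  assumes "v \<in> verts \<Theta>" "pmin \<alpha>" "opath_begin \<alpha> = \<rho> v"
  shows "opath_end (lift \<Theta> \<rho> v \<alpha>) = transport v (opath_end \<alpha>)"
proof -
  have D: "opath_end \<alpha> \<in> chambers A" using opath_end_in'[OF chE_sub pmin_path[OF assms(2)]] .
  note m = minimal_path_props[OF rho_chamber[OF assms(1)] D]
  show ?thesis
    unfolding transport_def
    by (rule lift_related_end[OF cover assms(1) pmin_prel]) (use assms m in simp_all)
qed

lemma transport_props:
  assumes "v \<in> verts \<Theta>" "D \<in> chambers A"
  shows "transport v D \<in> verts \<Theta>" "\<rho> (transport v D) = D"
proof -
  note m = minimal_path_props[OF rho_chamber[OF assms(1)] assms(2)]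
  note l = lift_props[OF cover assms(1) pmin_paths_of[OF m(1)] m(2)]
  show "transport v D \<in> verts \<Theta>" "\<rho> (transport v D) = D" using l m by (simp_all add: transport_def)
qed

lemma transport_self:
  assumes "v \<in> verts \<Theta>" shows "transport v (\<rho> v) = v"
proof -
  have p: "pmin (opath_const (\<rho> v))"
    using rho_chamber[OF assms] by (simp add: opath_const_def pmin_iff opath_positive_def)
  have "lift \<Theta> \<rho> v (opath_const (\<rho> v)) = opath_const v"
    by (rule lift_unique[OF cover assms pmin_paths_of[OF p]])
       (use assms in \<open>simp_all add: is_lift_def opath_const_def opath_map_eq\<close>)
  then show ?thesis using transport_eq[OF assms p] by simp
qed

text \<open>Disjoint separating sets make the concatenation of the two minimal galleries minimal.
  Functoriality of the diagram comes from this.\<close>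

lemma transport_comp:
  assumes v: "v \<in> verts \<Theta>" and K: "K \<in> chambers A" and D: "D \<in> chambers A"
    and "sep_set A (\<rho> v) K \<inter> sep_set A K D = {}"
  shows "transport (transport v K) D = transport v D"
proof -
  note m = minimal_path_props[OF rho_chamber[OF v] K] and n = minimal_path_props[OF K D]
  let ?\<mu> = "minimal_path A (\<rho> v) K" and ?\<nu> = "minimal_path A K D"
  have p: "pmin (opath_comp ?\<mu> ?\<nu>)" by (rule pmin_comp) (use m n assms in simp_all)
  have "transport v D = opath_end (lift \<Theta> \<rho> v (opath_comp ?\<mu> ?\<nu>))"
    using transport_eq[OF v p] m n by (simp add: opath_end_comp)
  also have "lift \<Theta> \<rho> v (opath_comp ?\<mu> ?\<nu>) = opath_comp (lift \<Theta> \<rho> v ?\<mu>) (lift \<Theta> \<rho> (transport v K) ?\<nu>)"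
    unfolding transport_def
    by (rule lift_comp[OF cover v pmin_paths_of[OF m(1)] pmin_paths_of[OF n(1)]]) (use m n in simp_all)
  also have "opath_end \<dots> = opath_end (lift \<Theta> \<rho> (transport v K) ?\<nu>)"
  proof (rule opath_end_comp)
    note t = transport_props[OF v K]
    have b: "opath_begin ?\<nu> = \<rho> (transport v K)" using n t by simp
    show "opath_end (lift \<Theta> \<rho> v ?\<mu>) = opath_begin (lift \<Theta> \<rho> (transport v K) ?\<nu>)"
      using lift_props(2)[OF cover t(1) pmin_paths_of[OF n(1)] b] by (simp add: transport_def)
  qed
  also have "\<dots> = transport (transport v K) D"
    using transport_eq[OF transport_props(1)[OF v K] n(1)] n transport_props(2)[OF v K] by simp
  finally show ?thesis by simp
qed

text \<open>The reversed gallery has one lift at the common end, and it leads back to both v and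
  w.\<close>

lemma transport_inj:
  assumes v: "v \<in> verts \<Theta>" and w: "w \<in> verts \<Theta>" and "\<rho> v = \<rho> w" "D \<in> chambers A" "transport v D = transport w D"
  shows "v = w"
proof -
  let ?\<mu> = "minimal_path A (\<rho> v) D"
  note m = minimal_path_props[OF rho_chamber[OF v] assms(4)]
  have mw: "opath_begin ?\<mu> = \<rho> w" using m(2) assms(3) by simp
  have "opath_inv (lift \<Theta> \<rho> v ?\<mu>) = opath_inv (lift \<Theta> \<rho> w ?\<mu>)"
    using lift_inv[OF cover v pmin_paths_of[OF m(1)] m(2)] lift_inv[OF cover w pmin_paths_of[OF m(1)] mw]
      assms(3,5) by (simp add: transport_def)
  then have "opath_end (opath_inv (lift \<Theta> \<rho> v ?\<mu>)) = opath_end (opath_inv (lift \<Theta> \<rho> w ?\<mu>))" by simp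
  then show ?thesis
    using lift_props(1,2)[OF cover v pmin_paths_of[OF m(1)] m(2)]
      lift_props(1,2)[OF cover w pmin_paths_of[OF m(1)] mw] by simp
qed

text \<open>The vertex v is reached by lifting the reversed gallery at w. Existence of lifts upward
  in the poset limit rests on this, their uniqueness on \<open>transport_inj\<close>.\<close>

lemma transport_surj:
  assumes w: "w \<in> verts \<Theta>" and C: "C \<in> chambers A"
  shows "\<exists>v\<in>verts \<Theta>. \<rho> v = C \<and> transport v (\<rho> w) = w"
proof -
  let ?\<mu> = "minimal_path A C (\<rho> w)"
  note m = minimal_path_props[OF C rho_chamber[OF w]]
  have G_edges: "edges G \<subseteq> verts G \<times> verts G" using chE_sub by (simp add: G_simps)
  have i: "opath_inv ?\<mu> \<in> paths_of G" using opath_inv_in[OF G_edges pmin_paths_of[OF m(1)]] .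
  have ib: "opath_begin (opath_inv ?\<mu>) = \<rho> w" using m by simp
  note l = lift_props[OF cover w i ib]
  let ?\<beta> = "opath_inv (lift \<Theta> \<rho> w (opath_inv ?\<mu>))"
  let ?v = "opath_end (lift \<Theta> \<rho> w (opath_inv ?\<mu>))"
  have b: "?\<beta> \<in> paths_of \<Theta>" using opath_inv_in[OF edges_verts l(1)] .
  have "opath_map \<rho> ?\<beta> = ?\<mu>" using l(3) opath_inv_inv[OF pmin_paths_of[OF m(1)]] by (simp add: opath_map_inv)
  then have "lift \<Theta> \<rho> ?v ?\<mu> = ?\<beta>" using lift_of_map[OF cover b] by simp
  moreover have "\<rho> ?v = C" using l(5) opath_end_inv[OF pmin_paths_of[OF m(1)]] m by simp
  moreover have "opath_end ?\<beta> = w" using opath_end_inv[OF l(1)] l(2) by simp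
  ultimately show ?thesis using l(4) by (intro bexI[of _ ?v]) (simp_all add: transport_def)
qed

text \<open>A hyperplane crossed from C to C_F does not contain F, whereas one crossed from C_F to
  the chamber at F' does contain F. No hyperplane does both.\<close>

lemma chamber_at_disjoint:
  assumes "C \<in> chambers A" "F \<in> faces A" "F' \<in> faces A" "face_ge F F'"
  shows "sep_set A C (chamber_at A C F) \<inter> sep_set A (chamber_at A C F) (chamber_at A C F') = {}"
proof -
  have False if "H \<in> sep_set A C (chamber_at A C F)" "H \<in> sep_set A (chamber_at A C F) (chamber_at A C F')" for H
  proof -
    have H: "H \<in> A" "face_sign C H \<noteq> face_sign (chamber_at A C F) H"
      "face_sign (chamber_at A C F) H \<noteq> face_sign (chamber_at A C F') H" using that sep_setD by auto
    show False
      using H face_sign_chamber_at[OF arr assms(1,2) H(1)] face_sign_chamber_at[OF arr assms(1,3) H(1)]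
        face_geD[OF assms(4,2,3) H(1)] by (auto split: if_splits)
  qed
  then show ?thesis by blast
qed

section \<open>The poset limit as a covering of the Salvetti poset\<close>

abbreviation "P \<equiv> plim A \<Theta> \<rho>"
abbreviation "pge \<equiv> plim_ge A \<Theta> \<rho>"
abbreviation "proj \<equiv> \<lambda>(F, v). (F, \<rho> v)"
abbreviation "W \<equiv> W_complex A \<Theta> \<rho>"

lemma P_iff: "(F, v) \<in> P \<longleftrightarrow> F \<in> faces A \<and> v \<in> verts \<Theta> \<and> face_ge F (\<rho> v)"
  by (auto simp: plim_def diagram_space_def)

lemma pge_iff: "pge (F, v) (F', v') \<longleftrightarrow> face_ge F F' \<and> v' = transport v (chamber_at A (\<rho> v) F')"
  by (simp add: plim_ge_def diagram_map_def transport_def)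

lemma pge_refl: "x \<in> P \<Longrightarrow> pge x x"
  by (cases x) (auto simp: P_iff pge_iff chamber_at_self rho_chamber transport_self)

lemma pge_trans:
  assumes "x \<in> P" "y \<in> P" "z \<in> P" "pge x y" "pge y z"
  shows "pge x z"
proof -
  obtain F1 v1 F2 v2 F3 v3 where xyz: "x = (F1, v1)" "y = (F2, v2)" "z = (F3, v3)" by (cases x; cases y; cases z)
  note [simp] = xyz
  have v: "v1 \<in> verts \<Theta>" and F: "F2 \<in> faces A" "F3 \<in> faces A" and g: "face_ge F1 F2" "face_ge F2 F3"
    and C: "\<rho> v1 \<in> chambers A"
    and e: "v2 = transport v1 (chamber_at A (\<rho> v1) F2)" "v3 = transport v2 (chamber_at A (\<rho> v2) F3)"
    using assms rho_chamber by (auto simp: P_iff pge_iff)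
  have r2: "\<rho> v2 = chamber_at A (\<rho> v1) F2" using e(1) transport_props(2)[OF v] arr C F by simp
  have "chamber_at A (\<rho> v2) F3 = chamber_at A (\<rho> v1) F3"
    unfolding r2 by (rule chamber_at_chamber_at[OF F C g(2)])
  then have "v3 = transport v1 (chamber_at A (\<rho> v1) F3)"
    using e transport_comp[OF v _ _ chamber_at_disjoint[OF C F g(2)]] arr C F by simp
  then show ?thesis using face_ge_trans[OF g] by (simp add: pge_iff)
qed

lemma proj_in: "x \<in> P \<Longrightarrow> proj x \<in> sal_poset"
  by (cases x) (auto simp: P_iff sal_poset_def rho_chamber)

lemma proj_mono:
  assumes "x \<in> P" "y \<in> P" "pge x y" shows "sal_ge (proj x) (proj y)"
  using assms transport_props(2) arr rho_chamber
  by (cases x; cases y) (auto simp: P_iff pge_iff sal_ge_def)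

text \<open>Downward a lift is dictated by the diagram map; upward it exists and is unique because
  minimal galleries can be lifted backwards.\<close>

lemma star_bijective_proj: "star_bijective W sal_cx proj"
  unfolding W_complex_def sal_cx_def
proof (rule star_bijective_order_complex)
  show "\<exists>y\<in>P. pge x y \<and> proj y = q" if x: "x \<in> P" and q: "q \<in> sal_poset" "sal_ge (proj x) q" for x q
  proof -
    obtain F v F' C' where [simp]: "x = (F, v)" "q = (F', C')" by (cases x; cases q)
    have v: "v \<in> verts \<Theta>" "F' \<in> faces A" "C' \<in> chambers A" "C' = chamber_at A (\<rho> v) F'" "face_ge F F'" "face_ge F' C'"
      using x q by (auto simp: P_iff sal_poset_def sal_ge_def)
    show ?thesis
      using v transport_props[OF v(1,3)]
      by (intro bexI[of _ "(F', transport v C')"]) (auto simp: P_iff pge_iff)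
  qed
  show "y = z" if "x \<in> P" "y \<in> P" "z \<in> P" "pge x y" "pge x z" "proj y = proj z" for x y z
    using that by (cases x; cases y; cases z) (auto simp: pge_iff)
  show "\<exists>y\<in>P. pge y x \<and> proj y = q" if x: "x \<in> P" and q: "q \<in> sal_poset" "sal_ge q (proj x)" for x q
  proof -
    obtain F v F' C' where [simp]: "x = (F, v)" "q = (F', C')" by (cases x; cases q)
    have v: "v \<in> verts \<Theta>" "F' \<in> faces A" "C' \<in> chambers A" "\<rho> v = chamber_at A C' F" "face_ge F' F" "face_ge F' C'"
      using x q by (auto simp: P_iff sal_poset_def sal_ge_def)
    obtain w where "w \<in> verts \<Theta>" "\<rho> w = C'" "transport w (\<rho> v) = v" using transport_surj[OF v(1,3)] by blast
    then show ?thesis using v by (intro bexI[of _ "(F', w)"]) (auto simp: P_iff pge_iff)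
  qed
  show "y = z" if "x \<in> P" "y \<in> P" "z \<in> P" "pge y x" "pge z x" "proj y = proj z" for x y z
  proof -
    obtain F v F' w F'' w' where [simp]: "x = (F, v)" "y = (F', w)" "z = (F'', w')" by (cases x; cases y; cases z)
    have "w = w'"
      by (rule transport_inj[where D = "chamber_at A (\<rho> w) F"])
         (use that arr rho_chamber in \<open>auto simp: P_iff pge_iff\<close>)
    then show ?thesis using that by simp
  qed
qed (fact proj_in proj_mono pge_refl pge_trans sal_ge_antisym)+

lemma abstract_W: "abstract_complex W"
  unfolding W_complex_def by (rule abstract_complex_order_complex)

lemma W_verts: "\<Union>W = P"
proof (intro equalityI subsetI)
  fix x assume "x \<in> P"
  then have "{x} \<in> W" using pge_refl by (auto simp: W_complex_def order_complex_def)
  then show "x \<in> \<Union>W" by blast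
qed (auto simp: W_complex_def order_complex_def)

lemma sal_cx_verts: "\<Union>sal_cx = sal_poset"
proof (intro equalityI subsetI)
  fix x assume "x \<in> sal_poset"
  then have "{x} \<in> sal_cx" using sal_ge_refl by (auto simp: sal_cx_def order_complex_def)
  then show "x \<in> \<Union>sal_cx" by blast
qed (auto simp: sal_cx_def order_complex_def)

lemma cover_nonempty: "\<exists>v. v \<in> verts \<Theta>"
  using cover by (auto simp: os_cover_def os_connected_def)

lemma proj_surj: "\<Union>sal_cx \<subseteq> proj ` \<Union>W"
proof
  fix x assume "x \<in> \<Union>sal_cx"
  then obtain F C where x: "x = (F, C)" "F \<in> faces A" "C \<in> chambers A" "face_ge F C"
    by (auto simp: sal_cx_verts sal_poset_def)
  obtain v where v: "v \<in> verts \<Theta>" using cover_nonempty by blast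
  note t = transport_props[OF v x(3)]
  have "(F, transport v C) \<in> P" using t x by (simp add: P_iff)
  then have "proj (F, transport v C) \<in> proj ` P" by (rule imageI)
  then show "x \<in> proj ` \<Union>W" unfolding W_verts using t x by simp
qed

text \<open>A simplex through p is determined by its image in the finite complex
  \<open>sal_cx\<close>. The complex \<open>W\<close> itself may be infinite.\<close>

lemma W_locally_finite: "finite {\<sigma>\<in>W. p \<in> \<sigma>}"
proof (rule finite_imageD[of "(`) proj"])
  show "finite ((`) proj ` {\<sigma>\<in>W. p \<in> \<sigma>})"
    by (rule finite_subset[OF _ finite_sal_cx]) (use star_bijective_image[OF star_bijective_proj] in blast)
  show "inj_on ((`) proj) {\<sigma>\<in>W. p \<in> \<sigma>}"
  proof (rule inj_onI)
    fix \<sigma> \<tau> assume st: "\<sigma> \<in> {\<sigma>\<in>W. p \<in> \<sigma>}" "\<tau> \<in> {\<sigma>\<in>W. p \<in> \<sigma>}" "proj ` \<sigma> = proj ` \<tau>"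
    then show "\<sigma> = \<tau>"
      using star_bijective_subset[OF abstract_W abstract_sal_cx star_bijective_proj, of \<sigma> \<tau> p]
        star_bijective_subset[OF abstract_W abstract_sal_cx star_bijective_proj, of \<tau> \<sigma> p] by simp
  qed
qed

lemma W_pair: "x \<in> P \<Longrightarrow> y \<in> P \<Longrightarrow> pge x y \<or> pge y x \<Longrightarrow> {x, y} \<in> W"
  unfolding W_complex_def order_complex_def using pge_refl by auto

lemma W_pairD: "{x, y} \<in> W \<Longrightarrow> x \<in> P \<and> y \<in> P \<and> (pge x y \<or> pge y x)"
  unfolding W_complex_def order_complex_def by auto

section \<open>Edge-connectedness of the poset limit\<close>

definition linked :: "(real^'n) set \<times> 'v \<Rightarrow> (real^'n) set \<times> 'v \<Rightarrow> bool" where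
  "linked x y \<longleftrightarrow> (\<exists>xs. edge_path W xs \<and> hd xs = x \<and> last xs = y)"

lemma linked_sym: "linked x y \<Longrightarrow> linked y x"
  unfolding linked_def by (metis edge_path_rev edge_path_def hd_rev last_rev)

lemma linked_trans:
  assumes "linked x y" "linked y z" shows "linked x z"
proof -
  obtain xs ys where xs: "edge_path W xs" "hd xs = x" "last xs = y" and ys: "edge_path W ys" "hd ys = y" "last ys = z"
    using assms unfolding linked_def by blast
  have "edge_path W (xs @ ys)" by (rule edge_path_joinI[OF abstract_W xs(1) ys(1)]) (use xs ys in simp)
  moreover have "xs \<noteq> []" "ys \<noteq> []" using xs ys by (auto simp: edge_path_def)
  ultimately show ?thesis unfolding linked_def using xs ys by (intro exI[of _ "xs @ ys"]) auto
qed

lemma linked_edge: "x \<in> P \<Longrightarrow> y \<in> P \<Longrightarrow> pge x y \<Longrightarrow> linked x y"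
  unfolding linked_def using W_pair[of x y] W_verts by (intro exI[of _ "[x, y]"]) (simp add: edge_path_def)

lemma below_in_P: "v \<in> verts \<Theta> \<Longrightarrow> (\<rho> v, v) \<in> P"
  using rho_chamber chamber_face by (simp add: P_iff)

lemma linked_bottom:
  assumes "(F, v) \<in> P" shows "linked (F, v) (\<rho> v, v)"
proof (rule linked_edge[OF assms])
  have v: "v \<in> verts \<Theta>" "face_ge F (\<rho> v)" using assms by (auto simp: P_iff)
  show "(\<rho> v, v) \<in> P" using below_in_P[OF v(1)] .
  show "pge (F, v) (\<rho> v, v)"
    using v rho_chamber by (simp add: pge_iff chamber_at_chamber transport_self)
qed

lemma transport_edge:
  assumes "(a, b) \<in> edges \<Theta>"
  shows "(\<rho> a, \<rho> b) \<in> chE" "transport a (\<rho> b) = b" "a \<in> verts \<Theta>" "b \<in> verts \<Theta>"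
proof -
  have mor: "graph_morphism \<Theta> G \<rho>" using cover by (simp add: os_cover_def)
  show ab: "a \<in> verts \<Theta>" "b \<in> verts \<Theta>" using assms edges_verts by auto
  show e: "(\<rho> a, \<rho> b) \<in> chE"
    using mor assms by (force simp: graph_morphism_def G_simps)
  have p: "pmin (\<rho> a, [((\<rho> a, \<rho> b), True)])"
    using e rho_chamber[OF ab(1)] by (auto simp: pmin_iff opath_positive_def chE_iff)
  have "lift \<Theta> \<rho> a (opath_map \<rho> (a, [((a, b), True)])) = (a, [((a, b), True)])"
    using lift_of_map[OF cover, of "(a, [((a, b), True)])"] assms ab by simp
  then show "transport a (\<rho> b) = b"
    using transport_eq[OF ab(1) p] by (simp add: opath_map_eq)
qed

text \<open>The vertex over the common facet of the two chambers, taken at a, lies above the bottom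
  elements of both a and b.\<close>

lemma linked_cover_edge:
  assumes "(a, b) \<in> edges \<Theta>"
  shows "linked (\<rho> a, a) (\<rho> b, b)"
proof -
  note t = transport_edge[OF assms]
  note w = wall_props[OF t(1)]
  have wP: "(wall (\<rho> a) (\<rho> b), a) \<in> P" using w t by (simp add: P_iff)
  have "pge (wall (\<rho> a) (\<rho> b), a) (\<rho> b, b)"
    using w t by (simp add: pge_iff chamber_at_chamber)
  then have "linked (wall (\<rho> a) (\<rho> b), a) (\<rho> b, b)" using linked_edge[OF wP below_in_P[OF t(4)]] by blast
  then show ?thesis using linked_trans linked_sym linked_bottom[OF wP] by blast
qed

lemma linked_cover_path:
  "(v, ss) \<in> paths_of \<Theta> \<Longrightarrow> linked (\<rho> v, v) (\<rho> (opath_end (v, ss)), opath_end (v, ss))"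
proof (induction ss arbitrary: v)
  case Nil
  then show ?case using linked_edge[OF below_in_P below_in_P] pge_refl[OF below_in_P] by simp
next
  case (Cons s ss)
  then have p: "(step_end s, ss) \<in> paths_of \<Theta>" and s: "fst s \<in> edges \<Theta>" "step_begin s = v"
    using step_verts[OF edges_verts] by auto
  have "linked (\<rho> (step_begin s), step_begin s) (\<rho> (step_end s), step_end s)"
    using linked_cover_edge[of "fst (fst s)" "snd (fst s)"] s(1) linked_sym by (cases s; cases "fst s") auto
  then show ?case using linked_trans[OF _ Cons.IH[OF p]] s(2) by simp
qed

lemma linked_all:
  assumes "x \<in> P" "y \<in> P" shows "linked x y"
proof -
  obtain F v F' w where xy: "x = (F, v)" "y = (F', w)" by (cases x; cases y)
  have vw: "v \<in> verts \<Theta>" "w \<in> verts \<Theta>" using assms xy by (auto simp: P_iff)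
  then obtain \<alpha> where a: "\<alpha> \<in> paths_of \<Theta>" "opath_begin \<alpha> = v" "opath_end \<alpha> = w"
    using cover unfolding os_cover_def os_connected_def by blast
  then obtain ss where "\<alpha> = (v, ss)" by (cases \<alpha>) auto
  then have "linked (\<rho> v, v) (\<rho> w, w)" using linked_cover_path[of v ss] a by simp
  then show ?thesis using assms xy linked_bottom linked_trans linked_sym by metis
qed

section \<open>Edge loops in the poset limit of the universal cover\<close>

text \<open>Both \<rho> v and \<rho> v' lie around F, so the minimal gallery between them is coned
  off from (F, \<rho> v), and (F', \<rho> v') is then inserted through a triangle. The lift of this
  gallery at v ends at v' by the definition of the order.\<close>

lemma edge_lift_down:
  assumes x: "(F, v) \<in> P" and y: "(F', v') \<in> P" and g: "pge (F, v) (F', v')"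
  shows "\<exists>\<alpha>\<in>paths_of \<Theta>. opath_begin \<alpha> = v \<and> opath_end \<alpha> = v' \<and>
    path_list (opath_map \<rho> \<alpha>) \<approx> [bottom (\<rho> v), (F, \<rho> v), (F', \<rho> v'), bottom (\<rho> v')]"
proof -
  have v: "v \<in> verts \<Theta>" "v' \<in> verts \<Theta>" "F \<in> faces A" "F' \<in> faces A" "face_ge F (\<rho> v)" "face_ge F' (\<rho> v')" "face_ge F F'"
    and t: "v' = transport v (chamber_at A (\<rho> v) F')"
    using x y g by (auto simp: P_iff pge_iff)
  have C: "\<rho> v \<in> chambers A" "\<rho> v' \<in> chambers A" using rho_chamber v by auto
  have tv: "v' = transport v (\<rho> v')" using t transport_props(2)[OF v(1)] arr C v by simp
  note m = minimal_path_props[OF C]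
  let ?\<mu> = "minimal_path A (\<rho> v) (\<rho> v')"
  note l = lift_props[OF cover v(1) pmin_paths_of[OF m(1)] m(2)]
  obtain ss where ss: "?\<mu> = (\<rho> v, ss)" using m(2) by (cases ?\<mu>) auto
  have FF: "face_ge F (\<rho> v')" using face_ge_trans v by blast
  have "path_list ?\<mu> \<approx> [bottom (\<rho> v), (F, \<rho> v), bottom (\<rho> v')]"
    unfolding ss by (rule path_list_star) (use m ss C v FF in auto)
  also have "\<dots> \<approx> [bottom (\<rho> v), (F, \<rho> v), (F', \<rho> v'), bottom (\<rho> v')]"
  proof -
    have "sal_ge (F, \<rho> v) (F', \<rho> v')" using proj_mono[OF x y g] by simp
    then have "{(F, \<rho> v), (F', \<rho> v'), bottom (\<rho> v')} \<in> sal_cx"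
      by (intro sal_cx_triple) (use proj_in[OF x] proj_in[OF y] C FF v in \<open>auto simp: bottom_in sal_ge_bottom\<close>)
    from edge_hom_sym[OF edge_hom_tri[OF this, of "[bottom (\<rho> v)]" "[]"]] show ?thesis by simp
  qed
  finally show ?thesis
    using l tv by (intro bexI[of _ "lift \<Theta> \<rho> v ?\<mu>"]) (simp_all add: transport_def)
qed

lemma edge_lift:
  assumes "{(F, v), (F', v')} \<in> W"
  shows "\<exists>\<alpha>\<in>paths_of \<Theta>. opath_begin \<alpha> = v \<and> opath_end \<alpha> = v' \<and>
    path_list (opath_map \<rho> \<alpha>) \<approx> [bottom (\<rho> v), (F, \<rho> v), (F', \<rho> v'), bottom (\<rho> v')]"
proof -
  have mor: "graph_morphism \<Theta> G \<rho>" using cover by (simp add: os_cover_def)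
  have x: "(F, v) \<in> P" and y: "(F', v') \<in> P" and g: "pge (F, v) (F', v') \<or> pge (F', v') (F, v)"
    using W_pairD[OF assms] by auto
  from g show ?thesis
  proof
    assume "pge (F', v') (F, v)"
    from edge_lift_down[OF y x this] obtain \<alpha> where a: "\<alpha> \<in> paths_of \<Theta>" "opath_begin \<alpha> = v'" "opath_end \<alpha> = v"
      "path_list (opath_map \<rho> \<alpha>) \<approx> [bottom (\<rho> v'), (F', \<rho> v'), (F, \<rho> v), bottom (\<rho> v)]" by blast
    have aG: "opath_map \<rho> \<alpha> \<in> opaths (chambers A) chE"
      using opath_map_in[OF mor a(1)] by (simp add: G_simps)
    have "path_list (opath_map \<rho> (opath_inv \<alpha>)) \<approx> rev (path_list (opath_map \<rho> \<alpha>))"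
      unfolding opath_map_inv by (rule path_list_inv[OF aG])
    also have "\<dots> \<approx> [bottom (\<rho> v), (F, \<rho> v), (F', \<rho> v'), bottom (\<rho> v')]"
      using edge_hom_rev[OF a(4)] by simp
    finally show ?thesis
      using a opath_inv_in[OF edges_verts a(1)] by (intro bexI[of _ "opath_inv \<alpha>"]) auto
  qed (rule edge_lift_down[OF x y])
qed

text \<open>Bottom elements serve as joints, since paths of the oriented graph begin and end there.
  Consecutive edges of xs compose once the spur from their common vertex to the bottom below it is
  cancelled.\<close>

lemma edge_path_lift:
  assumes "edge_path W xs"
  shows "\<exists>\<alpha>\<in>paths_of \<Theta>. opath_begin \<alpha> = snd (hd xs) \<and> opath_end \<alpha> = snd (last xs) \<and>
    path_list (opath_map \<rho> \<alpha>) \<approx> [bottom (\<rho> (snd (hd xs)))] @ map proj xs @ [bottom (\<rho> (snd (last xs)))]"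
  using assms
proof (induction xs rule: induct_list012)
  case (2 x)
  obtain F v where x: "x = (F, v)" by (cases x)
  have P: "(F, v) \<in> P" using 2 x W_verts by (auto simp: edge_path_def)
  then have v: "v \<in> verts \<Theta>" "face_ge F (\<rho> v)" by (auto simp: P_iff)
  have e: "{bottom (\<rho> v), (F, \<rho> v)} \<in> sal_cx"
    by (rule sal_cx_pair) (use proj_in[OF P] v rho_chamber[OF v(1)] in \<open>auto simp: bottom_in sal_ge_bottom\<close>)
  have "[bottom (\<rho> v)] \<approx> [bottom (\<rho> v), (F, \<rho> v), bottom (\<rho> v)]"
    using edge_hom_sym[OF edge_hom_spur[OF e, of "[]" "[]"]] by simp
  then show ?case
    using v by (intro bexI[of _ "opath_const v"]) (auto simp: x opath_const_def opath_map_eq)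
next
  case (3 x y zs)
  obtain F v F' v' where xy: "x = (F, v)" "y = (F', v')" by (cases x; cases y)
  have e: "{(F, v), (F', v')} \<in> W" and ep: "edge_path W (y # zs)" using 3(3) xy by (auto simp: edge_path_def)
  have mor: "graph_morphism \<Theta> G \<rho>" using cover by (simp add: os_cover_def)
  obtain \<alpha> where a: "\<alpha> \<in> paths_of \<Theta>" "opath_begin \<alpha> = v" "opath_end \<alpha> = v'"
    "path_list (opath_map \<rho> \<alpha>) \<approx> [bottom (\<rho> v), (F, \<rho> v), (F', \<rho> v'), bottom (\<rho> v')]" using edge_lift[OF e] by blast
  let ?w = "snd (last (y # zs))"
  obtain \<beta> where b: "\<beta> \<in> paths_of \<Theta>" "opath_begin \<beta> = v'" "opath_end \<beta> = ?w"
    "path_list (opath_map \<rho> \<beta>) \<approx> [bottom (\<rho> v')] @ map proj (y # zs) @ [bottom (\<rho> ?w)]"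
    using 3(2)[OF ep] xy by auto
  have bG: "opath_map \<rho> \<beta> \<in> opaths (chambers A) chE" using opath_map_in[OF mor b(1)] by (simp add: G_simps)
  have P: "(F', v') \<in> P" using W_pairD[OF e] by blast
  then have v': "v' \<in> verts \<Theta>" "face_ge F' (\<rho> v')" by (auto simp: P_iff)
  have sp: "{(F', \<rho> v'), bottom (\<rho> v')} \<in> sal_cx"
    by (rule sal_cx_pair) (use proj_in[OF P] v' rho_chamber[OF v'(1)] in \<open>auto simp: bottom_in sal_ge_bottom\<close>)
  let ?r = "map proj zs @ [bottom (\<rho> ?w)]"
  have "path_list (opath_map \<rho> (opath_comp \<alpha> \<beta>)) \<approx> path_list (opath_map \<rho> \<alpha>) @ path_list (opath_map \<rho> \<beta>)"
    unfolding opath_map_comp by (rule edge_hom_sym[OF path_list_comp[OF bG]]) (use a b in simp)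
  also have "\<dots> \<approx> [bottom (\<rho> v), (F, \<rho> v), (F', \<rho> v'), bottom (\<rho> v')] @ [bottom (\<rho> v')] @ map proj (y # zs) @ [bottom (\<rho> ?w)]"
    by (rule edge_hom_append[OF a(4) b(4)])
  also have "\<dots> \<approx> [bottom (\<rho> v), (F, \<rho> v), (F', \<rho> v')] @ [bottom (\<rho> v')] @ [(F', \<rho> v')] @ ?r"
    using edge_hom_dup[of sal_cx "[bottom (\<rho> v), (F, \<rho> v), (F', \<rho> v')]" "bottom (\<rho> v')" "(F', \<rho> v') # ?r"] by (simp add: xy)
  also have "\<dots> \<approx> [bottom (\<rho> v), (F, \<rho> v)] @ [(F', \<rho> v')] @ ?r"
    using edge_hom_spur[OF sp, of "[bottom (\<rho> v), (F, \<rho> v)]" ?r] by simp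
  finally have "path_list (opath_map \<rho> (opath_comp \<alpha> \<beta>)) \<approx> [bottom (\<rho> v), (F, \<rho> v)] @ [(F', \<rho> v')] @ ?r" .
  then show ?case
    using a b opath_comp_in[OF a(1) b(1)]
    by (intro bexI[of _ "opath_comp \<alpha> \<beta>"]) (auto simp: xy opath_end_comp)
qed (simp add: edge_path_def)

lemma universal_edge_loop_null:
  assumes u: "universal_os_cover \<Theta> G \<rho>" and xs: "edge_path W xs" "hd xs = last xs"
  shows "edge_hom W xs [hd xs]"
proof -
  obtain F v where h: "hd xs = (F, v)" by (cases "hd xs")
  obtain \<alpha> where a: "\<alpha> \<in> paths_of \<Theta>" "opath_begin \<alpha> = v" "opath_end \<alpha> = v"
    "path_list (opath_map \<rho> \<alpha>) \<approx> [bottom (\<rho> v)] @ map proj xs @ [bottom (\<rho> v)]"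
    using edge_path_lift[OF xs(1)] unfolding xs(2)[symmetric] h snd_conv by blast
  have "hd xs \<in> P" using xs(1) W_verts hd_in_set[of xs] unfolding edge_path_def by blast
  then have P: "(F, v) \<in> P" using h by simp
  then have v: "v \<in> verts \<Theta>" "face_ge F (\<rho> v)" by (auto simp: P_iff)
  have "countable (paths_of G)"
    unfolding G_simps
    by (rule countable_opaths[OF _ chE_sub]) (rule finite_subset[OF _ finite_faces[OF arr]], use chamber_face in blast)
  from universal_cover_loop_null[OF u this a(1)] a
  have "(opath_map \<rho> \<alpha>, opath_const (\<rho> v)) \<in> prel G" by simp
  then have "(opath_map \<rho> \<alpha>, opath_const (\<rho> v)) \<in> list_rel" using prel_subset_list_rel by blast
  then have "path_list (opath_map \<rho> \<alpha>) \<approx> [bottom (\<rho> v)]" by (simp add: list_rel_def)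
  then have n: "[bottom (\<rho> v)] @ map proj xs @ [bottom (\<rho> v)] \<approx> [bottom (\<rho> v)]"
    using edge_hom_trans[OF edge_hom_sym[OF a(4)]] by blast
  have sp: "{(F, \<rho> v), bottom (\<rho> v)} \<in> sal_cx"
    by (rule sal_cx_pair) (use proj_in[OF P] v rho_chamber[OF v(1)] in \<open>auto simp: bottom_in sal_ge_bottom\<close>)
  have ne: "map proj xs \<noteq> []" using xs(1) by (simp add: edge_path_def)
  have hl: "hd (map proj xs) = (F, \<rho> v)" "last (map proj xs) = (F, \<rho> v)"
    using ne h xs(2) by (auto simp: hd_map last_map)
  let ?x = "(F, \<rho> v)" and ?b = "bottom (\<rho> v)"
  obtain ys where ys: "map proj xs = ?x # ys" using hl(1) ne by (metis list.collapse)
  obtain zs where zs: "map proj xs = zs @ [?x]" using hl(2) ne by (metis append_butlast_last_id)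
  \<comment> \<open>The known homotopy is based at the bottom element below (F, \<rho> v).
    Conjugation by the edge between the two moves the base point to the first vertex of the
    loop.\<close>
  have "map proj xs \<approx> [?x, ?b] @ map proj xs"
    using edge_hom_sym[OF edge_hom_spur[OF sp, of "[]" ys]] ys by simp
  also have "[?x, ?b] @ map proj xs \<approx> ([?x, ?b] @ map proj xs) @ [?b, ?x]"
    using edge_hom_sym[OF edge_hom_spur[OF sp, of "[?x, ?b] @ zs" "[]"]] zs by simp
  also have "([?x, ?b] @ map proj xs) @ [?b, ?x] \<approx> [?x] @ [?b] @ [?x]"
    using edge_hom_append_middle[OF n, of "[?x]" "[?x]"] by simp
  also have "[?x] @ [?b] @ [?x] \<approx> [?x]" using edge_hom_spur[OF sp, of "[]" "[]"] by simp
  finally have "map proj xs \<approx> [proj (hd xs)]" using h by simp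
  then show ?thesis by (rule null_lift[OF abstract_W abstract_sal_cx star_bijective_proj xs(1)])
qed

theorem universal_W_simply_connected:
  assumes "universal_os_cover \<Theta> G \<rho>"
  shows "simply_connected_space (realization W)"
proof (rule simply_connected_realization[OF abstract_W W_locally_finite])
  obtain v where "v \<in> verts \<Theta>" using cover_nonempty by blast
  then have "(\<rho> v, v) \<in> \<Union>W" using below_in_P W_verts by simp
  then show "W \<noteq> {}" by blast
  show "\<exists>xs. edge_path W xs \<and> hd xs = p \<and> last xs = q" if "p \<in> \<Union>W" "q \<in> \<Union>W" for p q
    using linked_all that W_verts unfolding linked_def by blast
qed (rule universal_edge_loop_null[OF assms])

theorem covering_Lambda: "covering_map (realization W) (realization sal_cx) (Lambda_map \<rho>)"
  unfolding Lambda_map_def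
  by (rule covering_map_simplicial_extension[OF abstract_W abstract_sal_cx star_bijective_proj proj_surj])

end

section \<open>The geometric Salvetti complex\<close>

text \<open>The simplex is closed in a product of unit intervals, which is compact by Tychonoff's
  theorem.\<close>

lemma compact_closed_simplex:
  assumes "finite \<sigma>"
  shows "compact (closed_simplex \<sigma>)"
proof -
  have "compactin (product_topology (\<lambda>i::'a. euclidean :: real topology) UNIV) (PiE UNIV (\<lambda>_. {0..1}))"
    by (subst compactin_PiE) auto
  then have "compact (PiE UNIV (\<lambda>_::'a. {0..1::real}))"
    by (simp only: euclidean_product_topology compactin_euclidean_iff)
  moreover have "closed_simplex \<sigma> \<subseteq> PiE UNIV (\<lambda>_. {0..1})"
  proof
    fix x :: "'a \<Rightarrow> real" assume x: "x \<in> closed_simplex \<sigma>"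
    have "x v \<le> 1" for v
    proof (cases "v \<in> \<sigma>")
      case True
      then have "x v \<le> sum x \<sigma>" using closed_simplexD(1)[OF x] assms by (intro member_le_sum) auto
      then show ?thesis using closed_simplexD(3)[OF x] by simp
    qed (use closed_simplexD(2)[OF x] in simp)
    then show "x \<in> PiE UNIV (\<lambda>_. {0..1})" using closed_simplexD(1)[OF x] by auto
  qed
  ultimately show ?thesis
    using closed_closed_simplex[OF assms] compact_Int_closed inf.absorb_iff2 by metis
qed

lemma compact_geom_carrier:
  assumes K: "abstract_complex K" and "finite K"
  shows "compact (geom_carrier K)"
  unfolding geom_carrier_def
  by (intro compact_UN assms(2) compact_closed_simplex abstract_complexD(1)[OF K])

lemma affine_extension_on_simplex:
  assumes "finite \<sigma>" "x \<in> closed_simplex \<sigma>"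
  shows "affine_extension f x = (\<Sum>p\<in>\<sigma>. x p *\<^sub>R f p)"
  unfolding affine_extension_def
  by (rule sum.mono_neutral_left) (use assms support_subset_simplex[OF assms(2)] in \<open>auto simp: support_def\<close>)

text \<open>The extension carries \<open>seg\<close> to convex combinations, so the image is convex;
  it contains the images of the vertices, and its points are convex combinations of them.\<close>

lemma affine_extension_image:
  fixes f :: "'v \<Rightarrow> 'b::real_vector"
  assumes fin: "finite \<sigma>"
  shows "affine_extension f ` closed_simplex \<sigma> = convex hull (f ` \<sigma>)"
proof
  show "affine_extension f ` closed_simplex \<sigma> \<subseteq> convex hull (f ` \<sigma>)"
  proof
    fix y assume "y \<in> affine_extension f ` closed_simplex \<sigma>"
    then obtain x where x: "x \<in> closed_simplex \<sigma>" "y = (\<Sum>p\<in>\<sigma>. x p *\<^sub>R f p)"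
      using affine_extension_on_simplex[OF fin] by auto
    show "y \<in> convex hull (f ` \<sigma>)" unfolding x(2)
      by (rule convex_sum[OF fin convex_convex_hull]) (use closed_simplexD[OF x(1)] in \<open>auto intro: hull_inc\<close>)
  qed
  have "convex (affine_extension f ` closed_simplex \<sigma>)"
  proof (rule convexI)
    fix a b and u v :: real
    assume ab: "a \<in> affine_extension f ` closed_simplex \<sigma>" "b \<in> affine_extension f ` closed_simplex \<sigma>"
      and uv: "0 \<le> u" "0 \<le> v" "u + v = 1"
    obtain x y where x: "x \<in> closed_simplex \<sigma>" "a = affine_extension f x"
      and y: "y \<in> closed_simplex \<sigma>" "b = affine_extension f y" using ab by blast
    have z: "seg x y v \<in> closed_simplex \<sigma>"
      using seg_closed_simplex[of \<sigma>] x(1) y(1) uv unfolding seg_closed_def by auto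
    have "affine_extension f (seg x y v) = u *\<^sub>R a + v *\<^sub>R b"
      unfolding x(2) y(2) affine_extension_on_simplex[OF fin z] affine_extension_on_simplex[OF fin x(1)]
        affine_extension_on_simplex[OF fin y(1)]
      using uv(3) by (simp add: seg_def scaleR_left_distrib sum.distrib scaleR_sum_right flip: uv(3))
    then show "u *\<^sub>R a + v *\<^sub>R b \<in> affine_extension f ` closed_simplex \<sigma>" using z by (metis image_eqI)
  qed
  moreover have "f ` \<sigma> \<subseteq> affine_extension f ` closed_simplex \<sigma>"
  proof
    fix y assume "y \<in> f ` \<sigma>"
    then obtain p where p: "p \<in> \<sigma>" "y = f p" by blast
    have "affine_extension f (vertex_point p) = f p"
      by (simp add: affine_extension_def vertex_point_def)
    then show "y \<in> affine_extension f ` closed_simplex \<sigma>"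
      using vertex_point_in_simplex[OF fin p(1)] p(2) by (metis image_eqI)
  qed
  ultimately show "convex hull (f ` \<sigma>) \<subseteq> affine_extension f ` closed_simplex \<sigma>"
    by (intro hull_minimal)
qed

lemma continuous_on_affine_extension:
  fixes f :: "'v \<Rightarrow> 'b::real_normed_vector"
  assumes "finite \<sigma>"
  shows "continuous_on (closed_simplex \<sigma>) (affine_extension f)"
proof -
  have "continuous_on (closed_simplex \<sigma>) (\<lambda>x. \<Sum>p\<in>\<sigma>. x p *\<^sub>R f p)"
    by (intro continuous_on_sum continuous_on_scaleR continuous_on_coordinate continuous_on_const)
  then show ?thesis by (rule continuous_on_eq) (simp add: affine_extension_on_simplex[OF assms])
qed

context hyperplane_arrangement
begin

definition face_chain :: "(real^'n) set set \<Rightarrow> bool" where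
  "face_chain S \<longleftrightarrow> finite S \<and> S \<subseteq> faces A \<and> (\<forall>F\<in>S. \<forall>G\<in>S. face_ge F G \<or> face_ge G F)"

text \<open>A rank for the face order: a strictly greater face lies in strictly more hyperplanes. In
  a chain it finds the least face as a minimum over numbers.\<close>

definition zeros :: "(real^'n) set \<Rightarrow> nat" where
  "zeros F = card {H\<in>A. face_sign F H = 0}"

lemma face_ge_zeros:
  assumes "F \<in> faces A" "G \<in> faces A" "face_ge F G \<or> face_ge G F" "zeros G \<le> zeros F"
  shows "face_ge F G"
proof (cases "face_ge F G")
  case False
  then have g: "face_ge G F" using assms by blast
  have "{H\<in>A. face_sign F H = 0} \<subseteq> {H\<in>A. face_sign G H = 0}"
    using face_geD[OF g assms(2,1)] by fastforce
  then have "{H\<in>A. face_sign F H = 0} = {H\<in>A. face_sign G H = 0}"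
    using assms(4) finite_A unfolding zeros_def by (intro card_seteq) auto
  then have "face_sign F H = face_sign G H" if "H \<in> A" for H
    using face_geD[OF g assms(2,1) that] that by auto
  then have "F = G" using face_sign_eqI[OF arr assms(1,2)] by blast
  then show ?thesis by simp
qed

lemma face_chain_least:
  assumes S: "face_chain S" "S \<noteq> {}"
  shows "\<exists>F\<in>S. \<forall>G\<in>S. face_ge G F"
proof -
  have fin: "finite (zeros ` S)" "zeros ` S \<noteq> {}" using S by (auto simp: face_chain_def)
  have "Min (zeros ` S) \<in> zeros ` S" by (rule Min_in[OF fin])
  then obtain F where F: "F \<in> S" "zeros F = Min (zeros ` S)" by (elim imageE) simp
  show ?thesis
  proof (intro bexI[OF _ F(1)] ballI)
    fix G assume G: "G \<in> S"
    then have "zeros F \<le> zeros G" using F(2) fin by simp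
    then show "face_ge G F" using face_ge_zeros[of G F] S(1) F(1) G unfolding face_chain_def by blast
  qed
qed

text \<open>No term opposes g i in sign, so nothing cancels; if g i is zero, all terms
  vanish.\<close>

lemma sgn_sum_dominant:
  fixes g :: "'i \<Rightarrow> real"
  assumes "finite S" "i \<in> S" "\<And>j. j \<in> S \<Longrightarrow> sgn (g j) = 0 \<or> sgn (g j) = sgn (g i)"
  shows "sgn (sum g S) = sgn (g i)"
proof -
  consider "g i > 0" | "g i = 0" | "g i < 0" by linarith
  then show ?thesis
  proof cases
    case 1
    then have "0 \<le> g j" if "j \<in> S" for j using assms(3)[OF that] by (auto simp: sgn_if split: if_splits)
    then have "sum g S > 0" using 1 assms(1,2) by (intro sum_pos2[of S i]) auto
    then show ?thesis using 1 by simp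
  next
    case 2
    then have "g j = 0" if "j \<in> S" for j using assms(3)[OF that] by (auto simp: sgn_zero_iff)
    then show ?thesis using 2 by simp
  next
    case 3
    then have "0 \<le> - g j" if "j \<in> S" for j using assms(3)[OF that] by (auto simp: sgn_if split: if_splits)
    then have "sum (\<lambda>j. - g j) S > 0" using 3 assms(1,2) by (intro sum_pos2[of S i]) auto
    then have "sum g S < 0" by (simp add: sum_negf)
    then show ?thesis using 3 by simp
  qed
qed

end

section \<open>The affine map from the order complex onto Sal(A)\<close>

locale salvetti_points = hyperplane_arrangement A for A :: "(real^'n) set set" +
  fixes w :: "(real^'n) set \<Rightarrow> real^'n"
  assumes w: "\<And>F. F \<in> faces A \<Longrightarrow> w F \<in> F"
begin

lemma sgn_w: "F \<in> faces A \<Longrightarrow> H \<in> A \<Longrightarrow> sgn (hyp_form H (w F)) = face_sign F H"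
  using sign_mem[OF _ w] .

lemma sum_hyp_form:
  "(\<Sum>F\<in>S. a F * hyp_form H (p F)) = hyp_normal H \<bullet> (\<Sum>F\<in>S. a F *\<^sub>R p F) - hyp_offset H * (\<Sum>F\<in>S. a F)"
  by (simp add: hyp_form_def inner_sum_right right_diff_distrib sum_subtractf sum_distrib_left mult.commute)

text \<open>The signs of the other faces vanish or agree with those of the least one. A positive
  combination of chosen points along a chain therefore lies, once normalized, in the least face. The
  weights are left unnormalized because the uniqueness induction changes their total.\<close>

lemma sgn_chain_sum:
  assumes S: "face_chain S" and F: "F \<in> S" "\<And>G. G \<in> S \<Longrightarrow> face_ge G F" and a: "\<And>G. G \<in> S \<Longrightarrow> a G > 0"
    and H: "H \<in> A"
  shows "sgn (\<Sum>G\<in>S. a G * hyp_form H (w G)) = face_sign F H"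
proof -
  have Sf: "G \<in> faces A" if "G \<in> S" for G using S that by (auto simp: face_chain_def)
  have s: "sgn (a G * hyp_form H (w G)) = face_sign G H" if "G \<in> S" for G
    using a[OF that] sgn_w[OF Sf[OF that] H] by (simp add: sgn_mult)
  have "sgn (\<Sum>G\<in>S. a G * hyp_form H (w G)) = sgn (a F * hyp_form H (w F))"
    by (rule sgn_sum_dominant)
       (use S F s face_geD[OF F(2) Sf Sf[OF F(1)] H] in \<open>auto simp: face_chain_def\<close>)
  then show ?thesis using s[OF F(1)] by simp
qed

text \<open>The least face of a chain is the face containing the point, so its coordinate can be split off.\<close>

lemma chain_barycentric_unique:
  assumes "face_chain S" "face_chain T" "\<And>F. F \<in> S \<Longrightarrow> a F > 0" "\<And>F. F \<in> T \<Longrightarrow> b F > 0"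
    "sum a S = sum b T" "(\<Sum>F\<in>S. a F *\<^sub>R w F) = (\<Sum>F\<in>T. b F *\<^sub>R w F)"
  shows "S = T \<and> (\<forall>F\<in>S. a F = b F)"
  using assms
proof (induction "card S + card T" arbitrary: S T a b rule: less_induct)
  case less
  note S = less.prems(1) and T = less.prems(2)
  have fin: "finite S" "finite T" using S T by (auto simp: face_chain_def)
  show ?case
  proof (cases "S = {} \<or> T = {}")
    case True
    have "sum a S > 0 \<or> S = {}" "sum b T > 0 \<or> T = {}"
      using less.prems(3,4) fin by (auto intro: sum_pos)
    then show ?thesis using True less.prems(5) by auto
  next
    case False
    obtain F where F: "F \<in> S" "\<And>G. G \<in> S \<Longrightarrow> face_ge G F"
      using face_chain_least[OF S] False by blast
    obtain F' where F': "F' \<in> T" "\<And>G. G \<in> T \<Longrightarrow> face_ge G F'"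
      using face_chain_least[OF T] False by blast
    have FF: "F \<in> faces A" "F' \<in> faces A" using F F' S T by (auto simp: face_chain_def)
    \<comment> \<open>The sum of the weighted forms depends only on the weighted sum of the points
      and the total weight, which agree for both chains; so the two least faces have equal
      signs.\<close>
    have "face_sign F H = face_sign F' H" if H: "H \<in> A" for H
      using sgn_chain_sum[where a = a, OF S F less.prems(3) H] sgn_chain_sum[where a = b, OF T F' less.prems(4) H]
        less.prems(5,6) unfolding sum_hyp_form by simp
    then have "F = F'" using face_sign_eqI[OF arr FF] by blast
    note F'' = F'[folded this]
    have chain_sub: "face_chain S'" if "S' \<subseteq> S \<or> S' \<subseteq> T" for S'
    proof -
      have "face_chain V" if "face_chain U" "V \<subseteq> U" for U V
        using that finite_subset[of V U] unfolding face_chain_def by (auto dest: subsetD)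
      then show ?thesis using that S T by blast
    qed
    have rm: "sum g (U - {F}) = sum g U - g F" if "finite U" "F \<in> U" for U and g :: "_ \<Rightarrow> 'z::ab_group_add"
      using that by (simp add: sum_diff1)
    have upd: "sum (\<lambda>G. (g(F := c)) G) U = sum g U - g F + c" if "finite U" "F \<in> U" for U and g :: "_ \<Rightarrow> real" and c
    proof -
      have "sum (\<lambda>G. (g(F := c)) G) U = c + sum (\<lambda>G. (g(F := c)) G) (U - {F})"
        using sum.remove[OF that, of "\<lambda>G. (g(F := c)) G"] by simp
      also have "sum (\<lambda>G. (g(F := c)) G) (U - {F}) = sum g (U - {F})" by (rule sum.cong) auto
      finally show ?thesis using rm[OF that, of g] by simp
    qed
    have updv: "(\<Sum>G\<in>U. (g(F := c)) G *\<^sub>R w G) = (\<Sum>G\<in>U. g G *\<^sub>R w G) - g F *\<^sub>R w F + c *\<^sub>R w F"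
      if "finite U" "F \<in> U" for U and g :: "_ \<Rightarrow> real" and c
    proof -
      have "(\<Sum>G\<in>U. (g(F := c)) G *\<^sub>R w G) = c *\<^sub>R w F + (\<Sum>G\<in>U - {F}. (g(F := c)) G *\<^sub>R w G)"
        using sum.remove[OF that, of "\<lambda>G. (g(F := c)) G *\<^sub>R w G"] by simp
      also have "(\<Sum>G\<in>U - {F}. (g(F := c)) G *\<^sub>R w G) = (\<Sum>G\<in>U - {F}. g G *\<^sub>R w G)" by (rule sum.cong) auto
      finally show ?thesis using rm[OF that, of "\<lambda>G. g G *\<^sub>R w G"] by simp
    qed
    have cS: "card (S - {F}) < card S" and cT: "card (T - {F}) < card T"
      by (rule card_Diff1_less[OF fin(1) F(1)], rule card_Diff1_less[OF fin(2) F''(1)])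
    \<comment> \<open>The smaller coefficient of F is subtracted on both sides. If the coefficients
      differ, F survives in one chain only, which the induction hypothesis excludes.\<close>
    consider "a F = b F" | "a F < b F" | "a F > b F" by linarith
    then show ?thesis
    proof cases
      case 1
      have "S - {F} = T - {F} \<and> (\<forall>G\<in>S - {F}. a G = b G)"
        by (rule less.hyps)
           (use cS cT chain_sub less.prems 1 F(1) F''(1) fin in \<open>auto simp: rm\<close>)
      then show ?thesis using F(1) F''(1) 1 by blast
    next
      case 2
      have "S - {F} = T \<and> (\<forall>G\<in>S - {F}. a G = (b(F := b F - a F)) G)"
      proof (rule less.hyps)
        show "sum a (S - {F}) = sum (b(F := b F - a F)) T"
          using upd[OF fin(2) F''(1), of b] less.prems(5) rm[OF fin(1) F(1), of a] by simp
        show "(\<Sum>G\<in>S - {F}. a G *\<^sub>R w G) = (\<Sum>G\<in>T. (b(F := b F - a F)) G *\<^sub>R w G)"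
          unfolding updv[OF fin(2) F''(1)] rm[OF fin(1) F(1)] less.prems(6) by (simp add: algebra_simps)
      qed (use cS chain_sub less.prems 2 in auto)
      then show ?thesis using F''(1) by blast
    next
      case 3
      have "S = T - {F} \<and> (\<forall>G\<in>S. (a(F := a F - b F)) G = b G)"
      proof (rule less.hyps)
        show "sum (a(F := a F - b F)) S = sum b (T - {F})"
          using upd[OF fin(1) F(1), of a] less.prems(5) rm[OF fin(2) F''(1), of b] by simp
        show "(\<Sum>G\<in>S. (a(F := a F - b F)) G *\<^sub>R w G) = (\<Sum>G\<in>T - {F}. b G *\<^sub>R w G)"
          unfolding updv[OF fin(1) F(1)] rm[OF fin(2) F''(1)] less.prems(6) by (simp add: algebra_simps)
      qed (use cT chain_sub less.prems 3 in auto)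
      then show ?thesis using F(1) by blast
    qed
  qed
qed

text \<open>At the least face where the sections differ, a hyperplane through that face separates them on all
  faces above it, and the terms of the other faces cancel.\<close>

lemma chamber_section_unique:
  assumes S: "face_chain S" and a: "\<And>F. F \<in> S \<Longrightarrow> a F > 0"
    and D: "\<And>F. F \<in> S \<Longrightarrow> D F \<in> chambers A \<and> face_ge F (D F)"
      "\<And>F G. F \<in> S \<Longrightarrow> G \<in> S \<Longrightarrow> face_ge F G \<Longrightarrow> D G = chamber_at A (D F) G"
    and D': "\<And>F. F \<in> S \<Longrightarrow> D' F \<in> chambers A \<and> face_ge F (D' F)"
      "\<And>F G. F \<in> S \<Longrightarrow> G \<in> S \<Longrightarrow> face_ge F G \<Longrightarrow> D' G = chamber_at A (D' F) G"
    and eq: "(\<Sum>F\<in>S. a F *\<^sub>R w (D F)) = (\<Sum>F\<in>S. a F *\<^sub>R w (D' F))"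
  shows "\<forall>F\<in>S. D F = D' F"
proof (rule ccontr)
  assume "\<not> (\<forall>F\<in>S. D F = D' F)"
  then have J: "face_chain {F\<in>S. D F \<noteq> D' F}" "{F\<in>S. D F \<noteq> D' F} \<noteq> {}" using S by (auto simp: face_chain_def)
  obtain F0 where F0: "F0 \<in> {F\<in>S. D F \<noteq> D' F}" "\<And>G. G \<in> {F\<in>S. D F \<noteq> D' F} \<Longrightarrow> face_ge G F0"
    using face_chain_least[OF J] by blast
  then have F0S: "F0 \<in> S" and ne: "D F0 \<noteq> D' F0" by auto
  have Sf: "G \<in> faces A" if "G \<in> S" for G using S that by (auto simp: face_chain_def)
  note d = D(1)[OF F0S] and d' = D'(1)[OF F0S]
  obtain H where H: "H \<in> sep_set A (D F0) (D' F0)"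
    using chamber_eqI[OF arr conjunct1[OF d] conjunct1[OF d']] ne by blast
  then have HA: "H \<in> A" and Hs: "face_sign (D F0) H \<noteq> face_sign (D' F0) H" using sep_setD by auto
  \<comment> \<open>Both chambers lie around \<open>F0\<close> and differ at H, so \<open>F0\<close>
    lies in H. On faces above \<open>F0\<close> each section then keeps the sign at H that it has
    over \<open>F0\<close>.\<close>
  have z0: "face_sign F0 H = 0"
    using face_geD[OF conjunct2[OF d] Sf[OF F0S] chamber_face[OF conjunct1[OF d]] HA]
      face_geD[OF conjunct2[OF d'] Sf[OF F0S] chamber_face[OF conjunct1[OF d']] HA] Hs by auto
  have above: "face_sign (D F) H = face_sign (D F0) H" "face_sign (D' F) H = face_sign (D' F0) H"
    if F: "F \<in> S" "face_ge F F0" for F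
    using face_sign_chamber_at[OF arr _ Sf[OF F0S] HA, of "D F"] face_sign_chamber_at[OF arr _ Sf[OF F0S] HA, of "D' F"]
      D(1)[OF F(1)] D'(1)[OF F(1)] D(2)[OF F(1) F0S F(2)] D'(2)[OF F(1) F0S F(2)] z0 by auto
  let ?g = "\<lambda>F. a F * (hyp_form H (w (D F)) - hyp_form H (w (D' F)))"
  have s: "sgn (hyp_form H (w (D F))) = face_sign (D F) H" "sgn (hyp_form H (w (D' F))) = face_sign (D' F) H"
    if "F \<in> S" for F
    using sgn_w[OF chamber_face HA] D(1)[OF that] D'(1)[OF that] by auto
  have cs: "face_sign (D F0) H = 1 \<and> face_sign (D' F0) H = -1 \<or> face_sign (D F0) H = -1 \<and> face_sign (D' F0) H = 1"
    using chamber_sign[OF conjunct1[OF d] HA] chamber_sign[OF conjunct1[OF d'] HA] Hs by auto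
  have up: "sgn (?g F) = face_sign (D F0) H" if F: "F \<in> S" "face_ge F F0" for F
  proof -
    have "sgn (hyp_form H (w (D F)) - hyp_form H (w (D' F))) = face_sign (D F0) H"
      using cs s[OF F(1)] above[OF F] by (auto simp: sgn_1_pos sgn_1_neg)
    then show ?thesis using a[OF F(1)] by (simp add: sgn_mult)
  qed
  have "sgn (sum ?g S) = sgn (?g F0)"
  proof (rule sgn_sum_dominant)
    show "finite S" "F0 \<in> S" using S F0S by (auto simp: face_chain_def)
    fix F assume F: "F \<in> S"
    show "sgn (?g F) = 0 \<or> sgn (?g F) = sgn (?g F0)"
    proof (cases "D F = D' F")
      case False
      then show ?thesis using up[OF F] up[OF F0S] F0(2)[of F] F by simp
    qed simp
  qed
  moreover have "sum ?g S = 0"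
  proof -
    have "sum ?g S = (\<Sum>F\<in>S. a F * hyp_form H (w (D F))) - (\<Sum>F\<in>S. a F * hyp_form H (w (D' F)))"
      by (simp add: right_diff_distrib sum_subtractf)
    then show ?thesis unfolding sum_hyp_form[where p = "\<lambda>F. w (D F)"] sum_hyp_form[where p = "\<lambda>F. w (D' F)"] eq by simp
  qed
  ultimately show False using up[OF F0S] cs by auto
qed

abbreviation "\<phi> \<equiv> \<lambda>(F, C). sal_vertex A w F C"

lemma phi_eq: "(F, C) \<in> sal_poset \<Longrightarrow> \<phi> (F, C) = (w F, w F - w C)"
  using chamber_at_self by (simp add: sal_vertex_def sal_poset_def)

lemma sal_identification_eq: "sal_identification A w = affine_extension \<phi>"
  by (simp add: sal_identification_def)

text \<open>A simplex is the graph of a function on its chain of faces: two elements over the same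
  face are comparable, and C_F = C for a chamber around F forces them to agree.\<close>

lemma simplex_section:
  assumes "\<sigma> \<in> sal_cx"
  obtains D where "face_chain (fst ` \<sigma>)" "\<sigma> = (\<lambda>F. (F, D F)) ` (fst ` \<sigma>)"
    "\<And>F. F \<in> fst ` \<sigma> \<Longrightarrow> D F \<in> chambers A \<and> face_ge F (D F)"
    "\<And>F G. F \<in> fst ` \<sigma> \<Longrightarrow> G \<in> fst ` \<sigma> \<Longrightarrow> face_ge F G \<Longrightarrow> D G = chamber_at A (D F) G"
proof -
  have s: "\<sigma> \<subseteq> sal_poset" "finite \<sigma>" and c: "\<And>x y. x \<in> \<sigma> \<Longrightarrow> y \<in> \<sigma> \<Longrightarrow> sal_ge x y \<or> sal_ge y x"
    using assms by (auto simp: sal_cx_def order_complex_def)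
  have mem: "F \<in> faces A \<and> C \<in> chambers A \<and> face_ge F C" if "(F, C) \<in> \<sigma>" for F C
    using s that by (auto simp: sal_poset_def)
  have ge: "C' = chamber_at A C F'" if x: "(F, C) \<in> \<sigma>" "(F', C') \<in> \<sigma>" "face_ge F F'" for F C F' C'
  proof -
    from c[OF x(1,2)] show ?thesis
    proof
      assume "sal_ge (F', C') (F, C)"
      then have g: "face_ge F' F" "C = chamber_at A C' F" by (auto simp: sal_ge_def)
      have "F = F'" using face_ge_antisym[OF arr _ _ x(3) g(1)] mem[OF x(1)] mem[OF x(2)] by blast
      then have "C = C'" using g(2) chamber_at_self mem[OF x(2)] by simp
      then show ?thesis using \<open>F = F'\<close> chamber_at_self mem[OF x(2)] by simp
    qed (simp add: sal_ge_def)
  qed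
  have uniq: "C = C'" if "(F, C) \<in> \<sigma>" "(F, C') \<in> \<sigma>" for F C C'
    using ge[OF that face_ge_refl] chamber_at_self mem[OF that(1)] by simp
  define D where "D F = (SOME C. (F, C) \<in> \<sigma>)" for F
  have D: "(F, D F) \<in> \<sigma>" if "F \<in> fst ` \<sigma>" for F
  proof -
    have "\<exists>C. (F, C) \<in> \<sigma>" using that by force
    then show ?thesis unfolding D_def by (rule someI_ex)
  qed
  show ?thesis
  proof (rule that)
    show "face_chain (fst ` \<sigma>)"
      unfolding face_chain_def
    proof (intro conjI ballI)
      show "fst ` \<sigma> \<subseteq> faces A" using mem by force
      fix F G assume "F \<in> fst ` \<sigma>" "G \<in> fst ` \<sigma>"
      then show "face_ge F G \<or> face_ge G F" using c[OF D D] by (auto simp: sal_ge_def)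
    qed (use s in simp)
    show "\<sigma> = (\<lambda>F. (F, D F)) ` (fst ` \<sigma>)"
    proof (intro equalityI subsetI)
      fix x assume x: "x \<in> \<sigma>"
      then have "fst x \<in> fst ` \<sigma>" by simp
      from D[OF this] have "x = (fst x, D (fst x))" using uniq[of "fst x" "snd x"] x by (simp add: prod_eq_iff)
      then show "x \<in> (\<lambda>F. (F, D F)) ` (fst ` \<sigma>)" using \<open>fst x \<in> fst ` \<sigma>\<close> by (rule image_eqI)
    qed (use D in blast)
    show "D F \<in> chambers A \<and> face_ge F (D F)" if "F \<in> fst ` \<sigma>" for F
      using mem[OF D[OF that]] by simp
    show "D G = chamber_at A (D F) G" if "F \<in> fst ` \<sigma>" "G \<in> fst ` \<sigma>" "face_ge F G" for F G
      by (rule ge[OF D[OF that(1)] D[OF that(2)] that(3)])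
  qed
qed

lemma affine_extension_phi:
  assumes x: "x \<in> geom_carrier sal_cx" and D: "support x = (\<lambda>F. (F, D F)) ` S"
    and DS: "\<And>F. F \<in> S \<Longrightarrow> (F, D F) \<in> sal_poset"
  shows "affine_extension \<phi> x = (\<Sum>F\<in>S. x (F, D F) *\<^sub>R w F, (\<Sum>F\<in>S. x (F, D F) *\<^sub>R w F) - (\<Sum>F\<in>S. x (F, D F) *\<^sub>R w (D F)))"
    and "(\<Sum>F\<in>S. x (F, D F)) = 1"
proof -
  note s = support_in_complex[OF abstract_sal_cx x]
  have inj: "inj_on (\<lambda>F. (F, D F)) S" by (simp add: inj_on_def)
  have "affine_extension \<phi> x = (\<Sum>p\<in>support x. x p *\<^sub>R \<phi> p)"
    by (rule affine_extension_on_simplex[OF s(3,2)])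
  also have "\<dots> = (\<Sum>F\<in>S. x (F, D F) *\<^sub>R \<phi> (F, D F))"
    unfolding D by (simp add: sum.reindex[OF inj])
  also have "\<dots> = (\<Sum>F\<in>S. x (F, D F) *\<^sub>R (w F, w F - w (D F)))"
    by (rule sum.cong[OF refl]) (simp only: phi_eq[OF DS])
  finally show "affine_extension \<phi> x = (\<Sum>F\<in>S. x (F, D F) *\<^sub>R w F, (\<Sum>F\<in>S. x (F, D F) *\<^sub>R w F) - (\<Sum>F\<in>S. x (F, D F) *\<^sub>R w (D F)))"
    by (simp add: sum_prod scaleR_right_diff_distrib sum_subtractf)
  show "(\<Sum>F\<in>S. x (F, D F)) = 1"
    using closed_simplexD(3)[OF s(2)] unfolding D by (simp add: sum.reindex[OF inj])
qed

lemma inj_on_sal: "inj_on (affine_extension \<phi>) (geom_carrier sal_cx)"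
proof (rule inj_onI)
  fix x y assume x: "x \<in> geom_carrier sal_cx" and y: "y \<in> geom_carrier sal_cx"
    and eq: "affine_extension \<phi> x = affine_extension \<phi> y"
  note sx = support_in_complex[OF abstract_sal_cx x] and sy = support_in_complex[OF abstract_sal_cx y]
  obtain D where D: "face_chain (fst ` support x)" "support x = (\<lambda>F. (F, D F)) ` (fst ` support x)"
    "\<And>F. F \<in> fst ` support x \<Longrightarrow> D F \<in> chambers A \<and> face_ge F (D F)"
    "\<And>F G. F \<in> fst ` support x \<Longrightarrow> G \<in> fst ` support x \<Longrightarrow> face_ge F G \<Longrightarrow> D G = chamber_at A (D F) G"
    using simplex_section[OF sx(1)] by blast
  obtain E where E: "face_chain (fst ` support y)" "support y = (\<lambda>F. (F, E F)) ` (fst ` support y)"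
    "\<And>F. F \<in> fst ` support y \<Longrightarrow> E F \<in> chambers A \<and> face_ge F (E F)"
    "\<And>F G. F \<in> fst ` support y \<Longrightarrow> G \<in> fst ` support y \<Longrightarrow> face_ge F G \<Longrightarrow> E G = chamber_at A (E F) G"
    using simplex_section[OF sy(1)] by blast
  let ?S = "fst ` support x" and ?T = "fst ` support y"
  have SD: "(F, D F) \<in> sal_poset" if "F \<in> ?S" for F
    using D(1) D(3)[OF that] that unfolding face_chain_def sal_poset_def by blast
  have TE: "(F, E F) \<in> sal_poset" if "F \<in> ?T" for F
    using E(1) E(3)[OF that] that unfolding face_chain_def sal_poset_def by blast
  have px: "x (F, D F) > 0" if "F \<in> ?S" for F
  proof -
    have "(F, D F) \<in> support x" by (subst D(2)) (use that in blast)
    then show ?thesis using closed_simplexD(1)[OF sx(2), of "(F, D F)"] by (simp add: support_def less_le)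
  qed
  have py: "y (F, E F) > 0" if "F \<in> ?T" for F
  proof -
    have "(F, E F) \<in> support y" by (subst E(2)) (use that in blast)
    then show ?thesis using closed_simplexD(1)[OF sy(2), of "(F, E F)"] by (simp add: support_def less_le)
  qed
  note ax = affine_extension_phi[OF x D(2) SD] and ay = affine_extension_phi[OF y E(2) TE]
  have fst_eq: "(\<Sum>F\<in>?S. x (F, D F) *\<^sub>R w F) = (\<Sum>F\<in>?T. y (F, E F) *\<^sub>R w F)"
    and snd_eq: "(\<Sum>F\<in>?S. x (F, D F) *\<^sub>R w (D F)) = (\<Sum>F\<in>?T. y (F, E F) *\<^sub>R w (E F))"
  proof -
    have e: "(\<Sum>F\<in>?S. x (F, D F) *\<^sub>R w F) = (\<Sum>F\<in>?T. y (F, E F) *\<^sub>R w F) \<and>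
      (\<Sum>F\<in>?S. x (F, D F) *\<^sub>R w F) - (\<Sum>F\<in>?S. x (F, D F) *\<^sub>R w (D F)) =
      (\<Sum>F\<in>?T. y (F, E F) *\<^sub>R w F) - (\<Sum>F\<in>?T. y (F, E F) *\<^sub>R w (E F))"
      using trans[OF ax(1)[symmetric] trans[OF eq ay(1)]] unfolding prod.inject .
    then show "(\<Sum>F\<in>?S. x (F, D F) *\<^sub>R w F) = (\<Sum>F\<in>?T. y (F, E F) *\<^sub>R w F)" by (rule conjunct1)
    \<comment> \<open>The imaginary part of a vertex is w F - w (D F). Once the real parts agree,
      the sums of the points w (D F) are isolated.\<close>
    from conjunct2[OF e, unfolded conjunct1[OF e]]
    show "(\<Sum>F\<in>?S. x (F, D F) *\<^sub>R w (D F)) = (\<Sum>F\<in>?T. y (F, E F) *\<^sub>R w (E F))"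
      by (rule diff_left_imp_eq)
  qed
  have ST_co: "?S = ?T \<and> (\<forall>F\<in>?S. x (F, D F) = y (F, E F))"
    by (rule chain_barycentric_unique[OF D(1) E(1) px py _ fst_eq]) (simp_all only: ax(2) ay(2))
  from ST_co have ST: "?S = ?T" by (rule conjunct1)
  from ST_co have co: "x (F, D F) = y (F, E F)" if "F \<in> ?S" for F
    by (rule bspec[OF conjunct2 that])
  have sec: "(\<Sum>F\<in>?S. x (F, D F) *\<^sub>R w (D F)) = (\<Sum>F\<in>?S. x (F, D F) *\<^sub>R w (E F))"
    unfolding snd_eq ST[symmetric] by (rule sum.cong[OF refl]) (simp only: co)
  have DE: "\<forall>F\<in>?S. D F = E F"
    by (rule chamber_section_unique[OF D(1) px D(3,4) E(3,4)[folded ST] sec])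
  have supp: "support x = support y"
  proof -
    have "(\<lambda>F. (F, D F)) ` ?S = (\<lambda>F. (F, E F)) ` ?S"
      by (rule image_cong[OF refl]) (simp only: DE[rule_format])
    also have "\<dots> = support y" using E(2) unfolding ST[symmetric] by (rule sym)
    finally show ?thesis using D(2) by (rule trans[rotated])
  qed
  show "x = y"
  proof
    fix p
    show "x p = y p"
    proof (cases "p \<in> support x")
      case True
      then have "p \<in> (\<lambda>F. (F, D F)) ` ?S" by (subst (asm) D(2))
      then obtain F where F: "p = (F, D F)" "F \<in> ?S" by (rule imageE)
      have "x (F, D F) = y (F, D F)" using co[OF F(2)] bspec[OF DE F(2)] by simp
      then show ?thesis by (simp only: F(1))
    next
      case False
      then show ?thesis using supp unfolding support_def by (metis (mono_tags, lifting) mem_Collect_eq)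
    qed
  qed
qed

text \<open>The least face is split off and placed at the last index, so that the enumeration
  descends as in the definition of the Salvetti simplices.\<close>

lemma chain_enumeration:
  assumes "face_chain S" "S \<noteq> {}"
  shows "\<exists>(F :: nat \<Rightarrow> (real^'n) set) k. F ` {..k} = S \<and> (\<forall>i<k. face_gt (F i) (F (Suc i)))"
  using assms
proof (induction "card S" arbitrary: S)
  case (Suc n)
  obtain G where G: "G \<in> S" "\<And>F. F \<in> S \<Longrightarrow> face_ge F G"
    using face_chain_least[OF Suc.prems] by blast
  have fin: "finite S" using Suc.prems by (simp add: face_chain_def)
  show ?case
  proof (cases "S = {G}")
    case True
    then show ?thesis by (intro exI[of _ "\<lambda>_. G"] exI[of _ 0]) auto
  next
    case False
    have "face_chain (S - {G})" using Suc.prems(1) by (auto simp: face_chain_def)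
    moreover have "n = card (S - {G})" using Suc.hyps(2) G(1) fin by simp
    moreover have "S - {G} \<noteq> {}" using False G(1) by blast
    ultimately have "\<exists>(F :: nat \<Rightarrow> (real^'n) set) k. F ` {..k} = S - {G} \<and> (\<forall>i<k. face_gt (F i) (F (Suc i)))"
      using Suc.hyps(1)[of "S - {G}"] by (simp only: simp_thms)
    then obtain F :: "nat \<Rightarrow> (real^'n) set" and k
      where F: "F ` {..k} = S - {G}" "\<forall>i<k. face_gt (F i) (F (Suc i))" by (elim exE conjE)
    let ?F = "F(Suc k := G)"
    have "?F ` {..k} = F ` {..k}" by (rule image_cong) simp_all
    then have "?F ` {..Suc k} = insert G (F ` {..k})" by (simp only: atMost_Suc image_insert fun_upd_same)
    also have "\<dots> = insert G (S - {G})" by (simp only: F(1))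
    also have "\<dots> = S" using G(1) by (rule insert_Diff)
    finally have "?F ` {..Suc k} = S" .
    moreover have "face_gt (?F i) (?F (Suc i))" if "i < Suc k" for i
    proof (cases "i = k")
      case True
      have "F k \<in> S - {G}" unfolding F(1)[symmetric] by simp
      then show ?thesis using G(2) True by (simp add: face_gt_def)
    next
      case False
      then show ?thesis using F(2) that by simp
    qed
    ultimately show ?thesis by (intro exI[of _ ?F] exI[of _ "Suc k"] conjI allI impI)
  qed
qed (simp add: face_chain_def)

text \<open>The chambers C_i of a Salvetti simplex are constrained only through (C_0)_{F_i} =
  (C_i)_{F_i}. Replacing each by its chamber at F_i yields a chain of \<open>sal_poset\<close> with
  the same geometric vertices. In the other direction the chamber over the greatest face of the
  chain serves as C_i for every i.\<close>

lemma salvetti_union: "\<Union> (salvetti_complex A w) = affine_extension \<phi> ` geom_carrier sal_cx"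
proof (intro equalityI subsetI)
  fix z assume "z \<in> \<Union> (salvetti_complex A w)"
  then obtain F C and k :: nat where z: "z \<in> convex hull ((\<lambda>i. sal_vertex A w (F i) (C i)) ` {..k})"
    and FC: "\<And>i. i \<le> k \<Longrightarrow> F i \<in> faces A \<and> C i \<in> chambers A"
    and gt: "\<And>i. i < k \<Longrightarrow> face_gt (F i) (F (Suc i))"
    and cc: "\<And>i. i \<le> k \<Longrightarrow> chamber_at A (C 0) (F i) = chamber_at A (C i) (F i)"
    unfolding salvetti_complex_def by blast
  define p where "p i = (F i, chamber_at A (C i) (F i))" for i
  have pP: "p i \<in> sal_poset" if "i \<le> k" for i
    using FC[OF that] arr face_ge_chamber_at by (simp add: p_def sal_poset_def)
  have ge: "face_ge (F i) (F j)" if "i \<le> j" "j \<le> k" for i j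
    using that
  proof (induction j rule: dec_induct)
    case (step j)
    then show ?case using gt[of j] face_ge_trans[of "F i" "F j"] by (simp add: face_gt_def)
  qed simp
  have chain: "sal_ge (p i) (p j)" if "i \<le> j" "j \<le> k" for i j
  proof -
    have i: "i \<le> k" using that by simp
    have "chamber_at A (chamber_at A (C i) (F i)) (F j) = chamber_at A (C j) (F j)"
      using chamber_at_chamber_at[of "F i" "F j" "C 0"] FC[OF i] FC[OF that(2)] FC[of 0] ge[OF that]
        cc[OF i] cc[OF that(2)] by simp
    then show ?thesis using ge[OF that] by (simp add: p_def sal_ge_def)
  qed
  have s: "p ` {..k} \<in> sal_cx"
    unfolding sal_cx_def order_complex_def
  proof (intro CollectI conjI ballI)
    fix x y assume "x \<in> p ` {..k}" "y \<in> p ` {..k}"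
    then obtain i j where ij: "i \<le> k" "j \<le> k" "x = p i" "y = p j" by blast
    then show "sal_ge x y \<or> sal_ge y x" using chain[of i j] chain[of j i] by (cases "i \<le> j") auto
  qed (use pP in auto)
  have "\<phi> (p i) = sal_vertex A w (F i) (C i)" if "i \<le> k" for i
    using FC[OF that] chamber_at_chamber_at[of "F i" "F i" "C i"] by (simp add: p_def sal_vertex_def)
  then have "\<phi> ` p ` {..k} = (\<lambda>i. sal_vertex A w (F i) (C i)) ` {..k}"
    unfolding image_image by (intro image_cong) auto
  then have "z \<in> affine_extension \<phi> ` closed_simplex (p ` {..k})"
    using z affine_extension_image[of "p ` {..k}" \<phi>] by simp
  then show "z \<in> affine_extension \<phi> ` geom_carrier sal_cx"
    using closed_simplex_subset_geom_carrier[OF s] by blast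
next
  fix z assume "z \<in> affine_extension \<phi> ` geom_carrier sal_cx"
  then obtain x where x: "x \<in> geom_carrier sal_cx" "z = affine_extension \<phi> x" by blast
  note s = support_in_complex[OF abstract_sal_cx x(1)]
  obtain D where D: "face_chain (fst ` support x)" "support x = (\<lambda>F. (F, D F)) ` (fst ` support x)"
    "\<And>F. F \<in> fst ` support x \<Longrightarrow> D F \<in> chambers A \<and> face_ge F (D F)"
    "\<And>F G. F \<in> fst ` support x \<Longrightarrow> G \<in> fst ` support x \<Longrightarrow> face_ge F G \<Longrightarrow> D G = chamber_at A (D F) G"
    using simplex_section[OF s(1)] by blast
  let ?S = "fst ` support x"
  have "?S \<noteq> {}" using s(4) by simp
  then obtain F :: "nat \<Rightarrow> (real^'n) set" and k where F: "F ` {..k} = ?S" "\<And>i. i < k \<Longrightarrow> face_gt (F i) (F (Suc i))"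
    using chain_enumeration[OF D(1)] by blast
  have FS: "F i \<in> ?S" if "i \<le> k" for i using F(1) that by blast
  have Ff: "F i \<in> faces A" if "i \<le> k" for i using D(1) FS[OF that] by (auto simp: face_chain_def)
  have ge: "face_ge (F 0) (F j)" if "j \<le> k" for j
    using that
  proof (induction j)
    case (Suc j)
    then show ?case using F(2)[of j] face_ge_trans[of "F 0" "F j"] by (simp add: face_gt_def)
  qed simp
  have ch: "chamber_at A (D (F 0)) (F i) = D (F i)" if "i \<le> k" for i
    using D(4)[OF FS[of 0] FS[OF that] ge[OF that]] by simp
  have v: "\<phi> (F i, D (F i)) = sal_vertex A w (F i) (D (F 0))" if "i \<le> k" for i
    using ch[OF that] chamber_at_self[OF Ff[OF that]] D(3)[OF FS[OF that]] by (simp add: sal_vertex_def)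
  have "\<phi> ` support x = (\<lambda>i. sal_vertex A w (F i) (D (F 0))) ` {..k}"
  proof -
    have "\<phi> ` support x = (\<lambda>F. \<phi> (F, D F)) ` ?S"
      using arg_cong[OF D(2), of "image \<phi>"] unfolding image_image .
    also have "\<dots> = (\<lambda>i. \<phi> (F i, D (F i))) ` {..k}" unfolding F(1)[symmetric] image_image ..
    also have "\<dots> = (\<lambda>i. sal_vertex A w (F i) (D (F 0))) ` {..k}"
      by (rule image_cong[OF refl], rule v) simp
    finally show ?thesis .
  qed
  then have "z \<in> convex hull ((\<lambda>i. sal_vertex A w (F i) (D (F 0))) ` {..k})"
    unfolding x(2) using imageI[OF s(2), of "affine_extension \<phi>"] affine_extension_image[OF s(3), of \<phi>] by simp
  moreover have "convex hull ((\<lambda>i. sal_vertex A w (F i) (D (F 0))) ` {..k}) \<in> salvetti_complex A w"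
    unfolding salvetti_complex_def
    by (rule CollectI, rule exI[of _ F], rule exI[of _ "\<lambda>_. D (F 0)"], rule exI[of _ k])
       (use F(2) Ff D(3)[OF FS[of 0]] in auto)
  ultimately show "z \<in> \<Union> (salvetti_complex A w)" by blast
qed

text \<open>A continuous bijection from a compact space onto a Hausdorff space; compactness comes
  from the finiteness of \<open>sal_cx\<close>.\<close>

theorem sal_identification_homeomorphic:
  "homeomorphic_map (realization sal_cx) (top_of_set (\<Union> (salvetti_complex A w))) (sal_identification A w)"
  unfolding sal_identification_eq
proof (rule continuous_imp_homeomorphic_map)
  have top: "realization sal_cx = top_of_set (geom_carrier sal_cx)"
    by (rule realization_locally_finite[OF abstract_sal_cx]) (use finite_sal_cx in simp)
  show "compact_space (realization sal_cx)"
    unfolding top by (simp add: compact_space_subtopology compact_geom_carrier[OF abstract_sal_cx finite_sal_cx])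
  show "Hausdorff_space (top_of_set (\<Union> (salvetti_complex A w)))"
    by (simp add: Hausdorff_space_subtopology)
  show "continuous_map (realization sal_cx) (top_of_set (\<Union> (salvetti_complex A w))) (affine_extension \<phi>)"
  proof (rule continuous_map_realization)
    show "affine_extension \<phi> \<in> geom_carrier sal_cx \<rightarrow> topspace (top_of_set (\<Union> (salvetti_complex A w)))"
      unfolding salvetti_union by auto
    fix \<sigma> assume s: "\<sigma> \<in> sal_cx"
    show "continuous_map (top_of_set (closed_simplex \<sigma>)) (top_of_set (\<Union> (salvetti_complex A w))) (affine_extension \<phi>)"
      unfolding continuous_map_in_subtopology salvetti_union
      using continuous_on_affine_extension[OF abstract_complexD(1)[OF abstract_sal_cx s], of \<phi>]
        closed_simplex_subset_geom_carrier[OF s] by auto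
  qed
  show "affine_extension \<phi> ` topspace (realization sal_cx) = topspace (top_of_set (\<Union> (salvetti_complex A w)))"
    by (simp add: salvetti_union)
  show "inj_on (affine_extension \<phi>) (topspace (realization sal_cx))" using inj_on_sal by simp
qed

end

theorem corollary7p2:
  fixes A :: "(real^'n) set set"
    and w :: "(real^'n) set \<Rightarrow> real^'n"
    and \<Gamma>' :: "'v osys"
    and \<rho> :: "'v \<Rightarrow> (real^'n) set"
  assumes "arrangement A"
    and "\<And>F. F \<in> faces A \<Longrightarrow> w F \<in> F"
    and "universal_os_cover \<Gamma>' (arrangement_system A) \<rho>"
  shows "universal_covering_map
           (realization (W_complex A \<Gamma>' \<rho>))
           (top_of_set (\<Union> (salvetti_complex A w)))
           (sal_identification A w \<circ> Lambda_map \<rho>)"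
proof -
  interpret C: arrangement_cover A \<Gamma>' \<rho>
    by unfold_locales (use assms in \<open>auto simp: universal_os_cover_def\<close>)
  interpret S: salvetti_points A w
    by unfold_locales (use assms in auto)
  show ?thesis
    unfolding universal_covering_map_def
    using covering_map_compose_homeomorphic[OF C.covering_Lambda S.sal_identification_homeomorphic]
      C.universal_W_simply_connected[OF assms(3)] by blast
qed

end
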